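(* There exists a deterministic, combinatorial, polynomial-time algorithm that achieves an approximation ratio of $6-\frac{2}{m}$ for the flow-level coflow scheduling problem in identical parallel networks with (arbitrary) release times, where $m$ is the number of network cores.
   Context: Identical parallel network: $m$ identical network cores, each an $N\times N$ non-blocking switch; the $i$-th input port of every core is connected to source server $i\in\mathcal{I}=\{1,\dots,N\}$ and the $j$-th output port of every core to destination server $j\in\mathcal{J}=\{1,\dots,N\}$. All links have unit capacity, so on each core, at any time, each input port and each output port transmits data of at most one flow, at rate at most 1; transmission may be preempted. A set $\mathcal{K}$ of $n$ coflows is given; coflow $k$ has a demand matrix $D^{(k)}=(d_{i,j,k})_{i,j=1}^N$ of nonnegative integers, where $d_{i,j,k}$ is the size (equivalently, transmission time) of flow $(i,j,k)$ from source $i$ to destination $j$, a release time $r_k\ge 0$ before which none of its flows may be transmitted, and a positive weight $w_k$. The completion time $C_k$ of coflow $k$ is the time at which the last of its flows finishes. In the flow-level scheduling problem, each flow must be transmitted entirely on a single core, but different flows of the same coflow may use different cores. The objective is to minimize $\sum_{k\in\mathcal{K}} w_k C_k$. An algorithm has approximation ratio $\rho$ if on every instance its schedule has objective at most $\rho$ times the optimum. *)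

theory Defs
  imports
    "HOL-Analysis.Analysis"
    "HOL-Computational_Algebra.Polynomial"
    "HOL-Library.Log_Nat"
begin

section \<open>Flow-level coflow scheduling in identical parallel networks\<close>

text \<open>
  Cores, ports and coflows are numbered from 0. Release times and weights are rational, so that an
  instance is a finite object which can be handed to an algorithm.
\<close>

record coflow_instance =
  cores :: nat
  ports :: nat
  coflows :: nat
  demand :: "nat \<Rightarrow> nat \<Rightarrow> nat \<Rightarrow> nat"
  release :: "nat \<Rightarrow> rat"
  weight :: "nat \<Rightarrow> rat"

definition valid_instance :: "coflow_instance \<Rightarrow> bool" where
  "valid_instance I \<longleftrightarrow> cores I \<ge> 1 \<and> ports I \<ge> 1 \<and>
     (\<forall>k<coflows I. release I k \<ge> 0 \<and> weight I k > 0)"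

type_synonym flow = "nat \<times> nat \<times> nat"  \<comment> \<open>(source, destination, coflow)\<close>

fun source :: "flow \<Rightarrow> nat" where "source (i, j, k) = i"
fun destination :: "flow \<Rightarrow> nat" where "destination (i, j, k) = j"
fun coflow_of :: "flow \<Rightarrow> nat" where "coflow_of (i, j, k) = k"

definition flows :: "coflow_instance \<Rightarrow> flow set" where
  "flows I = {..<ports I} \<times> {..<ports I} \<times> {..<coflows I}"

definition flow_size :: "coflow_instance \<Rightarrow> flow \<Rightarrow> real" where
  "flow_size I f = real (demand I (source f) (destination f) (coflow_of f))"

definition flow_release :: "coflow_instance \<Rightarrow> flow \<Rightarrow> real" where
  "flow_release I f = real_of_rat (release I (coflow_of f))"

text \<open>
  A schedule gives, for each core and flow, the transmission rate as a function of time.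
\<close>

type_synonym schedule = "nat \<Rightarrow> flow \<Rightarrow> real \<Rightarrow> real"

definition transmitted :: "coflow_instance \<Rightarrow> schedule \<Rightarrow> flow \<Rightarrow> real \<Rightarrow> real" where
  "transmitted I x f T = (\<Sum>h<cores I. integral {0..T} (x h f))"

definition feasible :: "coflow_instance \<Rightarrow> schedule \<Rightarrow> bool" where
  "feasible I x \<longleftrightarrow>
     (\<forall>h<cores I. \<forall>f\<in>flows I.
        (\<forall>t. 0 \<le> x h f t \<and> x h f t \<le> 1) \<and>
        (\<forall>t<flow_release I f. x h f t = 0) \<and>
        (\<forall>T. x h f integrable_on {0..T})) \<and>
     (\<forall>h<cores I. \<forall>t. \<forall>f\<in>flows I. \<forall>g\<in>flows I.
        x h f t > 0 \<and> x h g t > 0 \<and> (source f = source g \<or> destination f = destination g)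
        \<longrightarrow> f = g) \<and>
     (\<forall>f\<in>flows I. \<exists>h<cores I. \<forall>h'<cores I. h' \<noteq> h \<longrightarrow> (\<forall>t. x h' f t = 0)) \<and>
     (\<forall>f\<in>flows I. (\<forall>T. transmitted I x f T \<le> flow_size I f) \<and>
        (\<exists>T. transmitted I x f T = flow_size I f))"

text \<open>
  The bound by the release time only matters for flows of size 0, which count as finished as soon
  as they are released; a coflow without any data is thus completed at its release time.
\<close>

definition flow_finish :: "coflow_instance \<Rightarrow> schedule \<Rightarrow> flow \<Rightarrow> real" where
  "flow_finish I x f = Inf {T. flow_release I f \<le> T \<and> transmitted I x f T = flow_size I f}"

definition completion_time :: "coflow_instance \<Rightarrow> schedule \<Rightarrow> nat \<Rightarrow> real" where
  "completion_time I x k = Max (flow_finish I x ` {f \<in> flows I. coflow_of f = k})"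

definition objective :: "coflow_instance \<Rightarrow> schedule \<Rightarrow> real" where
  "objective I x = (\<Sum>k<coflows I. real_of_rat (weight I k) * completion_time I x k)"

definition optimum :: "coflow_instance \<Rightarrow> real" where
  "optimum I = Inf (objective I ` {x. feasible I x})"


section \<open>Random access machines with logarithmic cost\<close>

text \<open>
  The deterministic RAM in structured form: memory cells holding natural numbers of
  arbitrary size with indirect addressing, a read-only input tape, a write-only output tape. Every
  operation is charged the bit lengths of the addresses and values it handles, so that
  polynomial time coincides with polynomial time on Turing machines. Subtraction is truncated;
  a condition holds iff its value is nonzero.
\<close>

datatype aexp =
    Const nat
  | Cell aexp  \<comment> \<open>content of the cell with the given address\<close>
  | Plus aexp aexp
  | Minus aexp aexp
  | Times aexp aexp
  | Quot aexp aexp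

datatype com =
    Skip
  | Assign aexp aexp  \<comment> \<open>address of the target cell, value\<close>
  | Read aexp
  | Write aexp
  | Seq com com
  | Cond aexp com com
  | While aexp com

type_synonym memory = "nat \<Rightarrow> nat"

type_synonym config = "memory \<times> nat list \<times> nat list"  \<comment> \<open>memory, remaining input, output so far\<close>

definition bits :: "nat \<Rightarrow> nat" where
  "bits v = max 1 (floorlog 2 v)"

fun aval :: "memory \<Rightarrow> aexp \<Rightarrow> nat" where
  "aval s (Const c) = c"
| "aval s (Cell a) = s (aval s a)"
| "aval s (Plus a b) = aval s a + aval s b"
| "aval s (Minus a b) = aval s a - aval s b"
| "aval s (Times a b) = aval s a * aval s b"
| "aval s (Quot a b) = aval s a div aval s b"

fun acost :: "memory \<Rightarrow> aexp \<Rightarrow> nat" where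
  "acost s (Const c) = bits c"
| "acost s (Cell a) = acost s a + bits (aval s a) + bits (s (aval s a))"
| "acost s (Plus a b) = acost s a + acost s b + bits (aval s a) + bits (aval s b)"
| "acost s (Minus a b) = acost s a + acost s b + bits (aval s a) + bits (aval s b)"
| "acost s (Times a b) = acost s a + acost s b + bits (aval s a) + bits (aval s b)"
| "acost s (Quot a b) = acost s a + acost s b + bits (aval s a) + bits (aval s b)"

text \<open>\<open>exec c \<sigma> t \<tau>\<close>: started in \<open>\<sigma>\<close>, the program \<open>c\<close> halts in \<open>\<tau>\<close> with total cost \<open>t\<close>.\<close>

inductive exec :: "com \<Rightarrow> config \<Rightarrow> nat \<Rightarrow> config \<Rightarrow> bool" where
  Skip: "exec Skip \<sigma> 1 \<sigma>"
| Assign: "exec (Assign a e) (s, inp, out)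
     (acost s a + acost s e + bits (aval s a) + bits (aval s e))
     (s(aval s a := aval s e), inp, out)"
| Read: "exec (Read a) (s, v # inp, out)
     (acost s a + bits (aval s a) + bits v) (s(aval s a := v), inp, out)"
| Write: "exec (Write e) (s, inp, out)
     (acost s e + bits (aval s e)) (s, inp, out @ [aval s e])"
| Seq: "exec c \<sigma> t \<sigma>' \<Longrightarrow> exec d \<sigma>' u \<tau> \<Longrightarrow> exec (Seq c d) \<sigma> (t + u) \<tau>"
| CondTrue: "aval s b \<noteq> 0 \<Longrightarrow> exec c (s, inp, out) t \<tau> \<Longrightarrow>
     exec (Cond b c d) (s, inp, out) (acost s b + bits (aval s b) + t) \<tau>"
| CondFalse: "aval s b = 0 \<Longrightarrow> exec d (s, inp, out) t \<tau> \<Longrightarrow>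
     exec (Cond b c d) (s, inp, out) (acost s b + bits (aval s b) + t) \<tau>"
| WhileFalse: "aval s b = 0 \<Longrightarrow>
     exec (While b c) (s, inp, out) (acost s b + bits (aval s b)) (s, inp, out)"
| WhileTrue: "aval s b \<noteq> 0 \<Longrightarrow> exec c (s, inp, out) t \<sigma>' \<Longrightarrow> exec (While b c) \<sigma>' u \<tau> \<Longrightarrow>
     exec (While b c) (s, inp, out) (acost s b + bits (aval s b) + t + u) \<tau>"

inductive_cases exec_SkipE: "exec Skip \<sigma> t \<tau>"
inductive_cases exec_AssignE: "exec (Assign a e) \<sigma> t \<tau>"
inductive_cases exec_ReadE: "exec (Read a) \<sigma> t \<tau>"
inductive_cases exec_WriteE: "exec (Write e) \<sigma> t \<tau>"
inductive_cases exec_SeqE: "exec (Seq c d) \<sigma> t \<tau>"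
inductive_cases exec_CondE: "exec (Cond b c d) \<sigma> t \<tau>"
inductive_cases exec_WhileE: "exec (While b c) \<sigma> t \<tau>"

lemma exec_deterministic:
  "exec c \<sigma> t \<tau> \<Longrightarrow> exec c \<sigma> t' \<tau>' \<Longrightarrow> t = t' \<and> \<tau> = \<tau>'"
proof (induction arbitrary: t' \<tau>' rule: exec.induct)
  case Skip
  then show ?case by - (erule exec_SkipE, simp_all)
next
  case Assign
  then show ?case by - (erule exec_AssignE, simp_all)
next
  case Read
  then show ?case by - (erule exec_ReadE, simp_all)
next
  case Write
  then show ?case by - (erule exec_WriteE, simp_all)
next
  case (Seq c \<sigma> t \<sigma>' d u \<tau>)
  from Seq.prems obtain t2 \<sigma>2 u2 where
    t': "t' = t2 + u2" and c: "exec c \<sigma> t2 \<sigma>2" and d: "exec d \<sigma>2 u2 \<tau>'"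
    by (rule exec_SeqE)
  have 1: "t = t2 \<and> \<sigma>' = \<sigma>2" by (rule Seq.IH(1)[OF c])
  with d have "exec d \<sigma>' u2 \<tau>'" by simp
  then have "u = u2 \<and> \<tau> = \<tau>'" by (rule Seq.IH(2))
  with 1 t' show ?case by simp
next
  case (CondTrue s b c inp out t \<tau> d)
  from CondTrue.prems CondTrue.hyps obtain t2 where
    t': "t' = acost s b + bits (aval s b) + t2" and c: "exec c (s, inp, out) t2 \<tau>'"
    by - (erule exec_CondE, simp_all)
  from CondTrue.IH[OF c] t' show ?case by simp
next
  case (CondFalse s b d inp out t \<tau> c)
  from CondFalse.prems CondFalse.hyps obtain t2 where
    t': "t' = acost s b + bits (aval s b) + t2" and d: "exec d (s, inp, out) t2 \<tau>'"
    by - (erule exec_CondE, simp_all)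
  from CondFalse.IH[OF d] t' show ?case by simp
next
  case (WhileFalse s b c inp out)
  from WhileFalse.prems show ?case
    by (rule exec_WhileE) (use WhileFalse.hyps in simp_all)
next
  case (WhileTrue s b c inp out t \<sigma>' u \<tau>)
  from WhileTrue.prems WhileTrue.hyps obtain t2 \<sigma>2 u2 where
    t': "t' = acost s b + bits (aval s b) + t2 + u2" and
    c: "exec c (s, inp, out) t2 \<sigma>2" and w: "exec (While b c) \<sigma>2 u2 \<tau>'"
    by - (erule exec_WhileE, simp_all)
  have 1: "t = t2 \<and> \<sigma>' = \<sigma>2" by (rule WhileTrue.IH(1)[OF c])
  with w have "exec (While b c) \<sigma>' u2 \<tau>'" by simp
  then have "u = u2 \<and> \<tau> = \<tau>'" by (rule WhileTrue.IH(2))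
  with 1 t' show ?case by simp
qed


section \<open>Approximation algorithms for the scheduling problem\<close>

definition encode_rat :: "rat \<Rightarrow> nat list" where
  "encode_rat q = (case quotient_of q of (a, b) \<Rightarrow> [nat a, nat b])"

definition encode_coflow :: "coflow_instance \<Rightarrow> nat \<Rightarrow> nat list" where
  "encode_coflow I k =
     [demand I i j k. i \<leftarrow> [0..<ports I], j \<leftarrow> [0..<ports I]]
     @ encode_rat (release I k) @ encode_rat (weight I k)"

definition encode_instance :: "coflow_instance \<Rightarrow> nat list" where
  "encode_instance I =
     [cores I, ports I, coflows I] @ concat (map (encode_coflow I) [0..<coflows I])"

definition input_size :: "coflow_instance \<Rightarrow> nat" where
  "input_size I = sum_list (map bits (encode_instance I))"

text \<open>
  The output lists periods of transmission, each given by the core, the flow, and the start and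
  end times as fractions. During such a period the flow is transmitted at full rate.
\<close>

type_synonym period = "nat \<times> flow \<times> real \<times> real"

fun decode_periods :: "nat list \<Rightarrow> period list" where
  "decode_periods (h # i # j # k # a # b # c # d # xs) =
     (h, (i, j, k), real a / real b, real c / real d) # decode_periods xs"
| "decode_periods _ = []"

definition schedule_of :: "period list \<Rightarrow> schedule" where
  "schedule_of ps h f t = of_bool (\<exists>a b. (h, f, a, b) \<in> set ps \<and> a \<le> t \<and> t < b)"

definition start :: "coflow_instance \<Rightarrow> config" where
  "start I = (\<lambda>_. 0, encode_instance I, [])"

definition polynomial_time :: "com \<Rightarrow> bool" where
  "polynomial_time c \<longleftrightarrow> (\<exists>p :: nat poly. \<forall>I. valid_instance I \<longrightarrow>
     (\<exists>t \<tau>. exec c (start I) t \<tau> \<and> t \<le> poly p (input_size I)))"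

definition computes_schedule :: "com \<Rightarrow> coflow_instance \<Rightarrow> schedule \<Rightarrow> bool" where
  "computes_schedule c I x \<longleftrightarrow>
     (\<exists>t s inp out. exec c (start I) t (s, inp, out) \<and> x = schedule_of (decode_periods out))"

definition has_approximation_ratio :: "com \<Rightarrow> (coflow_instance \<Rightarrow> real) \<Rightarrow> bool" where
  "has_approximation_ratio c \<rho> \<longleftrightarrow> (\<forall>I. valid_instance I \<longrightarrow>
     (\<exists>x. computes_schedule c I x \<and> feasible I x \<and> objective I x \<le> \<rho> I * optimum I))"

end

theory Submission
  imports Defs
begin

text \<open>
  After clearing denominators all release times, sizes and weights are integers. Two lower bounds on
  the completion times of a feasible schedule are used: the coflows completed by time \<open>t\<close> load each
  port by at most \<open>m * t\<close>, and a flow needs its size after its release.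

  For \<open>m \<ge> 2\<close> the coflows are ordered by a local ratio argument, which loses a factor 2 against the
  first bound. Every flow in turn is assigned to the core on which its two ports are least loaded and
  transmitted there as early as possible. It waits at most for the load of both ports, so the ratio
  is \<open>1 + 2 * 2 = 5 \<le> 6 - 2 / m\<close>.

  For \<open>m = 1\<close> the ratio 4 is needed. A linear program relaxes the first bound to fractional completion
  on a geometric time grid. It is solved approximately by a drift-plus-penalty iteration; the
  data sent in each grid interval form a bipartite multigraph of bounded degree, and an edge
  colouring with alternating chains turns it into matchings that are transmitted one after another.

  Both algorithms are written in a small array language, whose programs are compiled to
  the random access machine with a polynomial bound on the cost.
\<close>

section \<open>A structured array language on the random access machine\<close>

text \<open>
  A store maps an array name, a row and a column to a number. Scalars live in position (0, 0).
\<close>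

type_synonym store = "nat => nat => nat => nat"

datatype expr =
    Cn nat
  | Arr nat expr expr
  | Add expr expr  (infixl ".+" 65)
  | Sub expr expr  (infixl ".-" 65)
  | Mul expr expr  (infixl ".*" 70)
  | Div expr expr  (infixl "\<oslash>" 70)

abbreviation Vec :: "nat => expr => expr" where "Vec r i == Arr r i (Cn 0)"

abbreviation V :: "nat => expr" where "V r == Vec r (Cn 0)"

datatype prog =
    Skp
  | Put nat expr expr expr  \<comment> \<open>array, row, column, value\<close>
  | Sq prog prog  (infixr ";;" 60)
  | Test expr prog prog
  | Iterate expr prog  \<comment> \<open>repeated as long as the expression is nonzero\<close>

abbreviation Let_be :: "nat => expr => prog"  (infix ":=:" 61) where "r :=: e == Put r (Cn 0) (Cn 0) e"

primrec ev :: "store => expr => nat" where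
  "ev S (Cn c) = c"
| "ev S (Arr r a b) = S r (ev S a) (ev S b)"
| "ev S (a .+ b) = ev S a + ev S b"
| "ev S (a .- b) = ev S a - ev S b"
| "ev S (a .* b) = ev S a * ev S b"
| "ev S (a \<oslash> b) = ev S a div ev S b"

primrec reads :: "expr => nat set" where
  "reads (Cn c) = {}"
| "reads (Arr r a b) = insert r (reads a \<union> reads b)"
| "reads (a .+ b) = reads a \<union> reads b"
| "reads (a .- b) = reads a \<union> reads b"
| "reads (a .* b) = reads a \<union> reads b"
| "reads (a \<oslash> b) = reads a \<union> reads b"

lemma ev_cong: "(\<And>r. r \<in> reads e ==> S r = S' r) ==> ev S e = ev S' e"
  by (induction e) auto

definition upd :: "store => nat => nat => nat => nat => store" where
  "upd S r i j x = (\<lambda>r' i' j'. if r' = r \<and> i' = i \<and> j' = j then x else S r' i' j')"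

lemma upd_apply: "upd S r i j x r' i' j' = (if r' = r \<and> i' = i \<and> j' = j then x else S r' i' j')"
  by (simp add: upd_def)

lemma upd_other [simp]: "r' \<noteq> r ==> upd S r i j x r' = S r'"
  by (simp add: upd_def)

lemma upd_same [simp]: "upd S r i j x r i' j' = (if i' = i \<and> j' = j then x else S r i' j')"
  by (simp add: upd_def)

primrec sem :: "prog => store => store" where
  "sem Skp = (\<lambda>S. S)"
| "sem (Put r i j e) = (\<lambda>S. upd S r (ev S i) (ev S j) (ev S e))"
| "sem (p ;; q) = (\<lambda>S. sem q (sem p S))"
| "sem (Test c p q) = (\<lambda>S. if ev S c \<noteq> 0 then sem p S else sem q S)"
| "sem (Iterate c p) = (\<lambda>S. (sem p ^^ (LEAST k. ev ((sem p ^^ k) S) c = 0)) S)"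

primrec mods :: "prog => nat set" where
  "mods Skp = {}"
| "mods (Put r i j e) = {r}"
| "mods (p ;; q) = mods p \<union> mods q"
| "mods (Test c p q) = mods p \<union> mods q"
| "mods (Iterate c p) = mods p"

lemma sem_frame: "r \<notin> mods p ==> sem p S r = S r"
proof (induction p arbitrary: S)
  case (Iterate c p)
  have "(sem p ^^ i) S r = S r" for i
    using Iterate by (induction i) simp_all
  then show ?case by simp
qed (simp_all add: upd_def)

declare sem.simps(5) [simp del]

lemma sem_Iterate:
  assumes "ev ((sem p ^^ k) S) c = 0" "\<And>i. i < k ==> ev ((sem p ^^ i) S) c \<noteq> 0"
  shows "sem (Iterate c p) S = (sem p ^^ k) S"
proof -
  have "(LEAST k. ev ((sem p ^^ k) S) c = 0) = k"
    by (rule Least_equality) (use assms not_le in blast)+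
  then show ?thesis by (simp add: sem.simps(5))
qed

definition Loop :: "nat => nat => prog => prog" where
  "Loop v l p = (v :=: Cn 0 ;; Iterate (V l .- V v) (p ;; v :=: V v .+ Cn 1))"

lemma mods_Loop [simp]: "mods (Loop v l p) = insert v (mods p)"
  by (auto simp: Loop_def)

definition Sum_to :: "nat => nat => nat => expr => prog" where
  "Sum_to a v l e = (a :=: Cn 0 ;; Loop v l (a :=: V a .+ e))"

lemma mods_Sum_to [simp]: "mods (Sum_to a v l e) = {a, v}"
  by (auto simp: Sum_to_def)

definition Bit_length :: "nat => nat => expr => prog" where
  "Bit_length r t e = (t :=: e ;; r :=: Cn 0 ;; Iterate (V t) (t :=: V t \<oslash> Cn 2 ;; r :=: V r .+ Cn 1))"

lemma mods_Bit_length [simp]: "mods (Bit_length r t e) = {r, t}"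
  by (auto simp: Bit_length_def)

definition Eq :: "expr => expr => expr" where
  "Eq a b = Cn 1 .- ((a .- b) .+ (b .- a))"

lemma ev_Eq [simp]: "ev S (Eq a b) = of_bool (ev S a = ev S b)"
  by (auto simp: Eq_def)

definition Mod :: "expr => expr => expr" where
  "Mod a b = a .- (a \<oslash> b) .* b"

lemma ev_Mod [simp]: "ev S (Mod a b) = ev S a mod ev S b"
  by (simp add: Mod_def modulo_nat_def mult.commute minus_div_mult_eq_mod)

lemma reads_Mod [simp]: "reads (Mod a b) = reads a \<union> reads b"
  by (auto simp: Mod_def)

subsection \<open>Weakest preconditions with bounded values and loops\<close>

locale ram =
  fixes M Lim :: nat
  assumes Lim_le_M: "Lim \<le> M" and Lim_pos: "1 \<le> Lim"
begin

primrec safe :: "prog => store => bool" where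
  "safe Skp = (\<lambda>S. True)"
| "safe (Put r i j e) = (\<lambda>S. ev S e \<le> M)"
| "safe (p ;; q) = (\<lambda>S. safe p S \<and> safe q (sem p S))"
| "safe (Test c p q) = (\<lambda>S. if ev S c \<noteq> 0 then safe p S else safe q S)"
| "safe (Iterate c p) = (\<lambda>S. \<exists>k\<le>Lim. ev ((sem p ^^ k) S) c = 0 \<and>
     (\<forall>i<k. ev ((sem p ^^ i) S) c \<noteq> 0 \<and> safe p ((sem p ^^ i) S)))"

definition wp :: "prog => (store => bool) => store => bool" where
  "wp p Q S \<longleftrightarrow> safe p S \<and> Q (sem p S)"

lemma one_le_M: "Suc 0 \<le> M"
  using Lim_le_M Lim_pos by simp

lemma wp_Skp [simp]: "wp Skp Q S = Q S"
  by (simp add: wp_def)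

lemma wp_Put [simp]: "wp (Put r i j e) Q S \<longleftrightarrow> ev S e \<le> M \<and> Q (upd S r (ev S i) (ev S j) (ev S e))"
  by (simp add: wp_def)

lemma wp_Sq [simp]: "wp (p ;; q) Q S \<longleftrightarrow> wp p (wp q Q) S"
  by (auto simp: wp_def)

lemma wp_Test [simp]: "wp (Test c p q) Q S \<longleftrightarrow> (if ev S c \<noteq> 0 then wp p Q S else wp q Q S)"
  by (simp add: wp_def)

lemma wp_mono:
  assumes "wp p Q S" and "\<And>S'. Q S' ==> (\<And>r. r \<notin> mods p ==> S' r = S r) ==> Q' S'"
  shows "wp p Q' S"
  using assms sem_frame by (auto simp: wp_def)

lemma wp_seq:
  assumes "wp p R S" "\<And>S'. R S' ==> (\<And>r. r \<notin> mods p ==> S' r = S r) ==> wp q Q S'"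
  shows "wp (p ;; q) Q S"
  unfolding wp_Sq using assms(1) by (rule wp_mono) (rule assms(2))

lemma wp_Iterate:
  assumes rounds: "k \<le> Lim" and init: "Inv 0 S"
    and step: "\<And>i S'. i < k ==> Inv i S' ==> ev S' c \<noteq> 0 \<and> wp p (Inv (Suc i)) S'"
    and final: "\<And>S'. Inv k S' ==> ev S' c = 0 \<and> Q S'"
  shows "wp (Iterate c p) Q S"
proof -
  have inv: "Inv i ((sem p ^^ i) S)" if "i \<le> k" for i
    using that by (induction i) (use init step in \<open>auto simp: wp_def\<close>)
  have continue: "ev ((sem p ^^ i) S) c \<noteq> 0" "safe p ((sem p ^^ i) S)" if "i < k" for i
    using step[OF that inv] that by (auto simp: wp_def)
  have stop: "ev ((sem p ^^ k) S) c = 0" "Q ((sem p ^^ k) S)"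
    using final[OF inv] by auto
  have "safe (Iterate c p) S" using rounds continue stop by auto
  moreover have "sem (Iterate c p) S = (sem p ^^ k) S" using stop(1) continue(1) by (rule sem_Iterate)
  ultimately show ?thesis using stop by (simp add: wp_def)
qed

lemma wp_Loop:
  assumes fresh: "v \<noteq> l" "v \<notin> mods p" "l \<notin> mods p"
    and rounds: "S l 0 0 \<le> Lim"
    and init: "Inv 0 (upd S v 0 0 0)"
    and step: "\<And>i S'. i < S l 0 0 ==> Inv i S' ==> S' v 0 0 = i ==>
       (\<And>r. r \<noteq> v ==> r \<notin> mods p ==> S' r = S r) ==>
       wp p (\<lambda>S''. Inv (Suc i) (upd S'' v 0 0 (Suc i))) S'"
    and final: "\<And>S'. Inv (S l 0 0) S' ==> S' v 0 0 = S l 0 0 ==>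
       (\<And>r. r \<noteq> v ==> r \<notin> mods p ==> S' r = S r) ==> Q S'"
  shows "wp (Loop v l p) Q S"
proof -
  define J where "J i S' \<longleftrightarrow> Inv i S' \<and> S' v 0 0 = i \<and> (\<forall>r. r \<noteq> v \<longrightarrow> r \<notin> mods p \<longrightarrow> S' r = S r)" for i S'
  have "wp (Iterate (V l .- V v) (p ;; v :=: V v .+ Cn 1)) Q (upd S v 0 0 0)"
  proof (rule wp_Iterate[where Inv = J, OF rounds])
    show "J 0 (upd S v 0 0 0)" using init by (simp add: J_def)
    show "ev S' (V l .- V v) \<noteq> 0 \<and> wp (p ;; v :=: V v .+ Cn 1) (J (Suc i)) S'"
      if i: "i < S l 0 0" and J: "J i S'" for i S'
    proof
      have l: "S' l = S l" using J fresh unfolding J_def by metis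
      then show "ev S' (V l .- V v) \<noteq> 0" using i J by (simp add: J_def)
      have "wp p (\<lambda>S''. Inv (Suc i) (upd S'' v 0 0 (Suc i))) S'"
        using i J by (intro step) (auto simp: J_def)
      then show "wp (p ;; v :=: V v .+ Cn 1) (J (Suc i)) S'"
        unfolding wp_Sq by (rule wp_mono) (use i J fresh rounds Lim_le_M in \<open>simp add: J_def\<close>)
    qed
    show "ev S' (V l .- V v) = 0 \<and> Q S'" if "J (S l 0 0) S'" for S'
      using that final[of S'] fresh unfolding J_def by simp
  qed
  then show ?thesis by (simp add: Loop_def)
qed

lemma wp_fill:
  assumes fresh: "x \<noteq> y" "la \<notin> {x, y}" "lb \<notin> {x, y}" "arr \<notin> {x, y}" "{x, y, la, lb} \<inter> mods b = {}"
    and rounds: "S la 0 0 \<le> Lim" "S lb 0 0 \<le> Lim"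
    and body: "\<And>i j S1. i < S la 0 0 ==> j < S lb 0 0 ==> S1 x 0 0 = i ==> S1 y 0 0 = j ==>
       (\<And>r. r \<notin> insert x (insert y (mods b)) ==> S1 r = S r) ==> S1 arr i j = S arr i j ==>
       wp b (\<lambda>S'. S' arr i j = f i j \<and> (\<forall>i' j'. \<not> (i' = i \<and> j' = j) \<longrightarrow> S' arr i' j' = S1 arr i' j')) S1"
  shows "wp (Loop x la (Loop y lb b)) (\<lambda>S'. \<forall>i<S la 0 0. \<forall>j<S lb 0 0. S' arr i j = f i j) S"
proof -
  define filled where "filled i j S' \<longleftrightarrow> (\<forall>i' j'. j' < S lb 0 0 \<longrightarrow>
     S' arr i' j' = (if i' < i \<or> i' = i \<and> j' < j then f i' j' else S arr i' j'))" for i j and S' :: store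
  have filled_upd: "filled i j (upd S' r 0 0 z) = filled i j S'" if "r \<noteq> arr" for i j r z and S' :: store
    using that by (simp add: filled_def)
  show ?thesis
  proof (rule wp_Loop[where Inv = "\<lambda>i. filled i 0"])
    fix i and S1 :: store
    assume i: "i < S la 0 0" and inv: "filled i 0 S1" and x: "S1 x 0 0 = i"
      and frame: "\<And>r. r \<noteq> x ==> r \<notin> mods (Loop y lb b) ==> S1 r = S r"
    have lb: "S1 lb = S lb" using frame fresh by auto
    show "wp (Loop y lb b) (\<lambda>S''. filled (Suc i) 0 (upd S'' x 0 0 (Suc i))) S1"
    proof (rule wp_Loop[where Inv = "filled i"])
      fix j and S2 :: store
      assume j: "j < S1 lb 0 0" and inv2: "filled i j S2" and y: "S2 y 0 0 = j"
        and frame2: "\<And>r. r \<noteq> y ==> r \<notin> mods b ==> S2 r = S1 r"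
      have "wp b (\<lambda>S'. S' arr i j = f i j \<and> (\<forall>i' j'. \<not> (i' = i \<and> j' = j) \<longrightarrow> S' arr i' j' = S2 arr i' j')) S2"
        by (rule body) (use i j lb x y frame frame2 fresh inv2 in \<open>auto simp: filled_def\<close>)
      then show "wp b (\<lambda>S''. filled i (Suc j) (upd S'' y 0 0 (Suc j))) S2"
        by (rule wp_mono) (use inv2 fresh in \<open>auto simp: filled_def less_Suc_eq\<close>)
    next
      fix S2 :: store
      assume "filled i (S1 lb 0 0) S2"
      then have "filled (Suc i) 0 S2" using lb by (auto simp: filled_def less_Suc_eq)
      then show "filled (Suc i) 0 (upd S2 x 0 0 (Suc i))" using fresh filled_upd by auto
    qed (use fresh rounds lb inv filled_upd in auto)
  next
    fix S1 :: store
    assume "filled (S la 0 0) 0 S1"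
    then show "\<forall>i<S la 0 0. \<forall>j<S lb 0 0. S1 arr i j = f i j" by (simp add: filled_def)
  qed (use fresh rounds in \<open>auto simp: filled_def\<close>)
qed

lemma wp_Sum_to:
  assumes fresh: "v \<noteq> l" "v \<noteq> a" "l \<noteq> a" "a \<notin> reads e"
    and rounds: "S l 0 0 \<le> Lim"
    and bound: "(\<Sum>i<S l 0 0. ev (upd S v 0 0 i) e) \<le> M"
    and post: "Q (upd (upd S v 0 0 (S l 0 0)) a 0 0 (\<Sum>i<S l 0 0. ev (upd S v 0 0 i) e))"
  shows "wp (Sum_to a v l e) Q S"
proof -
  let ?f = "\<lambda>i. ev (upd S v 0 0 i) e"
  let ?S = "\<lambda>i. upd (upd S v 0 0 i) a 0 0 (\<Sum>j<i. ?f j)"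
  have "wp (Loop v l (a :=: V a .+ e)) Q (upd S a 0 0 0)"
  proof (rule wp_Loop[where Inv = "\<lambda>i S'. S' = ?S i"])
    fix i S'
    assume i: "i < upd S a 0 0 0 l 0 0" and S': "S' = ?S i"
    have e: "ev S' e = ?f i"
      using fresh(4) by (intro ev_cong ext) (auto simp: S' upd_def)
    have "(\<Sum>j<Suc i. ?f j) \<le> (\<Sum>j<S l 0 0. ?f j)"
      using i fresh by (intro sum_mono2) auto
    then have "(\<Sum>j<i. ?f j) + ?f i \<le> M" using bound by simp
    then show "wp (a :=: V a .+ e) (\<lambda>S''. upd S'' v 0 0 (Suc i) = ?S (Suc i)) S'"
      using fresh(1-3) by (auto simp: e) (auto simp: S' fun_eq_iff upd_def)
  next
    show "upd (upd S a 0 0 0) v 0 0 0 = ?S 0"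
      by (auto simp: fun_eq_iff upd_def)
  qed (use assms in auto)
  then show ?thesis by (simp add: Sum_to_def)
qed

lemma wp_Bit_length:
  assumes fresh: "r \<noteq> t" and bound: "ev S e \<le> M" "floorlog 2 (ev S e) \<le> Lim"
    and post: "Q (upd (upd S t 0 0 0) r 0 0 (floorlog 2 (ev S e)))"
  shows "wp (Bit_length r t e) Q S"
proof -
  define x where "x = ev S e"
  let ?S = "\<lambda>i. upd (upd S t 0 0 (x div 2 ^ i)) r 0 0 i"
  have halved: "x div 2 ^ i = 0 \<longleftrightarrow> floorlog 2 x \<le> i" for i
    by (simp add: floorlog_le_iff div_eq_0_iff)
  have "wp (Iterate (V t) (t :=: V t \<oslash> Cn 2 ;; r :=: V r .+ Cn 1)) Q (?S 0)"
  proof (rule wp_Iterate[where Inv = "\<lambda>i S'. S' = ?S i", OF bound(2)[folded x_def]])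
    fix i S'
    assume i: "i < floorlog 2 x" and S': "S' = ?S i"
    have "x div 2 ^ Suc i \<le> M" "Suc i \<le> M"
      using bound i Lim_le_M div_le_dividend[of x "2 ^ Suc i"] unfolding x_def by linarith+
    moreover have "x div 2 ^ i div 2 = x div 2 ^ Suc i" by (simp add: mult.commute flip: div_mult2_eq)
    ultimately show "ev S' (V t) \<noteq> 0 \<and> wp (t :=: V t \<oslash> Cn 2 ;; r :=: V r .+ Cn 1) (\<lambda>S'. S' = ?S (Suc i)) S'"
      using i fresh halved[of i] by (auto simp: S') (auto simp: fun_eq_iff upd_def)
  next
    have "x div 2 ^ floorlog 2 x = 0" using halved by blast
    then show "ev S' (V t) = 0 \<and> Q S'" if "S' = ?S (floorlog 2 x)" for S'
      using that fresh post by (simp add: x_def)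
  qed simp
  then show ?thesis using bound fresh by (simp add: Bit_length_def x_def)
qed

end

subsection \<open>Compilation\<close>

definition cell :: "nat => nat => nat => nat" where
  "cell r i j = prod_encode (r, prod_encode (i, j))"

definition enc :: "store => memory" where
  "enc S a = (case prod_decode a of (r, q) => case prod_decode q of (i, j) => S r i j)"

lemma enc_cell: "enc S (cell r i j) = S r i j"
  by (simp add: enc_def cell_def)

lemma enc_upd: "(enc S)(cell r i j := x) = enc (upd S r i j x)"
proof
  fix a
  obtain r' q i' j' where "prod_decode a = (r', q)" "prod_decode q = (i', j')"
    by (metis surj_pair)
  then have "a = cell r' i' j'" by (metis cell_def prod_decode_inverse)
  then show "((enc S)(cell r i j := x)) a = enc (upd S r i j x) a"
    by (auto simp: enc_cell upd_apply) (auto simp: cell_def)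
qed

lemma enc_zero: "enc (\<lambda>_ _ _. 0) = (\<lambda>_. 0)"
  by (simp add: enc_def fun_eq_iff split: prod.split)

definition pairing :: "aexp => aexp => aexp" where
  "pairing a b = Plus (Quot (Times (Plus a b) (Plus (Plus a b) (Const 1))) (Const 2)) a"

definition addr :: "nat => aexp => aexp => aexp" where
  "addr r a b = pairing (Const r) (pairing a b)"

primrec aexp_of :: "expr => aexp" where
  "aexp_of (Cn c) = Const c"
| "aexp_of (Arr r a b) = Cell (addr r (aexp_of a) (aexp_of b))"
| "aexp_of (a .+ b) = Plus (aexp_of a) (aexp_of b)"
| "aexp_of (a .- b) = Minus (aexp_of a) (aexp_of b)"
| "aexp_of (a .* b) = Times (aexp_of a) (aexp_of b)"
| "aexp_of (a \<oslash> b) = Quot (aexp_of a) (aexp_of b)"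

lemma aval_addr: "aval s (addr r a b) = cell r (aval s a) (aval s b)"
  by (simp add: addr_def pairing_def cell_def prod_encode_def triangle_def)

lemma aval_aexp_of: "aval (enc S) (aexp_of e) = ev S e"
  by (induction e) (simp_all add: aval_addr enc_cell)

primrec compile :: "prog => com" where
  "compile Skp = Skip"
| "compile (Put r i j e) = Assign (addr r (aexp_of i) (aexp_of j)) (aexp_of e)"
| "compile (p ;; q) = Seq (compile p) (compile q)"
| "compile (Test c p q) = Cond (aexp_of c) (compile p) (compile q)"
| "compile (Iterate c p) = While (aexp_of c) (compile p)"

subsection \<open>Cost of compiled programs\<close>

lemma bits_pos: "1 \<le> bits v"
  by (simp add: bits_def)

lemma bits_le_iff: "1 \<le> b ==> bits v \<le> b \<longleftrightarrow> v < 2 ^ b"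
  by (auto simp: bits_def floorlog_le_iff)

lemma less_two_power_bits: "v < 2 ^ bits v"
  using bits_le_iff[OF bits_pos, of v v] by simp

lemma bits_mono: "u \<le> v ==> bits u \<le> bits v"
  using less_two_power_bits[of v] by (simp add: bits_le_iff[OF bits_pos])

lemma bits_mult_Suc: "bits (Suc u * Suc v - 1) \<le> bits u + bits v"
proof -
  have "Suc u * Suc v \<le> 2 ^ bits u * 2 ^ bits v"
    by (intro mult_le_mono Suc_leI less_two_power_bits)
  then show ?thesis
    using bits_pos[of u] by (subst bits_le_iff) (auto simp: power_add)
qed

lemma bits_arith:
  "bits (u + v) \<le> bits u + bits v" "bits (u - v) \<le> bits u + bits v"
  "bits (u * v) \<le> bits u + bits v" "bits (u div v) \<le> bits u + bits v"
  by (rule order_trans[OF bits_mono bits_mult_Suc], simp add: div_le_dividend trans_le_add1)+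

primrec value_factor :: "aexp => nat" where
  "value_factor (Const c) = bits c"
| "value_factor (Cell a) = 1"
| "value_factor (Plus a b) = value_factor a + value_factor b"
| "value_factor (Minus a b) = value_factor a + value_factor b"
| "value_factor (Times a b) = value_factor a + value_factor b"
| "value_factor (Quot a b) = value_factor a + value_factor b"

primrec eval_factor :: "aexp => nat" where
  "eval_factor (Const c) = bits c"
| "eval_factor (Cell a) = eval_factor a + value_factor a + 1"
| "eval_factor (Plus a b) = eval_factor a + eval_factor b + value_factor a + value_factor b"
| "eval_factor (Minus a b) = eval_factor a + eval_factor b + value_factor a + value_factor b"
| "eval_factor (Times a b) = eval_factor a + eval_factor b + value_factor a + value_factor b"
| "eval_factor (Quot a b) = eval_factor a + eval_factor b + value_factor a + value_factor b"

definition cost_factor :: "aexp => nat" where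
  "cost_factor e = eval_factor e + value_factor e"

context
  fixes s :: memory and M :: nat
  assumes bounded: "\<And>a. s a \<le> M"
begin

lemma bits_aval: "bits (aval s e) \<le> value_factor e * bits M"
proof (induction e)
  case (Const c)
  then show ?case using bits_pos[of M] by simp
next
  case (Cell a)
  then show ?case using bounded bits_mono by simp
qed (auto simp: add_mult_distrib intro: order_trans[OF bits_arith(1)] order_trans[OF bits_arith(2)]
  order_trans[OF bits_arith(3)] order_trans[OF bits_arith(4)] add_mono)

lemma acost_le: "acost s e \<le> eval_factor e * bits M"
proof (induction e)
  case (Const c)
  then show ?case using bits_pos[of M] by simp
next
  case (Cell a)
  then show ?case using bits_aval[of a] bits_mono[OF bounded, of "aval s a"] by (simp add: add_mult_distrib)
qed (simp_all add: add_mult_distrib add_mono bits_aval)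

lemma acost_bits_le: "acost s e + bits (aval s e) \<le> cost_factor e * bits M"
  using acost_le[of e] bits_aval[of e] by (simp add: cost_factor_def add_mult_distrib)

end

definition runs :: "com => config => nat => config => bool" where
  "runs c \<sigma> b \<tau> \<longleftrightarrow> (\<exists>t\<le>b. exec c \<sigma> t \<tau>)"

lemma runsI: "exec c \<sigma> t \<tau> ==> t \<le> b ==> runs c \<sigma> b \<tau>"
  unfolding runs_def by blast

lemma runs_mono: "runs c \<sigma> a \<tau> ==> a \<le> b ==> runs c \<sigma> b \<tau>"
  unfolding runs_def by (meson order_trans)

lemma runs_Skip: "runs Skip \<sigma> 1 \<sigma>"
  unfolding runs_def using exec.Skip by blast

lemma runs_Seq: "runs c \<sigma> a \<sigma>' ==> runs d \<sigma>' b \<tau> ==> runs (Seq c d) \<sigma> (a + b) \<tau>"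
  unfolding runs_def by (meson add_mono exec.Seq)

definition bounded_store :: "nat => store => bool" where
  "bounded_store M S \<longleftrightarrow> (\<forall>r i j. S r i j \<le> M)"

lemma bounded_storeD: "bounded_store M S ==> enc S a \<le> M"
  by (simp add: bounded_store_def enc_def split: prod.split)

lemma bounded_store_upd: "bounded_store M S ==> x \<le> M ==> bounded_store M (upd S r i j x)"
  by (auto simp: bounded_store_def upd_def)

context
  fixes M :: nat and S :: store
  assumes bounded: "bounded_store M S"
begin

lemma aexp_of_cost_le: "acost (enc S) a + bits (aval (enc S) a) \<le> cost_factor a * bits M"
  by (rule acost_bits_le) (rule bounded_storeD[OF bounded])

lemma runs_Assign:
  "runs (Assign (addr r (aexp_of i) (aexp_of j)) (aexp_of e)) (enc S, inp, out)
     ((cost_factor (addr r (aexp_of i) (aexp_of j)) + cost_factor (aexp_of e)) * bits M)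
     (enc (upd S r (ev S i) (ev S j) (ev S e)), inp, out)"
  using runsI[OF exec.Assign[of "addr r (aexp_of i) (aexp_of j)" "aexp_of e" "enc S" inp out]]
    aexp_of_cost_le[of "addr r (aexp_of i) (aexp_of j)"] aexp_of_cost_le[of "aexp_of e"]
  unfolding aval_addr aval_aexp_of enc_upd by (simp add: add_mult_distrib)

lemma runs_Read:
  assumes "v \<le> M"
  shows "runs (Read (addr r (aexp_of i) (aexp_of j))) (enc S, v # inp, out)
    ((cost_factor (addr r (aexp_of i) (aexp_of j)) + 1) * bits M) (enc (upd S r (ev S i) (ev S j) v), inp, out)"
  using runsI[OF exec.Read[of "addr r (aexp_of i) (aexp_of j)" "enc S" v inp out]]
    aexp_of_cost_le[of "addr r (aexp_of i) (aexp_of j)"] bits_mono[OF assms]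
  unfolding aval_addr aval_aexp_of enc_upd by (simp add: add_mult_distrib)

lemma runs_Write:
  "runs (Write (aexp_of e)) (enc S, inp, out) (cost_factor (aexp_of e) * bits M) (enc S, inp, out @ [ev S e])"
  using exec.Write[of "aexp_of e" "enc S" inp out] aexp_of_cost_le[of "aexp_of e"]
  unfolding runs_def aval_aexp_of by blast

lemma runs_Cond:
  assumes "runs (if ev S c \<noteq> 0 then p else q) (enc S, inp, out) t \<tau>"
  shows "runs (Cond (aexp_of c) p q) (enc S, inp, out) (cost_factor (aexp_of c) * bits M + t) \<tau>"
proof -
  obtain u where u: "exec (if ev S c \<noteq> 0 then p else q) (enc S, inp, out) u \<tau>" "u \<le> t"
    using assms unfolding runs_def by blast
  have "exec (Cond (aexp_of c) p q) (enc S, inp, out) (acost (enc S) (aexp_of c) + bits (aval (enc S) (aexp_of c)) + u) \<tau>"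
    using u(1) exec.CondTrue[of "enc S" "aexp_of c" p inp out u \<tau> q] exec.CondFalse[of "enc S" "aexp_of c" q inp out u \<tau> p]
    by (cases "ev S c = 0") (simp_all add: aval_aexp_of)
  then show ?thesis using add_mono[OF aexp_of_cost_le u(2)] by (rule runsI)
qed

lemma runs_While_end:
  assumes "ev S c = 0"
  shows "runs (While (aexp_of c) p) (enc S, inp, out) (cost_factor (aexp_of c) * bits M) (enc S, inp, out)"
  using assms exec.WhileFalse[of "enc S" "aexp_of c" p inp out] aexp_of_cost_le[of "aexp_of c"]
  unfolding runs_def aval_aexp_of by blast

lemma runs_While_step:
  assumes "ev S c \<noteq> 0" "runs p (enc S, inp, out) t \<sigma>" "runs (While (aexp_of c) p) \<sigma> u \<tau>"
  shows "runs (While (aexp_of c) p) (enc S, inp, out) (cost_factor (aexp_of c) * bits M + t + u) \<tau>"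
  using assms exec.WhileTrue[of "enc S" "aexp_of c" p inp out _ \<sigma> _ \<tau>] aexp_of_cost_le[of "aexp_of c"]
  unfolding runs_def aval_aexp_of by (meson add_mono)

end

lemma runs_While:
  assumes bounded: "\<And>i. i \<le> k ==> bounded_store M (S i)"
    and continue: "\<And>i. i < k ==> ev (S i) c \<noteq> 0" and stop: "ev (S k) c = 0"
    and body: "\<And>i. i < k ==> runs p (enc (S i), inp i, out i) T (enc (S (Suc i)), inp (Suc i), out (Suc i))"
  shows "runs (While (aexp_of c) p) (enc (S 0), inp 0, out 0)
     (cost_factor (aexp_of c) * bits M + k * (cost_factor (aexp_of c) * bits M + T)) (enc (S k), inp k, out k)"
proof -
  let ?c = "cost_factor (aexp_of c) * bits M"
  have "runs (While (aexp_of c) p) (enc (S (k - d)), inp (k - d), out (k - d)) (?c + d * (?c + T))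
     (enc (S k), inp k, out k)" if "d \<le> k" for d
    using that
  proof (induction d)
    case 0
    show ?case using runs_While_end[OF bounded stop] by simp
  next
    case (Suc d)
    define i where "i = k - Suc d"
    have i: "i < k" "i \<le> k" "k - d = Suc i" using Suc.prems by (auto simp: i_def)
    have "runs (While (aexp_of c) p) (enc (S i), inp i, out i) (?c + T + (?c + d * (?c + T))) (enc (S k), inp k, out k)"
      by (rule runs_While_step[OF bounded[OF i(2)] continue[OF i(1)] body[OF i(1)]]) (use Suc i in simp)
    then show ?case by (simp add: i_def algebra_simps)
  qed
  from this[of k] show ?thesis by simp
qed

text \<open>The running time in units of the bit length of \<open>M\<close>, as a polynomial in the loop bound.\<close>

primrec time_poly :: "prog => nat poly" where
  "time_poly Skp = [:1:]"
| "time_poly (Put r i j e) = [:cost_factor (addr r (aexp_of i) (aexp_of j)) + cost_factor (aexp_of e):]"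
| "time_poly (p ;; q) = time_poly p + time_poly q"
| "time_poly (Test c p q) = [:cost_factor (aexp_of c):] + time_poly p + time_poly q"
| "time_poly (Iterate c p) = [:cost_factor (aexp_of c):] + [:0, 1:] * ([:cost_factor (aexp_of c):] + time_poly p)"

context ram
begin

lemma bounded_store_sem: "safe p S ==> bounded_store M S ==> bounded_store M (sem p S)"
proof (induction p arbitrary: S)
  case (Iterate c p)
  then obtain k where k: "ev ((sem p ^^ k) S) c = 0"
      "\<And>i. i < k ==> ev ((sem p ^^ i) S) c \<noteq> 0" "\<And>i. i < k ==> safe p ((sem p ^^ i) S)"
    by auto
  have "bounded_store M ((sem p ^^ i) S)" if "i \<le> k" for i
    using that by (induction i) (use Iterate k in auto)
  moreover have "sem (Iterate c p) S = (sem p ^^ k) S" using k(1,2) by (rule sem_Iterate)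
  ultimately show ?case by simp
qed (auto intro: bounded_store_upd)

lemma runs_compile:
  assumes "safe p S" "bounded_store M S"
  shows "runs (compile p) (enc S, inp, out) (poly (time_poly p) Lim * bits M) (enc (sem p S), inp, out)"
  using assms
proof (induction p arbitrary: S)
  case Skp
  then show ?case using bits_pos[of M] by (auto intro: runs_mono[OF runs_Skip])
next
  case (Put r i j e)
  then show ?case using runs_Assign by simp
next
  case (Sq p q)
  then have "runs (Seq (compile p) (compile q)) (enc S, inp, out)
      (poly (time_poly p) Lim * bits M + poly (time_poly q) Lim * bits M) (enc (sem q (sem p S)), inp, out)"
    by (intro runs_Seq[of _ _ _ "(enc (sem p S), inp, out)"]) (auto intro: bounded_store_sem)
  then show ?case by (simp add: add_mult_distrib)
next
  case (Test c p q)
  have "runs (if ev S c \<noteq> 0 then compile p else compile q) (enc S, inp, out)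
      (poly (time_poly p) Lim * bits M + poly (time_poly q) Lim * bits M) (enc (sem (Test c p q) S), inp, out)"
    using Test by (auto intro: runs_mono[OF _ le_add1] runs_mono[OF _ le_add2])
  from runs_Cond[OF Test.prems(2) this] show ?case by (simp add: add_mult_distrib add.assoc)
next
  case (Iterate c p)
  let ?T = "poly (time_poly p) Lim * bits M" and ?c = "cost_factor (aexp_of c) * bits M"
  obtain k where k: "ev ((sem p ^^ k) S) c = 0"
      "\<And>i. i < k ==> ev ((sem p ^^ i) S) c \<noteq> 0" "\<And>i. i < k ==> safe p ((sem p ^^ i) S)" "k \<le> Lim"
    using Iterate.prems by auto
  have bounded: "bounded_store M ((sem p ^^ i) S)" if "i \<le> k" for i
    using that by (induction i) (use Iterate.prems k in \<open>auto intro: bounded_store_sem\<close>)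
  have "runs (While (aexp_of c) (compile p)) (enc S, inp, out) (?c + k * (?c + ?T)) (enc ((sem p ^^ k) S), inp, out)"
    using runs_While[where S = "\<lambda>i. (sem p ^^ i) S" and inp = "\<lambda>_. inp" and out = "\<lambda>_. out", OF bounded k(2,1)]
      Iterate.IH k(3) bounded by simp
  moreover have "?c + k * (?c + ?T) \<le> ?c + Lim * (?c + ?T)" using k(4) by simp
  moreover have "sem (Iterate c p) S = (sem p ^^ k) S" using k(1,2) by (rule sem_Iterate)
  ultimately show ?case by (auto simp: algebra_simps intro: runs_mono)
qed

end

section \<open>What feasibility means for the completion times\<close>

definition share_port :: "flow => flow => bool" where
  "share_port f g \<longleftrightarrow> source f = source g \<or> destination f = destination g"

lemma finite_flows [simp]: "finite (flows I)"
  by (simp add: flows_def)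

lemma feasible_rate:
  assumes "feasible I x" "h < cores I" "f \<in> flows I"
  shows "0 \<le> x h f t" "x h f t \<le> 1" "x h f integrable_on {0..T}"
    "t < flow_release I f ==> x h f t = 0"
  using assms by (auto simp: feasible_def)

lemma transmitted_mono:
  assumes "feasible I x" "f \<in> flows I" "T \<le> T'"
  shows "transmitted I x f T \<le> transmitted I x f T'"
  unfolding transmitted_def
  using assms by (intro sum_mono integral_subset_le) (auto intro: feasible_rate)

lemma transmitted_le_size: "feasible I x ==> f \<in> flows I ==> transmitted I x f T \<le> flow_size I f"
  by (simp add: feasible_def)

lemma transmitted_complete:
  assumes x: "feasible I x" and f: "f \<in> flows I"
  obtains T where "flow_release I f \<le> T" "transmitted I x f T = flow_size I f"
proof -
  obtain T where T: "transmitted I x f T = flow_size I f"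
    using x f by (auto simp: feasible_def)
  have "transmitted I x f T \<le> transmitted I x f (max T (flow_release I f))"
    using transmitted_mono[OF x f] by simp
  then have "transmitted I x f (max T (flow_release I f)) = flow_size I f"
    using transmitted_le_size[OF x f] T by (simp add: antisym)
  then show ?thesis by (rule that[rotated]) simp
qed

lemma transmitted_after_finish:
  assumes x: "feasible I x" and f: "f \<in> flows I" and T: "flow_finish I x f < T"
  shows "transmitted I x f T = flow_size I f"
proof -
  obtain T' where "T' < T" "transmitted I x f T' = flow_size I f"
    using T transmitted_complete[OF x f] cInf_lessD unfolding flow_finish_def
    by (smt (verit) empty_Collect_eq mem_Collect_eq)
  then show ?thesis
    using transmitted_mono[OF x f, of T' T] transmitted_le_size[OF x f, of T] by simp
qed

lemma conflicting_rates_le_one: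
  assumes x: "feasible I x" and h: "h < cores I" and F: "F \<subseteq> flows I"
    and conflict: "\<And>f g. f \<in> F ==> g \<in> F ==> share_port f g"
  shows "(\<Sum>f\<in>F. x h f t) \<le> 1"
proof (cases "\<exists>f\<in>F. x h f t > 0")
  case True
  then obtain f where f: "f \<in> F" "x h f t > 0" by blast
  have idle: "x h g t = 0" if "g \<in> F - {f}" for g
  proof (rule ccontr)
    assume "x h g t \<noteq> 0"
    then have "x h g t > 0"
      using feasible_rate(1)[OF x h, of g t] that F by (auto simp: less_le)
    then have "f = g"
      using x f that h conflict[of f g] F unfolding feasible_def share_port_def by blast
    with that show False by simp
  qed
  have "finite F" using F finite_flows finite_subset by blast
  then have "(\<Sum>f\<in>F. x h f t) = x h f t"
    using f idle by (simp add: sum.remove)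
  then show ?thesis using feasible_rate(2)[OF x h, of f t] f F by auto
next
  case False
  then have "(\<Sum>f\<in>F. x h f t) \<le> 0" by (intro sum_nonpos) force
  then show ?thesis by linarith
qed

lemma conflicting_flows_load:
  assumes x: "feasible I x" and F: "F \<subseteq> flows I" and t: "0 \<le> t"
    and conflict: "\<And>f g. f \<in> F ==> g \<in> F ==> share_port f g"
    and finished: "\<And>f. f \<in> F ==> flow_finish I x f \<le> t"
  shows "(\<Sum>f\<in>F. flow_size I f) \<le> real (cores I) * t"
proof (rule field_le_epsilon)
  fix e :: real
  assume e: "0 < e"
  define T where "T = t + e / (real (cores I) + 1)"
  have T: "t < T" using e by (simp add: T_def)
  have finite_F: "finite F" using F finite_flows finite_subset by blast
  have "(\<Sum>f\<in>F. flow_size I f) = (\<Sum>f\<in>F. transmitted I x f T)"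
    using T finished F by (intro sum.cong refl transmitted_after_finish[symmetric, OF x]) force+
  also have "... = (\<Sum>h<cores I. \<Sum>f\<in>F. integral {0..T} (x h f))"
    unfolding transmitted_def by (rule sum.swap)
  also have "... = (\<Sum>h<cores I. integral {0..T} (\<lambda>\<tau>. \<Sum>f\<in>F. x h f \<tau>))"
    using F finite_F by (intro sum.cong refl integral_sum[symmetric]) (auto intro: feasible_rate[OF x])
  also have "... \<le> (\<Sum>h<cores I. integral {0..T} (\<lambda>\<tau>. 1))"
  proof (intro sum_mono integral_le)
    fix h \<tau>
    assume h: "h \<in> {..<cores I}"
    show "(\<lambda>\<tau>. \<Sum>f\<in>F. x h f \<tau>) integrable_on {0..T}"
      using h F finite_F by (intro integrable_sum) (auto intro: feasible_rate[OF x])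
    show "(\<Sum>f\<in>F. x h f \<tau>) \<le> 1"
      using h F conflict by (intro conflicting_rates_le_one[OF x]) auto
  qed auto
  also have "... = real (cores I) * T"
    using t T by simp
  also have "... \<le> real (cores I) * t + e"
    using e by (simp add: T_def field_simps)
  finally show "(\<Sum>f\<in>F. flow_size I f) \<le> real (cores I) * t + e" .
qed

lemma flow_release_nonneg: "valid_instance I ==> f \<in> flows I ==> 0 \<le> flow_release I f"
  by (auto simp: valid_instance_def flow_release_def flows_def)

lemma transmitted_le_elapsed:
  assumes I: "valid_instance I" and x: "feasible I x" and f: "f \<in> flows I" and T: "flow_release I f \<le> T"
  shows "transmitted I x f T \<le> T - flow_release I f"
proof -
  obtain h where h: "h < cores I" "\<And>h' t. h' < cores I ==> h' \<noteq> h ==> x h' f t = 0"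
    using x f unfolding feasible_def by meson
  have "integral {0..T} (x h' f) = 0" if "h' \<in> {..<cores I} - {h}" for h'
  proof -
    have "x h' f = (\<lambda>t. 0)" using h(2) that by auto
    then show ?thesis by simp
  qed
  then have "transmitted I x f T = integral {0..T} (x h f)"
    unfolding transmitted_def using h(1) by (simp add: sum.remove)
  also have "... \<le> T - flow_release I f"
  proof (rule has_integral_le)
    show "(x h f has_integral integral {0..T} (x h f)) {0..T}"
      using feasible_rate(3)[OF x h(1) f] by (rule integrable_integral)
    show "((\<lambda>t. if t \<in> {flow_release I f..T} then 1 else 0) has_integral T - flow_release I f) {0..T}"
      using flow_release_nonneg[OF I f] T has_integral_const_real[of "1::real" "flow_release I f" T]
      by (subst has_integral_restrict) auto
  qed (use feasible_rate[OF x h(1) f] in \<open>auto simp: not_le\<close>)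
  finally show ?thesis .
qed

lemma flow_finish_ge:
  assumes "valid_instance I" "feasible I x" "f \<in> flows I"
  shows "flow_release I f + flow_size I f \<le> flow_finish I x f"
  unfolding flow_finish_def
proof (rule cInf_greatest)
  show "{T. flow_release I f \<le> T \<and> transmitted I x f T = flow_size I f} \<noteq> {}"
    using transmitted_complete[OF assms(2,3)] by blast
  show "flow_release I f + flow_size I f \<le> T"
    if "T \<in> {T. flow_release I f \<le> T \<and> transmitted I x f T = flow_size I f}" for T
    using transmitted_le_elapsed[OF assms, of T] that by simp
qed

lemma flow_finish_le_completion:
  assumes "f \<in> flows I"
  shows "flow_finish I x f \<le> completion_time I x (coflow_of f)"
  unfolding completion_time_def using assms by (intro Max_ge) auto

lemma completion_le_iff:
  assumes "valid_instance I" "k < coflows I"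
  shows "completion_time I x k \<le> t \<longleftrightarrow> (\<forall>f\<in>flows I. coflow_of f = k \<longrightarrow> flow_finish I x f \<le> t)"
proof -
  have "(0, 0, k) \<in> {f \<in> flows I. coflow_of f = k}"
    using assms by (auto simp: flows_def valid_instance_def)
  then show ?thesis unfolding completion_time_def by (subst Max_le_iff) auto
qed

lemma le_mult_optimum:
  assumes "feasible I x" "0 \<le> \<rho>" and le: "\<And>x. feasible I x ==> v \<le> \<rho> * objective I x"
  shows "v \<le> \<rho> * optimum I"
proof (cases "\<rho> = 0")
  case True
  then show ?thesis using le[OF assms(1)] by simp
next
  case False
  then have \<rho>: "0 < \<rho>" using assms(2) by simp
  have "v / \<rho> \<le> optimum I"
    unfolding optimum_def
    by (rule cInf_greatest) (use assms(1) le \<rho> in \<open>auto simp: field_simps\<close>)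
  then show ?thesis using \<rho> by (simp add: field_simps)
qed

section \<open>Schedules given by disjoint periods\<close>

lemma has_integral_period:
  fixes a b T :: real
  assumes "0 \<le> a" "a \<le> b" "0 \<le> T"
  shows "((\<lambda>t. of_bool (a \<le> t \<and> t < b)) has_integral (min b T - min a T)) {0..T}"
proof (cases "a \<le> T")
  case True
  have "((\<lambda>t. if t \<in> {a..min b T} then 1 else 0) has_integral (min b T - a)) {0..T}"
    using assms True has_integral_const_real[of "1::real" a "min b T"] by (subst has_integral_restrict) auto
  then have "((\<lambda>t. of_bool (a \<le> t \<and> t < b)) has_integral (min b T - a)) {0..T}"
    by (rule has_integral_spike_finite[of "{b}", rotated 2]) auto
  then show ?thesis using True by simp
next
  case False
  have "((\<lambda>t. of_bool (a \<le> t \<and> t < b)) has_integral 0) {0..T}"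
    by (rule has_integral_is_0) (use False in auto)
  then show ?thesis using False assms by (simp add: min_def)
qed

locale periods =
  fixes I :: coflow_instance and X :: nat and cnt :: nat
    and c :: "nat => nat" and fl :: "nat => flow" and a b :: "nat => nat"
  assumes valid: "valid_instance I" and X: "0 < X"
    and period_in: "\<And>q. q < cnt ==> c q < cores I \<and> fl q \<in> flows I \<and> a q \<le> b q"
    and released: "\<And>q. q < cnt ==> flow_release I (fl q) * X \<le> a q"
    and disjoint: "\<And>q q'. q < q' ==> q' < cnt ==> c q = c q' ==> share_port (fl q) (fl q') ==>
        b q \<le> a q' \<or> b q' \<le> a q"
    and one_core: "\<And>q q'. q < cnt ==> q' < cnt ==> fl q = fl q' ==> c q = c q'"
    and full_size: "\<And>f. f \<in> flows I ==> (\<Sum>q | q < cnt \<and> fl q = f. real (b q) - real (a q)) = X * flow_size I f"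
begin

definition sched where "sched = schedule_of (map (\<lambda>q. (c q, fl q, real (a q) / real X, real (b q) / real X)) [0..<cnt])"

lemma sched_iff: "sched h f t = of_bool (\<exists>q<cnt. c q = h \<and> fl q = f \<and> a q / X \<le> t \<and> t < b q / X)"
proof -
  have "(h, f, u, v) \<in> set (map (\<lambda>q. (c q, fl q, real (a q) / real X, real (b q) / real X)) [0..<cnt]) \<longleftrightarrow>
      (\<exists>q<cnt. c q = h \<and> fl q = f \<and> a q / X = u \<and> b q / X = v)" for u v
    by auto
  then show ?thesis
    unfolding sched_def schedule_of_def by (intro arg_cong[of _ _ of_bool]) (simp, blast)
qed

lemma at_most_one:
  assumes "q < cnt" "q' < cnt" "c q = c q'" "share_port (fl q) (fl q')"
    "a q / X \<le> t" "t < b q / X" "a q' / X \<le> t" "t < b q' / X"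
  shows "q = q'"
proof (rule ccontr)
  assume "q \<noteq> q'"
  then have "b q \<le> a q' \<or> b q' \<le> a q"
    using disjoint[of q q'] disjoint[of q' q] assms(1-4) by (auto simp: share_port_def nat_neq_iff)
  then have "b q / X \<le> a q' / X \<or> b q' / X \<le> a q / X"
    by (auto intro!: divide_right_mono)
  then show False using assms(5-8) by linarith
qed

lemma sched_sum: "sched h f t = (\<Sum>q | q < cnt \<and> c q = h \<and> fl q = f. of_bool (a q / X \<le> t \<and> t < b q / X))"
proof (cases "\<exists>q<cnt. c q = h \<and> fl q = f \<and> a q / X \<le> t \<and> t < b q / X")
  case True
  then obtain q where q: "q < cnt" "c q = h" "fl q = f" "a q / X \<le> t" "t < b q / X" by blast
  have "(\<Sum>q | q < cnt \<and> c q = h \<and> fl q = f. of_bool (a q / X \<le> t \<and> t < b q / X) :: real)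
     = (\<Sum>q\<in>{q}. of_bool (a q / X \<le> t \<and> t < b q / X))"
    by (rule sum.mono_neutral_right)
      (use q in \<open>auto dest: at_most_one[of q, rotated 4] simp: share_port_def\<close>)
  also have "... = 1" using q by simp
  finally show ?thesis using True unfolding sched_iff by simp
next
  case False
  then have "(\<Sum>q | q < cnt \<and> c q = h \<and> fl q = f. of_bool (a q / X \<le> t \<and> t < b q / X) :: real) = 0"
    by (intro sum.neutral) auto
  then show ?thesis using False unfolding sched_iff by simp
qed

lemma sched_has_integral:
  assumes "0 \<le> T"
  shows "(sched h f has_integral
    (\<Sum>q | q < cnt \<and> c q = h \<and> fl q = f. min (b q / X) T - min (a q / X) T)) {0..T}"
  unfolding sched_sum[abs_def]
  using assms period_in by (intro has_integral_sum has_integral_period) (auto intro!: divide_right_mono)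

lemma sched_transmitted:
  assumes "0 \<le> T" "f \<in> flows I"
  shows "transmitted I sched f T = (\<Sum>q | q < cnt \<and> fl q = f. min (b q / X) T - min (a q / X) T)"
proof -
  have "transmitted I sched f T = (\<Sum>h<cores I. \<Sum>q | q < cnt \<and> c q = h \<and> fl q = f. min (b q / X) T - min (a q / X) T)"
    unfolding transmitted_def by (intro sum.cong refl integral_unique sched_has_integral[OF assms(1)])
  also have "... = (\<Sum>h<cores I. \<Sum>q\<in>{q \<in> {q. q < cnt \<and> fl q = f}. c q = h}. min (b q / X) T - min (a q / X) T)"
    by (intro sum.cong refl) auto
  also have "... = (\<Sum>q | q < cnt \<and> fl q = f. min (b q / X) T - min (a q / X) T)"
    by (rule sum.group) (use period_in in auto)
  finally show ?thesis .
qed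

lemma size_eq: "f \<in> flows I ==> flow_size I f = (\<Sum>q | q < cnt \<and> fl q = f. b q / X - a q / X)"
  using full_size[of f] X by (simp add: field_simps flip: sum_divide_distrib diff_divide_distrib)

lemma transmitted_done:
  assumes "f \<in> flows I" "0 \<le> T" "\<And>q. q < cnt ==> fl q = f ==> b q / X \<le> T"
  shows "transmitted I sched f T = flow_size I f"
proof -
  have "min (b q / X) T - min (a q / X) T = b q / X - a q / X" if "q < cnt" "fl q = f" for q
  proof -
    have "a q / X \<le> b q / X" using period_in[OF that(1)] by (intro divide_right_mono) auto
    then show ?thesis using assms(3)[OF that] by simp
  qed
  then show ?thesis
    using sched_transmitted[OF assms(2,1)] size_eq[OF assms(1)] by simp
qed

lemma integrable_sched: "sched h f integrable_on {0..T}"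
proof (cases "0 \<le> T")
  case True
  then show ?thesis using sched_has_integral by blast
next
  case False
  then have "{0..T} = {}" by auto
  then show ?thesis using integrable_on_empty by metis
qed

lemma sched_before_release: "t < flow_release I f ==> sched h f t = 0"
proof -
  have "flow_release I f \<le> a q / X" if "q < cnt" "fl q = f" for q
    using released[OF that(1)] that(2) X by (simp add: field_simps)
  then show "t < flow_release I f ==> sched h f t = 0" by (force simp: sched_iff)
qed

lemma sched_single_core: "\<exists>h<cores I. \<forall>h'<cores I. h' \<noteq> h \<longrightarrow> (\<forall>t. sched h' f t = 0)"
proof (cases "\<exists>q<cnt. fl q = f")
  case True
  then obtain q where q: "q < cnt" "fl q = f" by blast
  have "sched h' f t = 0" if "h' \<noteq> c q" for h' t
    using that one_core[OF _ q(1)] q(2) unfolding sched_iff by auto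
  then show ?thesis using period_in[OF q(1)] by blast
next
  case False
  then show ?thesis using valid by (intro exI[of _ 0]) (auto simp: sched_iff valid_instance_def)
qed

lemma sched_transmitted_le:
  assumes "f \<in> flows I"
  shows "transmitted I sched f T \<le> flow_size I f"
proof (cases "0 \<le> T")
  case True
  have "min (b q / X) T - min (a q / X) T \<le> b q / X - a q / X" if "q < cnt" for q
  proof -
    have "a q / X \<le> b q / X" using period_in[OF that] by (intro divide_right_mono) auto
    then show ?thesis by (simp add: min_def)
  qed
  then show ?thesis
    unfolding sched_transmitted[OF True assms] size_eq[OF assms] by (intro sum_mono) auto
next
  case False
  then have "{0..T} = {}" by auto
  then show ?thesis by (simp add: transmitted_def flow_size_def)
qed

lemma sched_transmitted_complete:
  assumes "f \<in> flows I"
  shows "\<exists>T. transmitted I sched f T = flow_size I f"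
proof -
  define T where "T = (\<Sum>q<cnt. b q / X)"
  have "b q / X \<le> T" if "q < cnt" for q
    unfolding T_def using that by (intro member_le_sum) auto
  then have "transmitted I sched f T = flow_size I f"
    using assms by (intro transmitted_done) (auto simp: T_def intro: sum_nonneg)
  then show ?thesis ..
qed

lemma feasible_sched: "feasible I sched"
  unfolding feasible_def
proof (intro conjI allI impI ballI)
  fix h t f g
  assume "0 < sched h f t \<and> 0 < sched h g t \<and> (source f = source g \<or> destination f = destination g)"
  then obtain q q' where "q < cnt" "q' < cnt" "c q = h" "c q' = h" "fl q = f" "fl q' = g"
    "a q / X \<le> t" "t < b q / X" "a q' / X \<le> t" "t < b q' / X" "share_port f g"
    by (auto simp: sched_iff share_port_def)
  then show "f = g" using at_most_one[of q q' t] by auto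
qed (use integrable_sched sched_before_release sched_single_core sched_transmitted_le sched_transmitted_complete in \<open>auto simp: sched_iff\<close>)

lemma flow_finish_sched_le:
  assumes f: "f \<in> flows I" and T: "flow_release I f \<le> T"
    and le: "\<And>q. q < cnt ==> fl q = f ==> b q / X \<le> T"
  shows "flow_finish I sched f \<le> T"
proof -
  have "0 \<le> T" using flow_release_nonneg[OF valid f] T by linarith
  then have "transmitted I sched f T = flow_size I f"
    using f le by (intro transmitted_done)
  then show ?thesis
    unfolding flow_finish_def using T
    by (intro cInf_lower) (auto intro!: bdd_belowI[of _ "flow_release I f"])
qed

end

lemma decode_periods_map:
  "decode_periods (concat (map (\<lambda>q. case fl q of (i, j, k) => [c q, i, j, k, a q, X, b q, X]) qs)) =
     map (\<lambda>q. (c q, fl q, real (a q) / real X, real (b q) / real X)) qs"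
  by (induction qs) (auto split: prod.split)

section \<open>Ordering coflows by local ratios\<close>

locale port_loads =
  fixes L :: "nat => nat => nat" and P n m :: nat
begin

definition total_load :: "nat set => nat => nat" where
  "total_load A p = (\<Sum>k\<in>A. L p k)"

definition max_load :: "nat set => nat" where
  "max_load A = Max (insert 0 (total_load A ` {..<P}))"

lemma total_load_le_max: "p < P ==> total_load A p \<le> max_load A"
  unfolding max_load_def by (intro Max_ge) auto

lemma max_load_le_iff: "max_load A \<le> x \<longleftrightarrow> (\<forall>p<P. total_load A p \<le> x)"
  unfolding max_load_def by (subst Max_le_iff) auto

lemma max_load_mono: "finite B ==> A \<subseteq> B ==> max_load A \<le> max_load B"
proof -
  assume "finite B" "A \<subseteq> B"
  then have "total_load A p \<le> total_load B p" for p
    unfolding total_load_def by (intro sum_mono2) auto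
  then show ?thesis unfolding max_load_le_iff using total_load_le_max order_trans by blast
qed

text \<open>
  The list is built from its head, which is the coflow to be scheduled last. The weights are
  multiplied by the load of the chosen coflow in each round so that they remain integers.
\<close>

inductive local_ratio_order :: "(nat => nat) => nat list => bool" where
  Nil: "local_ratio_order W []"
| Zero: "local_ratio_order W xs ==> max_load (set (k # xs)) = 0 ==> local_ratio_order W (k # xs)"
| Step: "\<mu> < P ==> total_load (set (k # xs)) \<mu> = max_load (set (k # xs)) ==> 0 < L \<mu> k ==>
    (\<And>l. l \<in> set xs ==> W k * L \<mu> l \<le> W l * L \<mu> k) ==>
    (\<And>l. l \<in> set xs ==> W' l = W l * L \<mu> k - W k * L \<mu> l) ==>
    local_ratio_order W' xs ==> local_ratio_order W (k # xs)"

fun order_cost :: "(nat => nat) => nat list => nat" where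
  "order_cost W [] = 0"
| "order_cost W (k # xs) = W k * max_load (set (k # xs)) + order_cost W xs"

lemma order_cost_bound:
  assumes "\<And>k. k \<in> set xs ==> U * W k \<le> W' k + W0 * c k"
  shows "U * order_cost W xs \<le> order_cost W' xs + W0 * ((\<Sum>k\<leftarrow>xs. c k) * max_load (set xs))"
  using assms
proof (induction xs)
  case (Cons k xs)
  have "U * order_cost W (k # xs) = (U * W k) * max_load (set (k # xs)) + U * order_cost W xs"
    by (simp add: algebra_simps)
  also have "... \<le> (W' k + W0 * c k) * max_load (set (k # xs)) +
      (order_cost W' xs + W0 * ((\<Sum>k\<leftarrow>xs. c k) * max_load (set xs)))"
    using Cons by (intro add_mono mult_right_mono) auto
  also have "... \<le> (W' k + W0 * c k) * max_load (set (k # xs)) +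
      (order_cost W' xs + W0 * ((\<Sum>k\<leftarrow>xs. c k) * max_load (set (k # xs))))"
    by (intro add_mono mult_left_mono max_load_mono) auto
  finally show ?case by (simp add: algebra_simps)
qed simp

lemma load_squared_le:
  fixes C :: "nat => real"
  assumes fin: "finite A" and C: "\<And>k. k \<in> A ==> real (\<Sum>l | l \<in> A \<and> C l \<le> C k. L p l) \<le> m * C k"
  shows "(real (total_load A p))\<^sup>2 \<le> 2 * real m * (\<Sum>k\<in>A. L p k * C k)"
proof -
  let ?L = "\<lambda>k. real (L p k)"
  have "(real (total_load A p))\<^sup>2 = (\<Sum>k\<in>A. \<Sum>l\<in>A. ?L k * ?L l)"
    by (simp add: total_load_def power2_eq_square sum_product)
  also have "... \<le> (\<Sum>k\<in>A. \<Sum>l\<in>A. ?L k * ?L l * of_bool (C l \<le> C k) + ?L k * ?L l * of_bool (C k \<le> C l))"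
    by (intro sum_mono) auto
  also have "... = (\<Sum>k\<in>A. \<Sum>l\<in>A. ?L k * ?L l * of_bool (C l \<le> C k)) + (\<Sum>k\<in>A. \<Sum>l\<in>A. ?L k * ?L l * of_bool (C k \<le> C l))"
    by (simp add: sum.distrib)
  also have "(\<Sum>k\<in>A. \<Sum>l\<in>A. ?L k * ?L l * of_bool (C k \<le> C l)) = (\<Sum>k\<in>A. \<Sum>l\<in>A. ?L k * ?L l * of_bool (C l \<le> C k))"
    by (subst sum.swap) (simp add: mult.commute)
  also have "(\<Sum>k\<in>A. \<Sum>l\<in>A. ?L k * ?L l * of_bool (C l \<le> C k)) \<le> (\<Sum>k\<in>A. ?L k * (m * C k))"
  proof (intro sum_mono)
    fix k assume k: "k \<in> A"
    have "(\<Sum>l\<in>A. ?L k * ?L l * of_bool (C l \<le> C k)) = ?L k * (\<Sum>l\<in>A. ?L l * of_bool (C l \<le> C k))"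
      by (simp add: sum_distrib_left mult.assoc)
    also have "(\<Sum>l\<in>A. ?L l * of_bool (C l \<le> C k)) = real (\<Sum>l | l \<in> A \<and> C l \<le> C k. L p l)"
      using fin by (simp add: of_bool_def if_distrib sum.If_cases Int_def cong: if_cong)
    also have "?L k * ... \<le> ?L k * (m * C k)"
      using C[OF k] by (intro mult_left_mono) auto
    finally show "(\<Sum>l\<in>A. ?L k * ?L l * of_bool (C l \<le> C k)) \<le> ?L k * (m * C k)" .
  qed
  finally show ?thesis by (simp add: sum_distrib_left mult_ac)
qed

lemma order_cost_residual:
  assumes "distinct (k # xs)" and tight: "total_load (set (k # xs)) \<mu> = max_load (set (k # xs))"
    and ratio: "\<And>l. l \<in> set xs ==> W k * L \<mu> l \<le> W l * L \<mu> k"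
    and residual: "\<And>l. l \<in> set xs ==> W' l = W l * L \<mu> k - W k * L \<mu> l"
  shows "L \<mu> k * order_cost W (k # xs) \<le> order_cost W' xs + W k * (total_load (set (k # xs)) \<mu>)\<^sup>2"
proof -
  let ?S = "set (k # xs)"
  have "L \<mu> k * order_cost W xs \<le> order_cost W' xs + W k * ((\<Sum>l\<leftarrow>xs. L \<mu> l) * max_load (set xs))"
    using ratio residual by (intro order_cost_bound) (auto simp: mult.commute)
  also have "... \<le> order_cost W' xs + W k * ((\<Sum>l\<leftarrow>xs. L \<mu> l) * max_load ?S)"
    by (intro add_left_mono mult_left_mono max_load_mono) auto
  finally have "L \<mu> k * order_cost W (k # xs) \<le> order_cost W' xs + W k * ((\<Sum>l\<leftarrow>k # xs. L \<mu> l) * max_load ?S)"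
    by (simp add: algebra_simps)
  also have "(\<Sum>l\<leftarrow>k # xs. L \<mu> l) = total_load ?S \<mu>"
    unfolding total_load_def using assms(1) by (metis sum_list_distinct_conv_sum_set)
  finally show ?thesis using tight by (simp add: power2_eq_square)
qed

lemma residual_weight_sum:
  fixes C :: "nat => real"
  assumes "distinct (k # xs)"
    and ratio: "\<And>l. l \<in> set xs ==> W k * L \<mu> l \<le> W l * L \<mu> k"
    and residual: "\<And>l. l \<in> set xs ==> W' l = W l * L \<mu> k - W k * L \<mu> l"
  shows "(\<Sum>l\<in>set xs. W' l * C l) + W k * (\<Sum>l\<in>set (k # xs). L \<mu> l * C l) = L \<mu> k * (\<Sum>l\<in>set (k # xs). W l * C l)"
proof -
  have "real (W' l) * C l + W k * (L \<mu> l * C l) = L \<mu> k * (W l * C l)" if "l \<in> set xs" for l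
    using ratio[OF that] residual[OF that] by (simp add: of_nat_diff algebra_simps flip: of_nat_mult)
  then have "(\<Sum>l\<in>set xs. W' l * C l) + (\<Sum>l\<in>set xs. W k * (L \<mu> l * C l)) = (\<Sum>l\<in>set xs. L \<mu> k * (W l * C l))"
    unfolding sum.distrib[symmetric] by (intro sum.cong refl)
  then show ?thesis using assms(1) by (simp add: sum_distrib_left algebra_simps)
qed

theorem local_ratio_order_cost:
  fixes C :: "nat => real"
  assumes "local_ratio_order W xs" "distinct xs" "set xs \<subseteq> {..<n}"
    and load: "\<And>(t::real) p. 0 \<le> t ==> p < P ==> real (\<Sum>k | k < n \<and> C k \<le> t. L p k) \<le> m * t"
    and nonneg: "\<And>k. k < n ==> 0 \<le> C k"
  shows "real (order_cost W xs) \<le> 2 * real m * (\<Sum>k\<in>set xs. W k * C k)"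
  using assms(1-3)
proof (induction rule: local_ratio_order.induct)
  case (Nil W)
  then show ?case by simp
next
  case (Zero W xs k)
  have "0 \<le> real m * (W k * C k)" using nonneg Zero.prems by (intro mult_nonneg_nonneg) auto
  then show ?case using Zero by (auto simp: algebra_simps)
next
  case (Step \<mu> k xs W W')
  let ?S = "set (k # xs)"
  have squared: "(real (total_load ?S \<mu>))\<^sup>2 \<le> 2 * real m * (\<Sum>l\<in>?S. L \<mu> l * C l)"
  proof (rule load_squared_le)
    fix l assume l: "l \<in> ?S"
    have "real (\<Sum>l' | l' \<in> ?S \<and> C l' \<le> C l. L \<mu> l') \<le> real (\<Sum>k | k < n \<and> C k \<le> C l. L \<mu> k)"
      unfolding of_nat_le_iff using Step.prems by (intro sum_mono2) auto
    also have "... \<le> m * C l" using l Step.prems Step.hyps(1) nonneg[of l] load[of "C l" \<mu>] by auto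
    finally show "real (\<Sum>l' | l' \<in> ?S \<and> C l' \<le> C l. L \<mu> l') \<le> m * C l" .
  qed simp
  have "real (L \<mu> k * order_cost W (k # xs)) \<le> real (order_cost W' xs + W k * (total_load ?S \<mu>)\<^sup>2)"
    unfolding of_nat_le_iff using Step by (intro order_cost_residual) auto
  also have "... = real (order_cost W' xs) + W k * (real (total_load ?S \<mu>))\<^sup>2" by simp
  also have "... \<le> 2 * real m * (\<Sum>l\<in>set xs. W' l * C l) + W k * (2 * real m * (\<Sum>l\<in>?S. L \<mu> l * C l))"
    using Step by (intro add_mono mult_left_mono squared) auto
  also have "... = 2 * real m * ((\<Sum>l\<in>set xs. W' l * C l) + W k * (\<Sum>l\<in>?S. L \<mu> l * C l))"
    by (simp only: distrib_left mult.left_commute)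
  also have "... = L \<mu> k * (2 * real m * (\<Sum>l\<in>?S. W l * C l))"
    using residual_weight_sum[OF Step.prems(1) Step.hyps(4,5)] by (simp only: mult.left_commute)
  finally show ?case
    using Step.hyps(3) by simp
qed

lemma local_ratio_order_zero_load: "max_load (set xs) = 0 ==> local_ratio_order W xs"
proof (induction xs)
  case (Cons k xs)
  have "max_load (set xs) = 0"
    using Cons.prems max_load_mono[of "set (k # xs)" "set xs"] by auto
  then show ?case using Cons by (intro local_ratio_order.Zero) auto
qed (rule local_ratio_order.Nil)

lemma local_ratio_order_cong:
  assumes "local_ratio_order W xs" "\<And>k. k \<in> set xs ==> W k = W' k"
  shows "local_ratio_order W' xs"
  using assms
proof (induction arbitrary: W' rule: local_ratio_order.induct)
  case (Step \<mu> k xs V V')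
  show ?case
    by (rule local_ratio_order.Step[of \<mu> k xs W' V']) (use Step in auto)
qed (auto intro: local_ratio_order.intros)

definition up_to :: "nat list => nat => nat set" where
  "up_to xs k = set (dropWhile (\<lambda>l. l \<noteq> k) xs)"

lemma up_to_subset: "up_to xs k \<subseteq> set xs"
  unfolding up_to_def by (meson set_dropWhileD subsetI)

lemma up_to_nth: "distinct xs ==> t < length xs ==> up_to xs (xs ! t) = set (drop t xs)"
proof (induction xs arbitrary: t)
  case (Cons y xs)
  then show ?case by (cases t) (auto simp: up_to_def)
qed simp

lemma order_cost_sum: "distinct xs ==> order_cost W xs = (\<Sum>k\<in>set xs. W k * max_load (up_to xs k))"
proof (induction xs)
  case (Cons y xs)
  have "(\<Sum>k\<in>set xs. W k * max_load (up_to (y # xs) k)) = (\<Sum>k\<in>set xs. W k * max_load (up_to xs k))"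
    using Cons.prems by (intro sum.cong) (auto simp: up_to_def)
  then show ?case using Cons by (simp add: up_to_def)
qed simp

end

section \<open>Fractional completion on a geometric time grid\<close>

definition ceil_div :: "nat => nat => nat" where
  "ceil_div x s = (x + (s - 1)) div s"

lemma ceil_div_le_iff: "0 < s ==> ceil_div x s \<le> k \<longleftrightarrow> x \<le> s * k"
proof -
  assume s: "0 < s"
  have "ceil_div x s \<le> k \<longleftrightarrow> ceil_div x s < Suc k" by (simp add: less_Suc_eq_le)
  also have "... \<longleftrightarrow> x + (s - 1) < Suc k * s" unfolding ceil_div_def using s by (rule div_less_iff_less_mult)
  also have "... \<longleftrightarrow> x \<le> s * k" using s by (simp add: mult.commute) arith
  finally show ?thesis .
qed

lemma le_mult_ceil_div: "0 < s ==> x \<le> s * ceil_div x s"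
  by (simp flip: ceil_div_le_iff)

lemma mult_ceil_div_le: "s * ceil_div x s \<le> x + s"
  using times_div_less_eq_dividend[of s "x + (s - 1)"] unfolding ceil_div_def by linarith

lemma exp_mean_le:
  fixes y :: "'a => real"
  assumes "finite A" "A \<noteq> {}"
  shows "exp ((\<Sum>i\<in>A. y i) / card A) \<le> (\<Sum>i\<in>A. exp (y i)) / card A"
  using convex_on_sum[OF assms exp_convex, of "\<lambda>_. 1 / card A" y] assms
  by (simp add: card_gt_0_iff flip: sum_divide_distrib)

text \<open>
  A coflow that is completed at time \<open>C\<close> occupies the grid points from \<open>C\<close> on; a port cannot have
  more than \<open>t\<close> units of data completed at time \<open>t\<close>. The resulting linear program is solved
  approximately by a drift-plus-penalty iteration: a queue for each port and grid point
  accumulates the violation of its constraint, and in each round every coflow chooses the grid point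
  that minimises its weighted completion time plus the queue lengths it would see.
\<close>

locale drift =
  fixes N n H :: nat and L :: "nat => nat => nat" and B W :: "nat => nat"
  assumes N: "1 \<le> N" and n: "1 \<le> n" and H: "12 \<le> H"
    and L_le: "\<And>p k. p < 2 * N ==> k < n ==> L p k \<le> B k"
    and top: "\<And>k. k < n ==> n * B k * 10 ^ (H - 12) \<le> 11 ^ (H - 12)"
    and weighted_pos: "\<And>k. k < n ==> 0 < W k ==> 0 < B k"
begin

definition T :: "nat => nat" where "T g = 11 ^ g * 10 ^ (H - g)"

definition load :: "(nat => nat) => nat => nat => nat" where
  "load G p g = (\<Sum>k<n. L p k * of_bool (G k \<le> g))"

primrec queue :: "(nat => nat => nat) => nat => nat => nat => nat" where
  "queue Gs 0 = (\<lambda>p g. 0)"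
| "queue Gs (Suc s) = (\<lambda>p g. queue Gs s p g + 10 ^ H * load (Gs s) p g - T g)"

definition drift_bound :: nat where "drift_bound = N * H * n * n"

definition base_cost :: nat where "base_cost = (\<Sum>k<n. W k * B k) * 10 ^ H + 1"

definition cost :: "(nat => nat => nat) => nat => nat => nat" where
  "cost q k g = 40 * drift_bound * 110 ^ H * 110 ^ H * W k * T g + base_cost * 10 ^ H *
     (\<Sum>g'\<in>{g..<H}. (\<Sum>p<2*N. q p g' * L p k) * (110 ^ H div T g') * (110 ^ H div T g'))"

definition allowed :: "nat => nat => bool" where
  "allowed k g \<longleftrightarrow> g \<le> H - 12 \<and> 10 ^ H * B k \<le> T g"

definition best :: "(nat => nat => nat) => nat => nat => bool" where
  "best q k g \<longleftrightarrow> allowed k g \<and> (\<forall>g'. allowed k g' \<longrightarrow> cost q k g \<le> cost q k g')"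

definition rounds :: nat where "rounds = 9000 * N * H * n * n * n"

definition hits :: "(nat => nat => nat) => nat => nat => nat" where
  "hits Gs k g = (\<Sum>s<rounds. of_bool (Gs s k \<le> g))"

definition \<tau> :: "nat => real" where "\<tau> g = (11 / 10) ^ g"

lemma T_eq: "g \<le> H ==> real (T g) = 10 ^ H * \<tau> g"
proof -
  assume "g \<le> H"
  then have "(10::real) ^ H = 10 ^ (H - g) * 10 ^ g" by (simp flip: power_add)
  then show ?thesis by (simp add: T_def \<tau>_def power_divide)
qed

lemma T_pos: "0 < T g"
  by (simp add: T_def)

lemma \<tau>_pos: "0 < \<tau> g"
  by (simp add: \<tau>_def)

lemma \<tau>_mono: "g \<le> g' ==> \<tau> g \<le> \<tau> g'"
  unfolding \<tau>_def by (intro power_increasing) auto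

lemma T_div: "g \<le> H ==> real (110 ^ H div T g) = 110 ^ H / T g"
proof -
  assume g: "g \<le> H"
  have "T g * (11 ^ (H - g) * 10 ^ g) = 11 ^ (g + (H - g)) * 10 ^ ((H - g) + g)"
    unfolding T_def power_add by (simp add: algebra_simps)
  also have "... = 110 ^ H"
    using g by (simp flip: power_mult_distrib)
  finally have "T g dvd 110 ^ H" by (metis dvd_triv_left)
  then show ?thesis by (simp add: real_of_nat_div)
qed

lemma top_real: "k < n ==> real n * B k \<le> \<tau> (H - 12)"
proof -
  assume "k < n"
  then have "real (n * B k * 10 ^ (H - 12)) \<le> real (11 ^ (H - 12))"
    using top of_nat_le_iff by blast
  then show ?thesis by (simp add: \<tau>_def power_divide field_simps)
qed

lemma B_le_top: "k < n ==> real (B k) \<le> \<tau> (H - 12)"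
  using top_real[of k] n mult_right_mono[of 1 "real n" "real (B k)"] by auto

lemma allowed_iff: "allowed k g \<longleftrightarrow> g \<le> H - 12 \<and> real (B k) \<le> \<tau> g"
proof (cases "g \<le> H - 12")
  case True
  then have g: "g \<le> H" by simp
  have "10 ^ H * B k \<le> T g \<longleftrightarrow> real (10 ^ H * B k) \<le> real (T g)" by (simp only: of_nat_le_iff)
  also have "... \<longleftrightarrow> real (B k) \<le> \<tau> g" by (simp add: T_eq[OF g])
  finally show ?thesis by (simp add: allowed_def)
qed (simp add: allowed_def)

lemma base_cost_pos: "0 < real base_cost"
  unfolding of_nat_0_less_iff by (simp add: base_cost_def)

definition greedy :: "(nat => nat => nat) => bool" where
  "greedy Gs \<longleftrightarrow> (\<forall>s<rounds. \<forall>k<n. best (queue Gs s) k (Gs s k))"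

lemma rounds_eq: "rounds = 9000 * drift_bound * n"
  by (simp add: rounds_def drift_bound_def)

lemma drift_bound_pos: "0 < drift_bound"
  using N n H by (simp add: drift_bound_def)

lemma rounds_pos: "0 < rounds"
  using drift_bound_pos n by (simp add: rounds_eq)

context
  fixes Gs :: "nat => nat => nat"
  assumes greedy: "greedy Gs"
begin

lemma best: "s < rounds ==> k < n ==> best (queue Gs s) k (Gs s k)"
  using greedy by (simp add: greedy_def)

definition Q :: "nat => nat => nat => real" where
  "Q s p g = queue Gs s p g / T g"

definition violation :: "(nat => nat) => nat => nat => real" where
  "violation G p g = load G p g / \<tau> g - 1"

definition penalty :: real where "penalty = 40 * drift_bound * 10 ^ H / base_cost"

definition real_cost :: "nat => nat => nat => real" where
  "real_cost s k g = penalty * W k * \<tau> g + (\<Sum>g'\<in>{g..<H}. \<Sum>p<2*N. Q s p g' * L p k / \<tau> g')"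

definition grid_objective :: "(nat => nat) => real" where
  "grid_objective G = (\<Sum>k<n. W k * \<tau> (G k))"

definition potential :: "nat => real" where
  "potential s = (\<Sum>g<H. \<Sum>p<2*N. (Q s p g)\<^sup>2) / 2"

lemma Q_nonneg: "0 \<le> Q s p g"
  by (simp add: Q_def)

lemma Q_Suc: "g < H ==> Q (Suc s) p g = max 0 (Q s p g + violation (Gs s) p g)"
proof -
  assume g: "g < H"
  let ?a = "queue Gs s p g + 10 ^ H * load (Gs s) p g"
  have "real (a - b) = max 0 (real a - real b)" for a b :: nat
    by (cases "b \<le> a") (auto simp: of_nat_diff max_def)
  then have "Q (Suc s) p g = max 0 (real ?a - real (T g)) / T g"
    unfolding Q_def queue.simps by metis
  also have "... = max 0 ((real ?a - real (T g)) / T g)"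
    by (simp add: max_divide_distrib_right)
  also have "(real ?a - real (T g)) / T g = Q s p g + violation (Gs s) p g"
    using g T_pos[of g] \<tau>_pos[of g] by (simp add: Q_def violation_def T_eq field_simps)
  finally show ?thesis .
qed

lemma cost_eq: "g \<le> H ==> real (cost (queue Gs s) k g) = real base_cost * 110 ^ H * 110 ^ H * real_cost s k g"
proof -
  assume g: "g \<le> H"
  have "real (40 * drift_bound * 110 ^ H * 110 ^ H * W k * T g) = real base_cost * 110 ^ H * 110 ^ H * (penalty * W k * \<tau> g)"
    using base_cost_pos by (simp add: penalty_def T_eq[OF g])
  moreover have "real (base_cost * 10 ^ H * (\<Sum>g'\<in>{g..<H}. (\<Sum>p<2*N. queue Gs s p g' * L p k) * (110 ^ H div T g') * (110 ^ H div T g')))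
     = real base_cost * 110 ^ H * 110 ^ H * (\<Sum>g'\<in>{g..<H}. \<Sum>p<2*N. Q s p g' * L p k / \<tau> g')"
  proof -
    have "10 ^ H * (real (\<Sum>p<2*N. queue Gs s p g' * L p k) * (110 ^ H div T g') * (110 ^ H div T g'))
        = 110 ^ H * 110 ^ H * (\<Sum>p<2*N. Q s p g' * L p k / \<tau> g')" if "g' \<in> {g..<H}" for g'
      using that T_pos[of g'] \<tau>_pos[of g']
      by (simp add: T_div Q_def sum_distrib_left sum_distrib_right sum_divide_distrib T_eq field_simps)
    moreover define f where "f g' = (\<Sum>p<2*N. queue Gs s p g' * L p k) * (110 ^ H div T g') * (110 ^ H div T g')" for g'
    moreover define h where "h g' = (\<Sum>p<2*N. Q s p g' * L p k / \<tau> g')" for g'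
    ultimately have eq: "10 ^ H * real (f g') = 110 ^ H * 110 ^ H * h g'" if "g' \<in> {g..<H}" for g'
      using that by simp
    have "real (base_cost * 10 ^ H * (\<Sum>g'\<in>{g..<H}. f g')) = real base_cost * (\<Sum>g'\<in>{g..<H}. 10 ^ H * real (f g'))"
      by (simp add: sum_distrib_left mult.assoc)
    also have "... = real base_cost * (\<Sum>g'\<in>{g..<H}. 110 ^ H * 110 ^ H * h g')"
      using eq by simp
    also have "... = real base_cost * 110 ^ H * 110 ^ H * (\<Sum>g'\<in>{g..<H}. h g')"
      by (simp add: sum_distrib_left mult.assoc)
    finally show ?thesis by (simp only: f_def h_def)
  qed
  ultimately show ?thesis
    unfolding cost_def real_cost_def by (simp only: of_nat_add distrib_left)
qed

lemma real_cost_best: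
  assumes "s < rounds" "k < n" "allowed k g"
  shows "real_cost s k (Gs s k) \<le> real_cost s k g"
proof -
  have "cost (queue Gs s) k (Gs s k) \<le> cost (queue Gs s) k g" "Gs s k \<le> H" "g \<le> H"
    using best[OF assms(1,2)] assms(3) by (auto simp: best_def allowed_def)
  then have "real base_cost * 110 ^ H * 110 ^ H * real_cost s k (Gs s k) \<le> real base_cost * 110 ^ H * 110 ^ H * real_cost s k g"
    by (metis cost_eq of_nat_le_iff)
  moreover have "0 < real base_cost * 110 ^ H * 110 ^ H" using base_cost_pos by simp
  ultimately show ?thesis using mult_le_cancel_left_pos by blast
qed

lemma queue_load:
  assumes "\<And>k. k < n ==> G k \<le> H"
  shows "(\<Sum>g<H. \<Sum>p<2*N. Q s p g * (load G p g / \<tau> g)) = (\<Sum>k<n. real_cost s k (G k)) - penalty * grid_objective G"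
proof -
  have "(\<Sum>g<H. \<Sum>p<2*N. Q s p g * (load G p g / \<tau> g))
     = (\<Sum>g<H. \<Sum>p<2*N. \<Sum>k<n. Q s p g * L p k / \<tau> g * of_bool (G k \<le> g))"
    by (simp add: load_def sum_distrib_left sum_divide_distrib mult_ac
        del: sum_mult_of_bool_eq sum_of_bool_mult_eq)
  also have "... = (\<Sum>k<n. \<Sum>g<H. \<Sum>p<2*N. Q s p g * L p k / \<tau> g * of_bool (G k \<le> g))"
    by (subst (2) sum.swap, subst sum.swap) simp
  also have "... = (\<Sum>k<n. \<Sum>g\<in>{G k..<H}. \<Sum>p<2*N. Q s p g * L p k / \<tau> g)"
  proof (rule sum.cong[OF refl])
    fix k
    have "(\<Sum>g<H. \<Sum>p<2*N. Q s p g * L p k / \<tau> g * of_bool (G k \<le> g)) =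
       (\<Sum>g\<in>{G k..<H}. \<Sum>p<2*N. Q s p g * L p k / \<tau> g * of_bool (G k \<le> g))"
      by (rule sum.mono_neutral_right) auto
    then show "(\<Sum>g<H. \<Sum>p<2*N. Q s p g * L p k / \<tau> g * of_bool (G k \<le> g)) =
       (\<Sum>g\<in>{G k..<H}. \<Sum>p<2*N. Q s p g * L p k / \<tau> g)" by simp
  qed
  also have "... = (\<Sum>k<n. real_cost s k (G k)) - penalty * grid_objective G"
    by (simp add: real_cost_def grid_objective_def sum.distrib sum_distrib_left mult.assoc)
  finally show ?thesis .
qed

lemma violation_squared_le:
  assumes "s < rounds" "g < H" "p < 2 * N"
  shows "(violation (Gs s) p g)\<^sup>2 \<le> real n * n"
proof -
  have "real (load (Gs s) p g) \<le> (\<Sum>k<n. \<tau> g)"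
    unfolding load_def of_nat_sum
  proof (intro sum_mono)
    fix k assume "k \<in> {..<n}"
    then have k: "k < n" by simp
    have "real (B k) \<le> \<tau> (Gs s k)"
      using best[OF assms(1) k] by (simp add: best_def allowed_iff)
    then show "real (L p k * of_bool (Gs s k \<le> g)) \<le> \<tau> g"
      using L_le[OF assms(3) k] \<tau>_mono[of "Gs s k" g] \<tau>_pos[of g]
      by (cases "Gs s k \<le> g") (simp_all add: order_trans)
  qed
  then have "real (load (Gs s) p g) / \<tau> g \<le> n"
    using \<tau>_pos[of g] by (simp add: field_simps)
  moreover have "0 \<le> real (load (Gs s) p g) / \<tau> g" using \<tau>_pos[of g] by simp
  moreover have "1 \<le> real n" using n by simp
  ultimately have "\<bar>violation (Gs s) p g\<bar> \<le> n" unfolding violation_def by linarith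
  then have "\<bar>violation (Gs s) p g\<bar>\<^sup>2 \<le> (real n)\<^sup>2" by (intro power_mono) auto
  then show ?thesis by (simp add: power2_eq_square)
qed

lemma potential_step:
  assumes s: "s < rounds"
    and G: "\<And>k. k < n ==> allowed k (G k)"
    and feas: "\<And>p g. p < 2 * N ==> g < H ==> load G p g \<le> \<tau> g"
  shows "potential (Suc s) + penalty * grid_objective (Gs s) \<le> potential s + drift_bound + penalty * grid_objective G"
proof -
  let ?v = "violation (Gs s)"
  have "(Q (Suc s) p g)\<^sup>2 \<le> (Q s p g)\<^sup>2 + 2 * (Q s p g * ?v p g) + real n * n" if "g < H" "p < 2 * N" for p g
  proof -
    have "(Q (Suc s) p g)\<^sup>2 \<le> (Q s p g + ?v p g)\<^sup>2"
      unfolding Q_Suc[OF that(1)] by (simp add: max_def power2_le_iff_abs_le)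
    then show ?thesis using violation_squared_le[OF s that] by (simp add: power2_sum)
  qed
  then have "2 * potential (Suc s) \<le> (\<Sum>g<H. \<Sum>p<2*N. (Q s p g)\<^sup>2 + 2 * (Q s p g * ?v p g) + real n * n)"
    unfolding potential_def by (simp, intro sum_mono) auto
  also have "... = 2 * potential s + 2 * (\<Sum>g<H. \<Sum>p<2*N. Q s p g * ?v p g) + 2 * drift_bound"
    by (simp add: potential_def drift_bound_def sum.distrib flip: sum_distrib_left)
  also have "(\<Sum>g<H. \<Sum>p<2*N. Q s p g * ?v p g) =
     (\<Sum>g<H. \<Sum>p<2*N. Q s p g * (load (Gs s) p g / \<tau> g)) - (\<Sum>g<H. \<Sum>p<2*N. Q s p g)"
    by (simp add: violation_def algebra_simps sum_subtractf)
  also have "(\<Sum>g<H. \<Sum>p<2*N. Q s p g * (load (Gs s) p g / \<tau> g)) = (\<Sum>k<n. real_cost s k (Gs s k)) - penalty * grid_objective (Gs s)"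
  proof (rule queue_load)
    show "Gs s k \<le> H" if "k < n" for k using best[OF s that] by (auto simp: best_def allowed_def intro: order_trans)
  qed
  finally have step: "2 * potential (Suc s) \<le> 2 * potential s +
      2 * ((\<Sum>k<n. real_cost s k (Gs s k)) - penalty * grid_objective (Gs s) - (\<Sum>g<H. \<Sum>p<2*N. Q s p g)) + 2 * drift_bound" .
  have chosen_best: "(\<Sum>k<n. real_cost s k (Gs s k)) \<le> (\<Sum>k<n. real_cost s k (G k))"
    using G by (intro sum_mono real_cost_best[OF s]) auto
  have "Q s p g * (load G p g / \<tau> g) \<le> Q s p g * 1" if "g < H" "p < 2 * N" for p g
    using feas[OF that(2,1)] \<tau>_pos[of g] Q_nonneg by (intro mult_left_mono) auto
  then have "(\<Sum>g<H. \<Sum>p<2*N. Q s p g * (load G p g / \<tau> g)) \<le> (\<Sum>g<H. \<Sum>p<2*N. Q s p g)"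
    by (intro sum_mono) force
  moreover have "(\<Sum>g<H. \<Sum>p<2*N. Q s p g * (load G p g / \<tau> g)) = (\<Sum>k<n. real_cost s k (G k)) - penalty * grid_objective G"
  proof (rule queue_load)
    show "G k \<le> H" if "k < n" for k using G[OF that] by (auto simp: allowed_def)
  qed
  ultimately show ?thesis using step chosen_best by (simp add: algebra_simps)
qed

lemma potential_total:
  assumes "\<And>k. k < n ==> allowed k (G k)"
    and "\<And>p g. p < 2 * N ==> g < H ==> load G p g \<le> \<tau> g"
  shows "potential rounds + penalty * (\<Sum>s<rounds. grid_objective (Gs s)) \<le> rounds * (drift_bound + penalty * grid_objective G)"
proof -
  have "potential s + penalty * (\<Sum>s<s. grid_objective (Gs s)) \<le> s * (drift_bound + penalty * grid_objective G)" if "s \<le> rounds" for s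
    using that
  proof (induction s)
    case 0
    then show ?case by (simp add: potential_def Q_def)
  next
    case (Suc s)
    then show ?case
      using potential_step[of s G, OF _ assms] by (simp add: algebra_simps)
  qed
  then show ?thesis by blast
qed

lemma penalty_pos: "0 < penalty"
  using drift_bound_pos base_cost_pos by (simp add: penalty_def)

lemma grid_objective_nonneg: "0 \<le> grid_objective G"
  unfolding grid_objective_def using \<tau>_pos by (intro sum_nonneg mult_nonneg_nonneg) (auto intro: less_imp_le)

definition grid_index :: "real => nat" where
  "grid_index c = (LEAST g. c \<le> \<tau> g \<or> g = H - 12)"

lemma grid_index_cases: "c \<le> \<tau> (grid_index c) \<or> grid_index c = H - 12"
  unfolding grid_index_def by (rule LeastI[of _ "H - 12"]) simp

lemma grid_index_le: "grid_index c \<le> H - 12"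
  unfolding grid_index_def by (rule Least_le) simp

lemma grid_index_overshoot:
  assumes "1 \<le> c"
  shows "\<tau> (grid_index c) \<le> 11 / 10 * c"
proof (cases "grid_index c")
  case 0
  then show ?thesis using assms by (simp add: \<tau>_def)
next
  case (Suc g)
  then have "\<not> c \<le> \<tau> g"
    unfolding grid_index_def using not_less_Least[of g "\<lambda>g. c \<le> \<tau> g \<or> g = H - 12"] by simp
  then show ?thesis using Suc by (simp add: \<tau>_def)
qed

lemma allowed_grid_index:
  fixes c :: real
  assumes "k < n" "B k \<le> c"
  shows "allowed k (grid_index c)"
  using grid_index_cases[of c] grid_index_le[of c] B_le_top[OF assms(1)] assms(2) by (auto simp: allowed_iff)

lemma grid_objective_grid_index:
  fixes C :: "nat => real"
  assumes "\<And>k. k < n ==> 0 < W k ==> 1 \<le> C k"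
  shows "grid_objective (\<lambda>k. grid_index (C k)) \<le> 11 / 10 * (\<Sum>k<n. W k * C k)"
  unfolding grid_objective_def sum_distrib_left
proof (rule sum_mono)
  fix k assume "k \<in> {..<n}"
  then have "W k = 0 \<or> \<tau> (grid_index (C k)) \<le> 11 / 10 * C k"
    using assms[of k] grid_index_overshoot by auto
  then show "W k * \<tau> (grid_index (C k)) \<le> 11 / 10 * (W k * C k)"
    using mult_left_mono[of "\<tau> (grid_index (C k))" "11 / 10 * C k" "real (W k)"] by (auto simp: mult_ac)
qed

lemma load_le_top:
  assumes p: "p < 2 * N"
  shows "load G p g \<le> \<tau> (H - 12)"
proof -
  have "real (load G p g) \<le> (\<Sum>k<n. \<tau> (H - 12) / n)"
    unfolding load_def of_nat_sum
  proof (intro sum_mono)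
    fix k assume "k \<in> {..<n}"
    then have k: "k < n" by simp
    have "real (L p k * of_bool (G k \<le> g)) \<le> L p k" by simp
    also have "... \<le> B k" using L_le[OF p k] by simp
    also have "... \<le> \<tau> (H - 12) / n" using top_real[OF k] n by (simp add: field_simps)
    finally show "real (L p k * of_bool (G k \<le> g)) \<le> \<tau> (H - 12) / n" .
  qed
  then show ?thesis using n by simp
qed

lemma load_grid_index:
  fixes C :: "nat => real"
  assumes p: "p < 2 * N" and load: "\<And>t. 0 \<le> t ==> real (\<Sum>k | k < n \<and> C k \<le> t. L p k) \<le> t"
  shows "load (\<lambda>k. grid_index (C k)) p g \<le> \<tau> g"
proof (cases "g < H - 12")
  case True
  have "load (\<lambda>k. grid_index (C k)) p g = (\<Sum>k | k < n \<and> grid_index (C k) \<le> g. L p k)"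
    unfolding load_def by (simp add: of_bool_def if_distrib sum.If_cases Int_def cong: if_cong)
  also have "... \<le> (\<Sum>k | k < n \<and> C k \<le> \<tau> g. L p k)"
  proof (rule sum_mono2)
    show "{k. k < n \<and> grid_index (C k) \<le> g} \<subseteq> {k. k < n \<and> C k \<le> \<tau> g}"
      using grid_index_cases True \<tau>_mono order_trans by fastforce
  qed auto
  finally have "real (load (\<lambda>k. grid_index (C k)) p g) \<le> real (\<Sum>k | k < n \<and> C k \<le> \<tau> g. L p k)"
    by (simp only: of_nat_le_iff)
  also have "... \<le> \<tau> g" using \<tau>_pos[of g] by (intro load) auto
  finally show ?thesis .
next
  case False
  then show ?thesis using load_le_top[OF p] \<tau>_mono[of "H - 12" g] by (meson not_less order_trans)
qed

lemma crude_load: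
  assumes p: "p < 2 * N" and t: "0 \<le> t"
  shows "real (\<Sum>k | k < n \<and> real n * B k \<le> t. L p k) \<le> t"
proof -
  have "real (L p k) \<le> t / n" if "k < n" "real n * B k \<le> t" for k
  proof -
    have "real n * L p k \<le> real n * B k" using L_le[OF p that(1)] by (intro mult_left_mono) auto
    then have "real n * L p k \<le> t" using that(2) by linarith
    then show ?thesis using n by (simp add: pos_le_divide_eq mult.commute)
  qed
  then have "real (\<Sum>k | k < n \<and> real n * B k \<le> t. L p k) \<le> (\<Sum>k | k < n \<and> real n * B k \<le> t. t / n)"
    unfolding of_nat_sum by (intro sum_mono) auto
  also have "... \<le> (\<Sum>k<n. t / n)" using t by (intro sum_mono2) auto
  finally show ?thesis using n by simp
qed

lemma crude_objective: "penalty * grid_objective (\<lambda>k. grid_index (real n * B k)) \<le> 44 * n * drift_bound"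
proof -
  define z where "z = (\<Sum>k<n. W k * B k)"
  have "1 \<le> real n * B k" if "k < n" "0 < W k" for k
    using weighted_pos[OF that] n mult_mono[of 1 "real n" 1 "real (B k)"] by simp
  then have "grid_objective (\<lambda>k. grid_index (real n * B k)) \<le> 11 / 10 * (\<Sum>k<n. W k * (real n * B k))"
    by (rule grid_objective_grid_index)
  also have "... = 11 / 10 * n * real z"
    by (simp add: z_def sum_distrib_left mult_ac)
  finally have "penalty * grid_objective (\<lambda>k. grid_index (real n * B k)) \<le> penalty * (11 / 10 * n * real z)"
    using penalty_pos by (intro mult_left_mono) auto
  also have "... = real (44 * n * drift_bound) * (10 ^ H * real z / base_cost)"
    by (simp add: penalty_def)
  also have "... \<le> real (44 * n * drift_bound) * 1"
    using base_cost_pos unfolding base_cost_def z_def[symmetric] by (intro mult_left_mono) auto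
  finally show ?thesis by simp
qed

lemma potential_bound: "potential rounds \<le> (rounds / 10)\<^sup>2 / 2"
proof -
  let ?G = "\<lambda>k. grid_index (real n * B k)"
  have "real (B k) \<le> real n * B k" for k
    using n mult_right_mono[of 1 "real n" "real (B k)"] by simp
  then have "potential rounds + penalty * (\<Sum>s<rounds. grid_objective (Gs s)) \<le> rounds * (drift_bound + penalty * grid_objective ?G)"
    by (intro potential_total) (auto intro: allowed_grid_index load_grid_index crude_load)
  moreover have "0 \<le> penalty * (\<Sum>s<rounds. grid_objective (Gs s))"
    using penalty_pos grid_objective_nonneg by (intro mult_nonneg_nonneg sum_nonneg) auto
  ultimately have "potential rounds \<le> rounds * (drift_bound + penalty * grid_objective ?G)" by linarith
  also have "... \<le> rounds * (drift_bound + real (44 * n * drift_bound))"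
    using crude_objective by (intro mult_left_mono) auto
  also have "... \<le> rounds * real (45 * n * drift_bound)"
    using n mult_right_mono[of 1 "real n" "real drift_bound"] by (intro mult_left_mono) auto
  also have "... = (rounds / 10)\<^sup>2 / 2"
    by (simp add: rounds_eq power2_eq_square)
  finally show ?thesis .
qed

lemma queue_bound:
  assumes "p < 2 * N" "g < H"
  shows "Q rounds p g \<le> rounds / 10"
proof -
  have "(Q rounds p g)\<^sup>2 \<le> (\<Sum>p<2*N. (Q rounds p g)\<^sup>2)" using assms by (intro member_le_sum) auto
  also have "... \<le> (\<Sum>g<H. \<Sum>p<2*N. (Q rounds p g)\<^sup>2)"
    using assms by (intro member_le_sum[of g "{..<H}" "\<lambda>g. \<Sum>p<2*N. (Q rounds p g)\<^sup>2"] sum_nonneg) auto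
  also have "... = 2 * potential rounds" by (simp add: potential_def)
  finally have "(Q rounds p g)\<^sup>2 \<le> (rounds / 10)\<^sup>2" using potential_bound by linarith
  then show ?thesis by (rule power2_le_imp_le) simp
qed

lemma sum_violation_le: "g < H ==> (\<Sum>s<s'. violation (Gs s) p g) \<le> Q s' p g"
  by (induction s') (auto simp: Q_Suc, simp add: Q_def)

theorem fractional_load:
  assumes "p < 2 * N" "g < H"
  shows "10 * 10 ^ H * (\<Sum>k<n. L p k * hits Gs k g) \<le> 11 * rounds * T g"
proof -
  have "(\<Sum>k<n. L p k * hits Gs k g) = (\<Sum>s<rounds. load (Gs s) p g)"
    unfolding hits_def load_def sum_distrib_left by (rule sum.swap)
  then have "real (\<Sum>k<n. L p k * hits Gs k g) / \<tau> g - rounds = (\<Sum>s<rounds. violation (Gs s) p g)"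
    by (simp add: violation_def sum_subtractf sum_divide_distrib)
  also have "... \<le> rounds / 10"
    using sum_violation_le[OF assms(2)] queue_bound[OF assms] by (rule order_trans)
  finally have "10 * real (\<Sum>k<n. L p k * hits Gs k g) \<le> 11 * rounds * \<tau> g"
    using \<tau>_pos[of g] by (simp add: field_simps)
  then have "10 ^ H * (10 * real (\<Sum>k<n. L p k * hits Gs k g)) \<le> 10 ^ H * (11 * rounds * \<tau> g)"
    by (intro mult_left_mono) auto
  then have "real (10 * 10 ^ H * (\<Sum>k<n. L p k * hits Gs k g)) \<le> real (11 * rounds * T g)"
    using assms by (simp add: T_eq mult_ac)
  then show ?thesis by (simp only: of_nat_le_iff)
qed

definition finish_index :: "nat => nat" where
  "finish_index k = 12 + ceil_div (\<Sum>s<rounds. Gs s k) rounds"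

lemma finish_index_le: "k < n ==> finish_index k \<le> H"
proof -
  assume k: "k < n"
  have "(\<Sum>s<rounds. Gs s k) \<le> (\<Sum>s<rounds. H - 12)"
    using best k by (intro sum_mono) (auto simp: best_def allowed_def)
  then have "ceil_div (\<Sum>s<rounds. Gs s k) rounds \<le> H - 12" using rounds_pos by (simp add: ceil_div_le_iff)
  then show ?thesis using H by (simp add: finish_index_def)
qed

lemma sum_G_le: "(\<Sum>s<rounds. Gs s k) \<le> rounds * (finish_index k - 12)"
  using le_mult_ceil_div[OF rounds_pos] by (simp add: finish_index_def)

theorem finish_index_enough: "12 * rounds \<le> (\<Sum>g<finish_index k. hits Gs k g)"
proof -
  let ?e = "finish_index k"
  have "rounds * ?e = (\<Sum>s<rounds. ?e)" by simp
  also have "... \<le> (\<Sum>s<rounds. Gs s k + (\<Sum>g<?e. of_bool (Gs s k \<le> g)))"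
  proof (intro sum_mono)
    fix s
    have "(\<Sum>g<?e. of_bool (Gs s k \<le> g)) = card {g. g < ?e \<and> Gs s k \<le> g}"
      by (simp add: of_bool_def sum.If_cases Int_def)
    also have "{g. g < ?e \<and> Gs s k \<le> g} = {Gs s k..<?e}" by auto
    finally show "?e \<le> Gs s k + (\<Sum>g<?e. of_bool (Gs s k \<le> g))" by simp
  qed
  also have "... = (\<Sum>s<rounds. Gs s k) + (\<Sum>g<?e. hits Gs k g)"
    unfolding hits_def sum.distrib by (subst (2) sum.swap) simp
  also have "... \<le> rounds * (?e - 12) + (\<Sum>g<?e. hits Gs k g)"
    using sum_G_le by simp
  finally have "rounds * ?e \<le> rounds * (?e - 12) + (\<Sum>g<?e. hits Gs k g)" .
  moreover have "rounds * ?e = rounds * (?e - 12) + 12 * rounds"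
    by (simp add: finish_index_def algebra_simps)
  ultimately show ?thesis by linarith
qed

text \<open>The geometric mean of the chosen grid points is at most their arithmetic mean.\<close>

lemma finish_time_le: "\<tau> (finish_index k) * rounds \<le> (11 / 10) ^ 13 * (\<Sum>s<rounds. \<tau> (Gs s k))"
proof -
  define mean where "mean = (\<Sum>s<rounds. real (Gs s k)) / rounds"
  have \<tau>_exp: "\<tau> g = exp (real g * ln (11 / 10))" for g by (simp add: \<tau>_def exp_of_nat_mult)
  have S: "{..<rounds} \<noteq> {}" using rounds_pos by auto
  have "mean * ln (11 / 10) = (\<Sum>s<rounds. real (Gs s k) * ln (11 / 10)) / card {..<rounds}"
    by (simp add: mean_def sum_distrib_right)
  also have "exp ... \<le> (\<Sum>s<rounds. \<tau> (Gs s k)) / rounds"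
    using exp_mean_le[OF finite_lessThan S] by (simp add: \<tau>_exp)
  finally have mean_le: "exp (mean * ln (11 / 10)) * rounds \<le> (\<Sum>s<rounds. \<tau> (Gs s k))"
    using rounds_pos by (simp add: field_simps)
  have "real (rounds * ceil_div (\<Sum>s<rounds. Gs s k) rounds) \<le> real ((\<Sum>s<rounds. Gs s k) + rounds)"
    unfolding of_nat_le_iff by (rule mult_ceil_div_le)
  then have "real (finish_index k) \<le> 13 + mean"
    using rounds_pos by (simp add: finish_index_def mean_def field_simps)
  then have "\<tau> (finish_index k) \<le> exp ((13 + mean) * ln (11 / 10))"
    by (simp add: \<tau>_exp)
  also have "... = \<tau> 13 * exp (mean * ln (11 / 10))"
    by (simp add: \<tau>_exp distrib_right exp_add)
  finally have "\<tau> (finish_index k) * rounds \<le> \<tau> 13 * exp (mean * ln (11 / 10)) * rounds"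
    by (rule mult_right_mono) simp
  also have "... \<le> \<tau> 13 * (\<Sum>s<rounds. \<tau> (Gs s k))"
    using mean_le \<tau>_pos[of 13] by simp
  finally show ?thesis by (simp only: \<tau>_def)
qed

context
  fixes C :: "nat => real"
  assumes B_le_C: "\<And>k. k < n ==> B k \<le> C k"
    and load_C: "\<And>t p. 0 \<le> t ==> p < 2 * N ==> real (\<Sum>k | k < n \<and> C k \<le> t. L p k) \<le> t"
    and some_weight: "\<not> (\<forall>k<n. W k = 0)"
begin

lemma penalty_term_le: "drift_bound / penalty \<le> (\<Sum>k<n. W k * C k) / 20"
proof -
  define z where "z = (\<Sum>k<n. W k * B k)"
  obtain k where k: "k < n" "0 < W k" using some_weight by auto
  have "0 < W k * B k" using k weighted_pos by simp
  also have "W k * B k \<le> z" unfolding z_def using k by (intro member_le_sum) auto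
  finally have z: "1 \<le> real z" by simp
  have "drift_bound / penalty = base_cost / (40 * 10 ^ H)"
    using drift_bound_pos by (simp add: penalty_def)
  also have "... = (real z + 1 / 10 ^ H) / 40"
    by (simp add: base_cost_def z_def field_simps)
  also have "... \<le> z / 20"
    using z mult_mono[OF z one_le_power[of "10::real" H]] by (simp add: field_simps)
  also have "real z \<le> (\<Sum>k<n. W k * C k)"
    unfolding z_def of_nat_sum of_nat_mult using B_le_C by (intro sum_mono mult_left_mono) auto
  finally show ?thesis by simp
qed

lemma average_objective: "(\<Sum>s<rounds. grid_objective (Gs s)) \<le> rounds * (23 / 20 * (\<Sum>k<n. W k * C k))"
proof -
  let ?G = "\<lambda>k. grid_index (C k)"
  have "potential rounds + penalty * (\<Sum>s<rounds. grid_objective (Gs s)) \<le> rounds * (drift_bound + penalty * grid_objective ?G)"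
    by (intro potential_total) (auto intro: allowed_grid_index load_grid_index load_C B_le_C)
  moreover have "0 \<le> potential rounds" unfolding potential_def by (intro divide_nonneg_pos sum_nonneg) auto
  ultimately have "penalty * (\<Sum>s<rounds. grid_objective (Gs s)) \<le> penalty * (rounds * (drift_bound / penalty + grid_objective ?G))"
    using penalty_pos by (simp add: algebra_simps)
  then have "(\<Sum>s<rounds. grid_objective (Gs s)) \<le> rounds * (drift_bound / penalty + grid_objective ?G)"
    using penalty_pos by simp
  also have "... \<le> rounds * ((\<Sum>k<n. W k * C k) / 20 + 11 / 10 * (\<Sum>k<n. W k * C k))"
  proof (intro mult_left_mono add_mono penalty_term_le grid_objective_grid_index)
    fix k assume "k < n" "0 < W k"
    then show "1 \<le> C k" using weighted_pos[of k] B_le_C[of k] by simp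
  qed simp
  finally show ?thesis by (simp add: algebra_simps)
qed

lemma weighted_finish_cost: "(\<Sum>k<n. W k * \<tau> (finish_index k)) \<le> 4 * (\<Sum>k<n. W k * C k)"
proof -
  let ?WC = "\<Sum>k<n. W k * C k"
  have "rounds * (\<Sum>k<n. W k * \<tau> (finish_index k)) = (\<Sum>k<n. W k * (\<tau> (finish_index k) * rounds))"
    by (simp add: sum_distrib_left mult_ac)
  also have "... \<le> (\<Sum>k<n. W k * ((11 / 10) ^ 13 * (\<Sum>s<rounds. \<tau> (Gs s k))))"
    by (intro sum_mono mult_left_mono finish_time_le) auto
  also have "... = (11 / 10) ^ 13 * (\<Sum>k<n. \<Sum>s<rounds. W k * \<tau> (Gs s k))"
    unfolding sum_distrib_left by (intro sum.cong refl) (simp add: mult_ac)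
  also have "(\<Sum>k<n. \<Sum>s<rounds. W k * \<tau> (Gs s k)) = (\<Sum>s<rounds. grid_objective (Gs s))"
    unfolding grid_objective_def by (rule sum.swap)
  also have "(11 / 10) ^ 13 * ... \<le> (11 / 10) ^ 13 * (rounds * (23 / 20 * ?WC))"
    by (intro mult_left_mono average_objective) simp
  also have "... = rounds * ((11 / 10) ^ 13 * (23 / 20) * ?WC)"
    by (simp add: algebra_simps)
  also have "... \<le> rounds * (4 * ?WC)"
  proof (intro mult_left_mono mult_right_mono sum_nonneg mult_nonneg_nonneg)
    show "(11 / 10) ^ 13 * (23 / 20) \<le> (4::real)" by (simp add: power_divide)
    fix k assume "k \<in> {..<n}"
    then show "0 \<le> C k" using B_le_C[of k] by (simp add: order_trans[rotated])
  qed auto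
  finally show ?thesis using rounds_pos by simp
qed

end

theorem finish_cost:
  fixes C :: "nat => real"
  assumes "\<And>k. k < n ==> B k \<le> C k"
    and "\<And>t p. 0 \<le> t ==> p < 2 * N ==> real (\<Sum>k | k < n \<and> C k \<le> t. L p k) \<le> t"
  shows "(\<Sum>k<n. W k * \<tau> (finish_index k)) \<le> 4 * (\<Sum>k<n. W k * C k)"
  using weighted_finish_cost[of C, OF assms] by (cases "\<forall>k<n. W k = 0") simp_all

end

end

section \<open>Instances with integral release times, sizes and weights\<close>

locale nonempty_instance =
  fixes I :: coflow_instance
  assumes valid: "valid_instance I" and coflows_pos: "1 \<le> coflows I"
begin

abbreviation "N == ports I"
abbreviation "n == coflows I"
abbreviation "m == cores I"

definition "release_num k = nat (fst (quotient_of (release I k)))"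
definition "release_den k = nat (snd (quotient_of (release I k)))"
definition "weight_num k = nat (fst (quotient_of (weight I k)))"
definition "weight_den k = nat (snd (quotient_of (weight I k)))"
definition "D = (\<Prod>k<n. release_den k)"
definition "Dw = (\<Prod>k<n. weight_den k)"
definition "rho k = release_num k * (D div release_den k)"
definition "W k = weight_num k * (Dw div weight_den k)"
definition "dd i j k = D * demand I i j k"
definition "L p k = (if p < N then \<Sum>j<N. dd p j k else \<Sum>i<N. dd i (p - N) k)"

lemma N_pos: "1 \<le> N" and m_pos: "1 \<le> m"
  using valid by (auto simp: valid_instance_def)

lemma release_den_pos: "0 < release_den k" and weight_den_pos: "0 < weight_den k"
  using quotient_of_denom_pos' by (auto simp: release_den_def weight_den_def)

lemma D_pos: "0 < D" and Dw_pos: "0 < Dw"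
  using release_den_pos weight_den_pos by (auto simp: D_def Dw_def)

lemma rat_of_nats:
  assumes "0 \<le> q"
  shows "real_of_rat q = real (nat (fst (quotient_of q))) / real (nat (snd (quotient_of q)))"
proof -
  obtain a b where ab: "quotient_of q = (a, b)" by (cases "quotient_of q")
  have b: "0 < b" using quotient_of_denom_pos[OF ab] .
  have q: "q = of_int a / of_int b" using quotient_of_div[OF ab] .
  then have "0 \<le> a" using assms b by (simp add: zero_le_divide_iff)
  then show ?thesis using b unfolding ab by (simp add: q of_rat_divide)
qed

lemma rho_eq: "k < n ==> real (rho k) = D * real_of_rat (release I k)"
proof -
  assume k: "k < n"
  have "release_den k dvd D" unfolding D_def using k by (intro dvd_prodI) auto
  then have "real (D div release_den k) = real D / release_den k" by (simp add: real_of_nat_div)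
  moreover have "0 \<le> release I k" using valid k by (simp add: valid_instance_def)
  ultimately show ?thesis by (simp add: rat_of_nats rho_def release_num_def release_den_def)
qed

lemma W_eq: "k < n ==> real (W k) = Dw * real_of_rat (weight I k)"
proof -
  assume k: "k < n"
  have "weight_den k dvd Dw" unfolding Dw_def using k by (intro dvd_prodI) auto
  then have "real (Dw div weight_den k) = real Dw / weight_den k" by (simp add: real_of_nat_div)
  moreover have "0 \<le> weight I k" using valid k by (simp add: valid_instance_def less_imp_le)
  ultimately show ?thesis by (simp add: rat_of_nats W_def weight_num_def weight_den_def)
qed

definition dd_flow :: "flow => nat" where
  "dd_flow f = dd (source f) (destination f) (coflow_of f)"

lemma dd_flow_eq: "real (dd_flow f) = D * flow_size I f"
  by (simp add: dd_flow_def dd_def flow_size_def)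

definition port_flows :: "nat set => nat => flow set" where
  "port_flows A p = (if p < N then {p} \<times> {..<N} \<times> A else {..<N} \<times> {p - N} \<times> A)"

lemma sum_port_flows: "(\<Sum>f\<in>port_flows A p. dd_flow f) = (\<Sum>k\<in>A. L p k)"
proof (cases "p < N")
  case True
  have "(\<Sum>f\<in>port_flows A p. dd_flow f) = (\<Sum>j<N. \<Sum>k\<in>A. dd p j k)"
    using True by (simp add: port_flows_def dd_flow_def sum.cartesian_product')
  also have "... = (\<Sum>k\<in>A. \<Sum>j<N. dd p j k)" by (rule sum.swap)
  finally show ?thesis using True by (simp add: L_def)
next
  case False
  have "(\<Sum>f\<in>port_flows A p. dd_flow f) = (\<Sum>i<N. \<Sum>k\<in>A. dd i (p - N) k)"
    using False by (simp add: port_flows_def dd_flow_def sum.cartesian_product')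
  also have "... = (\<Sum>k\<in>A. \<Sum>i<N. dd i (p - N) k)" by (rule sum.swap)
  finally show ?thesis using False by (simp add: L_def)
qed

definition lower_bounds :: "(nat => real) => bool" where
  "lower_bounds C \<longleftrightarrow>
    (\<forall>t::real. 0 \<le> t \<longrightarrow> (\<forall>p<2*N. real (\<Sum>k | k < n \<and> C k \<le> t. L p k) \<le> m * t)) \<and>
    (\<forall>k<n. \<forall>i<N. \<forall>j<N. real (rho k + dd i j k) \<le> C k)"

lemma lower_bounds_load:
  "lower_bounds C ==> 0 \<le> t ==> p < 2 * N ==> real (\<Sum>k | k < n \<and> C k \<le> t. L p k) \<le> m * t" for t :: real
  by (simp add: lower_bounds_def)

lemma lower_bounds_flow:
  "lower_bounds C ==> k < n ==> i < N ==> j < N ==> real (rho k + dd i j k) \<le> C k"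
  by (simp add: lower_bounds_def)

lemma lower_bounds_rho: "lower_bounds C ==> k < n ==> real (rho k) \<le> C k"
  using lower_bounds_flow[of C k 0 0] N_pos by simp

lemma lower_bounds_nonneg: "lower_bounds C ==> k < n ==> 0 \<le> C k"
  using lower_bounds_rho[of C k] by (simp add: order_trans[rotated])

lemma completed_load:
  fixes t :: real
  assumes x: "feasible I x" and t: "0 \<le> t" and p: "p < 2 * N"
  shows "real (\<Sum>k | k < n \<and> D * completion_time I x k \<le> t. L p k) \<le> m * t"
proof -
  define A where "A = {k. k < n \<and> D * completion_time I x k \<le> t}"
  let ?F = "port_flows A p"
  have F: "?F \<subseteq> flows I" using p by (auto simp: port_flows_def A_def flows_def split: if_splits)
  have "flow_finish I x f \<le> t / D" if "f \<in> ?F" for f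
  proof -
    have "coflow_of f \<in> A" using that by (auto simp: port_flows_def split: if_splits)
    then have "completion_time I x (coflow_of f) \<le> t / D" using D_pos by (simp add: A_def field_simps)
    then show ?thesis using flow_finish_le_completion[of f I x] F that by auto
  qed
  then have "(\<Sum>f\<in>?F. flow_size I f) \<le> m * (t / D)"
    using t F by (intro conflicting_flows_load[OF x]) (auto simp: port_flows_def share_port_def split: if_splits)
  moreover have "real (\<Sum>k\<in>A. L p k) = D * (\<Sum>f\<in>?F. flow_size I f)"
    unfolding sum_port_flows[symmetric] of_nat_sum dd_flow_eq sum_distrib_left ..
  ultimately show ?thesis
    using D_pos unfolding A_def[symmetric] by (simp add: field_simps)
qed

lemma lower_bounds_feasible:
  assumes x: "feasible I x"
  shows "lower_bounds (\<lambda>k. D * completion_time I x k)"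
proof -
  have "real (rho k + dd i j k) \<le> D * completion_time I x k" if "k < n" "i < N" "j < N" for k i j
  proof -
    let ?f = "(i, j, k)"
    have f: "?f \<in> flows I" using that by (simp add: flows_def)
    have "flow_release I ?f + flow_size I ?f \<le> completion_time I x k"
      using flow_finish_ge[OF valid x f] flow_finish_le_completion[OF f, of x] by simp
    then have "D * (flow_release I ?f + flow_size I ?f) \<le> D * completion_time I x k"
      using D_pos by (intro mult_left_mono) auto
    then show ?thesis
      using that by (simp add: rho_eq dd_def flow_release_def flow_size_def algebra_simps)
  qed
  then show ?thesis using completed_load[OF x] by (simp add: lower_bounds_def)
qed

subsection \<open>Integral schedules\<close>

text \<open>Times are measured in units of \<open>1 / (D * X)\<close>.\<close>

definition partial_schedule ::
    "nat => nat => (nat => nat) => (nat => flow) => (nat => nat) => (nat => nat) => bool" where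
  "partial_schedule X cnt c fl a b \<longleftrightarrow>
    (\<forall>q<cnt. c q < m \<and> source (fl q) < N \<and> destination (fl q) < N \<and> coflow_of (fl q) < n \<and>
       X * rho (coflow_of (fl q)) \<le> a q \<and> a q < b q) \<and>
    (\<forall>q'<cnt. \<forall>q<q'. c q = c q' \<and> share_port (fl q) (fl q') \<longrightarrow> b q \<le> a q' \<or> b q' \<le> a q) \<and>
    (\<forall>q<cnt. \<forall>q'<cnt. fl q = fl q' \<longrightarrow> c q = c q')"

definition sent :: "nat => (nat => flow) => (nat => nat) => (nat => nat) => flow => nat" where
  "sent cnt fl a b f = (\<Sum>q | q < cnt \<and> fl q = f. b q - a q)"

lemma partial_schedule_0: "partial_schedule X 0 c fl a b"
  by (simp add: partial_schedule_def)

lemma sent_0: "sent 0 fl a b f = 0"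
  by (simp add: sent_def)

lemma partial_schedule_Suc:
  assumes "partial_schedule X cnt c fl a b"
    and "\<And>q. q < cnt ==> c' q = c q \<and> fl' q = fl q \<and> a' q = a q \<and> b' q = b q"
    and "c' cnt < m" "source (fl' cnt) < N" "destination (fl' cnt) < N" "coflow_of (fl' cnt) < n"
    and "X * rho (coflow_of (fl' cnt)) \<le> a' cnt" "a' cnt < b' cnt"
    and "\<And>q. q < cnt ==> c q = c' cnt ==> share_port (fl q) (fl' cnt) ==> b q \<le> a' cnt \<or> b' cnt \<le> a q"
    and "\<And>q. q < cnt ==> fl q = fl' cnt ==> c q = c' cnt"
  shows "partial_schedule X (Suc cnt) c' fl' a' b'"
  unfolding partial_schedule_def
proof (intro conjI allI impI)
  have period: "c q < m \<and> source (fl q) < N \<and> destination (fl q) < N \<and> coflow_of (fl q) < n \<and>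
       X * rho (coflow_of (fl q)) \<le> a q \<and> a q < b q" if "q < cnt" for q
    using assms(1) that unfolding partial_schedule_def by blast
  fix q assume "q < Suc cnt"
  then have "q < cnt \<or> q = cnt" by linarith
  then show "c' q < m" "source (fl' q) < N" "destination (fl' q) < N" "coflow_of (fl' q) < n"
    "X * rho (coflow_of (fl' q)) \<le> a' q" "a' q < b' q"
    using period[of q] assms(2)[of q] assms(3-8) by auto
next
  have disjoint: "b q \<le> a q' \<or> b q' \<le> a q" if "q' < cnt" "q < q'" "c q = c q'" "share_port (fl q) (fl q')" for q q'
    using assms(1) that unfolding partial_schedule_def by blast
  fix q' q assume q: "q' < Suc cnt" "q < q'" "c' q = c' q' \<and> share_port (fl' q) (fl' q')"
  show "b' q \<le> a' q' \<or> b' q' \<le> a' q"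
  proof (cases "q' = cnt")
    case True
    then show ?thesis using q assms(2)[of q] assms(9)[of q] by simp
  next
    case False
    then show ?thesis using q assms(2)[of q] assms(2)[of q'] disjoint[of q' q] by simp
  qed
next
  have one_core: "c q = c q'" if "q < cnt" "q' < cnt" "fl q = fl q'" for q q'
    using assms(1) that unfolding partial_schedule_def by blast
  fix q q' assume q: "q < Suc cnt" "q' < Suc cnt" "fl' q = fl' q'"
  show "c' q = c' q'"
    using q assms(2)[of q] assms(2)[of q'] assms(10)[of q] assms(10)[of q'] one_core[of q q']
    by (cases "q = cnt"; cases "q' = cnt") simp_all
qed

lemma sent_Suc:
  assumes "\<And>q. q < cnt ==> fl' q = fl q \<and> a' q = a q \<and> b' q = b q"
  shows "sent (Suc cnt) fl' a' b' f = sent cnt fl a b f + (if f = fl' cnt then b' cnt - a' cnt else 0)"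
proof -
  have "{q. q < Suc cnt \<and> fl' q = f} = {q. q < cnt \<and> fl q = f} \<union> (if f = fl' cnt then {cnt} else {})"
    using assms by (auto simp: less_Suc_eq)
  then have "sent (Suc cnt) fl' a' b' f = (\<Sum>q\<in>{q. q < cnt \<and> fl q = f} \<union> (if f = fl' cnt then {cnt} else {}). b' q - a' q)"
    by (simp add: sent_def)
  also have "... = (\<Sum>q | q < cnt \<and> fl q = f. b' q - a' q) + (if f = fl' cnt then b' cnt - a' cnt else 0)"
    by (subst sum.union_disjoint) auto
  also have "(\<Sum>q | q < cnt \<and> fl q = f. b' q - a' q) = sent cnt fl a b f"
    unfolding sent_def using assms by (intro sum.cong) auto
  finally show ?thesis .
qed

lemma partial_schedule_periods:
  assumes X: "0 < X" and plan: "partial_schedule X cnt c fl a b"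
    and full: "\<And>i j k. i < N ==> j < N ==> k < n ==> sent cnt fl a b (i, j, k) = X * dd i j k"
  shows "periods I (D * X) cnt c fl a b"
proof
  have period: "c q < m \<and> source (fl q) < N \<and> destination (fl q) < N \<and> coflow_of (fl q) < n \<and>
       X * rho (coflow_of (fl q)) \<le> a q \<and> a q < b q" if "q < cnt" for q
    using plan that unfolding partial_schedule_def by blast
  show "valid_instance I" by (rule valid)
  show "0 < D * X" using D_pos X by simp
  fix q assume q: "q < cnt"
  obtain i j k where f: "fl q = (i, j, k)" by (cases "fl q")
  show "c q < cores I \<and> fl q \<in> flows I \<and> a q \<le> b q"
    using period[OF q] f by (auto simp: flows_def)
  have k: "k < n" and "X * rho k \<le> a q" using period[OF q] f by auto
  then have "real (X * rho k) \<le> a q" by (simp only: of_nat_le_iff)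
  then show "flow_release I (fl q) * real (D * X) \<le> real (a q)"
    using k by (simp add: f flow_release_def rho_eq mult_ac)
next
  fix q q' assume "q < q'" "q' < cnt" "c q = c q'" "share_port (fl q) (fl q')"
  then show "b q \<le> a q' \<or> b q' \<le> a q" using plan unfolding partial_schedule_def by blast
next
  fix q q' assume "q < cnt" "q' < cnt" "fl q = fl q'"
  then show "c q = c q'" using plan unfolding partial_schedule_def by blast
next
  fix f assume "f \<in> flows I"
  then obtain i j k where f: "f = (i, j, k)" "i < N" "j < N" "k < n" by (auto simp: flows_def)
  have "a q \<le> b q" if "q < cnt" for q
    using plan that unfolding partial_schedule_def by (simp add: less_imp_le)
  then have "(\<Sum>q | q < cnt \<and> fl q = f. real (b q) - real (a q)) = real (sent cnt fl a b f)"
    unfolding sent_def of_nat_sum by (intro sum.cong) (auto simp: of_nat_diff)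
  also have "... = real (D * X) * flow_size I f"
    using full f by (simp add: dd_def flow_size_def)
  finally show "(\<Sum>q | q < cnt \<and> fl q = f. real (b q) - real (a q)) = real (D * X) * flow_size I f" .
qed

text \<open>The completion times \<open>U\<close> of the schedule are compared with any \<open>C\<close> that satisfies the lower bounds.\<close>

definition approximates :: "nat => nat => (nat => flow) => (nat => nat) => real => bool" where
  "approximates X cnt fl b \<rho> \<longleftrightarrow> (\<forall>C::nat => real. lower_bounds C \<longrightarrow> (\<exists>U::nat => real.
     (\<forall>k<n. rho k \<le> U k) \<and> (\<forall>q<cnt. b q \<le> X * U (coflow_of (fl q))) \<and>
     (\<Sum>k<n. W k * U k) \<le> \<rho> * (\<Sum>k<n. W k * C k)))"

lemma approximates_mono:
  assumes "approximates X cnt fl b \<rho>" "\<rho> \<le> \<rho>'"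
  shows "approximates X cnt fl b \<rho>'"
  unfolding approximates_def
proof (intro allI impI)
  fix C :: "nat => real"
  assume C: "lower_bounds C"
  then have "\<rho> * (\<Sum>k<n. W k * C k) \<le> \<rho>' * (\<Sum>k<n. W k * C k)"
    using lower_bounds_nonneg[OF C] assms(2) by (intro mult_right_mono sum_nonneg mult_nonneg_nonneg) auto
  moreover obtain U :: "nat => real" where "\<forall>k<n. rho k \<le> U k" "\<forall>q<cnt. b q \<le> X * U (coflow_of (fl q))"
      "(\<Sum>k<n. W k * U k) \<le> \<rho> * (\<Sum>k<n. W k * C k)"
    using assms(1)[unfolded approximates_def, rule_format, OF C] by blast
  ultimately show "\<exists>U::nat => real. (\<forall>k<n. rho k \<le> U k) \<and> (\<forall>q<cnt. b q \<le> X * U (coflow_of (fl q))) \<and>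
      (\<Sum>k<n. W k * U k) \<le> \<rho>' * (\<Sum>k<n. W k * C k)"
    by (intro exI[of _ U]) simp
qed

lemma weighted_sum_eq:
  "(\<Sum>k<n. W k * (D * C k)) = D * Dw * (\<Sum>k<n. real_of_rat (weight I k) * C k)" for C :: "nat => real"
  unfolding sum_distrib_left by (intro sum.cong) (auto simp: W_eq mult_ac)

lemma objective_le_bound:
  fixes U :: "nat => real"
  assumes "\<And>k. k < n ==> D * completion_time I x k \<le> U k"
  shows "D * Dw * objective I x \<le> (\<Sum>k<n. W k * U k)"
proof -
  have "D * Dw * objective I x = (\<Sum>k<n. W k * (D * completion_time I x k))"
    unfolding objective_def by (rule weighted_sum_eq[symmetric])
  also have "... \<le> (\<Sum>k<n. W k * U k)" using assms by (intro sum_mono mult_left_mono) auto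
  finally show ?thesis .
qed

theorem complete_schedule:
  assumes X: "0 < X" and plan: "partial_schedule X cnt c fl a b"
    and full: "\<And>i j k. i < N ==> j < N ==> k < n ==> sent cnt fl a b (i, j, k) = X * dd i j k"
  defines "x == schedule_of (map (\<lambda>q. (c q, fl q, real (a q) / real (D * X), real (b q) / real (D * X))) [0..<cnt])"
  shows "feasible I x" and "approximates X cnt fl b \<rho> ==> 0 \<le> \<rho> ==> objective I x \<le> \<rho> * optimum I"
proof -
  interpret periods I "D * X" cnt c fl a b by (rule partial_schedule_periods[OF X plan full])
  have x: "x = sched" unfolding x_def sched_def ..
  show feasible_x: "feasible I x" unfolding x by (rule feasible_sched)
  assume approx: "approximates X cnt fl b \<rho>" and \<rho>: "0 \<le> \<rho>"
  show "objective I x \<le> \<rho> * optimum I"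
  proof (rule le_mult_optimum[OF feasible_x \<rho>])
    fix x' assume x': "feasible I x'"
    let ?C = "\<lambda>k. D * completion_time I x' k"
    obtain U :: "nat => real" where U: "\<And>k. k < n ==> rho k \<le> U k" "\<And>q. q < cnt ==> b q \<le> X * U (coflow_of (fl q))"
      "(\<Sum>k<n. W k * U k) \<le> \<rho> * (\<Sum>k<n. W k * ?C k)"
      using approx[unfolded approximates_def, rule_format, OF lower_bounds_feasible[OF x']] by blast
    have "completion_time I x k \<le> U k / D" if k: "k < n" for k
      unfolding completion_le_iff[OF valid k] x
    proof (intro ballI impI flow_finish_sched_le)
      fix f assume f: "f \<in> flows I" "coflow_of f = k"
      show "flow_release I f \<le> U k / D"
        using U(1)[OF k] D_pos k f(2) by (simp add: flow_release_def field_simps rho_eq)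
      fix q assume "q < cnt" "fl q = f"
      then have "real (b q) \<le> X * U k" using U(2)[of q] f by simp
      then show "real (b q) / real (D * X) \<le> U k / D"
        using D_pos X by (simp add: field_simps)
    qed
    then have "D * Dw * objective I x \<le> (\<Sum>k<n. W k * U k)"
      using D_pos by (intro objective_le_bound) (simp add: field_simps)
    also have "... \<le> D * Dw * (\<rho> * objective I x')"
      using U(3) unfolding weighted_sum_eq objective_def by (simp add: mult_ac)
    finally show "objective I x \<le> \<rho> * objective I x'" using D_pos Dw_pos by simp
  qed
qed

end

section \<open>Edge colouring by alternating chains\<close>

text \<open>
  Colour \<open>c\<close> at input \<open>i\<close> is used by the edge with label \<open>l\<close> if \<open>A i c = Suc l\<close>; its output is
  \<open>l mod N\<close>, and then \<open>R (l mod N) c = Suc i\<close>. The value 0 marks an unused colour.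
\<close>

locale colouring =
  fixes N K :: nat
  assumes N_pos: "1 \<le> N"
begin

definition proper :: "(nat => nat => nat) => (nat => nat => nat) => bool" where
  "proper A R \<longleftrightarrow>
    (\<forall>i<N. \<forall>c<K. A i c \<noteq> 0 \<longrightarrow> R ((A i c - 1) mod N) c = Suc i) \<and>
    (\<forall>j<N. \<forall>c<K. R j c \<noteq> 0 \<longrightarrow> R j c \<le> N \<and> A (R j c - 1) c \<noteq> 0 \<and> (A (R j c - 1) c - 1) mod N = j)"

definition colours :: "(nat => nat => nat) => nat => nat => nat" where
  "colours A i l = card {c. c < K \<and> A i c = Suc l}"

abbreviation set2 :: "(nat => nat => nat) => nat => nat => nat => nat => nat => nat" where
  "set2 A i c v == A(i := (A i)(c := v))"

lemma colours_set2:
  assumes "c < K"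
  shows "colours (set2 A i c v) i' l + of_bool (i' = i \<and> A i c = Suc l) =
    colours A i' l + of_bool (i' = i \<and> v = Suc l)"
proof (cases "i' = i")
  case True
  have new_set: "{c'. c' < K \<and> ((A i)(c := v)) c' = Suc l} =
      {c'. c' < K \<and> c' \<noteq> c \<and> A i c' = Suc l} \<union> (if v = Suc l then {c} else {})"
    using assms by auto
  have old_set: "{c'. c' < K \<and> A i c' = Suc l} =
      {c'. c' < K \<and> c' \<noteq> c \<and> A i c' = Suc l} \<union> (if A i c = Suc l then {c} else {})"
    using assms by auto
  have "card {c'. c' < K \<and> ((A i)(c := v)) c' = Suc l} =
      card {c'. c' < K \<and> c' \<noteq> c \<and> A i c' = Suc l} + of_bool (v = Suc l)"
    unfolding new_set by (subst card_Un_disjoint) auto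
  moreover have "card {c'. c' < K \<and> A i c' = Suc l} =
      card {c'. c' < K \<and> c' \<noteq> c \<and> A i c' = Suc l} + of_bool (A i c = Suc l)"
    unfolding old_set by (subst card_Un_disjoint) auto
  ultimately show ?thesis using True by (simp add: colours_def)
qed (simp add: colours_def)

lemma proper_place:
  assumes is_proper: "proper A R" and i: "i < N" and free: "A i c = 0" "R (l mod N) c = 0"
  shows "proper (set2 A i c (Suc l)) (set2 R (l mod N) c (Suc i))"
  unfolding proper_def
proof (intro conjI allI impI)
  fix x d
  assume x: "x < N" "d < K" "set2 A i c (Suc l) x d \<noteq> 0"
  show "set2 R (l mod N) c (Suc i) ((set2 A i c (Suc l) x d - 1) mod N) d = Suc x"
  proof (cases "x = i \<and> d = c")
    case False
    then have "set2 A i c (Suc l) x d = A x d" by auto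
    moreover from this have "R ((A x d - 1) mod N) d = Suc x" using is_proper x by (auto simp: proper_def)
    ultimately show ?thesis using free by auto
  qed simp
next
  fix y d
  assume y: "y < N" "d < K" "set2 R (l mod N) c (Suc i) y d \<noteq> 0"
  let ?r = "set2 R (l mod N) c (Suc i) y d"
  have "?r \<le> N \<and> set2 A i c (Suc l) (?r - 1) d \<noteq> 0 \<and> (set2 A i c (Suc l) (?r - 1) d - 1) mod N = y"
  proof (cases "y = l mod N \<and> d = c")
    case False
    then have r: "?r = R y d" by auto
    then have used: "R y d \<le> N" "A (R y d - 1) d \<noteq> 0" "(A (R y d - 1) d - 1) mod N = y"
      using is_proper y by (auto simp: proper_def)
    then have "set2 A i c (Suc l) (R y d - 1) d = A (R y d - 1) d" using free by auto
    then show ?thesis using used r by simp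
  qed (use i in simp)
  then show "?r \<le> N" "set2 A i c (Suc l) (?r - 1) d \<noteq> 0" "(set2 A i c (Suc l) (?r - 1) d - 1) mod N = y"
    by simp_all
qed

lemma proper_remove:
  assumes is_proper: "proper A R" and i: "i < N" and c: "c < K" and used: "A i c \<noteq> 0"
  shows "proper (set2 A i c 0) (set2 R ((A i c - 1) mod N) c 0)"
  unfolding proper_def
proof (intro conjI allI impI)
  let ?j = "(A i c - 1) mod N"
  have output_c: "R ?j c = Suc i" using is_proper i c used by (simp add: proper_def)
  fix x d
  assume x: "x < N" "d < K" "set2 A i c 0 x d \<noteq> 0"
  then have "\<not> (x = i \<and> d = c)" "A x d \<noteq> 0" "set2 A i c 0 x d = A x d" by (auto split: if_splits)
  moreover from this have "R ((A x d - 1) mod N) d = Suc x" using is_proper x by (simp add: proper_def)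
  ultimately show "set2 R ?j c 0 ((set2 A i c 0 x d - 1) mod N) d = Suc x" using output_c by auto
next
  let ?j = "(A i c - 1) mod N"
  fix y d
  assume y: "y < N" "d < K" "set2 R ?j c 0 y d \<noteq> 0"
  then have other: "\<not> (y = ?j \<and> d = c)" and r: "R y d \<noteq> 0" "set2 R ?j c 0 y d = R y d" by (auto split: if_splits)
  then have "R y d \<le> N" "A (R y d - 1) d \<noteq> 0" "(A (R y d - 1) d - 1) mod N = y"
    using is_proper y by (auto simp: proper_def)
  moreover from this have "set2 A i c 0 (R y d - 1) d = A (R y d - 1) d" using other by auto
  ultimately show "set2 R ?j c 0 y d \<le> N" "set2 A i c 0 (set2 R ?j c 0 y d - 1) d \<noteq> 0"
    "(set2 A i c 0 (set2 R ?j c 0 y d - 1) d - 1) mod N = y"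
    unfolding r(2) by simp_all
qed

definition inserted where
  "inserted A0 i0 l0 A R \<longleftrightarrow> proper A R \<and>
    (\<forall>i l. colours A i l = colours A0 i l + of_bool (i = i0 \<and> l = l0))"

text \<open>
  The edge \<open>(i, l)\<close> is the only uncoloured one. The sets \<open>P\<close> and \<open>J\<close> collect the outputs and inputs
  passed so far; their colours \<open>a\<close> and \<open>b\<close> lead back into these sets, hence the chain never returns.
\<close>

definition passed where
  "passed a b s A R i l P J \<longleftrightarrow> P \<subseteq> {..<N} \<and> card P = s \<and> l mod N \<notin> P \<and> i \<in> J \<and>
    (\<forall>j\<in>P. R j b \<noteq> 0 \<and> R j b - 1 \<in> J) \<and> (\<forall>x\<in>J. x \<noteq> i \<longrightarrow> A x a \<noteq> 0 \<and> (A x a - 1) mod N \<in> P)"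

definition chain where
  "chain a b A0 i0 l0 s A R i l \<longleftrightarrow> proper A R \<and> i < N \<and> A i a = 0 \<and> R (l mod N) b = 0 \<and>
    (\<forall>x z. colours A x z + of_bool (x = i \<and> z = l) = colours A0 x z + of_bool (x = i0 \<and> z = l0)) \<and>
    (\<exists>P J. passed a b s A R i l P J)"

lemma chain_start:
  assumes "proper A R" "i < N" "A i a = 0" "R (l mod N) b = 0"
  shows "chain a b A i l 0 A R i l"
proof -
  have "passed a b 0 A R i l {} {i}" by (simp add: passed_def)
  then show ?thesis unfolding chain_def using assms by blast
qed

lemma chain_less:
  assumes "chain a b A0 i0 l0 s A R i l"
  shows "s < N"
proof -
  obtain P where P: "P \<subseteq> {..<N}" "card P = s" "l mod N \<notin> P"
    using assms unfolding chain_def passed_def by blast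
  have "l mod N < N" using N_pos by simp
  then have "P \<subset> {..<N}" using P by blast
  then have "card P < card {..<N}" by (intro psubset_card_mono) auto
  then show ?thesis using P by simp
qed

text \<open>
  The uncoloured edge takes colour \<open>a\<close> from the edge at input \<open>i'\<close> with the same output, which
  gets colour \<open>b\<close> instead.
\<close>

definition swap_inputs where
  "swap_inputs a b A i l i' = set2 (set2 (set2 A i a (Suc l)) i' a 0) i' b (A i' a)"

definition swap_outputs where
  "swap_outputs a b R i j i' = set2 (set2 R j a (Suc i)) j b (Suc i')"

context
  fixes a b A0 i0 l0 s A R i l
  assumes in_chain: "chain a b A0 i0 l0 s A R i l" and a: "a < K" and b: "b < K"
begin

lemma chain_proper: "proper A R" and chain_input: "i < N" "A i a = 0" and chain_output: "R (l mod N) b = 0"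
  and chain_colours: "colours A x z + of_bool (x = i \<and> z = l) = colours A0 x z + of_bool (x = i0 \<and> z = l0)"
  using in_chain by (auto simp: chain_def)

lemma chain_end_output:
  assumes "R (l mod N) a = 0"
  shows "inserted A0 i0 l0 (set2 A i a (Suc l)) (set2 R (l mod N) a (Suc i))"
proof -
  have "colours (set2 A i a (Suc l)) x z = colours A0 x z + of_bool (x = i0 \<and> z = l0)" for x z
    using colours_set2[OF a, of A i "Suc l" x z] chain_colours[of x z] chain_input(2)
    by (auto simp: of_bool_def split: if_splits)
  moreover have "proper (set2 A i a (Suc l)) (set2 R (l mod N) a (Suc i))"
    using chain_proper chain_input assms by (rule proper_place)
  ultimately show ?thesis by (auto simp: inserted_def)
qed

context
  fixes i'
  assumes output_a: "R (l mod N) a = Suc i'"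
begin

lemma chain_next_input: "a \<noteq> b" "i' < N" "i' \<noteq> i" "A i' a \<noteq> 0" "(A i' a - 1) mod N = l mod N"
proof -
  have "l mod N < N" using N_pos by simp
  then show "i' < N" "A i' a \<noteq> 0" "(A i' a - 1) mod N = l mod N"
    using chain_proper a output_a unfolding proper_def by fastforce+
  then show "i' \<noteq> i" using chain_input by auto
  show "a \<noteq> b" using output_a chain_output by auto
qed

lemma colours_swap_inputs:
  "colours (swap_inputs a b A i l i') x z + of_bool (x = i' \<and> A i' b = Suc z) = colours A x z + of_bool (x = i \<and> z = l)"
proof -
  define A1 where "A1 = set2 A i a (Suc l)"
  define A2 where "A2 = set2 A1 i' a 0"
  have "colours A1 x z + of_bool (x = i \<and> A i a = Suc z) = colours A x z + of_bool (x = i \<and> Suc l = Suc z)"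
    unfolding A1_def by (rule colours_set2[OF a])
  moreover have "colours A2 x z + of_bool (x = i' \<and> A1 i' a = Suc z) = colours A1 x z + of_bool (x = i' \<and> 0 = Suc z)"
    unfolding A2_def by (rule colours_set2[OF a])
  moreover have "colours (swap_inputs a b A i l i') x z + of_bool (x = i' \<and> A2 i' b = Suc z) =
      colours A2 x z + of_bool (x = i' \<and> A i' a = Suc z)"
    unfolding swap_inputs_def A2_def A1_def by (rule colours_set2[OF b])
  moreover have "A1 i' a = A i' a" "A2 i' b = A i' b"
    using chain_next_input(1,3) by (auto simp: A1_def A2_def)
  ultimately show ?thesis using chain_input(2) by (auto simp: of_bool_def split: if_splits)
qed

lemma proper_take_over: "proper (set2 (set2 A i' a 0) i a (Suc l)) (set2 (set2 R (l mod N) a 0) (l mod N) a (Suc i))"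
proof (rule proper_place)
  have "proper (set2 A i' a 0) (set2 R ((A i' a - 1) mod N) a 0)"
    using chain_proper chain_next_input(2) a chain_next_input(4) by (rule proper_remove)
  then show "proper (set2 A i' a 0) (set2 R (l mod N) a 0)" unfolding chain_next_input(5) .
qed (use chain_input chain_next_input(3) in auto)

lemma chain_end_input:
  assumes free: "A i' b = 0"
  shows "inserted A0 i0 l0 (swap_inputs a b A i l i') (swap_outputs a b R i (l mod N) i')"
proof -
  let ?A = "set2 (set2 A i' a 0) i a (Suc l)" and ?R = "set2 (set2 R (l mod N) a 0) (l mod N) a (Suc i)"
  have l: "Suc (A i' a - 1) = A i' a" using chain_next_input(4) by simp
  have "proper (set2 ?A i' b (Suc (A i' a - 1))) (set2 ?R ((A i' a - 1) mod N) b (Suc i'))"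
    using chain_next_input free chain_output by (intro proper_place proper_take_over) auto
  moreover have "set2 ?A i' b (A i' a) = swap_inputs a b A i l i'" "set2 ?R (l mod N) b (Suc i') = swap_outputs a b R i (l mod N) i'"
    using chain_next_input(1,3) by (auto simp: swap_inputs_def swap_outputs_def fun_eq_iff)
  ultimately have "proper (swap_inputs a b A i l i') (swap_outputs a b R i (l mod N) i')"
    unfolding l chain_next_input(5) by simp
  moreover have "colours (swap_inputs a b A i l i') x z = colours A0 x z + of_bool (x = i0 \<and> z = l0)" for x z
    using colours_swap_inputs[of x z] chain_colours[of x z] free by simp
  ultimately show ?thesis by (auto simp: inserted_def)
qed

context
  fixes l'
  assumes input_b: "A i' b = Suc l'"
begin

lemma chain_next_output: "R (l' mod N) b = Suc i'" "l' mod N \<noteq> l mod N"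
proof -
  show Rl': "R (l' mod N) b = Suc i'" using chain_proper chain_next_input(2) b input_b unfolding proper_def by fastforce
  show "l' mod N \<noteq> l mod N" using Rl' chain_output by auto
qed

lemma proper_chain_next: "proper (swap_inputs a b A i l i') (set2 (swap_outputs a b R i (l mod N) i') (l' mod N) b 0)"
proof -
  let ?A = "set2 (set2 A i' a 0) i a (Suc l)" and ?R = "set2 (set2 R (l mod N) a 0) (l mod N) a (Suc i)"
  have keep: "?A i' b = Suc l'" using chain_next_input(1,3) input_b by auto
  have "proper (set2 ?A i' b 0) (set2 ?R ((?A i' b - 1) mod N) b 0)"
    by (rule proper_remove[OF proper_take_over chain_next_input(2) b]) (use keep in simp)
  then have "proper (set2 ?A i' b 0) (set2 ?R (l' mod N) b 0)" unfolding keep by simp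
  then have "proper (set2 (set2 ?A i' b 0) i' b (Suc (A i' a - 1))) (set2 (set2 ?R (l' mod N) b 0) ((A i' a - 1) mod N) b (Suc i'))"
    by (intro proper_place) (use chain_next_input chain_output in auto)
  moreover have "set2 (set2 ?A i' b 0) i' b (A i' a) = swap_inputs a b A i l i'"
    "set2 (set2 ?R (l' mod N) b 0) (l mod N) b (Suc i') = set2 (swap_outputs a b R i (l mod N) i') (l' mod N) b 0"
    using chain_next_input(1,3) chain_next_output(2) by (auto simp: swap_inputs_def swap_outputs_def fun_eq_iff)
  moreover have "Suc (A i' a - 1) = A i' a" using chain_next_input(4) by simp
  ultimately show ?thesis unfolding chain_next_input(5) by simp
qed

lemma passed_next:
  assumes P: "passed a b s A R i l P J"
  shows "passed a b (Suc s) (swap_inputs a b A i l i') (set2 (swap_outputs a b R i (l mod N) i') (l' mod N) b 0) i' l'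
    (insert (l mod N) P) (insert i' J)"
proof -
  have l: "l mod N < N" using N_pos by simp
  have new_input: "i' \<notin> J" using P chain_next_input(3-5) by (auto simp: passed_def)
  have new_output: "(l' mod N) \<notin> P" using P chain_next_output(1) new_input by (auto simp: passed_def)
  have "finite P" using P finite_subset by (auto simp: passed_def)
  then show ?thesis
    using P l new_input new_output chain_next_input(1,3) chain_next_output(2)
    by (auto simp: passed_def swap_inputs_def swap_outputs_def)
qed

lemma chain_next:
  "chain a b A0 i0 l0 (Suc s) (swap_inputs a b A i l i') (set2 (swap_outputs a b R i (l mod N) i') (l' mod N) b 0) i' l'"
proof -
  have "colours (swap_inputs a b A i l i') x z + of_bool (x = i' \<and> z = l') =
      colours A0 x z + of_bool (x = i0 \<and> z = l0)" for x z
    using colours_swap_inputs[of x z] chain_colours[of x z] input_b by (simp add: eq_commute[of z])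
  moreover have "swap_inputs a b A i l i' i' a = 0" using chain_next_input(1) by (simp add: swap_inputs_def)
  moreover obtain P J where "passed a b s A R i l P J" using in_chain unfolding chain_def by blast
  then have "\<exists>P J. passed a b (Suc s) (swap_inputs a b A i l i') (set2 (swap_outputs a b R i (l mod N) i') (l' mod N) b 0)
      i' (l') P J"
    using passed_next by blast
  ultimately show ?thesis unfolding chain_def using proper_chain_next chain_next_input(2) by simp
qed

end

end

end

lemma used_at_input:
  assumes "\<And>l. LL \<le> l ==> colours A i l = 0"
  shows "card {c. c < K \<and> A i c \<noteq> 0} = (\<Sum>l<LL. colours A i l)"
proof -
  have "l < LL" if "c < K" "A i c = Suc l" for c l
  proof (rule ccontr)
    assume "\<not> ?thesis"
    then have "colours A i l = 0" using assms by simp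
    then show False using that by (auto simp: colours_def)
  qed
  then have "{c. c < K \<and> A i c \<noteq> 0} = (\<Union>l<LL. {c. c < K \<and> A i c = Suc l})"
    by (auto simp: gr0_conv_Suc)
  also have "card ... = (\<Sum>l<LL. colours A i l)"
    unfolding colours_def by (rule card_UN_disjoint) auto
  finally show ?thesis .
qed

lemma used_at_output:
  assumes is_proper: "proper A R" and j: "j < N"
    and "\<And>i l. i < N ==> LL \<le> l ==> colours A i l = 0"
  shows "card {c. c < K \<and> R j c \<noteq> 0} \<le> (\<Sum>i<N. \<Sum>l | l < LL \<and> l mod N = j. colours A i l)"
proof -
  have "{c. c < K \<and> R j c \<noteq> 0} \<subseteq> (\<Union>i<N. \<Union>l\<in>{l. l < LL \<and> l mod N = j}. {c. c < K \<and> A i c = Suc l})"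
  proof
    fix c assume "c \<in> {c. c < K \<and> R j c \<noteq> 0}"
    then have c: "c < K" "R j c \<noteq> 0" by auto
    define i l where "i = R j c - 1" and "l = A i c - 1"
    have i: "i < N" and A: "A i c = Suc l" and l: "l mod N = j"
      using is_proper j c unfolding proper_def i_def l_def by fastforce+
    have "l < LL"
    proof (rule ccontr)
      assume "\<not> ?thesis"
      then have "colours A i l = 0" using assms(3) i by simp
      then show False using A c by (auto simp: colours_def)
    qed
    then show "c \<in> (\<Union>i<N. \<Union>l\<in>{l. l < LL \<and> l mod N = j}. {c. c < K \<and> A i c = Suc l})"
      using i A l c by auto
  qed
  then have "card {c. c < K \<and> R j c \<noteq> 0} \<le> card (\<Union>i<N. \<Union>l\<in>{l. l < LL \<and> l mod N = j}. {c. c < K \<and> A i c = Suc l})"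
    by (intro card_mono) auto
  also have "... \<le> (\<Sum>i<N. card (\<Union>l\<in>{l. l < LL \<and> l mod N = j}. {c. c < K \<and> A i c = Suc l}))"
    by (rule card_UN_le) simp
  also have "... \<le> (\<Sum>i<N. \<Sum>l | l < LL \<and> l mod N = j. colours A i l)"
    unfolding colours_def by (intro sum_mono card_UN_le) simp
  finally show ?thesis .
qed

end

section \<open>Slots on a single core\<close>

lemma flat_less: "i < m ==> j < n ==> i * n + j < m * n" for i j m n :: nat
proof -
  assume i: "i < m" and j: "j < n"
  have "Suc i * n \<le> m * n" using i by (intro mult_le_mono1) simp
  then show ?thesis using j by simp
qed

lemma flat_eq_iff: "j < n ==> i * n + j = x \<longleftrightarrow> i = x div n \<and> j = x mod n" for i j n x :: nat
  by auto

lemma sum_flat: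
  fixes f :: "nat => nat => nat"
  assumes "0 < N"
  shows "(\<Sum>l<n * N. f (l div N) (l mod N)) = (\<Sum>k<n. \<Sum>j<N. f k j)"
  unfolding sum.cartesian_product
  by (rule sum.reindex_bij_witness[of _ "\<lambda>(k, j). k * N + j" "\<lambda>l. (l div N, l mod N)"])
    (use assms in \<open>auto simp: less_mult_imp_div_less intro: flat_less\<close>)

lemma sum_mod_class:
  fixes f :: "nat => nat"
  assumes "j < N"
  shows "(\<Sum>l | l < n * N \<and> l mod N = j. f (l div N)) = (\<Sum>k<n. f k)"
  by (rule sum.reindex_bij_witness[of _ "\<lambda>k. k * N + j" "\<lambda>l. l div N"])
    (use assms in \<open>auto simp: less_mult_imp_div_less intro: flat_less\<close>)

lemma sum_ceil_div_le:
  assumes s: "0 < s" and A: "finite A" "card A = c" and x: "(\<Sum>a\<in>A. x a) \<le> 11 * c * s"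
  shows "(\<Sum>a\<in>A. ceil_div (x a) s) \<le> 12 * c"
proof -
  have "s * (\<Sum>a\<in>A. ceil_div (x a) s) \<le> (\<Sum>a\<in>A. x a + s)"
    unfolding sum_distrib_left by (intro sum_mono mult_ceil_div_le)
  also have "... \<le> s * (12 * c)" using x A by (simp add: sum.distrib)
  finally show ?thesis using s by simp
qed

context nonempty_instance
begin

sublocale loads: port_loads L "2 * N" n m .

definition "B k = max (rho k) (loads.max_load {k})"
definition "active_weight k = (if loads.max_load {k} = 0 then 0 else W k)"
definition "max_B = Max (insert 0 (B ` {..<n}))"
definition "H = 8 * floorlog 2 (n * max_B) + 12"
definition "K = 12 * (N * n)"

lemma L_le_B: "p < 2 * N ==> L p k \<le> B k"
  using loads.total_load_le_max[of p "{k}"] by (simp add: loads.total_load_def B_def)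

lemma B_le_max_B: "k < n ==> B k \<le> max_B"
  unfolding max_B_def by (intro Max_ge) auto

lemma max_load_single:
  assumes "\<And>p. p < 2 * N ==> L p k \<le> x" "x = 0 \<or> (\<exists>p<2*N. x = L p k)"
  shows "loads.max_load {k} = x"
proof (rule antisym)
  show "loads.max_load {k} \<le> x" using assms(1) by (simp add: loads.max_load_le_iff loads.total_load_def)
  show "x \<le> loads.max_load {k}"
    using assms(2) loads.total_load_le_max[of _ "{k}"] by (auto simp: loads.total_load_def)
qed

sublocale dr: drift N n H L B active_weight
proof
  show "1 \<le> N" by (rule N_pos)
  show "1 \<le> n" by (rule coflows_pos)
  show "12 \<le> H" by (simp add: H_def)
  show "L p k \<le> B k" if "p < 2 * N" "k < n" for p k using that L_le_B by simp
  show "0 < B k" if "0 < active_weight k" for k using that by (auto simp: active_weight_def B_def split: if_splits)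
  fix k assume k: "k < n"
  let ?b = "floorlog 2 (n * max_B)"
  have "n * B k \<le> n * max_B" using B_le_max_B[OF k] by simp
  also have "... \<le> 2 ^ ?b"
    using floorlog_le_iff[of 2 "n * max_B" ?b] by (simp add: less_imp_le)
  finally have "n * B k * 10 ^ (8 * ?b) \<le> 2 ^ ?b * 10 ^ (8 * ?b)" by (intro mult_le_mono1)
  also have "... = (2 * 10 ^ 8) ^ ?b" unfolding power_mult power_mult_distrib ..
  also have "... \<le> (11 ^ 8) ^ ?b" by (intro power_mono) auto
  also have "... = 11 ^ (8 * ?b)" by (simp add: power_mult)
  finally show "n * B k * 10 ^ (H - 12) \<le> 11 ^ (H - 12)" by (simp add: H_def)
qed

lemma T_Suc: "g < H ==> dr.T g * 11 = 10 * dr.T (Suc g)"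
proof -
  assume "g < H"
  then have "H - g = Suc (H - Suc g)" by simp
  then show ?thesis by (simp add: dr.T_def)
qed

lemma T_le: "g \<le> H ==> dr.T g \<le> 11 ^ H"
proof -
  assume g: "g \<le> H"
  have "dr.T g \<le> 11 ^ g * 11 ^ (H - g)" unfolding dr.T_def by (intro mult_le_mono2 power_mono) auto
  then show ?thesis using g by (simp flip: power_add)
qed

lemma T_mono: "g \<le> g' ==> g' \<le> H ==> dr.T g \<le> dr.T g'"
proof (induction rule: dec_induct)
  case (step x)
  then have "dr.T x * 11 = 10 * dr.T (Suc x)" by (intro T_Suc) simp
  then show ?case using step by simp
qed simp

definition slots :: "(nat => nat => nat) => nat => nat => nat => nat => nat" where
  "slots Gs g i j k = ceil_div (10 * (N * n) * dd i j k * dr.hits Gs k g * 10 ^ H) (dr.rounds * dr.T g)"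

text \<open>The edge with label \<open>l = k * N + j\<close> at input \<open>i\<close> stands for the flow \<open>(i, j, k)\<close>.\<close>

definition edge_slots where
  "edge_slots Gs g i l = (if l < n * N then slots Gs g i (l mod N) (l div N) else 0)"

definition X :: nat where "X = 10 * K * 10 ^ H"

definition progress where
  "progress Gs g i j k = (\<Sum>g'<g. slots Gs g' i j k * dr.T g')"

lemma rounds_T_pos: "0 < dr.rounds * dr.T g"
  using dr.T_pos dr.rounds_pos by simp

context
  fixes Gs :: "nat => nat => nat"
  assumes greedy: "dr.greedy Gs"
begin

lemma port_slots:
  assumes p: "p < 2 * N" and g: "g < H" and A: "finite A" "card A = N * n"
    and load: "(\<Sum>a\<in>A. d a * dr.hits Gs (\<kappa> a) g) = (\<Sum>k<n. L p k * dr.hits Gs k g)"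
  shows "(\<Sum>a\<in>A. ceil_div (10 * (N * n) * d a * dr.hits Gs (\<kappa> a) g * 10 ^ H) (dr.rounds * dr.T g)) \<le> K"
  unfolding K_def
proof (rule sum_ceil_div_le[OF rounds_T_pos A])
  have "(\<Sum>a\<in>A. 10 * (N * n) * d a * dr.hits Gs (\<kappa> a) g * 10 ^ H) =
      N * n * (10 * 10 ^ H * (\<Sum>a\<in>A. d a * dr.hits Gs (\<kappa> a) g))"
    by (simp add: sum_distrib_left mult_ac)
  also have "... \<le> N * n * (11 * dr.rounds * dr.T g)"
    unfolding load by (intro mult_le_mono2 dr.fractional_load greedy p g)
  also have "... = 11 * (N * n) * (dr.rounds * dr.T g)" by (simp only: mult_ac)
  finally show "(\<Sum>a\<in>A. 10 * (N * n) * d a * dr.hits Gs (\<kappa> a) g * 10 ^ H) \<le> 11 * (N * n) * (dr.rounds * dr.T g)" .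
qed

lemma input_degree:
  assumes g: "g < H" and i: "i < N"
  shows "(\<Sum>l<n * N. edge_slots Gs g i l) \<le> K"
proof -
  have "(\<Sum>l<n * N. dd i (l mod N) (l div N) * dr.hits Gs (l div N) g) = (\<Sum>k<n. L i k * dr.hits Gs k g)"
    using sum_flat[where N = N and n = n and f = "\<lambda>k j. dd i j k * dr.hits Gs k g"] N_pos i
    by (simp add: L_def sum_distrib_right)
  from port_slots[OF _ g _ _ this] show ?thesis using i by (simp add: edge_slots_def slots_def)
qed

lemma output_degree:
  assumes g: "g < H" and j: "j < N"
  shows "(\<Sum>i<N. \<Sum>l | l < n * N \<and> l mod N = j. edge_slots Gs g i l) \<le> K"
proof -
  have "(\<Sum>l | l < n * N \<and> l mod N = j. edge_slots Gs g i l) = (\<Sum>k<n. slots Gs g i j k)" for i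
  proof -
    have "(\<Sum>l | l < n * N \<and> l mod N = j. edge_slots Gs g i l) = (\<Sum>l | l < n * N \<and> l mod N = j. slots Gs g i j (l div N))"
      by (intro sum.cong) (auto simp: edge_slots_def)
    also have "... = (\<Sum>k<n. slots Gs g i j k)" by (rule sum_mod_class[OF j])
    finally show ?thesis .
  qed
  then have "(\<Sum>i<N. \<Sum>l | l < n * N \<and> l mod N = j. edge_slots Gs g i l) = (\<Sum>a\<in>{..<N} \<times> {..<n}. slots Gs g (fst a) j (snd a))"
    by (simp add: sum.cartesian_product case_prod_beta)
  also have "... \<le> K"
    unfolding slots_def
  proof (rule port_slots[of "N + j"])
    have "(\<Sum>a\<in>{..<N} \<times> {..<n}. dd (fst a) j (snd a) * dr.hits Gs (snd a) g) = (\<Sum>i<N. \<Sum>k<n. dd i j k * dr.hits Gs k g)"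
      by (simp add: sum.cartesian_product case_prod_beta)
    also have "... = (\<Sum>k<n. \<Sum>i<N. dd i j k * dr.hits Gs k g)" by (rule sum.swap)
    finally show "(\<Sum>a\<in>{..<N} \<times> {..<n}. dd (fst a) j (snd a) * dr.hits Gs (snd a) g) = (\<Sum>k<n. L (N + j) k * dr.hits Gs k g)"
      by (simp add: L_def sum_distrib_right)
  qed (use g j in auto)
  finally show ?thesis .
qed

lemma edge_slots_le: "g < H ==> i < N ==> l < n * N ==> edge_slots Gs g i l \<le> K"
  using input_degree[of g i] member_le_sum[of l "{..<n * N}" "edge_slots Gs g i"] by simp

lemma progress_enough:
  assumes k: "k < n" and g: "dr.finish_index Gs k \<le> g"
  shows "X * dd i j k \<le> progress Gs g i j k"
proof -
  let ?e = "dr.finish_index Gs k"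
  have "dr.rounds * (X * dd i j k) = 10 * (N * n) * dd i j k * 10 ^ H * (12 * dr.rounds)"
    by (simp add: X_def K_def)
  also have "... \<le> 10 * (N * n) * dd i j k * 10 ^ H * (\<Sum>g<?e. dr.hits Gs k g)"
    by (intro mult_le_mono2 dr.finish_index_enough greedy)
  also have "... = (\<Sum>g<?e. 10 * (N * n) * dd i j k * dr.hits Gs k g * 10 ^ H)"
    by (simp add: sum_distrib_left mult_ac)
  also have "... \<le> (\<Sum>g<?e. dr.rounds * dr.T g * slots Gs g i j k)"
    unfolding slots_def by (intro sum_mono le_mult_ceil_div rounds_T_pos)
  also have "... = dr.rounds * progress Gs ?e i j k" by (simp add: progress_def sum_distrib_left mult_ac)
  also have "... \<le> dr.rounds * progress Gs g i j k"
    unfolding progress_def using g by (intro mult_le_mono2 sum_mono2) auto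
  finally show ?thesis using dr.rounds_pos by simp
qed

lemma hits_pos: "0 < dr.hits Gs k g ==> \<exists>s<dr.rounds. Gs s k \<le> g"
  unfolding dr.hits_def by (auto simp: card_gt_0_iff)

lemma slots_release:
  assumes k: "k < n" and g: "g < H" and s: "0 < slots Gs g i j k"
  shows "X * rho k \<le> 10 * K * dr.T g"
proof -
  have "0 < dr.hits Gs k g"
  proof (rule ccontr)
    assume "\<not> ?thesis"
    then have "slots Gs g i j k = 0"
      using ceil_div_le_iff[OF rounds_T_pos, of 0 g 0] by (simp add: slots_def)
    then show False using s by simp
  qed
  then obtain s where s: "s < dr.rounds" "Gs s k \<le> g" using hits_pos by blast
  have "10 ^ H * B k \<le> dr.T (Gs s k)" using dr.best[OF greedy s(1) k] by (simp add: dr.best_def dr.allowed_def)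
  also have "... \<le> dr.T g" using s g by (intro T_mono) auto
  finally have "10 ^ H * rho k \<le> dr.T g" by (simp add: B_def nat_mult_max_right)
  then have "10 * K * (10 ^ H * rho k) \<le> 10 * K * dr.T g" by (rule mult_le_mono2)
  then show ?thesis by (simp only: X_def mult.assoc)
qed

definition finish_bound :: "nat => real" where
  "finish_bound k = (if loads.max_load {k} = 0 then real (rho k) else dr.\<tau> (dr.finish_index Gs k))"

lemma rho_le_finish_bound:
  assumes k: "k < n"
  shows "rho k \<le> finish_bound k"
proof -
  have "0 < (\<Sum>g<dr.finish_index Gs k. dr.hits Gs k g)"
    using dr.finish_index_enough[OF greedy, of k] dr.rounds_pos by simp
  then obtain g where g: "g < dr.finish_index Gs k" "0 < dr.hits Gs k g"
    by (metis gr0I lessThan_iff less_irrefl sum.neutral)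
  then obtain s where s: "s < dr.rounds" "Gs s k \<le> g" using hits_pos by blast
  have "real (B k) \<le> dr.\<tau> (Gs s k)" using dr.best[OF greedy s(1) k] by (simp add: dr.best_def dr.allowed_iff)
  also have "... \<le> dr.\<tau> (dr.finish_index Gs k)" using s g by (intro dr.\<tau>_mono) simp
  finally show ?thesis by (auto simp: finish_bound_def B_def)
qed

context
  fixes C :: "nat => real"
  assumes single: "m = 1" and C: "lower_bounds C"
begin

lemma B_le_lower_bounds:
  assumes k: "k < n"
  shows "B k \<le> C k"
proof -
  have "L p k \<le> C k" if p: "p < 2 * N" for p
  proof -
    have "L p k \<le> (\<Sum>k' | k' < n \<and> C k' \<le> C k. L p k')" using k by (intro member_le_sum) auto
    then have "real (L p k) \<le> real (\<Sum>k' | k' < n \<and> C k' \<le> C k. L p k')" by (simp only: of_nat_le_iff)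
    also have "... \<le> m * C k" using lower_bounds_nonneg[OF C k] p by (intro lower_bounds_load[OF C])
    finally show ?thesis using single by simp
  qed
  moreover obtain p where "loads.max_load {k} = 0 \<or> p < 2 * N \<and> loads.max_load {k} = L p k"
    using Max_in[of "insert 0 ((\<lambda>p. loads.total_load {k} p) ` {..<2*N})"]
    unfolding loads.max_load_def loads.total_load_def by auto
  ultimately have "real (loads.max_load {k}) \<le> C k"
    using lower_bounds_nonneg[OF C k] by (metis of_nat_0)
  then show ?thesis using lower_bounds_rho[OF C k] by (simp add: B_def)
qed

lemma finish_bound_cost: "(\<Sum>k<n. W k * finish_bound k) \<le> 4 * (\<Sum>k<n. W k * C k)"
proof -
  have "(\<Sum>k<n. active_weight k * dr.\<tau> (dr.finish_index Gs k)) \<le> 4 * (\<Sum>k<n. active_weight k * C k)"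
    using lower_bounds_load[OF C] single by (intro dr.finish_cost greedy B_le_lower_bounds) simp_all
  moreover have "W k * finish_bound k \<le>
      active_weight k * dr.\<tau> (dr.finish_index Gs k) + (4 * (W k * C k) - 4 * (active_weight k * C k))" if k: "k < n" for k
  proof (cases "loads.max_load {k} = 0")
    case True
    have "W k * real (rho k) \<le> W k * C k" using lower_bounds_rho[OF C k] by (intro mult_left_mono) auto
    moreover have "0 \<le> W k * C k" using lower_bounds_nonneg[OF C k] by simp
    ultimately show ?thesis using True by (simp add: finish_bound_def active_weight_def)
  qed (simp add: finish_bound_def active_weight_def)
  then have "(\<Sum>k<n. W k * finish_bound k) \<le> (\<Sum>k<n. active_weight k * dr.\<tau> (dr.finish_index Gs k) +
      (4 * (W k * C k) - 4 * (active_weight k * C k)))"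
    by (intro sum_mono) simp
  ultimately show ?thesis
    by (simp add: sum.distrib sum_subtractf sum_distrib_left)
qed

end

end

end

section \<open>The program: preparing the instance\<close>

abbreviation "v_cores == 100::nat"
abbreviation "v_ports == 101::nat"
abbreviation "v_coflows == 102::nat"
abbreviation "v_pairs == 103::nat"
abbreviation "v_row == 104::nat"
abbreviation "a_input == 105::nat"
abbreviation "v_D == 106::nat"
abbreviation "v_Dw == 107::nat"
abbreviation "a_rho == 108::nat"
abbreviation "a_weight == 109::nat"
abbreviation "a_demand == 110::nat"
abbreviation "a_load == 111::nat"
abbreviation "v_2N == 112::nat"
abbreviation "v_flows == 113::nat"
abbreviation "v_sum == 114::nat"
abbreviation "i1 == 115::nat"
abbreviation "i2 == 116::nat"
abbreviation "i3 == 117::nat"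
abbreviation "i4 == 118::nat"
abbreviation "i5 == 119::nat"

abbreviation Row_entry :: "expr => expr" where
  "Row_entry e == Vec a_input (V i1 .* V v_row .+ e)"

definition prepare_scale :: prog where
  "prepare_scale =
    v_D :=: Cn 1 ;; v_Dw :=: Cn 1 ;;
    Loop i1 v_coflows (v_D :=: V v_D .* Row_entry (V v_pairs .+ Cn 1) ;; v_Dw :=: V v_Dw .* Row_entry (V v_pairs .+ Cn 3))"

definition prepare_coflow :: prog where
  "prepare_coflow =
    Put a_rho (V i1) (Cn 0) (Row_entry (V v_pairs) .* (V v_D \<oslash> Row_entry (V v_pairs .+ Cn 1))) ;;
    Put a_weight (V i1) (Cn 0) (Row_entry (V v_pairs .+ Cn 2) .* (V v_Dw \<oslash> Row_entry (V v_pairs .+ Cn 3))) ;;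
    Loop i2 v_pairs (Put a_demand (V i1) (V i2) (V v_D .* Row_entry (V i2)))"

definition port_load :: prog where
  "port_load =
    Sum_to v_sum i3 v_ports (Arr a_demand (V i1) (V i2 .* V v_ports .+ V i3)) ;; Put a_load (V i2) (V i1) (V v_sum) ;;
    Sum_to v_sum i3 v_ports (Arr a_demand (V i1) (V i3 .* V v_ports .+ V i2)) ;; Put a_load (V v_ports .+ V i2) (V i1) (V v_sum)"

definition prepare_loads :: prog where
  "prepare_loads =
    v_2N :=: Cn 2 .* V v_ports ;; v_flows :=: V v_pairs .* V v_coflows ;;
    Loop i1 v_coflows (Loop i2 v_ports port_load)"

definition prepare :: prog where
  "prepare = prepare_scale ;; Loop i1 v_coflows prepare_coflow ;; prepare_loads"

lemma mods_prepare [simp]: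
  "mods prepare_scale = {v_D, v_Dw, i1}"
  "mods prepare_coflow = {a_rho, a_weight, a_demand, i2}"
  "mods port_load = {v_sum, a_load, i3}"
  "mods prepare = {v_D, v_Dw, a_rho, a_weight, a_demand, v_2N, v_flows, v_sum, a_load, i1, i2, i3}"
  by (auto simp: prepare_scale_def prepare_coflow_def port_load_def prepare_def prepare_loads_def)

text \<open>
  All quantities that occur in the programs are products of few numbers below \<open>A\<close>, except for the
  weights of the local ratio argument, which are multiplied by a load in each of \<open>n\<close> rounds.
\<close>

locale bounded_run = nonempty_instance I + ram M Lim for I M Lim +
  fixes A :: nat
  assumes lim_input: "n * (N * N + 4) \<le> Lim" and lim_2N: "2 * N \<le> Lim"
    and lim_periods: "N * N * n * (2 * (N * N * n) + 1) \<le> Lim" and lim_H: "H + 1 \<le> Lim"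
    and lim_rounds: "dr.rounds \<le> Lim" and lim_K: "K \<le> Lim" and lim_HKN: "H * (K * N) \<le> Lim"
    and Lim_le_A: "Lim \<le> A" and numeral_le_A: "100 \<le> A" and D_le_A: "D \<le> A" "Dw \<le> A"
    and rho_le_A: "\<And>k. k < n ==> rho k \<le> A" and W_le_A: "(\<Sum>k<n. W k + 1) \<le> A"
    and L_le_A: "(\<Sum>p<2*N. \<Sum>k<n. L p k) + 1 \<le> A" and max_B_le_A: "max_B \<le> A" and power_le_A: "110 ^ H \<le> A"
    and A_le_M: "A ^ (18 + n) \<le> M"
begin

abbreviation "F == N * N * n"

definition "sum_L = (\<Sum>p<2*N. \<Sum>k<n. L p k)"

lemma le_M: "x \<le> A ^ c ==> c \<le> 18 + n ==> x \<le> M"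
  using power_increasing[of c "18 + n" A] numeral_le_A A_le_M by linarith

lemma mult_le_A: "x \<le> A ^ a ==> y \<le> A ^ b ==> x * y \<le> A ^ (a + b)"
  unfolding power_add by (rule mult_le_mono)

lemma add_le_A: "x \<le> A ^ a ==> y \<le> A ^ a ==> x + y \<le> A ^ Suc a"
proof -
  assume "x \<le> A ^ a" "y \<le> A ^ a"
  moreover have "2 * A ^ a \<le> A * A ^ a" using numeral_le_A by (intro mult_le_mono1) simp
  ultimately show ?thesis unfolding power_Suc by linarith
qed

lemma le_A_1: "x \<le> A ==> x \<le> A ^ 1"
  by simp

lemma A_le_M_1: "x \<le> A ==> x \<le> M"
  using le_M[of x 1] by simp

lemma lim_n: "n \<le> Lim" and lim_NN: "N * N \<le> Lim" and lim_N: "N \<le> Lim" and lim_F: "F \<le> Lim"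
proof -
  have "n * 1 \<le> n * (N * N + 4)" by (rule mult_le_mono2) simp
  then show "n \<le> Lim" using lim_input by linarith
  have "n * (N * N) \<le> n * (N * N + 4)" by (rule mult_le_mono2) simp
  from order_trans[OF this lim_input] show F: "F \<le> Lim" by (simp only: mult.commute)
  have "N * N * 1 \<le> F" using coflows_pos by (rule mult_le_mono2)
  then show "N * N \<le> Lim" using F by linarith
  show "N \<le> Lim" using lim_2N by simp
qed

lemma lim_Nn: "N * n \<le> Lim" and lim_le_H: "H \<le> Lim"
  using lim_K lim_H by (simp_all add: K_def)

lemma n_le_M: "n \<le> M" and N_le_M: "N \<le> M" and H_le_M: "H \<le> M" and K_le_M: "K \<le> M" and Nn_le_M: "N * n \<le> M"
  using lim_n lim_N lim_le_H lim_K lim_Nn Lim_le_M by linarith+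

lemma sum_L_le_A: "sum_L \<le> A" and Suc_sum_L_le_A: "1 + sum_L \<le> A"
  using L_le_A by (simp_all add: sum_L_def)

lemma L_le_sum_L: "p < 2 * N ==> U \<subseteq> {..<n} ==> (\<Sum>k\<in>U. L p k) \<le> sum_L"
proof -
  assume p: "p < 2 * N" and U: "U \<subseteq> {..<n}"
  have "(\<Sum>k\<in>U. L p k) \<le> (\<Sum>k<n. L p k)" using U by (intro sum_mono2) auto
  also have "... \<le> sum_L" unfolding sum_L_def using p by (intro member_le_sum) auto
  finally show ?thesis .
qed

lemma L1_le_sum_L: "p < 2 * N ==> k < n ==> L p k \<le> sum_L"
  using L_le_sum_L[of p "{k}"] by simp

lemma rho_sum_L_le_M: "k < n ==> rho k + 4 * sum_L \<le> M"
proof -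
  assume k: "k < n"
  have "4 * sum_L \<le> A ^ 2" using sum_L_le_A numeral_le_A by (simp add: power2_eq_square mult_le_mono)
  moreover have "rho k \<le> A ^ 2" using rho_le_A[OF k] power_increasing[of 1 2 A] numeral_le_A by simp
  ultimately have "rho k + 4 * sum_L \<le> A ^ Suc 2" by (intro add_le_A) simp_all
  then show ?thesis by (rule le_M) simp
qed

lemma sum_L_le_M: "4 * sum_L \<le> M"
  using rho_sum_L_le_M[of 0] coflows_pos by linarith

lemma L_le_M: "p < 2 * N ==> k < n ==> L p k \<le> M"
  using L1_le_sum_L[of p k] sum_L_le_M by simp

lemma dd_le_L: "i < N ==> j < N ==> dd i j k \<le> L i k" "i < N ==> j < N ==> dd i j k \<le> L (N + j) k"
  by (auto simp: L_def intro!: member_le_sum[of j "{..<N}" "\<lambda>j. dd i j k"] member_le_sum[of i "{..<N}" "\<lambda>i. dd i j k"])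

lemma dd_le_sum_L: "i < N ==> j < N ==> k < n ==> dd i j k \<le> sum_L"
  using dd_le_L(1)[of i j k] L1_le_sum_L[of i k] by simp

lemma dd_le_M: "i < N ==> j < N ==> k < n ==> dd i j k \<le> M"
  using dd_le_sum_L[of i j k] sum_L_le_M by simp

lemma rho_le_M: "k < n ==> rho k \<le> M"
  using A_le_M_1[OF rho_le_A] .

lemma W_le_M: "k < n ==> W k \<le> M"
proof -
  assume "k < n"
  then have "W k + 1 \<le> (\<Sum>k<n. W k + 1)" by (intro member_le_sum) auto
  then show ?thesis using A_le_M_1[OF W_le_A] by simp
qed

lemma div_mod_N: "e < N * N ==> e div N < N" "e mod N < N"
  using N_pos by (auto simp: less_mult_imp_div_less)

definition "input_ok S \<longleftrightarrow> (\<forall>k<n. (\<forall>e<N*N. S a_input (k * (N*N+4) + e) 0 = demand I (e div N) (e mod N) k) \<and>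
   S a_input (k * (N*N+4) + N*N) 0 = release_num k \<and> S a_input (k * (N*N+4) + (N*N+1)) 0 = release_den k \<and>
   S a_input (k * (N*N+4) + (N*N+2)) 0 = weight_num k \<and> S a_input (k * (N*N+4) + (N*N+3)) 0 = weight_den k)"

definition "params S \<longleftrightarrow> S v_cores 0 0 = m \<and> S v_ports 0 0 = N \<and> S v_coflows 0 0 = n \<and> S v_pairs 0 0 = N*N \<and> S v_row 0 0 = N*N+4"

definition "coflow_ok k S \<longleftrightarrow> S a_rho k 0 = rho k \<and> S a_weight k 0 = W k \<and> (\<forall>e<N*N. S a_demand k e = dd (e div N) (e mod N) k)"

definition "prepared S \<longleftrightarrow> params S \<and> S v_D 0 0 = D \<and> S v_2N 0 0 = 2 * N \<and> S v_flows 0 0 = F \<and>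
   (\<forall>k<n. S a_rho k 0 = rho k \<and> (\<forall>i<N. \<forall>j<N. S a_demand k (i * N + j) = dd i j k) \<and> (\<forall>p<2*N. S a_load p k = L p k))"

abbreviation "prepared_names == {v_cores, v_ports, v_coflows, v_pairs, v_row, v_D, v_2N, v_flows, a_rho, a_demand, a_load}"

lemma prepared_frame:
  assumes "prepared S" "\<And>r. r \<in> prepared_names ==> S' r = S r"
  shows "prepared S'"
  using assms by (simp add: prepared_def params_def)

lemma preparedD:
  assumes "prepared S"
  shows "S v_cores 0 0 = m" "S v_ports 0 0 = N" "S v_coflows 0 0 = n" "S v_pairs 0 0 = N * N" "S v_D 0 0 = D"
    "S v_2N 0 0 = 2 * N" "S v_flows 0 0 = F" "k < n ==> S a_rho k 0 = rho k" "k < n ==> p < 2 * N ==> S a_load p k = L p k"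
    "i < N ==> j < N ==> k < n ==> S a_demand k (i * N + j) = dd i j k"
  using assms by (simp_all add: prepared_def params_def)

lemma prepared_demand: "prepared S ==> k < n ==> e < N * N ==> S a_demand k e = dd (e div N) (e mod N) k"
  using preparedD(10)[of S "e div N" "e mod N" k] div_mod_N[of e] by simp

lemma prod_le_prod:
  assumes "\<And>k. 0 < f k" "i \<le> n"
  shows "(\<Prod>k<i. f k) \<le> (\<Prod>k<n. f k :: nat)"
proof -
  have "(\<Prod>k<i. f k) dvd (\<Prod>k<n. f k)" using assms by (intro prod_dvd_prod_subset) auto
  then show ?thesis using assms by (intro dvd_imp_le) auto
qed

lemma wp_prepare_scale:
  assumes params: "params S" and input: "input_ok S"
  shows "wp prepare_scale (\<lambda>S'. S' v_D 0 0 = D \<and> S' v_Dw 0 0 = Dw) S"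
proof -
  let ?S = "upd (upd S v_D 0 0 1) v_Dw 0 0 1"
  let ?b = "v_D :=: V v_D .* Row_entry (V v_pairs .+ Cn 1) ;; v_Dw :=: V v_Dw .* Row_entry (V v_pairs .+ Cn 3)"
  let ?Inv = "\<lambda>i S'. S' v_D 0 0 = (\<Prod>k<i. release_den k) \<and> S' v_Dw 0 0 = (\<Prod>k<i. weight_den k)"
  have "wp (Loop i1 v_coflows ?b) (\<lambda>S'. S' v_D 0 0 = D \<and> S' v_Dw 0 0 = Dw) ?S"
  proof (rule wp_Loop[where Inv = ?Inv])
    fix i S'
    assume i: "i < ?S v_coflows 0 0" and inv: "?Inv i S'" and "S' i1 0 0 = i"
      and frame: "\<And>r. r \<noteq> i1 ==> r \<notin> mods ?b ==> S' r = ?S r"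
    have "(\<Prod>k<Suc i. release_den k) \<le> M" "(\<Prod>k<Suc i. weight_den k) \<le> M"
      using prod_le_prod[of release_den "Suc i"] prod_le_prod[of weight_den "Suc i"] release_den_pos weight_den_pos i params
        A_le_M_1[OF D_le_A(1)] A_le_M_1[OF D_le_A(2)] by (simp_all add: params_def D_def Dw_def)
    then show "wp ?b (\<lambda>S''. ?Inv (Suc i) (upd S'' i1 0 0 (Suc i))) S'"
      using i inv \<open>S' i1 0 0 = i\<close> params input by (simp add: frame params_def input_ok_def ac_simps)
  qed (use params lim_n in \<open>simp_all add: params_def D_def Dw_def\<close>)
  then show ?thesis using one_le_M by (simp add: prepare_scale_def)
qed

lemma wp_prepare_coflow:
  assumes params: "params S" and input: "input_ok S" and k: "S i1 0 0 = k" "k < n" and D: "S v_D 0 0 = D" "S v_Dw 0 0 = Dw"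
    and before: "\<forall>k'<k. coflow_ok k' S"
  shows "wp prepare_coflow (\<lambda>S'. \<forall>k'<Suc k. coflow_ok k' S') S"
proof -
  let ?S = "upd (upd S a_rho k 0 (rho k)) a_weight k 0 (W k)"
  let ?b = "Put a_demand (V i1) (V i2) (V v_D .* Row_entry (V i2))"
  let ?Inv = "\<lambda>e S'. (\<forall>k'<k. \<forall>e<N*N. S' a_demand k' e = dd (e div N) (e mod N) k') \<and>
      (\<forall>e'<e. S' a_demand k e' = dd (e' div N) (e' mod N) k)"
  have "wp (Loop i2 v_pairs ?b) (\<lambda>S'. \<forall>k'<Suc k. coflow_ok k' S') ?S"
  proof (rule wp_Loop[where Inv = ?Inv])
    fix e S'
    assume e: "e < ?S v_pairs 0 0" and inv: "?Inv e S'" and "S' i2 0 0 = e"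
      and frame: "\<And>r. r \<noteq> i2 ==> r \<notin> mods ?b ==> S' r = ?S r"
    have "e < N * N" using e params by (simp add: params_def)
    then show "wp ?b (\<lambda>S''. ?Inv (Suc e) (upd S'' i2 0 0 (Suc e))) S'"
      using inv \<open>S' i2 0 0 = e\<close> params input k D dd_le_M[of "e div N" "e mod N" k] div_mod_N[of e]
      by (simp add: frame params_def input_ok_def dd_def less_Suc_eq)
  next
    fix S'
    assume "?Inv (?S v_pairs 0 0) S'" and "\<And>r. r \<noteq> i2 ==> r \<notin> mods ?b ==> S' r = ?S r"
    then show "\<forall>k'<Suc k. coflow_ok k' S'"
      using before params by (auto simp: coflow_ok_def params_def less_Suc_eq)
  qed (use before params lim_NN in \<open>simp_all add: params_def coflow_ok_def\<close>)
  then show ?thesis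
    using params input k D rho_le_M[OF k(2)] W_le_M[OF k(2)]
    by (simp add: prepare_coflow_def params_def input_ok_def flip: rho_def W_def)
qed

lemma wp_port_load:
  assumes params: "params S" and k: "S i1 0 0 = k" "k < n" and i: "S i2 0 0 = i" "i < N"
    and demands: "\<And>i j. i < N ==> j < N ==> S a_demand k (i * N + j) = dd i j k"
  shows "wp port_load (\<lambda>S'. S' a_load i k = L i k \<and> S' a_load (N + i) k = L (N + i) k \<and>
    (\<forall>p k'. (p \<noteq> i \<and> p \<noteq> N + i) \<or> k' \<noteq> k \<longrightarrow> S' a_load p k' = S a_load p k')) S"
proof -
  have N: "S v_ports 0 0 = N" using params by (simp add: params_def)
  have L: "L i k = (\<Sum>j<N. dd i j k)" "L (N + i) k = (\<Sum>j<N. dd j i k)" "L i k \<le> M" "L (N + i) k \<le> M"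
    using i k L_le_M[of i k] L_le_M[of "N + i" k] by (simp_all add: L_def)
  have row_sum: "(\<Sum>j<S v_ports 0 0. ev (upd S i3 0 0 j) (Arr a_demand (V i1) (V i2 .* V v_ports .+ V i3))) = L i k"
    using N k i demands by (simp add: L)
  let ?S = "upd (upd (upd S i3 0 0 N) v_sum 0 0 (L i k)) a_load i k (L i k)"
  have column_sum: "(\<Sum>j<?S v_ports 0 0. ev (upd ?S i3 0 0 j) (Arr a_demand (V i1) (V i3 .* V v_ports .+ V i2))) = L (N + i) k"
    using N k i demands by (simp add: L)
  let ?Q = "\<lambda>S'. S' a_load i k = L i k \<and> S' a_load (N + i) k = L (N + i) k \<and>
    (\<forall>p k'. (p \<noteq> i \<and> p \<noteq> N + i) \<or> k' \<noteq> k \<longrightarrow> S' a_load p k' = S a_load p k')"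
  have "wp (Sum_to v_sum i3 v_ports (Arr a_demand (V i1) (V i3 .* V v_ports .+ V i2)))
      (wp (Put a_load (V v_ports .+ V i2) (V i1) (V v_sum)) ?Q) ?S"
    by (rule wp_Sum_to, unfold column_sum) (use N k i L N_pos lim_N in auto)
  then show ?thesis
    unfolding port_load_def wp_Sq
    by (intro wp_Sum_to, unfold row_sum) (use N k i L lim_N in auto)
qed

lemma wp_coflow_loads:
  assumes params: "params S" and k: "S i1 0 0 = k" "k < n"
    and demands: "\<And>i j. i < N ==> j < N ==> S a_demand k (i * N + j) = dd i j k"
  shows "wp (Loop i2 v_ports port_load)
    (\<lambda>S'. (\<forall>p<2*N. S' a_load p k = L p k) \<and> (\<forall>p k'. k' \<noteq> k \<longrightarrow> S' a_load p k' = S a_load p k')) S"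
proof -
  let ?Inv = "\<lambda>i S'. (\<forall>i'<i. S' a_load i' k = L i' k \<and> S' a_load (N + i') k = L (N + i') k) \<and>
      (\<forall>p k'. k' \<noteq> k \<longrightarrow> S' a_load p k' = S a_load p k')"
  show ?thesis
  proof (rule wp_Loop[where Inv = ?Inv])
    fix i S1
    assume i: "i < S v_ports 0 0" "S1 i2 0 0 = i" and inv: "?Inv i S1"
      and frame: "\<And>r. r \<noteq> i2 ==> r \<notin> mods port_load ==> S1 r = S r"
    have i_less: "i < N" using i params by (simp add: params_def)
    have "params S1" "S1 i1 0 0 = k" "\<And>i j. i < N ==> j < N ==> S1 a_demand k (i * N + j) = dd i j k"
      using params k demands by (simp_all add: frame params_def)
    then show "wp port_load (\<lambda>S'. ?Inv (Suc i) (upd S' i2 0 0 (Suc i))) S1"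
      by (intro wp_mono[OF wp_port_load]) (use k(2) i i_less inv in \<open>auto simp: less_Suc_eq\<close>)
  next
    fix S1
    assume inv: "?Inv (S v_ports 0 0) S1"
    then have "\<forall>i<N. S1 a_load i k = L i k \<and> S1 a_load (N + i) k = L (N + i) k"
      using params by (simp add: params_def)
    then have "S1 a_load p k = L p k" if "p < 2 * N" for p
      using that by (cases "p < N") (auto dest: spec[of _ "p - N"])
    then show "(\<forall>p<2*N. S1 a_load p k = L p k) \<and> (\<forall>p k'. k' \<noteq> k \<longrightarrow> S1 a_load p k' = S a_load p k')"
      using inv by simp
  qed (use params lim_N in \<open>simp_all add: params_def\<close>)
qed

lemma wp_prepare_loads:
  assumes params: "params S" and D: "S v_D 0 0 = D" and coflows: "\<forall>k<n. coflow_ok k S"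
  shows "wp prepare_loads prepared S"
proof -
  let ?S = "upd (upd S v_2N 0 0 (2 * N)) v_flows 0 0 F"
  have demands: "S a_demand k (i * N + j) = dd i j k" if "k < n" "i < N" "j < N" for i j k
    using coflows that flat_less[OF that(2,3)] by (simp add: coflow_ok_def)
  have "wp (Loop i1 v_coflows (Loop i2 v_ports port_load)) prepared ?S"
  proof (rule wp_Loop[where Inv = "\<lambda>k S'. \<forall>k'<k. \<forall>p<2*N. S' a_load p k' = L p k'"])
    fix k S1
    assume k: "k < ?S v_coflows 0 0" "S1 i1 0 0 = k" and inv: "\<forall>k'<k. \<forall>p<2*N. S1 a_load p k' = L p k'"
      and frame: "\<And>r. r \<noteq> i1 ==> r \<notin> mods (Loop i2 v_ports port_load) ==> S1 r = ?S r"
    have k_less: "k < n" using k params by (simp add: params_def)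
    have "params S1" "\<And>i j. i < N ==> j < N ==> S1 a_demand k (i * N + j) = dd i j k"
      using params demands k_less by (simp_all add: frame params_def)
    then show "wp (Loop i2 v_ports port_load) (\<lambda>S'. \<forall>k'<Suc k. \<forall>p<2*N. upd S' i1 0 0 (Suc k) a_load p k' = L p k') S1"
      by (intro wp_mono[OF wp_coflow_loads]) (use k k_less inv in \<open>auto simp: less_Suc_eq\<close>)
  next
    fix S1
    assume "\<forall>k'<?S v_coflows 0 0. \<forall>p<2*N. S1 a_load p k' = L p k'"
      and "\<And>r. r \<noteq> i1 ==> r \<notin> mods (Loop i2 v_ports port_load) ==> S1 r = ?S r"
    then show "prepared S1" using params D demands coflows by (simp add: prepared_def params_def coflow_ok_def)
  qed (use params lim_n in \<open>simp_all add: params_def\<close>)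
  then show ?thesis
    using params lim_2N lim_F Lim_le_M by (simp add: prepare_loads_def params_def)
qed

lemma wp_prepare:
  assumes params: "params S" and input: "input_ok S"
  shows "wp prepare (\<lambda>S'. prepared S' \<and> (\<forall>k<n. S' a_weight k 0 = W k)) S"
  unfolding prepare_def
proof (rule wp_seq[OF wp_prepare_scale[OF params input]])
  fix S1
  assume D: "S1 v_D 0 0 = D \<and> S1 v_Dw 0 0 = Dw" and frame1: "\<And>r. r \<notin> mods prepare_scale ==> S1 r = S r"
  have params1: "params S1" "input_ok S1" using params input by (simp_all add: frame1 params_def input_ok_def)
  have "wp (Loop i1 v_coflows prepare_coflow) (\<lambda>S'. \<forall>k<n. coflow_ok k S') S1"
  proof (rule wp_Loop[where Inv = "\<lambda>k S'. \<forall>k'<k. coflow_ok k' S'"])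
    fix k S2
    assume "k < S1 v_coflows 0 0" "\<forall>k'<k. coflow_ok k' S2" "S2 i1 0 0 = k"
      and frame2: "\<And>r. r \<noteq> i1 ==> r \<notin> mods prepare_coflow ==> S2 r = S1 r"
    moreover from this have "params S2" "input_ok S2" "S2 v_D 0 0 = D" "S2 v_Dw 0 0 = Dw"
      using params1 D by (simp_all add: params_def input_ok_def)
    ultimately have "wp prepare_coflow (\<lambda>S'. \<forall>k'<Suc k. coflow_ok k' S') S2"
      using params1 by (intro wp_prepare_coflow) (simp_all add: params_def)
    then show "wp prepare_coflow (\<lambda>S'. \<forall>k'<Suc k. coflow_ok k' (upd S' i1 0 0 (Suc k))) S2"
      by (rule wp_mono) (simp add: coflow_ok_def)
  qed (use params1 lim_n in \<open>simp_all add: params_def\<close>)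
  then show "wp (Loop i1 v_coflows prepare_coflow ;; prepare_loads) (\<lambda>S'. prepared S' \<and> (\<forall>k<n. S' a_weight k 0 = W k)) S1"
  proof (rule wp_seq)
    fix S2
    assume coflows: "\<forall>k<n. coflow_ok k S2" and frame2: "\<And>r. r \<notin> mods (Loop i1 v_coflows prepare_coflow) ==> S2 r = S1 r"
    have "params S2" "S2 v_D 0 0 = D" using params1 D by (simp_all add: frame2 params_def)
    then show "wp prepare_loads (\<lambda>S'. prepared S' \<and> (\<forall>k<n. S' a_weight k 0 = W k)) S2"
      by (rule wp_mono[OF wp_prepare_loads[OF _ _ coflows]]) (use coflows in \<open>auto simp: coflow_ok_def prepare_loads_def\<close>)
  qed
qed

end

section \<open>The program: ordering the coflows\<close>

abbreviation "a_ordered == 120::nat"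
abbreviation "v_port == 121::nat"
abbreviation "v_portload == 122::nat"
abbreviation "v_cur == 123::nat"
abbreviation "v_found == 124::nat"
abbreviation "a_order == 125::nat"

definition unordered_load :: prog where
  "unordered_load = Sum_to v_sum i3 v_coflows ((Cn 1 .- Vec a_ordered (V i3)) .* Arr a_load (V i2) (V i3))"

definition compare_port :: prog where
  "compare_port = unordered_load ;; Test (V v_sum .- V v_portload) (v_port :=: V i2 ;; v_portload :=: V v_sum) Skp"

definition select_port :: prog where
  "select_port = v_port :=: Cn 0 ;; v_portload :=: Cn 0 ;; Loop i2 v_2N compare_port"

definition compare_coflow :: prog where
  "compare_coflow = Test (Vec a_ordered (V i2)) Skp (
      Test (V v_found)
        (Test (Arr a_load (V v_port) (V i2))
          (Test (Arr a_load (V v_port) (V v_cur))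
            (Test (Vec a_weight (V v_cur) .* Arr a_load (V v_port) (V i2) .- Vec a_weight (V i2) .* Arr a_load (V v_port) (V v_cur))
              (v_cur :=: V i2) Skp)
            (v_cur :=: V i2))
          Skp)
        (v_found :=: Cn 1 ;; v_cur :=: V i2))"

definition select_coflow :: prog where
  "select_coflow = v_found :=: Cn 0 ;; v_cur :=: Cn 0 ;; Loop i2 v_coflows compare_coflow"

definition reduce_weight :: prog where
  "reduce_weight = Test (Vec a_ordered (V i2) .+ Eq (V i2) (V v_cur)) Skp
      (Put a_weight (V i2) (Cn 0)
        (Vec a_weight (V i2) .* Arr a_load (V v_port) (V v_cur) .- Vec a_weight (V v_cur) .* Arr a_load (V v_port) (V i2)))"

definition reduce_weights :: prog where
  "reduce_weights = Test (Arr a_load (V v_port) (V v_cur)) (Loop i2 v_coflows reduce_weight) Skp"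

definition append_coflow :: prog where
  "append_coflow = Put a_ordered (V v_cur) (Cn 0) (Cn 1) ;; Put a_order (V v_coflows .- Cn 1 .- V i1) (Cn 0) (V v_cur)"

definition order_round :: prog where
  "order_round = select_port ;; select_coflow ;; reduce_weights ;; append_coflow"

definition compute_order :: prog where
  "compute_order = Loop i1 v_coflows order_round"

lemma mods_order [simp]:
  "mods unordered_load = {v_sum, i3}"
  "mods select_port = {v_port, v_portload, v_sum, i2, i3}"
  "mods compare_coflow = {v_found, v_cur}"
  "mods select_coflow = {v_found, v_cur, i2}"
  "mods reduce_weight = {a_weight}"
  "mods reduce_weights = {a_weight, i2}"
  "mods order_round = {v_port, v_portload, v_sum, i2, i3, v_found, v_cur, a_weight, a_ordered, a_order}"
  "mods compute_order = insert i1 (mods order_round)"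
  by (auto simp: unordered_load_def select_port_def compare_port_def compare_coflow_def select_coflow_def reduce_weight_def reduce_weights_def order_round_def append_coflow_def compute_order_def)

lemma ratio_trans:
  fixes wi wc wk li lc lk :: nat
  assumes "wi * lc < wc * li" "wc * lk \<le> wk * lc" "0 < lc"
  shows "wi * lk \<le> wk * li"
proof -
  have "lc * (wi * lk) \<le> (wc * li) * lk" using assms(1) by (simp add: mult_ac)
  also have "... = (wc * lk) * li" by (simp add: mult_ac)
  also have "... \<le> (wk * lc) * li" using assms(2) by (rule mult_le_mono1)
  finally have "lc * (wi * lk) \<le> lc * (wk * li)" by (simp add: mult_ac)
  then show ?thesis using assms(3) by simp
qed

context bounded_run
begin

definition "remaining U S \<longleftrightarrow> U \<subseteq> {..<n} \<and> (\<forall>k<n. S a_ordered k 0 = of_bool (k \<notin> U))"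

lemma wp_unordered_load:
  assumes ok: "prepared S" and U: "remaining U S" and p: "S i2 0 0 = p" "p < 2 * N"
    and post: "Q (upd (upd S i3 0 0 n) v_sum 0 0 (loads.total_load U p))"
  shows "wp unordered_load Q S"
proof -
  have "(\<Sum>k<n. (Suc 0 - S a_ordered k 0) * S a_load p k) = (\<Sum>k<n. if k \<in> U then L p k else 0)"
    using U p ok by (intro sum.cong) (auto simp: remaining_def preparedD[OF ok])
  also have "... = (\<Sum>k\<in>{..<n} \<inter> U. L p k)" by (simp add: sum.If_cases)
  also have "{..<n} \<inter> U = U" using U by (auto simp: remaining_def)
  finally have sum: "(\<Sum>k<S v_coflows 0 0. ev (upd S i3 0 0 k) ((Cn 1 .- Vec a_ordered (V i3)) .* Arr a_load (V i2) (V i3))) =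
      loads.total_load U p"
    using ok p by (simp add: preparedD[OF ok] loads.total_load_def)
  have "loads.total_load U p \<le> sum_L"
    unfolding loads.total_load_def by (rule L_le_sum_L[OF p(2)]) (use U in \<open>simp add: remaining_def\<close>)
  then have "loads.total_load U p \<le> M" using sum_L_le_M by simp
  then show ?thesis
    unfolding unordered_load_def
    by (intro wp_Sum_to, unfold sum) (use post lim_n in \<open>simp_all add: preparedD(3)[OF ok]\<close>)
qed

lemma wp_select_port:
  assumes ok: "prepared S" and U: "remaining U S"
  shows "wp select_port (\<lambda>S'. S' v_port 0 0 < 2 * N \<and> loads.total_load U (S' v_port 0 0) = loads.max_load U) S"
proof -
  let ?S = "upd (upd S v_port 0 0 0) v_portload 0 0 0"
  let ?Inv = "\<lambda>i S'. (\<forall>p<i. loads.total_load U p \<le> S' v_portload 0 0) \<and>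
        (S' v_portload 0 0 = 0 \<and> S' v_port 0 0 = 0 \<or> S' v_port 0 0 < i \<and> loads.total_load U (S' v_port 0 0) = S' v_portload 0 0)"
  have ports2: "S v_2N 0 0 = 2 * N" using ok by (simp add: preparedD[OF ok])
  have "wp (Loop i2 v_2N compare_port) (\<lambda>S'. S' v_port 0 0 < 2 * N \<and> loads.total_load U (S' v_port 0 0) = loads.max_load U) ?S"
  proof (rule wp_Loop[where Inv = ?Inv])
    fix p S1
    assume "p < ?S v_2N 0 0" and inv: "?Inv p S1" and port1: "S1 i2 0 0 = p"
      and frame: "\<And>r. r \<noteq> i2 ==> r \<notin> mods compare_port ==> S1 r = ?S r"
    then have p: "p < 2 * N" using ports2 by simp
    have "prepared S1" by (rule prepared_frame[OF ok]) (auto simp: frame compare_port_def)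
    moreover have "remaining U S1" using U by (simp add: frame remaining_def compare_port_def)
    moreover have "loads.total_load U p \<le> M" "p \<le> M"
      using L_le_sum_L[OF p, of U] U sum_L_le_M p lim_2N Lim_le_M
      by (simp_all add: loads.total_load_def remaining_def)
    ultimately show "wp compare_port (\<lambda>S'. ?Inv (Suc p) (upd S' i2 0 0 (Suc p))) S1"
      unfolding compare_port_def wp_Sq
      by (intro wp_unordered_load[where S = S1 and p = p and U = U]) (use inv port1 p in \<open>auto simp: less_Suc_eq\<close>)
  next
    fix S1
    assume inv: "?Inv (?S v_2N 0 0) S1"
    have port: "S1 v_port 0 0 < 2 * N" "loads.total_load U (S1 v_port 0 0) = S1 v_portload 0 0"
      using inv ports2 N_pos by force+
    moreover have "loads.max_load U \<le> S1 v_portload 0 0" using inv ports2 by (simp add: loads.max_load_le_iff)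
    ultimately show "S1 v_port 0 0 < 2 * N \<and> loads.total_load U (S1 v_port 0 0) = loads.max_load U"
      using loads.total_load_le_max[OF port(1), of U] by simp
  qed (use ports2 lim_2N in \<open>simp_all add: compare_port_def\<close>)
  then show ?thesis by (simp add: select_port_def)
qed

text \<open>The ratios of weight and load at port \<open>p\<close> are compared by cross-multiplication.\<close>

definition least_ratio :: "(nat => nat) => nat => nat set => nat => bool" where
  "least_ratio w p Z c \<longleftrightarrow> (\<forall>k\<in>Z. (L p c = 0 \<longrightarrow> L p k = 0) \<and> w c * L p k \<le> w k * L p c)"

lemma least_ratio_insert:
  assumes "least_ratio w p Z c"
  shows "L p i = 0 \<or> (0 < L p c \<and> w c * L p i \<le> w i * L p c) ==> least_ratio w p (insert i Z) c"
    and "0 < L p i ==> L p c = 0 \<or> w i * L p c < w c * L p i ==> least_ratio w p (insert i Z) i"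
  using assms ratio_trans[of "w i" "L p c" "w c" "L p i"] by (fastforce simp: least_ratio_def)+

lemma wp_compare_coflow:
  assumes ok: "prepared S" and U: "remaining U S" and p: "S v_port 0 0 = p" "p < 2 * N" and i: "S i2 0 0 = i" "i < n"
    and inv: "if S v_found 0 0 = 0 then U \<inter> {..<i} = {} else S v_cur 0 0 \<in> U \<and> least_ratio (\<lambda>k. S a_weight k 0) p (U \<inter> {..<i}) (S v_cur 0 0)"
  shows "wp compare_coflow (\<lambda>S'. if S' v_found 0 0 = 0 then U \<inter> {..<Suc i} = {}
    else S' v_cur 0 0 \<in> U \<and> least_ratio (\<lambda>k. S a_weight k 0) p (U \<inter> {..<Suc i}) (S' v_cur 0 0)) S"
proof -
  define c w where "c = S v_cur 0 0" and "w = (\<lambda>k. S a_weight k 0)"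
  have loads: "S a_load p k = L p k" if "k < n" for k using ok p that by (simp add: preparedD[OF ok])
  have "i \<le> M" using i n_le_M by simp
  consider (outside) "i \<notin> U" | (first) "i \<in> U" "S v_found 0 0 = 0" | (later) "i \<in> U" "S v_found 0 0 \<noteq> 0" by blast
  then show ?thesis
  proof cases
    case outside
    then have "U \<inter> {..<Suc i} = U \<inter> {..<i}" by (auto simp: less_Suc_eq)
    then show ?thesis using outside inv U i by (simp add: compare_coflow_def remaining_def)
  next
    case first
    then have "U \<inter> {..<Suc i} = {i}" using inv by (auto simp: less_Suc_eq)
    then show ?thesis
      using first U i \<open>i \<le> M\<close> one_le_M by (simp add: compare_coflow_def remaining_def least_ratio_def)
  next
    case later
    have insert: "U \<inter> {..<Suc i} = insert i (U \<inter> {..<i})" using later by (auto simp: less_Suc_eq)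
    have c: "c \<in> U" "c < n" "least_ratio w p (U \<inter> {..<i}) c"
      using inv later U by (auto simp: c_def w_def remaining_def)
    show ?thesis
      using later U i p \<open>i \<le> M\<close> c(1,2) least_ratio_insert[OF c(3), of i]
      unfolding insert by (auto simp: compare_coflow_def remaining_def loads w_def not_less simp flip: c_def)
  qed
qed

lemma wp_select_coflow:
  assumes ok: "prepared S" and U: "remaining U S" "U \<noteq> {}" and p: "S v_port 0 0 = p" "p < 2 * N"
  shows "wp select_coflow (\<lambda>S'. S' v_cur 0 0 \<in> U \<and> least_ratio (\<lambda>k. S a_weight k 0) p U (S' v_cur 0 0)) S"
proof -
  let ?S = "upd (upd S v_found 0 0 0) v_cur 0 0 0"
  let ?Inv = "\<lambda>i S'. if S' v_found 0 0 = 0 then U \<inter> {..<i} = {}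
    else S' v_cur 0 0 \<in> U \<and> least_ratio (\<lambda>k. S a_weight k 0) p (U \<inter> {..<i}) (S' v_cur 0 0)"
  have n: "S v_coflows 0 0 = n" using ok by (simp add: preparedD[OF ok])
  have "wp (Loop i2 v_coflows compare_coflow) (\<lambda>S'. S' v_cur 0 0 \<in> U \<and> least_ratio (\<lambda>k. S a_weight k 0) p U (S' v_cur 0 0)) ?S"
  proof (rule wp_Loop[where Inv = ?Inv])
    fix i S1
    assume "i < ?S v_coflows 0 0" and inv: "?Inv i S1" and i1: "S1 i2 0 0 = i"
      and frame: "\<And>r. r \<noteq> i2 ==> r \<notin> mods compare_coflow ==> S1 r = ?S r"
    then have i: "i < n" using n by simp
    have ok1: "prepared S1" by (rule prepared_frame[OF ok]) (auto simp: frame)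
    have remaining1: "remaining U S1" and port1: "S1 v_port 0 0 = p" and weight1: "S1 a_weight = S a_weight"
      using U p by (simp_all add: frame remaining_def)
    show "wp compare_coflow (\<lambda>S'. ?Inv (Suc i) (upd S' i2 0 0 (Suc i))) S1"
      by (rule wp_mono[OF wp_compare_coflow[where S = S1, OF ok1 remaining1 port1 p(2) i1 i, unfolded weight1, OF inv]]) (auto split: if_splits)
  next
    fix S1
    assume "?Inv (?S v_coflows 0 0) S1"
    moreover have "U \<inter> {..<n} = U" using U by (auto simp: remaining_def)
    ultimately show "S1 v_cur 0 0 \<in> U \<and> least_ratio (\<lambda>k. S a_weight k 0) p U (S1 v_cur 0 0)"
      using U(2) n by (simp split: if_splits)
  qed (use n lim_n in simp_all)
  then show ?thesis using one_le_M by (simp add: select_coflow_def)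
qed

definition residual :: "(nat => nat) => nat => nat set => nat => nat => nat" where
  "residual w p U c k = (if 0 < L p c \<and> k \<in> U \<and> k \<noteq> c then w k * L p c - w c * L p k else w k)"

lemma residual_le:
  assumes "p < 2 * N" "c < n"
  shows "residual w p U c k \<le> w k * (1 + sum_L)"
proof -
  have "w k * L p c - w c * L p k \<le> w k * (1 + sum_L)"
    using L1_le_sum_L[OF assms] mult_le_mono2[of "L p c" "1 + sum_L" "w k"] by linarith
  then show ?thesis by (simp add: residual_def)
qed

lemma wp_reduce_weights:
  assumes ok: "prepared S" and U: "remaining U S" and p: "S v_port 0 0 = p" "p < 2 * N"
    and c: "S v_cur 0 0 = c" "c \<in> U" and bound: "\<And>k. k < n ==> S a_weight k 0 * (1 + sum_L) \<le> M"
  shows "wp reduce_weights (\<lambda>S'. \<forall>k<n. S' a_weight k 0 = residual (\<lambda>k. S a_weight k 0) p U c k) S"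
proof -
  let ?w = "\<lambda>k. S a_weight k 0"
  have loads: "S a_load p k = L p k" if "k < n" for k using ok p that by (simp add: preparedD[OF ok])
  have c_less: "c < n" and n: "S v_coflows 0 0 = n" using U c ok by (auto simp: remaining_def preparedD[OF ok])
  show ?thesis
  proof (cases "L p c = 0")
    case True
    then show ?thesis using loads[OF c_less] p c by (simp add: reduce_weights_def residual_def)
  next
    case False
    let ?Inv = "\<lambda>i S'. \<forall>k<n. S' a_weight k 0 = (if k < i then residual ?w p U c k else ?w k)"
    have "wp (Loop i2 v_coflows reduce_weight) (\<lambda>S'. \<forall>k<n. S' a_weight k 0 = residual ?w p U c k) S"
    proof (rule wp_Loop[where Inv = ?Inv])
      fix i S1
      assume "i < S v_coflows 0 0" and inv: "?Inv i S1" and i1: "S1 i2 0 0 = i"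
        and frame: "\<And>r. r \<noteq> i2 ==> r \<notin> mods reduce_weight ==> S1 r = S r"
      then have i: "i < n" using n by simp
      have w: "S1 a_weight i 0 = ?w i" "S1 a_weight c 0 = ?w c" using inv i c_less by (auto simp: residual_def)
      have "residual ?w p U c i \<le> M" using residual_le[OF p(2) c_less, of ?w U i] bound[OF i] by linarith
      then show "wp reduce_weight (\<lambda>S'. ?Inv (Suc i) (upd S' i2 0 0 (Suc i))) S1"
        using inv i1 i c_less loads p c U w False
        by (auto simp: reduce_weight_def frame remaining_def less_Suc_eq residual_def split: if_splits)
    qed (use n lim_n in auto)
    then show ?thesis using False loads[OF c_less] p c by (simp add: reduce_weights_def)
  qed
qed

definition order_step :: "nat set => nat => (nat => nat) => (nat => nat) => bool" where
  "order_step U c w w' \<longleftrightarrow> c \<in> U \<and> (\<exists>p<2*N. loads.total_load U p = loads.max_load U \<and> least_ratio w p U c \<and>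
     (\<forall>k<n. w' k = residual w p U c k))"

lemma local_ratio_order_step:
  assumes step: "order_step U c w w'" and U: "set (c # xs) = U" "c \<notin> set xs" "U \<subseteq> {..<n}"
    and order: "loads.local_ratio_order w' xs"
  shows "loads.local_ratio_order w (c # xs)"
proof -
  obtain p where p: "p < 2 * N" "loads.total_load U p = loads.max_load U" "least_ratio w p U c"
    "\<And>k. k < n ==> w' k = residual w p U c k"
    using step unfolding order_step_def by blast
  show ?thesis
  proof (cases "L p c = 0")
    case True
    then have "loads.total_load U p = 0" using p(3) by (simp add: loads.total_load_def least_ratio_def)
    then show ?thesis using p(2) U(1) by (intro loads.local_ratio_order_zero_load) simp
  next
    case False
    show ?thesis
      by (rule loads.local_ratio_order.Step[where W' = w' and \<mu> = p])
        (use p U order False in \<open>auto simp: least_ratio_def residual_def\<close>)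
  qed
qed

lemma wp_order_round:
  assumes ok: "prepared S" and U: "remaining U S" "U \<noteq> {}" and s: "S i1 0 0 = s" "s < n"
    and bound: "\<And>k. k < n ==> S a_weight k 0 * (1 + sum_L) \<le> M"
  shows "wp order_round (\<lambda>S'. \<exists>c. order_step U c (\<lambda>k. S a_weight k 0) (\<lambda>k. S' a_weight k 0) \<and> remaining (U - {c}) S' \<and>
    S' a_order (n - 1 - s) 0 = c \<and> (\<forall>t. t \<noteq> n - 1 - s \<longrightarrow> S' a_order t 0 = S a_order t 0)) S"
    (is "wp _ ?Q S")
  unfolding order_round_def
proof (rule wp_seq[OF wp_select_port[OF ok U(1)]])
  fix S1
  assume port: "S1 v_port 0 0 < 2 * N \<and> loads.total_load U (S1 v_port 0 0) = loads.max_load U"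
    and frame1: "\<And>r. r \<notin> mods select_port ==> S1 r = S r"
  define p where "p = S1 v_port 0 0"
  have p: "p < 2 * N" using port by (simp add: p_def)
  have ok1: "prepared S1" by (rule prepared_frame[OF ok]) (auto simp: frame1)
  have remaining1: "remaining U S1" using U by (simp add: remaining_def frame1)
  show "wp (select_coflow ;; reduce_weights ;; append_coflow) ?Q S1"
  proof (rule wp_seq[OF wp_select_coflow[OF ok1 remaining1 U(2) p_def[symmetric] p]])
    fix S2
    assume selected: "S2 v_cur 0 0 \<in> U \<and> least_ratio (\<lambda>k. S1 a_weight k 0) p U (S2 v_cur 0 0)"
      and frame2: "\<And>r. r \<notin> mods select_coflow ==> S2 r = S1 r"
    define c where "c = S2 v_cur 0 0"
    have c: "c \<in> U" "c < n" using selected remaining1 by (auto simp: c_def remaining_def)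
    have ok2: "prepared S2" by (rule prepared_frame[OF ok1]) (auto simp: frame2)
    have remaining2: "remaining U S2" "S2 v_port 0 0 = p" using remaining1 by (simp_all add: remaining_def frame2 p_def)
    have weight2: "S2 a_weight = S a_weight" by (simp add: frame2 frame1)
    show "wp (reduce_weights ;; append_coflow) ?Q S2"
    proof (rule wp_seq[OF wp_reduce_weights[OF ok2 remaining2 p c_def[symmetric] c(1)]])
      show "S2 a_weight k 0 * (1 + sum_L) \<le> M" if "k < n" for k using bound[OF that] by (simp add: weight2)
      fix S3
      assume weight3: "\<forall>k<n. S3 a_weight k 0 = residual (\<lambda>k. S2 a_weight k 0) p U c k"
        and frame3: "\<And>r. r \<notin> mods reduce_weights ==> S3 r = S2 r"
      have "order_step U c (\<lambda>k. S a_weight k 0) (\<lambda>k. S3 a_weight k 0)"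
        unfolding order_step_def using port selected weight3 c by (auto simp: frame1 weight2 p_def c_def)
      then show "wp append_coflow ?Q S3"
        using c s remaining2 n_le_M one_le_M preparedD(3)[OF ok]
        by (auto simp: append_coflow_def frame3 frame2 frame1 remaining_def simp flip: c_def intro!: exI[of _ c])
    qed
  qed
qed

definition "weight_bound s = (\<Sum>k<n. W k + 1) * (1 + sum_L) ^ s"

lemma weight_bound_Suc: "weight_bound s * (1 + sum_L) = weight_bound (Suc s)"
  by (simp only: weight_bound_def power_Suc mult_ac)

lemma weight_bound_le_M: "s \<le> n ==> weight_bound s \<le> M"
proof -
  assume s: "s \<le> n"
  have "(1 + sum_L) ^ s \<le> A ^ s" using Suc_sum_L_le_A by (intro power_mono) auto
  then have "weight_bound s \<le> A ^ (1 + s)"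
    unfolding weight_bound_def by (intro mult_le_A le_A_1 W_le_A)
  then show ?thesis by (rule le_M) (use s in simp)
qed

definition "ordered s ys S \<longleftrightarrow> length ys = s \<and> distinct ys \<and> set ys \<subseteq> {..<n} \<and> remaining ({..<n} - set ys) S \<and>
   (\<forall>t<s. S a_order (n - 1 - t) 0 = ys ! t) \<and> (\<forall>k<n. S a_weight k 0 \<le> weight_bound s) \<and>
   (\<forall>xs. distinct xs \<longrightarrow> set xs = {..<n} - set ys \<longrightarrow> loads.local_ratio_order (\<lambda>k. S a_weight k 0) xs \<longrightarrow>
      loads.local_ratio_order W (ys @ xs))"

lemma ordered_start:
  assumes "\<And>k. k < n ==> S a_ordered k 0 = 0" "\<And>k. k < n ==> S a_weight k 0 = W k"
  shows "ordered 0 [] S"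
proof -
  have "W k \<le> weight_bound 0" if "k < n" for k
    using that member_le_sum[of k "{..<n}" "\<lambda>k. W k + 1"] by (simp add: weight_bound_def)
  moreover have "loads.local_ratio_order W xs"
    if "set xs = {..<n}" "loads.local_ratio_order (\<lambda>k. S a_weight k 0) xs" for xs
    using that(2) by (rule loads.local_ratio_order_cong) (use that(1) assms(2) in auto)
  ultimately show ?thesis using assms by (simp add: ordered_def remaining_def)
qed

lemma ordered_step:
  assumes ys: "ordered s ys S" and s: "s < n" and step: "order_step ({..<n} - set ys) c (\<lambda>k. S a_weight k 0) (\<lambda>k. S' a_weight k 0)"
    and remaining: "remaining ({..<n} - set ys - {c}) S'"
    and order: "S' a_order (n - 1 - s) 0 = c" "\<And>t. t \<noteq> n - 1 - s ==> S' a_order t 0 = S a_order t 0"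
  shows "ordered (Suc s) (ys @ [c]) S'"
proof -
  have c: "c < n" "c \<notin> set ys" using step by (auto simp: order_step_def)
  have "S' a_weight k 0 \<le> weight_bound (Suc s)" if k: "k < n" for k
  proof -
    have "S' a_weight k 0 \<le> S a_weight k 0 * (1 + sum_L)"
      using step k residual_le[OF _ c(1)] by (auto simp: order_step_def)
    also have "... \<le> weight_bound s * (1 + sum_L)" using ys k by (intro mult_le_mono1) (simp add: ordered_def)
    finally show ?thesis by (simp only: weight_bound_Suc)
  qed
  moreover have "loads.local_ratio_order W ((ys @ [c]) @ xs)"
    if xs: "distinct xs" "set xs = {..<n} - set (ys @ [c])" "loads.local_ratio_order (\<lambda>k. S' a_weight k 0) xs" for xs
  proof -
    have set_xs: "set (c # xs) = {..<n} - set ys" using xs(2) c by auto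
    have "loads.local_ratio_order (\<lambda>k. S a_weight k 0) (c # xs)"
      by (rule local_ratio_order_step[OF step set_xs]) (use xs in auto)
    moreover have "distinct (c # xs)" using xs by simp
    ultimately show ?thesis using ys set_xs unfolding ordered_def by (metis append_Cons append_Nil append_assoc)
  qed
  moreover have "S' a_order (n - 1 - t) 0 = (ys @ [c]) ! t" if "t < Suc s" for t
    using that s ys order by (cases "t = s") (auto simp: ordered_def nth_append)
  moreover have "{..<n} - set (ys @ [c]) = {..<n} - set ys - {c}" by auto
  ultimately show ?thesis using ys c remaining by (simp add: ordered_def)
qed

lemma wp_order_next:
  assumes ok: "prepared S" and ys: "ordered s ys S" and s: "S i1 0 0 = s" "s < n"
  shows "wp order_round (\<lambda>S'. \<exists>ys. ordered (Suc s) ys (upd S' i1 0 0 (Suc s))) S"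
proof -
  let ?U = "{..<n} - set ys"
  have "card (set ys) < n" using ys s by (simp add: ordered_def distinct_card)
  then have nonempty: "?U \<noteq> {}" using card_mono[of "set ys" "{..<n}"] by auto
  have bound: "S a_weight k 0 * (1 + sum_L) \<le> M" if "k < n" for k
  proof -
    have "S a_weight k 0 * (1 + sum_L) \<le> weight_bound (Suc s)"
      unfolding weight_bound_Suc[symmetric] using ys that by (intro mult_le_mono1) (simp add: ordered_def)
    also have "... \<le> M" using s by (intro weight_bound_le_M) simp
    finally show ?thesis .
  qed
  have "remaining ?U S" using ys by (simp add: ordered_def)
  from wp_order_round[OF ok this nonempty s bound] show ?thesis
  proof (rule wp_mono)
    fix S' :: store
    assume "\<exists>c. order_step ?U c (\<lambda>k. S a_weight k 0) (\<lambda>k. S' a_weight k 0) \<and> remaining (?U - {c}) S' \<and>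
      S' a_order (n - 1 - s) 0 = c \<and> (\<forall>t. t \<noteq> n - 1 - s \<longrightarrow> S' a_order t 0 = S a_order t 0)"
    then have "\<exists>c. ordered (Suc s) (ys @ [c]) (upd S' i1 0 0 (Suc s))"
      using s(2) by (auto intro!: ordered_step[OF ys] simp: remaining_def)
    then show "\<exists>ys. ordered (Suc s) ys (upd S' i1 0 0 (Suc s))" by blast
  qed
qed

lemma ordered_complete:
  assumes ys: "ordered n ys S"
  shows "distinct ys" "set ys = {..<n}" "loads.local_ratio_order W ys" "t < n ==> S a_order t 0 = ys ! (n - 1 - t)"
proof -
  show "distinct ys" using ys by (simp add: ordered_def)
  show set_ys: "set ys = {..<n}"
    using ys by (intro card_subset_eq) (auto simp: ordered_def distinct_card)
  then have "loads.local_ratio_order W (ys @ [])"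
    using ys loads.local_ratio_order.Nil unfolding ordered_def by (metis Diff_cancel distinct.simps(1) list.set(1))
  then show "loads.local_ratio_order W ys" by simp
  have "\<forall>u<n. S a_order (n - 1 - u) 0 = ys ! u" using ys by (simp add: ordered_def)
  from this[rule_format, of "n - 1 - t"] show "t < n ==> S a_order t 0 = ys ! (n - 1 - t)" by simp
qed

lemma wp_compute_order:
  assumes ok: "prepared S" and unordered: "\<And>k. k < n ==> S a_ordered k 0 = 0" and weights: "\<And>k. k < n ==> S a_weight k 0 = W k"
  shows "wp compute_order (\<lambda>S'. \<exists>ys. distinct ys \<and> set ys = {..<n} \<and> loads.local_ratio_order W ys \<and>
     (\<forall>t<n. S' a_order t 0 = ys ! (n - 1 - t))) S"
  unfolding compute_order_def
proof (rule wp_Loop[where Inv = "\<lambda>s S'. \<exists>ys. ordered s ys S'"])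
  show "\<exists>ys. ordered 0 ys (upd S i1 0 0 0)"
    using unordered weights by (intro exI[of _ "[]"] ordered_start) auto
next
  fix s S1
  assume "s < S v_coflows 0 0" and "\<exists>ys. ordered s ys S1" and "S1 i1 0 0 = s"
    and frame: "\<And>r. r \<noteq> i1 ==> r \<notin> mods order_round ==> S1 r = S r"
  moreover have "prepared S1" by (rule prepared_frame[OF ok]) (auto simp: frame)
  ultimately show "wp order_round (\<lambda>S'. \<exists>ys. ordered (Suc s) ys (upd S' i1 0 0 (Suc s))) S1"
    using wp_order_next preparedD(3)[OF ok] by auto
next
  fix S1
  assume "\<exists>ys. ordered (S v_coflows 0 0) ys S1"
  then obtain ys where "ordered n ys S1" unfolding preparedD(3)[OF ok] by blast
  then show "\<exists>ys. distinct ys \<and> set ys = {..<n} \<and> loads.local_ratio_order W ys \<and> (\<forall>t<n. S1 a_order t 0 = ys ! (n - 1 - t))"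
    using ordered_complete by blast
qed (use preparedD(3)[OF ok] lim_n in simp_all)

end

section \<open>The program: list scheduling on several cores\<close>

abbreviation "p_core == 130::nat"
abbreviation "p_src == 131::nat"
abbreviation "p_dst == 132::nat"
abbreviation "p_coflow == 133::nat"
abbreviation "p_start == 134::nat"
abbreviation "p_end == 135::nat"
abbreviation "v_count == 136::nat"
abbreviation "v_den == 137::nat"
abbreviation "v_used == 138::nat"
abbreviation "v_coflow == 139::nat"
abbreviation "v_size == 140::nat"
abbreviation "v_src == 141::nat"
abbreviation "v_dst == 142::nat"
abbreviation "v_core == 143::nat"
abbreviation "v_minload == 144::nat"
abbreviation "a_coreload == 145::nat"
abbreviation "v_time == 146::nat"
abbreviation "v_left == 147::nat"
abbreviation "v_busy == 148::nat"
abbreviation "v_stop == 149::nat"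
abbreviation "v_steps == 150::nat"

abbreviation "period_names == {p_core, p_src, p_dst, p_coflow, p_start, p_end, v_count}"

abbreviation "num_periods S == S v_count 0 0"
abbreviation "core_at S == (\<lambda>q. S p_core q 0)"
abbreviation "flow_at S == (\<lambda>q. (S p_src q 0, S p_dst q 0, S p_coflow q 0))"
abbreviation "start_at S == (\<lambda>q. S p_start q 0)"
abbreviation "end_at S == (\<lambda>q. S p_end q 0)"

subsection \<open>Recording periods\<close>

definition emit :: "expr => expr => expr => expr => expr => expr => prog" where
  "emit h i j k a b = Put p_core (V v_count) (Cn 0) h ;; Put p_src (V v_count) (Cn 0) i ;; Put p_dst (V v_count) (Cn 0) j ;;
     Put p_coflow (V v_count) (Cn 0) k ;; Put p_start (V v_count) (Cn 0) a ;; Put p_end (V v_count) (Cn 0) b ;; v_count :=: V v_count .+ Cn 1"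

definition emitted :: "store => nat => nat => nat => nat => nat => nat => store" where
  "emitted S h i j k a b = (let q = num_periods S in
     upd (upd (upd (upd (upd (upd (upd S p_core q 0 h) p_src q 0 i) p_dst q 0 j) p_coflow q 0 k) p_start q 0 a) p_end q 0 b) v_count 0 0 (Suc q))"

lemma mods_emit [simp]: "mods (emit h i j k a b) = period_names"
  by (auto simp: emit_def)

lemma emitted_frame [simp]: "r \<notin> period_names ==> emitted S h i j k a b r = S r"
  by (simp add: emitted_def Let_def)

lemma emitted_fields [simp]:
  "emitted S h i j k a b v_count 0 0 = Suc (num_periods S)"
  "emitted S h i j k a b p_core q 0 = (if q = num_periods S then h else S p_core q 0)"
  "emitted S h i j k a b p_src q 0 = (if q = num_periods S then i else S p_src q 0)"
  "emitted S h i j k a b p_dst q 0 = (if q = num_periods S then j else S p_dst q 0)"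
  "emitted S h i j k a b p_coflow q 0 = (if q = num_periods S then k else S p_coflow q 0)"
  "emitted S h i j k a b p_start q 0 = (if q = num_periods S then a else S p_start q 0)"
  "emitted S h i j k a b p_end q 0 = (if q = num_periods S then b else S p_end q 0)"
  by (auto simp: emitted_def Let_def)

lemma (in ram) wp_emit:
  assumes fresh: "(reads eh \<union> reads ei \<union> reads ej \<union> reads ek \<union> reads ea \<union> reads eb) \<inter> period_names = {}"
    and "ev S eh \<le> M" "ev S ei \<le> M" "ev S ej \<le> M" "ev S ek \<le> M" "ev S ea \<le> M" "ev S eb \<le> M" "num_periods S < Lim"
    and "Q (emitted S (ev S eh) (ev S ei) (ev S ej) (ev S ek) (ev S ea) (ev S eb))"
  shows "wp (emit eh ei ej ek ea eb) Q S"
proof -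
  have "ev (upd S' r i j v) x = ev S' x" if "x \<in> {eh, ei, ej, ek, ea, eb}" "r \<in> period_names" for S' x r i j v
    using that fresh by (intro ev_cong upd_other) blast
  then show ?thesis
    unfolding emit_def using assms(2-9) Lim_le_M by (simp add: emitted_def Let_def)
qed

context nonempty_instance
begin

definition "plan u S \<longleftrightarrow> partial_schedule u (num_periods S) (core_at S) (flow_at S) (start_at S) (end_at S)"
definition "sent_in S f = sent (num_periods S) (flow_at S) (start_at S) (end_at S) f"

definition "good_schedule u \<rho> S \<longleftrightarrow> plan u S \<and> (\<forall>i<N. \<forall>j<N. \<forall>k<n. sent_in S (i, j, k) = u * dd i j k) \<and>
   approximates u (num_periods S) (flow_at S) (end_at S) \<rho>"

lemma plan_cong: "(\<And>r. r \<in> period_names ==> S' r = S r) ==> plan u S' = plan u S"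
  by (simp add: plan_def)

lemma sent_in_cong: "(\<And>r. r \<in> period_names ==> S' r = S r) ==> sent_in S' f = sent_in S f"
  by (simp add: sent_in_def)

lemma sent_in_absent: "(\<And>q. q < num_periods S ==> flow_at S q \<noteq> f) ==> sent_in S f = 0"
  unfolding sent_in_def sent_def by (intro sum.neutral) blast

lemma plan_emitted:
  assumes "plan u S" "h < m" "i < N" "j < N" "k < n" "u * rho k \<le> a" "a < b"
    and "\<And>q. q < num_periods S ==> core_at S q = h ==> S p_src q 0 = i \<or> S p_dst q 0 = j ==> end_at S q \<le> a \<or> b \<le> start_at S q"
    and "\<And>q. q < num_periods S ==> flow_at S q = (i, j, k) ==> core_at S q = h"
  shows "plan u (emitted S h i j k a b)"
  unfolding plan_def emitted_fields(1)
  by (rule partial_schedule_Suc[OF assms(1)[unfolded plan_def]]) (use assms in \<open>auto simp: share_port_def\<close>)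

lemma sent_in_emitted: "sent_in (emitted S h i j k a b) f = sent_in S f + (if f = (i, j, k) then b - a else 0)"
  (is "sent_in ?S f = _")
proof -
  have "sent_in ?S f = sent_in S f + (if f = flow_at ?S (num_periods S) then end_at ?S (num_periods S) - start_at ?S (num_periods S) else 0)"
    unfolding sent_in_def emitted_fields(1) by (rule sent_Suc) simp
  then show ?thesis by simp
qed

lemma planD:
  assumes "plan u S" "q < num_periods S"
  shows "core_at S q < m" "S p_src q 0 < N" "S p_dst q 0 < N" "S p_coflow q 0 < n"
    "u * rho (S p_coflow q 0) \<le> start_at S q" "start_at S q < end_at S q"
proof -
  have "core_at S q < m \<and> source (flow_at S q) < N \<and> destination (flow_at S q) < N \<and> coflow_of (flow_at S q) < n \<and>
       u * rho (coflow_of (flow_at S q)) \<le> start_at S q \<and> start_at S q < end_at S q"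
    using assms unfolding plan_def partial_schedule_def by blast
  then show "core_at S q < m" "S p_src q 0 < N" "S p_dst q 0 < N" "S p_coflow q 0 < n"
    "u * rho (S p_coflow q 0) \<le> start_at S q" "start_at S q < end_at S q"
    by simp_all
qed

subsection \<open>The periods that block a flow\<close>

definition blocks :: "store => nat => nat => nat => nat => bool" where
  "blocks S h i j q \<longleftrightarrow> core_at S q = h \<and> (S p_src q 0 = i \<or> S p_dst q 0 = j)"

definition endpoints :: "store => nat set" where
  "endpoints S = (\<Union>q<num_periods S. {start_at S q, end_at S q})"

definition blocked_time :: "store => nat => nat => nat => nat => nat" where
  "blocked_time S h i j t = (\<Sum>q | q < num_periods S \<and> blocks S h i j q. min (end_at S q) t - min (start_at S q) t)"

definition blocked_total :: "store => nat => nat => nat => nat" where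
  "blocked_total S h i j = (\<Sum>q | q < num_periods S \<and> blocks S h i j q. end_at S q - start_at S q)"

lemma finite_endpoints [simp]: "finite (endpoints S)"
  by (simp add: endpoints_def)

lemma blocked_time_mono:
  assumes "plan u S" "t \<le> t'"
  shows "blocked_time S h i j t \<le> blocked_time S h i j t'"
  unfolding blocked_time_def
proof (intro sum_mono)
  fix q assume "q \<in> {q. q < num_periods S \<and> blocks S h i j q}"
  then have "start_at S q < end_at S q" using planD(6)[OF assms(1)] by simp
  then show "min (end_at S q) t - min (start_at S q) t \<le> min (end_at S q) t' - min (start_at S q) t'"
    using assms(2) by (auto simp: min_def)
qed

lemma blocked_time_period:
  assumes "plan u S" and q: "q < num_periods S" "blocks S h i j q" "start_at S q \<le> t" "t \<le> end_at S q"
  shows "blocked_time S h i j t + (end_at S q - t) \<le> blocked_time S h i j (end_at S q)"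
proof -
  let ?A = "{q. q < num_periods S \<and> blocks S h i j q}"
  have finite: "finite ?A" "q \<in> ?A" using q by auto
  have "(\<Sum>q'\<in>?A - {q}. min (end_at S q') t - min (start_at S q') t) \<le>
      (\<Sum>q'\<in>?A - {q}. min (end_at S q') (end_at S q) - min (start_at S q') (end_at S q))"
  proof (intro sum_mono)
    fix q' assume "q' \<in> ?A - {q}"
    then have "start_at S q' < end_at S q'" using planD(6)[OF assms(1)] by simp
    then show "min (end_at S q') t - min (start_at S q') t \<le> min (end_at S q') (end_at S q) - min (start_at S q') (end_at S q)"
      using q(4) by (auto simp: min_def)
  qed
  moreover have "(min (end_at S q) t - min (start_at S q) t) + (end_at S q - t) = min (end_at S q) (end_at S q) - min (start_at S q) (end_at S q)"
    using q(3,4) by auto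
  ultimately show ?thesis
    unfolding blocked_time_def sum.remove[OF finite] by linarith
qed

lemma blocked_time_le_total:
  assumes "plan u S"
  shows "blocked_time S h i j t \<le> blocked_total S h i j"
  unfolding blocked_time_def blocked_total_def
proof (intro sum_mono)
  fix q assume "q \<in> {q. q < num_periods S \<and> blocks S h i j q}"
  then have "start_at S q < end_at S q" using planD(6)[OF assms] by simp
  then show "min (end_at S q) t - min (start_at S q) t \<le> end_at S q - start_at S q" by (auto simp: min_def)
qed

definition extends :: "store => store => bool" where
  "extends S0 S \<longleftrightarrow> num_periods S0 \<le> num_periods S \<and>
    (\<forall>q<num_periods S0. core_at S q = core_at S0 q \<and> flow_at S q = flow_at S0 q \<and> start_at S q = start_at S0 q \<and> end_at S q = end_at S0 q)"

lemma extendsD: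
  assumes "extends S0 S" "q < num_periods S0"
  shows "core_at S q = core_at S0 q" "S p_src q 0 = S0 p_src q 0" "S p_dst q 0 = S0 p_dst q 0" "S p_coflow q 0 = S0 p_coflow q 0"
    "start_at S q = start_at S0 q" "end_at S q = end_at S0 q" "q < num_periods S"
  using assms by (auto simp: extends_def)

lemma blocks_extends: "extends S0 S ==> q < num_periods S0 ==> blocks S h i j q = blocks S0 h i j q"
  by (simp add: blocks_def extendsD)

text \<open>
  What a search through the first \<open>x\<close> periods yields: the end \<open>v\<close> of one that blocks the flow at time \<open>t\<close>
  (0 if there is none), and the first time \<open>w\<close> before \<open>u\<close> at which one begins to block it.
\<close>

definition blocking_end :: "store => nat => nat => nat => nat => nat => nat => bool" where
  "blocking_end S h i j t x v \<longleftrightarrow> v = 0 \<and> (\<forall>q<x. blocks S h i j q \<longrightarrow> \<not> (start_at S q \<le> t \<and> t < end_at S q)) \<or>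
     (\<exists>q<num_periods S. blocks S h i j q \<and> start_at S q \<le> t \<and> t < end_at S q \<and> v = end_at S q)"

definition next_start :: "store => nat => nat => nat => nat => nat => nat => nat => bool" where
  "next_start S h i j t u x w \<longleftrightarrow> t < w \<and> w \<le> u \<and> (\<forall>q<x. blocks S h i j q \<longrightarrow> t < start_at S q \<longrightarrow> w \<le> start_at S q) \<and>
     (w = u \<or> (\<exists>q<num_periods S. blocks S h i j q \<and> w = start_at S q))"

lemma blocking_end_Suc:
  "blocking_end S h i j t x v ==> \<not> (blocks S h i j x \<and> start_at S x \<le> t \<and> t < end_at S x) ==> blocking_end S h i j t (Suc x) v"
  "x < num_periods S ==> blocks S h i j x ==> start_at S x \<le> t ==> t < end_at S x ==> blocking_end S h i j t (Suc x) (end_at S x)"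
  unfolding blocking_end_def less_Suc_eq by blast+

lemma next_start_Suc:
  "next_start S h i j t u x w ==> (blocks S h i j x ==> t < start_at S x ==> w \<le> start_at S x) ==> next_start S h i j t u (Suc x) w"
  "next_start S h i j t u x w ==> x < num_periods S ==> blocks S h i j x ==> t < start_at S x ==> start_at S x < w ==>
     next_start S h i j t u (Suc x) (start_at S x)"
  unfolding next_start_def less_Suc_eq by (blast, fastforce)

end

definition scan_step :: prog where
  "scan_step = Test (Eq (Vec p_core (V i4)) (V v_core))
    (Test (Eq (Vec p_src (V i4)) (V v_src) .+ Eq (Vec p_dst (V i4)) (V v_dst))
      (Test (Vec p_start (V i4) .- V v_time)
        (Test (V v_stop .- Vec p_start (V i4)) (v_stop :=: Vec p_start (V i4)) Skp)
        (Test (Vec p_end (V i4) .- V v_time) (v_busy :=: Vec p_end (V i4)) Skp))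
      Skp) Skp"

definition scan :: prog where
  "scan = v_busy :=: Cn 0 ;; v_stop :=: V v_time .+ V v_left ;; Loop i4 v_count scan_step"

lemma mods_scan [simp]:
  "mods scan_step = {v_busy, v_stop}"
  "mods scan = {v_busy, v_stop, i4}"
  by (auto simp: scan_step_def scan_def)

context bounded_run
begin

lemma wp_scan:
  assumes at: "S v_core 0 0 = h" "S v_src 0 0 = i" "S v_dst 0 0 = j" "S v_time 0 0 = t" "S v_left 0 0 = r" "0 < r"
    and bounds: "num_periods S \<le> Lim" "t + r \<le> M" "\<And>q. q < num_periods S ==> end_at S q \<le> M"
  shows "wp scan (\<lambda>S'. blocking_end S h i j t (num_periods S) (S' v_busy 0 0) \<and>
    next_start S h i j t (t + r) (num_periods S) (S' v_stop 0 0)) S"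
proof -
  let ?S = "upd (upd S v_busy 0 0 0) v_stop 0 0 (t + r)"
  let ?Inv = "\<lambda>x S'. blocking_end S h i j t x (S' v_busy 0 0) \<and> next_start S h i j t (t + r) x (S' v_stop 0 0)"
  have "wp (Loop i4 v_count scan_step) (?Inv (num_periods S)) ?S"
  proof (rule wp_Loop[where Inv = ?Inv])
    fix x S1
    assume "x < ?S v_count 0 0" and inv: "?Inv x S1" and index: "S1 i4 0 0 = x"
      and frame: "\<And>r. r \<noteq> i4 ==> r \<notin> mods scan_step ==> S1 r = ?S r"
    then have x: "x < num_periods S" by simp
    have "S1 v_stop 0 0 \<le> M" using inv bounds(2) by (simp add: next_start_def)
    note facts = x index at bounds(3)[OF x] this blocking_end_Suc(1)[OF conjunct1[OF inv]]
      blocking_end_Suc(2)[where S = S and h = h and i = i and j = j and t = t and x = x] next_start_Suc[OF conjunct2[OF inv]]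
    consider "\<not> blocks S h i j x" | "blocks S h i j x" "t < start_at S x" "start_at S x < S1 v_stop 0 0"
      | "blocks S h i j x" "t < start_at S x" "S1 v_stop 0 0 \<le> start_at S x"
      | "blocks S h i j x" "start_at S x \<le> t" "t < end_at S x" | "blocks S h i j x" "start_at S x \<le> t" "end_at S x \<le> t"
      by linarith
    then show "wp scan_step (\<lambda>S'. ?Inv (Suc x) (upd S' i4 0 0 (Suc x))) S1"
      by cases (use facts in \<open>auto simp: scan_step_def frame blocks_def\<close>)
  qed (use at bounds(1) in \<open>simp_all add: blocking_end_def next_start_def\<close>)
  then show ?thesis using at bounds by (simp add: scan_def)
qed

end
subsection \<open>Placing one flow\<close>

definition send_period :: prog where
  "send_period = emit (V v_core) (V v_src) (V v_dst) (V v_coflow) (V v_time) (V v_stop) ;;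
     v_left :=: V v_left .- (V v_stop .- V v_time) ;; v_time :=: V v_stop"

definition place_step :: prog where
  "place_step = Test (V v_left) (scan ;; Test (V v_busy) (v_time :=: V v_busy) send_period) Skp"

definition choose_core :: prog where
  "choose_core = v_core :=: Cn 0 ;; v_minload :=: Arr a_coreload (V v_src) (Cn 0) .+ Arr a_coreload (V v_ports .+ V v_dst) (Cn 0) ;;
    Loop i3 v_used (Test (V v_minload .- (Arr a_coreload (V v_src) (V i3) .+ Arr a_coreload (V v_ports .+ V v_dst) (V i3)))
      (v_core :=: V i3 ;; v_minload :=: Arr a_coreload (V v_src) (V i3) .+ Arr a_coreload (V v_ports .+ V v_dst) (V i3)) Skp)"

definition assign_core :: prog where
  "assign_core = choose_core ;;
    Put a_coreload (V v_src) (V v_core) (Arr a_coreload (V v_src) (V v_core) .+ V v_size) ;;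
    Put a_coreload (V v_ports .+ V v_dst) (V v_core) (Arr a_coreload (V v_ports .+ V v_dst) (V v_core) .+ V v_size)"

definition transmit_flow :: prog where
  "transmit_flow = v_time :=: Vec a_rho (V v_coflow) ;; v_left :=: V v_size ;; Loop i3 v_steps place_step"

lemma mods_place [simp]:
  "mods place_step = {v_busy, v_stop, i4, v_time, v_left} \<union> period_names"
  "mods choose_core = {v_core, v_minload, i3}"
  "mods assign_core = {v_core, v_minload, i3, a_coreload}"
  "mods transmit_flow = {v_busy, v_stop, i3, i4, v_time, v_left} \<union> period_names"
  by (auto simp: place_step_def send_period_def choose_core_def assign_core_def transmit_flow_def)

context bounded_run
begin

definition placed :: "store => nat => nat => nat => nat => nat => store => bool" where
  "placed S0 h i j k d S \<longleftrightarrow> plan 1 S \<and> extends S0 S \<and> num_periods S \<le> num_periods S0 + (2 * F + 1) \<and>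
    (\<forall>q<num_periods S. num_periods S0 \<le> q \<longrightarrow> flow_at S q = (i, j, k) \<and> core_at S q = h \<and>
       end_at S q \<le> rho k + blocked_total S0 h i j + d) \<and>
    card (endpoints S) \<le> card (endpoints S0) + 2 \<and> sent_in S (i, j, k) = d \<and> (\<forall>f. f \<noteq> (i, j, k) \<longrightarrow> sent_in S f = sent_in S0 f)"

lemma placed_cong:
  assumes "placed S0' h i j k d S" "\<And>r. r \<in> period_names ==> S0' r = S0 r"
  shows "placed S0 h i j k d S"
  using assms(1) sent_in_cong[OF assms(2)] assms(2)
  by (simp add: placed_def extends_def blocked_total_def blocks_def endpoints_def)

context
  fixes S0 :: store and h i j k d :: nat
  assumes plan0: "plan 1 S0" and fresh: "\<And>q. q < num_periods S0 ==> flow_at S0 q \<noteq> (i, j, k)"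
    and ranges: "h < m" "h \<le> M" "i < N" "j < N" "k < n"
    and room: "rho k + blocked_total S0 h i j + d \<le> M" "\<And>q. q < num_periods S0 ==> end_at S0 q \<le> M"
    and count: "num_periods S0 + (2 * F + 1) \<le> Lim" "card (endpoints S0) \<le> 2 * F"
begin

definition new_period :: "store => nat => bool" where
  "new_period S q \<longleftrightarrow> flow_at S q = (i, j, k) \<and> core_at S q = h \<and> end_at S q \<le> S v_time 0 0 \<and>
     (\<forall>e\<in>{start_at S q, end_at S q}. e \<in> endpoints S0 \<union> {rho k} \<or> S v_left 0 0 = 0 \<and> e = S v_time 0 0)"

text \<open>
  Until the whole flow is sent, each step moves the time to a further endpoint of \<open>S0\<close>, which bounds the number of steps.
\<close>

definition placing :: "nat => store => bool" where
  "placing x S \<longleftrightarrow> plan 1 S \<and> extends S0 S \<and> num_periods S \<le> num_periods S0 + x \<and>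
    (\<forall>q<num_periods S. num_periods S0 \<le> q \<longrightarrow> new_period S q) \<and> rho k \<le> S v_time 0 0 \<and>
    sent_in S (i, j, k) + S v_left 0 0 = d \<and> (\<forall>f. f \<noteq> (i, j, k) \<longrightarrow> sent_in S f = sent_in S0 f) \<and>
    S v_time 0 0 + S v_left 0 0 \<le> rho k + blocked_time S0 h i j (S v_time 0 0) + d \<and>
    (S v_left 0 0 = 0 \<or> S v_time 0 0 \<in> endpoints S0 \<union> {rho k} \<and> x \<le> card {e \<in> endpoints S0. e \<le> S v_time 0 0})"

lemma placing_cong:
  assumes "placing x S" "\<And>r. r \<in> insert v_time (insert v_left period_names) ==> S' r = S r"
  shows "placing x S'"
proof -
  have "plan 1 S' = plan 1 S" "sent_in S' f = sent_in S f" for f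
    using assms(2) by (auto intro!: plan_cong sent_in_cong)
  moreover have "new_period S' = new_period S" "extends S0 S' = extends S0 S"
    by (simp_all add: new_period_def[abs_def] extends_def assms(2))
  ultimately show ?thesis using assms by (simp add: placing_def)
qed

lemma placing_le_M:
  assumes "placing x S"
  shows "S v_time 0 0 + S v_left 0 0 \<le> M" "q < num_periods S ==> end_at S q \<le> M"
proof -
  show time: "S v_time 0 0 + S v_left 0 0 \<le> M"
    using assms blocked_time_le_total[OF plan0, of h i j "S v_time 0 0"] room(1) by (simp add: placing_def)
  show "end_at S q \<le> M" if "q < num_periods S"
  proof (cases "q < num_periods S0")
    case True
    then show ?thesis using assms room(2) extendsD(6)[of S0 S q] by (simp add: placing_def)
  next
    case False
    then have "end_at S q \<le> S v_time 0 0" using assms that by (simp add: placing_def new_period_def)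
    then show ?thesis using time by simp
  qed
qed

lemma endpoint_passed:
  assumes "x \<le> card {e \<in> endpoints S0. e \<le> t}" "t' \<in> endpoints S0" "t < t'"
  shows "Suc x \<le> card {e \<in> endpoints S0. e \<le> t'}"
proof -
  have "t' \<in> {e \<in> endpoints S0. e \<le> t'} - {e \<in> endpoints S0. e \<le> t}" using assms by auto
  then have "{e \<in> endpoints S0. e \<le> t} \<subset> {e \<in> endpoints S0. e \<le> t'}" using assms(3) by fastforce
  then have "card {e \<in> endpoints S0. e \<le> t} < card {e \<in> endpoints S0. e \<le> t'}"
    by (intro psubset_card_mono) auto
  then show ?thesis using assms(1) by linarith
qed

lemma placing_wait:
  assumes placing: "placing x S" and left: "S v_left 0 0 \<noteq> 0"
    and q: "q < num_periods S" "blocks S h i j q" "start_at S q \<le> S v_time 0 0" "S v_time 0 0 < end_at S q"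
  shows "placing (Suc x) (upd S v_time 0 0 (end_at S q))"
proof -
  let ?t = "S v_time 0 0" and ?S = "upd S v_time 0 0 (end_at S q)"
  have ext: "extends S0 S" using placing by (simp add: placing_def)
  have "\<not> new_period S q" using q(4) by (simp add: new_period_def)
  then have q_old: "q < num_periods S0" using placing q(1) by (auto simp: placing_def not_less)
  have at: "end_at S q \<in> endpoints S0" using q_old extendsD[OF ext q_old] by (auto simp: endpoints_def)
  have "blocked_time S0 h i j ?t + (end_at S0 q - ?t) \<le> blocked_time S0 h i j (end_at S0 q)"
    using q q_old extendsD[OF ext q_old] blocks_extends[OF ext q_old] by (intro blocked_time_period[OF plan0]) auto
  moreover have "?t + S v_left 0 0 \<le> rho k + blocked_time S0 h i j ?t + d" using placing by (simp add: placing_def)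
  ultimately have "end_at S q + S v_left 0 0 \<le> rho k + blocked_time S0 h i j (end_at S q) + d"
    using q(4) unfolding extendsD(6)[OF ext q_old] by linarith
  moreover have "new_period ?S q'" if "q' < num_periods S" "num_periods S0 \<le> q'" for q'
  proof -
    have "new_period S q'" using placing that by (simp add: placing_def)
    then show ?thesis using left q(4) by (simp add: new_period_def)
  qed
  moreover have "Suc x \<le> card {e \<in> endpoints S0. e \<le> end_at S q}"
    using placing left at q(4) by (intro endpoint_passed[of x ?t]) (auto simp: placing_def)
  moreover have "plan 1 ?S = plan 1 S" "sent_in ?S f = sent_in S f" for f
    by (auto intro!: plan_cong sent_in_cong)
  ultimately show ?thesis
    using placing at q(4) by (simp add: placing_def extends_def)
qed

lemma next_start_endpoint:
  assumes placing: "placing x S" and next_t: "next_start S h i j (S v_time 0 0) u y t'"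
  shows "t' = u \<or> t' \<in> endpoints S0"
proof (cases "t' = u")
  case False
  then obtain q where q: "q < num_periods S" "t' = start_at S q" using next_t by (auto simp: next_start_def)
  have ext: "extends S0 S" and "plan 1 S" using placing by (simp_all add: placing_def)
  have "\<not> new_period S q"
    using next_t q(2) planD(6)[OF \<open>plan 1 S\<close> q(1)] by (simp add: new_period_def next_start_def)
  then have "q < num_periods S0" using placing q(1) by (auto simp: placing_def not_less)
  then show ?thesis using q(2) extendsD(5)[OF ext] by (auto simp: endpoints_def)
qed simp

lemma placing_send_plan:
  assumes placing: "placing x S" and free: "blocking_end S h i j (S v_time 0 0) (num_periods S) 0"
    and next_t: "next_start S h i j (S v_time 0 0) u (num_periods S) t'"
  shows "plan 1 (emitted S h i j k (S v_time 0 0) t')"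
proof (rule plan_emitted)
  have free': "\<not> (start_at S q \<le> S v_time 0 0 \<and> S v_time 0 0 < end_at S q)" if "q < num_periods S" "blocks S h i j q" for q
    using free that by (auto simp: blocking_end_def)
  fix q assume "q < num_periods S" "core_at S q = h" "S p_src q 0 = i \<or> S p_dst q 0 = j"
  then show "end_at S q \<le> S v_time 0 0 \<or> t' \<le> start_at S q"
    using next_t free'[of q] by (auto simp: blocks_def next_start_def not_le)
next
  fix q assume q: "q < num_periods S" "flow_at S q = (i, j, k)"
  then have "\<not> q < num_periods S0" using placing fresh[of q] by (auto simp: placing_def extendsD)
  then show "core_at S q = h" using placing q(1) by (simp add: placing_def new_period_def)
qed (use placing next_t ranges in \<open>auto simp: placing_def next_start_def\<close>)

lemma placing_send:
  assumes placing: "placing x S" and left: "S v_left 0 0 \<noteq> 0"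
    and free: "blocking_end S h i j (S v_time 0 0) (num_periods S) 0"
    and next_t: "next_start S h i j (S v_time 0 0) (S v_time 0 0 + S v_left 0 0) (num_periods S) t'"
  shows "placing (Suc x) (upd (upd (emitted S h i j k (S v_time 0 0) t') v_left 0 0 (S v_left 0 0 - (t' - S v_time 0 0))) v_time 0 0 t')"
proof -
  let ?t = "S v_time 0 0" and ?S = "emitted S h i j k (S v_time 0 0) t'"
  define S' where "S' = upd (upd ?S v_left 0 0 (S v_left 0 0 - (t' - ?t))) v_time 0 0 t'"
  have fields: "S' v_time 0 0 = t'" "S' v_left 0 0 = S v_left 0 0 - (t' - ?t)" "num_periods S' = Suc (num_periods S)"
    by (simp_all add: S'_def)
  have t': "?t < t'" "t' \<le> ?t + S v_left 0 0" using next_t by (simp_all add: next_start_def)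
  have frame: "plan u S' = plan u ?S" "sent_in S' f = sent_in ?S f" for f u
    unfolding S'_def by (auto intro!: plan_cong sent_in_cong)
  then have sent: "sent_in S' f = sent_in S f + (if f = (i, j, k) then t' - ?t else 0)" for f
    by (simp only: sent_in_emitted)
  have last: "t' = ?t + S v_left 0 0 \<or> t' \<in> endpoints S0" by (rule next_start_endpoint[OF placing next_t])
  have "new_period S' q" if q: "q < Suc (num_periods S)" "num_periods S0 \<le> q" for q
  proof (cases "q = num_periods S")
    case True
    then show ?thesis using placing left t' last by (auto simp: S'_def new_period_def placing_def)
  next
    case False
    then have "new_period S q" using placing q by (simp add: placing_def)
    then show ?thesis using False left t'(1) by (auto simp: S'_def new_period_def)
  qed
  moreover have "plan 1 S'" using placing_send_plan[OF placing free next_t] by (simp add: frame)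
  moreover have "extends S0 S'" using placing by (auto simp: S'_def placing_def extends_def)
  moreover have "blocked_time S0 h i j ?t \<le> blocked_time S0 h i j t'" using t'(1) by (intro blocked_time_mono[OF plan0]) simp
  moreover have "Suc x \<le> card {e \<in> endpoints S0. e \<le> t'}" if "t' \<in> endpoints S0"
    using placing left that t'(1) by (intro endpoint_passed[of x ?t]) (auto simp: placing_def)
  ultimately have "placing (Suc x) S'"
    using placing t' last by (auto simp: placing_def sent fields)
  then show ?thesis by (simp only: S'_def)
qed

lemma wp_send_period:
  assumes placing: "placing x S" and left: "S v_left 0 0 \<noteq> 0" and x: "x \<le> 2 * F"
    and at: "S v_core 0 0 = h" "S v_src 0 0 = i" "S v_dst 0 0 = j" "S v_coflow 0 0 = k"
    and free: "blocking_end S h i j (S v_time 0 0) (num_periods S) 0"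
    and next_t: "next_start S h i j (S v_time 0 0) (S v_time 0 0 + S v_left 0 0) (num_periods S) (S v_stop 0 0)"
  shows "wp send_period (placing (Suc x)) S"
proof -
  let ?t = "S v_time 0 0" and ?t' = "S v_stop 0 0"
  have t': "?t' \<le> ?t + S v_left 0 0" using next_t by (simp add: next_start_def)
  have "wp (v_left :=: V v_left .- (V v_stop .- V v_time) ;; v_time :=: V v_stop) (placing (Suc x)) (emitted S h i j k ?t ?t')"
    using placing_send[OF placing left free next_t] placing_le_M(1)[OF placing] t' by simp
  moreover have "num_periods S < Lim" using placing count(1) x by (simp add: placing_def)
  ultimately have "wp (emit (V v_core) (V v_src) (V v_dst) (V v_coflow) (V v_time) (V v_stop))
      (wp (v_left :=: V v_left .- (V v_stop .- V v_time) ;; v_time :=: V v_stop) (placing (Suc x))) S"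
    using at ranges N_le_M n_le_M placing_le_M(1)[OF placing] t' by (intro wp_emit) simp_all
  then show ?thesis by (simp add: send_period_def)
qed

lemma wp_place_step:
  assumes placing: "placing x S" and x: "x \<le> 2 * F"
    and at: "S v_core 0 0 = h" "S v_src 0 0 = i" "S v_dst 0 0 = j" "S v_coflow 0 0 = k"
  shows "wp place_step (placing (Suc x)) S"
proof (cases "S v_left 0 0 = 0")
  case True
  then have "placing (Suc x) S" using placing unfolding placing_def by auto
  then show ?thesis using True by (simp add: place_step_def)
next
  case False
  let ?t = "S v_time 0 0" and ?r = "S v_left 0 0"
  have count_less: "num_periods S < Lim" using placing count(1) x by (simp add: placing_def)
  have "wp (scan ;; Test (V v_busy) (v_time :=: V v_busy) send_period) (placing (Suc x)) S"
  proof (rule wp_seq[OF wp_scan[where S = S and h = h and i = i and j = j and t = ?t and r = ?r]])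
    fix S1
    assume scanned: "blocking_end S h i j ?t (num_periods S) (S1 v_busy 0 0) \<and> next_start S h i j ?t (?t + ?r) (num_periods S) (S1 v_stop 0 0)"
      and frame: "\<And>r. r \<notin> mods scan ==> S1 r = S r"
    have placing1: "placing x S1" by (rule placing_cong[OF placing]) (auto simp: frame)
    have frame_eq: "blocking_end S1 = blocking_end S" "next_start S1 = next_start S" "blocks S1 = blocks S"
      by (simp_all add: blocking_end_def[abs_def] next_start_def[abs_def] blocks_def[abs_def] frame)
    show "wp (Test (V v_busy) (v_time :=: V v_busy) send_period) (placing (Suc x)) S1"
    proof (cases "S1 v_busy 0 0 = 0")
      case busy: False
      then obtain q where "q < num_periods S" "blocks S h i j q" "start_at S q \<le> ?t" "?t < end_at S q" "S1 v_busy 0 0 = end_at S q"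
        using scanned by (auto simp: blocking_end_def)
      then show ?thesis
        using busy False placing_wait[OF placing1, of q] placing_le_M(2)[OF placing, of q] by (simp add: frame frame_eq)
    next
      case free: True
      then have "wp send_period (placing (Suc x)) S1"
        using scanned False x at by (intro wp_send_period[OF placing1]) (simp_all add: frame frame_eq)
      then show ?thesis using free by simp
    qed
  qed (use at False count_less placing_le_M[OF placing] in auto)
  then show ?thesis using False by (simp add: place_step_def)
qed

lemma placed_if_placing:
  assumes placing: "placing (2 * F + 1) S"
  shows "placed S0 h i j k d S"
proof -
  have "card {e \<in> endpoints S0. e \<le> S v_time 0 0} \<le> card (endpoints S0)" by (intro card_mono) auto
  then have left: "S v_left 0 0 = 0" using placing count(2) unfolding placing_def by linarith
  have time: "S v_time 0 0 \<le> rho k + blocked_total S0 h i j + d"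
    using placing blocked_time_le_total[OF plan0, of h i j "S v_time 0 0"] by (simp add: placing_def)
  have ext: "extends S0 S" and new: "\<And>q. q < num_periods S ==> num_periods S0 \<le> q ==> new_period S q"
    using placing by (simp_all add: placing_def)
  have "{start_at S q, end_at S q} \<subseteq> endpoints S0 \<union> {rho k, S v_time 0 0}" if q: "q < num_periods S" for q
  proof (cases "q < num_periods S0")
    case True
    then show ?thesis using extendsD[OF ext True] by (auto simp: endpoints_def)
  next
    case False
    then show ?thesis using new[OF q] left by (auto simp: new_period_def not_less)
  qed
  then have "endpoints S \<subseteq> endpoints S0 \<union> {rho k, S v_time 0 0}" unfolding endpoints_def[of S] by (intro UN_least) simp
  then have "card (endpoints S) \<le> card (endpoints S0 \<union> {rho k, S v_time 0 0})" by (intro card_mono) auto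
  also have "... \<le> card (endpoints S0) + card {rho k, S v_time 0 0}" by (rule card_Un_le)
  also have "card {rho k, S v_time 0 0} \<le> 2" by (simp add: card_insert_if)
  finally have "card (endpoints S) \<le> card (endpoints S0) + 2" by simp
  then show ?thesis using placing left time new by (auto simp: placed_def placing_def new_period_def)
qed

lemma wp_transmit_flow:
  assumes at: "S0 v_core 0 0 = h" "S0 v_src 0 0 = i" "S0 v_dst 0 0 = j" "S0 v_coflow 0 0 = k" "S0 v_steps 0 0 = 2 * F + 1"
    and size: "S0 v_size 0 0 = d" "S0 a_rho k 0 = rho k"
  shows "wp transmit_flow (placed S0 h i j k d) S0"
proof -
  let ?S = "upd (upd S0 v_time 0 0 (rho k)) v_left 0 0 d"
  have "wp (Loop i3 v_steps place_step) (placed S0 h i j k d) ?S"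
  proof (rule wp_Loop[where Inv = placing])
    have "plan 1 (upd ?S i3 0 0 0) = plan 1 S0" "sent_in (upd ?S i3 0 0 0) f = sent_in S0 f" for f
      by (auto intro!: plan_cong sent_in_cong)
    then show "placing 0 (upd ?S i3 0 0 0)"
      using plan0 sent_in_absent[where S = S0 and f = "(i, j, k)", OF fresh] by (simp add: placing_def extends_def)
  next
    fix x S1
    assume "x < ?S v_steps 0 0" and placing: "placing x S1" and "S1 i3 0 0 = x"
      and frame: "\<And>r. r \<noteq> i3 ==> r \<notin> mods place_step ==> S1 r = ?S r"
    then have "wp place_step (placing (Suc x)) S1"
      using at by (intro wp_place_step) (simp_all add: frame)
    then show "wp place_step (\<lambda>S'. placing (Suc x) (upd S' i3 0 0 (Suc x))) S1"
      by (rule wp_mono) (erule placing_cong, auto)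
  qed (use at count(1) placed_if_placing in simp_all)
  then show ?thesis using at size room(1) by (simp add: transmit_flow_def)
qed

end

end
subsection \<open>Placing all flows\<close>

definition place_flow :: prog where
  "place_flow = v_size :=: Arr a_demand (V v_coflow) (V i2) ;;
    Test (V v_size) (v_src :=: V i2 \<oslash> V v_ports ;; v_dst :=: Mod (V i2) (V v_ports) ;; assign_core ;; transmit_flow) Skp"

definition place_round :: prog where
  "place_round = v_coflow :=: Vec a_order (V i1) ;; Loop i2 v_pairs place_flow"

definition place_all :: prog where
  "place_all = Loop i1 v_coflows place_round"

definition list_scheduling :: prog where
  "list_scheduling = compute_order ;;
    Test (V v_flows .- V v_cores) (v_used :=: V v_cores) (v_used :=: V v_flows) ;; v_steps :=: Cn 2 .* V v_flows .+ Cn 1 ;;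
    place_all ;; v_den :=: V v_D"

abbreviation "place_names == {v_size, v_src, v_dst, v_core, v_minload, a_coreload, v_busy, v_stop, v_time, v_left, i3, i4} \<union> period_names"

lemma mods_list_scheduling [simp]:
  "mods place_flow = place_names"
  "mods place_round = {i2, v_coflow} \<union> place_names"
  "mods place_all = {i1, i2, v_coflow} \<union> place_names"
  by (auto simp: place_flow_def place_round_def place_all_def)

context nonempty_instance
begin

definition uses :: "nat => flow => bool" where
  "uses p f \<longleftrightarrow> p = source f \<or> p = N + destination f"

definition load_of :: "flow set => nat => nat" where
  "load_of Z p = (\<Sum>f | f \<in> Z \<and> uses p f. dd_flow f)"

definition busy :: "store => nat => nat => nat" where
  "busy S p h = (\<Sum>q | q < num_periods S \<and> core_at S q = h \<and> uses p (flow_at S q). end_at S q - start_at S q)"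

lemma load_of_insert:
  assumes "finite Z" "f \<notin> Z"
  shows "load_of (insert f Z) p = load_of Z p + (if uses p f then dd_flow f else 0)"
proof -
  have "{g. g \<in> insert f Z \<and> uses p g} = {g. g \<in> Z \<and> uses p g} \<union> (if uses p f then {f} else {})" by auto
  then show ?thesis
    unfolding load_of_def using assms by (simp add: sum.union_disjoint)
qed

lemma load_of_coflows:
  assumes p: "p < 2 * N" and "finite A" and Z: "Z \<subseteq> {..<N} \<times> {..<N} \<times> A"
  shows "load_of Z p \<le> loads.max_load A"
proof -
  have "load_of Z p \<le> (\<Sum>f\<in>port_flows A p. dd_flow f)"
    unfolding load_of_def by (rule sum_mono2) (use assms in \<open>auto simp: port_flows_def uses_def\<close>)
  also have "... \<le> loads.max_load A"
    using loads.total_load_le_max[OF p, of A] by (simp add: sum_port_flows loads.total_load_def)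
  finally show ?thesis .
qed

lemma blocked_total_le_busy: "blocked_total S h i j \<le> busy S i h + busy S (N + j) h"
proof -
  let ?A = "{q. q < num_periods S \<and> core_at S q = h \<and> uses i (flow_at S q)}"
  let ?B = "{q. q < num_periods S \<and> core_at S q = h \<and> uses (N + j) (flow_at S q)}"
  have "blocked_total S h i j \<le> (\<Sum>q\<in>?A \<union> ?B. end_at S q - start_at S q)"
    unfolding blocked_total_def by (rule sum_mono2) (auto simp: blocks_def uses_def)
  also have "... \<le> busy S i h + busy S (N + j) h"
    unfolding busy_def by (subst sum_Un_nat) auto
  finally show ?thesis .
qed

lemma card_flows: "card (flows I) = N * N * n"
  by (simp add: flows_def card_cartesian_product)

end

context bounded_run
begin

text \<open>No more cores than flows are used, because the number of cores is not bounded by the length of the input.\<close>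

definition "used_cores = min m F"

definition "occupied S = {h. h < used_cores \<and> (\<exists>p<2*N. S a_coreload p h \<noteq> 0)}"

text \<open>\<open>ml k\<close> stands for the largest load of the coflows up to \<open>k\<close> on a port.\<close>

definition list_inv :: "(nat => nat) => flow set => store => bool" where
  "list_inv ml Z S \<longleftrightarrow> Z \<subseteq> flows I \<and> plan 1 S \<and> (\<forall>f\<in>Z. sent_in S f = dd_flow f) \<and>
    (\<forall>q<num_periods S. flow_at S q \<in> Z \<and> core_at S q < used_cores \<and>
      m * end_at S q \<le> m * (rho (S p_coflow q 0) + dd_flow (flow_at S q)) + 2 * ml (S p_coflow q 0)) \<and>
    (\<forall>p<2*N. \<forall>h<used_cores. busy S p h = S a_coreload p h) \<and>
    (\<forall>p<2*N. (\<Sum>h<used_cores. S a_coreload p h) = load_of Z p) \<and> card (occupied S) \<le> card Z \<and>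
    card (endpoints S) \<le> 2 * card Z \<and> num_periods S \<le> card Z * (2 * F + 1)"

lemma list_inv_cong:
  assumes "list_inv ml Z S" "\<And>r. r \<in> insert a_coreload period_names ==> S' r = S r"
  shows "list_inv ml Z S'"
proof -
  have "plan 1 S' = plan 1 S" "sent_in S' f = sent_in S f" for f
    using assms(2) by (auto intro!: plan_cong sent_in_cong)
  moreover have "busy S' = busy S" "occupied S' = occupied S" "endpoints S' = endpoints S"
    by (simp_all add: busy_def[abs_def] occupied_def endpoints_def assms(2))
  ultimately show ?thesis using assms by (simp add: list_inv_def)
qed

lemma list_invD:
  assumes "list_inv ml Z S"
  shows "Z \<subseteq> flows I" "finite Z" "plan 1 S" "f \<in> Z ==> sent_in S f = dd_flow f"
    "q < num_periods S ==> flow_at S q \<in> Z" "q < num_periods S ==> core_at S q < used_cores"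
    "q < num_periods S ==> m * end_at S q \<le> m * (rho (S p_coflow q 0) + dd_flow (flow_at S q)) + 2 * ml (S p_coflow q 0)"
    "p < 2 * N ==> h < used_cores ==> busy S p h = S a_coreload p h"
    "p < 2 * N ==> (\<Sum>h<used_cores. S a_coreload p h) = load_of Z p"
    "card (occupied S) \<le> card Z" "card (endpoints S) \<le> 2 * card Z" "num_periods S \<le> card Z * (2 * F + 1)"
  using assms finite_subset[OF _ finite_flows] unfolding list_inv_def by blast+

lemma list_inv_zero:
  assumes inv: "list_inv ml Z S" and f: "f \<in> flows I" "f \<notin> Z" "dd_flow f = 0"
  shows "list_inv ml (insert f Z) S"
proof -
  have "sent_in S f = 0" using f(2) list_invD(5)[OF inv] by (intro sent_in_absent) auto
  then show ?thesis
    using inv f list_invD(2)[OF inv] unfolding list_inv_def by (auto simp: load_of_insert)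
qed

lemma unplaced_flow: "list_inv ml Z S ==> f \<in> flows I ==> f \<notin> Z ==> card Z < F"
  using psubset_card_mono[OF finite_flows, of Z I] card_flows by (auto simp: list_inv_def)

lemma least_loaded_core:
  assumes inv: "list_inv ml Z S" and f: "f \<in> flows I" "f \<notin> Z" and p: "p < 2 * N" "p' < 2 * N"
    and least: "\<And>h'. h' < used_cores ==> S a_coreload p h + S a_coreload p' h \<le> S a_coreload p h' + S a_coreload p' h'"
  shows "m * (S a_coreload p h + S a_coreload p' h) \<le> load_of Z p + load_of Z p'"
proof (cases "m \<le> F")
  case True
  then have used: "used_cores = m" by (simp add: used_cores_def)
  have "m * (S a_coreload p h + S a_coreload p' h) = (\<Sum>h'<used_cores. S a_coreload p h + S a_coreload p' h)" using used by simp
  also have "... \<le> (\<Sum>h'<used_cores. S a_coreload p h' + S a_coreload p' h')" using least by (intro sum_mono) auto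
  also have "... = load_of Z p + load_of Z p'"
    using list_invD(9)[OF inv] p by (simp add: sum.distrib)
  finally show ?thesis .
next
  case False
  then have "card (occupied S) < card {..<used_cores}"
    using list_invD(10)[OF inv] unplaced_flow[OF inv f] by (simp add: used_cores_def)
  moreover have "occupied S \<subseteq> {..<used_cores}" by (auto simp: occupied_def)
  ultimately obtain h' where "h' < used_cores" "h' \<notin> occupied S" by (metis lessThan_iff nat_less_le subsetI subset_antisym)
  then have "S a_coreload p h + S a_coreload p' h \<le> 0" using least[of h'] p by (simp add: occupied_def)
  then show ?thesis by simp
qed

context
  fixes ml :: "nat => nat" and Z :: "flow set" and f :: flow and i j k h :: nat and S0 S :: store
  assumes inv: "list_inv ml Z S0" and f: "f = (i, j, k)" "i < N" "j < N" "k < n" "f \<notin> Z" and h: "h < used_cores"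
    and ml: "\<And>p. p < 2 * N ==> load_of Z p \<le> ml k"
    and least: "\<And>h'. h' < used_cores ==> S0 a_coreload i h + S0 a_coreload (N + j) h \<le> S0 a_coreload i h' + S0 a_coreload (N + j) h'"
    and placed: "placed S0 h i j k (dd_flow f) S"
    and loads: "\<And>p h'. p < 2 * N ==> h' < used_cores ==>
      S a_coreload p h' = S0 a_coreload p h' + (if h' = h \<and> uses p f then dd_flow f else 0)"
begin

lemma f_in_flows: "f \<in> flows I"
  using f by (simp add: flows_def)

lemma placed_old: "extends S0 S"
  using placed by (simp add: placed_def)

lemma placed_new:
  assumes "q < num_periods S" "\<not> q < num_periods S0"
  shows "flow_at S q = f" "core_at S q = h" "end_at S q \<le> rho k + blocked_total S0 h i j + dd_flow f"
  using placed assms f(1) by (simp_all add: placed_def not_less)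

lemma busy_placed: "busy S p h' = busy S0 p h' + (if h' = h \<and> uses p f then dd_flow f else 0)"
proof -
  let ?new = "{q. q < num_periods S \<and> flow_at S q = f \<and> h' = h \<and> uses p f}"
  let ?old = "{q. q < num_periods S0 \<and> core_at S0 q = h' \<and> uses p (flow_at S0 q)}"
  have fresh: "flow_at S q \<noteq> f" if "q < num_periods S0" for q
    using list_invD(5)[OF inv that] f(5) extendsD[OF placed_old that] by metis
  have "q \<in> {q. q < num_periods S \<and> core_at S q = h' \<and> uses p (flow_at S q)} \<longleftrightarrow> q \<in> ?old \<union> ?new" for q
  proof (cases "q < num_periods S0")
    case True
    then show ?thesis using extendsD[OF placed_old True] fresh[OF True] by simp
  next
    case False
    then show ?thesis using placed_new[of q] by auto
  qed
  then have "{q. q < num_periods S \<and> core_at S q = h' \<and> uses p (flow_at S q)} = ?old \<union> ?new" by blast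
  moreover have "?old \<inter> ?new = {}" using fresh by blast
  ultimately have "busy S p h' = (\<Sum>q\<in>?old. end_at S q - start_at S q) + (\<Sum>q\<in>?new. end_at S q - start_at S q)"
    unfolding busy_def by (simp only:) (rule sum.union_disjoint, auto)
  also have "(\<Sum>q\<in>?old. end_at S q - start_at S q) = busy S0 p h'"
    unfolding busy_def using extendsD[OF placed_old] by (intro sum.cong) auto
  also have "(\<Sum>q\<in>?new. end_at S q - start_at S q) = (if h' = h \<and> uses p f then dd_flow f else 0)"
    using placed f(1) by (cases "h' = h \<and> uses p f") (auto simp: placed_def sent_in_def sent_def)
  finally show ?thesis .
qed

lemma placed_end_le:
  assumes q: "q < num_periods S" "\<not> q < num_periods S0"
  shows "m * end_at S q \<le> m * (rho k + dd_flow f) + 2 * ml k"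
proof -
  let ?load = "S0 a_coreload i h + S0 a_coreload (N + j) h"
  have "end_at S q \<le> rho k + dd_flow f + ?load"
    using placed_new(3)[OF q] blocked_total_le_busy[of S0 h i j] list_invD(8)[OF inv _ h] f by simp
  then have "m * end_at S q \<le> m * (rho k + dd_flow f) + m * ?load"
    by (metis distrib_left mult_le_mono2)
  moreover have "m * ?load \<le> load_of Z i + load_of Z (N + j)"
    using f by (intro least_loaded_core[OF inv f_in_flows f(5)] least) auto
  moreover have "load_of Z i + load_of Z (N + j) \<le> 2 * ml k"
    using ml[of i] ml[of "N + j"] f by simp
  ultimately show ?thesis by simp
qed

lemma load_placed:
  assumes "p < 2 * N"
  shows "(\<Sum>h'<used_cores. S a_coreload p h') = load_of (insert f Z) p"
proof -
  have "(\<Sum>h'<used_cores. S a_coreload p h') = load_of Z p + (\<Sum>h'<used_cores. if h' = h then (if uses p f then dd_flow f else 0) else 0)"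
    unfolding list_invD(9)[OF inv assms, symmetric] sum.distrib[symmetric] using loads[OF assms] by (intro sum.cong) auto
  then show ?thesis using h load_of_insert[OF list_invD(2)[OF inv] f(5)] by simp
qed

lemma list_inv_placed: "list_inv ml (insert f Z) S"
proof -
  have card: "card (insert f Z) = Suc (card Z)" using list_invD(2)[OF inv] f(5) by simp
  have sent: "sent_in S f = dd_flow f" "\<And>g. g \<noteq> f ==> sent_in S g = sent_in S0 g"
    using placed f(1) by (auto simp: placed_def)
  have "flow_at S q \<in> insert f Z \<and> core_at S q < used_cores \<and>
      m * end_at S q \<le> m * (rho (S p_coflow q 0) + dd_flow (flow_at S q)) + 2 * ml (S p_coflow q 0)" if q: "q < num_periods S" for q
  proof (cases "q < num_periods S0")
    case True
    then show ?thesis using list_invD(5-7)[OF inv True] extendsD[OF placed_old True] by simp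
  next
    case False
    then show ?thesis using placed_new[OF q False] placed_end_le[OF q False] f(1) h by simp
  qed
  moreover have "busy S p h' = S a_coreload p h'" if "p < 2 * N" "h' < used_cores" for p h'
    using that loads busy_placed list_invD(8)[OF inv] by simp
  moreover have "card (occupied S) \<le> Suc (card Z)"
  proof -
    have "occupied S \<subseteq> insert h (occupied S0)" using loads by (auto simp: occupied_def split: if_splits)
    then have "card (occupied S) \<le> card (insert h (occupied S0))" by (intro card_mono) (auto simp: occupied_def)
    also have "... \<le> Suc (card (occupied S0))" by (simp add: card_insert_if occupied_def)
    finally show ?thesis using list_invD(10)[OF inv] by simp
  qed
  moreover have "\<forall>g\<in>insert f Z. sent_in S g = dd_flow g"
    using sent list_invD(4)[OF inv] f(5) by (metis insert_iff)
  moreover have "insert f Z \<subseteq> flows I" using f_in_flows list_invD(1)[OF inv] by simp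
  moreover have "card (endpoints S) \<le> 2 * Suc (card Z)" "num_periods S \<le> Suc (card Z) * (2 * F + 1)" "plan 1 S"
    using placed list_invD(11,12)[OF inv] by (simp_all add: placed_def)
  ultimately show ?thesis unfolding list_inv_def card using load_placed by blast
qed

end

subsection \<open>The bounds on the numbers that occur\<close>

lemma list_inv_coreload_le:
  assumes inv: "list_inv ml Z S" and "p < 2 * N" "h < used_cores" "load_of Z p \<le> sum_L"
  shows "S a_coreload p h \<le> sum_L"
proof -
  have "S a_coreload p h \<le> (\<Sum>h<used_cores. S a_coreload p h)" using assms(3) by (intro member_le_sum) auto
  then show ?thesis using list_invD(9)[OF inv assms(2)] assms(4) by simp
qed

lemma list_inv_end_le:
  assumes inv: "list_inv ml Z S" and ml: "\<And>k. k < n ==> ml k \<le> sum_L" and q: "q < num_periods S"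
  shows "end_at S q \<le> M"
proof -
  let ?k = "S p_coflow q 0"
  have k: "?k < n" "S p_src q 0 < N" "S p_dst q 0 < N" using planD[OF list_invD(3)[OF inv] q] by auto
  have "m * end_at S q \<le> m * (rho ?k + dd_flow (flow_at S q)) + 2 * ml ?k"
    by (rule list_invD(7)[OF inv q])
  also have "2 * ml ?k \<le> m * (2 * sum_L)"
    using mult_le_mono[of 1 m "2 * ml ?k" "2 * sum_L"] ml[OF k(1)] m_pos by simp
  finally have "m * end_at S q \<le> m * (rho ?k + dd_flow (flow_at S q) + 2 * sum_L)" by (simp add: distrib_left)
  then have "end_at S q \<le> rho ?k + dd_flow (flow_at S q) + 2 * sum_L" using m_pos by simp
  also have "dd_flow (flow_at S q) \<le> sum_L" using dd_le_sum_L[OF k(2,3,1)] by (simp add: dd_flow_def)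
  finally show ?thesis using rho_sum_L_le_M[OF k(1)] by simp
qed

lemma list_inv_count:
  assumes inv: "list_inv ml Z S" and f: "f \<in> flows I" "f \<notin> Z"
  shows "num_periods S + (2 * F + 1) \<le> Lim"
proof -
  have "num_periods S + (2 * F + 1) \<le> Suc (card Z) * (2 * F + 1)" using list_invD(12)[OF inv] by simp
  also have "... \<le> F * (2 * F + 1)" using unplaced_flow[OF inv f] by (intro mult_le_mono1) simp
  finally show ?thesis using lim_periods by (rule order_trans)
qed

lemma wp_choose_core:
  assumes at: "S v_src 0 0 = i" "S v_dst 0 0 = j" "S v_ports 0 0 = N" "S v_used 0 0 = c" "0 < c" "c \<le> Lim"
    and bound: "\<And>h. h < c ==> S a_coreload i h + S a_coreload (N + j) h \<le> M"
  shows "wp choose_core (\<lambda>S'. S' v_core 0 0 < c \<and>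
    (\<forall>h<c. S a_coreload i (S' v_core 0 0) + S a_coreload (N + j) (S' v_core 0 0) \<le> S a_coreload i h + S a_coreload (N + j) h)) S"
proof -
  let ?load = "\<lambda>h. S a_coreload i h + S a_coreload (N + j) h"
  let ?S = "upd (upd S v_core 0 0 0) v_minload 0 0 (?load 0)"
  let ?b = "Test (V v_minload .- (Arr a_coreload (V v_src) (V i3) .+ Arr a_coreload (V v_ports .+ V v_dst) (V i3)))
      (v_core :=: V i3 ;; v_minload :=: Arr a_coreload (V v_src) (V i3) .+ Arr a_coreload (V v_ports .+ V v_dst) (V i3)) Skp"
  have "wp (Loop i3 v_used ?b) (\<lambda>S'. S' v_core 0 0 < c \<and> (\<forall>h<c. ?load (S' v_core 0 0) \<le> ?load h)) ?S"
  proof (rule wp_Loop[where Inv = "\<lambda>x S'. S' v_core 0 0 < c \<and> S' v_minload 0 0 = ?load (S' v_core 0 0) \<and> (\<forall>h<x. S' v_minload 0 0 \<le> ?load h)"])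
    fix x S1
    assume x: "x < ?S v_used 0 0" and "S1 i3 0 0 = x"
      and "S1 v_core 0 0 < c \<and> S1 v_minload 0 0 = ?load (S1 v_core 0 0) \<and> (\<forall>h<x. S1 v_minload 0 0 \<le> ?load h)"
      and "\<And>r. r \<noteq> i3 ==> r \<notin> mods ?b ==> S1 r = ?S r"
    then show "wp ?b (\<lambda>S'. upd S' i3 0 0 (Suc x) v_core 0 0 < c \<and>
        upd S' i3 0 0 (Suc x) v_minload 0 0 = ?load (upd S' i3 0 0 (Suc x) v_core 0 0) \<and>
        (\<forall>h<Suc x. upd S' i3 0 0 (Suc x) v_minload 0 0 \<le> ?load h)) S1"
      using at bound[of x] Lim_le_M by (auto simp: less_Suc_eq not_less)
  qed (use at in auto)
  then show ?thesis using at bound[of 0] by (simp add: choose_core_def)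
qed

lemma wp_assign_core:
  assumes inv: "list_inv ml Z S" and Z: "\<And>p. p < 2 * N ==> load_of Z p \<le> sum_L"
    and f: "f = (i, j, k)" "i < N" "j < N" "k < n"
    and at: "S v_src 0 0 = i" "S v_dst 0 0 = j" "S v_ports 0 0 = N" "S v_used 0 0 = used_cores" "S v_size 0 0 = dd_flow f"
  shows "wp assign_core (\<lambda>S'. S' v_core 0 0 < used_cores \<and>
    (\<forall>h<used_cores. S a_coreload i (S' v_core 0 0) + S a_coreload (N + j) (S' v_core 0 0) \<le> S a_coreload i h + S a_coreload (N + j) h) \<and>
    (\<forall>p<2*N. \<forall>h. S' a_coreload p h = S a_coreload p h + (if h = S' v_core 0 0 \<and> uses p f then dd_flow f else 0))) S"
  unfolding assign_core_def
proof (rule wp_seq[OF wp_choose_core[where S = S and i = i and j = j and c = used_cores]])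
  have load: "S a_coreload i h \<le> sum_L" "S a_coreload (N + j) h \<le> sum_L" if "h < used_cores" for h
    using that f by (auto intro!: list_inv_coreload_le[OF inv] Z)
  show "S a_coreload i h + S a_coreload (N + j) h \<le> M" if "h < used_cores" for h
    using load[OF that] sum_L_le_M by simp
  show "0 < used_cores" "used_cores \<le> Lim"
    using N_pos coflows_pos m_pos lim_F by (auto simp: used_cores_def)
  have "dd_flow f \<le> sum_L" using dd_le_sum_L f by (simp add: dd_flow_def)
  fix S1
  assume "S1 v_core 0 0 < used_cores \<and> (\<forall>h<used_cores. S a_coreload i (S1 v_core 0 0) + S a_coreload (N + j) (S1 v_core 0 0)
      \<le> S a_coreload i h + S a_coreload (N + j) h)"
    and "\<And>r. r \<notin> mods choose_core ==> S1 r = S r"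
  then show "wp (Put a_coreload (V v_src) (V v_core) (Arr a_coreload (V v_src) (V v_core) .+ V v_size) ;;
      Put a_coreload (V v_ports .+ V v_dst) (V v_core) (Arr a_coreload (V v_ports .+ V v_dst) (V v_core) .+ V v_size))
    (\<lambda>S'. S' v_core 0 0 < used_cores \<and>
      (\<forall>h<used_cores. S a_coreload i (S' v_core 0 0) + S a_coreload (N + j) (S' v_core 0 0) \<le> S a_coreload i h + S a_coreload (N + j) h) \<and>
      (\<forall>p<2*N. \<forall>h. S' a_coreload p h = S a_coreload p h + (if h = S' v_core 0 0 \<and> uses p f then dd_flow f else 0))) S1"
    using load[of "S1 v_core 0 0"] \<open>dd_flow f \<le> sum_L\<close> sum_L_le_M at f by (auto simp: uses_def)
qed (use at in auto)

lemma wp_transmit_assigned: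
  assumes inv: "list_inv ml Z S" and f: "f = (i, j, k)" "i < N" "j < N" "k < n" "f \<in> flows I" "f \<notin> Z" "0 < dd_flow f"
    and at: "S v_src 0 0 = i" "S v_dst 0 0 = j" "S v_size 0 0 = dd_flow f" "S v_coflow 0 0 = k" "S v_steps 0 0 = 2 * F + 1"
      "S a_rho k 0 = rho k"
    and ml: "\<And>p. p < 2 * N ==> load_of Z p \<le> ml k" "\<And>k. k < n ==> ml k \<le> sum_L"
    and h: "h < used_cores" "\<forall>h'<used_cores. S a_coreload i h + S a_coreload (N + j) h \<le> S a_coreload i h' + S a_coreload (N + j) h'"
    and assigned: "\<forall>p<2*N. \<forall>h'. S1 a_coreload p h' = S a_coreload p h' + (if h' = h \<and> uses p f then dd_flow f else 0)"
      "S1 v_core 0 0 = h"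
    and frame: "\<And>r. r \<notin> mods assign_core ==> S1 r = S r"
  shows "wp transmit_flow (list_inv ml (insert f Z)) S1"
proof -
  have frame_eq: "plan u S1 = plan u S" "blocked_total S1 = blocked_total S" "endpoints S1 = endpoints S" for u
    by (auto intro!: plan_cong simp: frame blocked_total_def[abs_def] blocks_def endpoints_def)
  have "load_of Z p \<le> sum_L" if "p < 2 * N" for p using ml(1)[OF that] ml(2)[OF f(4)] by simp
  then have "blocked_total S h i j \<le> 2 * sum_L"
    using blocked_total_le_busy[of S h i j] list_invD(8)[OF inv, of _ h] h f(2,3)
      list_inv_coreload_le[OF inv, of _ h] by (auto simp: add_mono mult_2 intro: order_trans)
  moreover have "used_cores \<le> m" "used_cores \<le> Lim" using lim_F by (auto simp: used_cores_def)
  moreover have "dd_flow f \<le> sum_L" using dd_le_sum_L f by (simp add: dd_flow_def)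
  ultimately have "wp transmit_flow (placed S1 h i j k (dd_flow f)) S1"
    using h assigned f(2-7) Lim_le_M rho_sum_L_le_M[OF f(4)] list_invD(3,11)[OF inv] list_invD(5)[OF inv]
      unplaced_flow[OF inv f(5,6)] list_inv_end_le[OF inv ml(2)] list_inv_count[OF inv f(5,6)] at
    by (intro wp_transmit_flow) (auto simp: frame_eq frame simp flip: f(1))
  then show ?thesis
  proof (rule wp_mono)
    fix S2
    assume "placed S1 h i j k (dd_flow f) S2" and "\<And>r. r \<notin> mods transmit_flow ==> S2 r = S1 r"
    moreover from this(1) have "placed S h i j k (dd_flow f) S2" by (rule placed_cong) (auto simp: frame)
    ultimately show "list_inv ml (insert f Z) S2"
      using h assigned ml by (intro list_inv_placed[OF inv f(1-4,6)]) auto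
  qed
qed

lemma wp_place_flow:
  assumes ok: "prepared S" and inv: "list_inv ml Z S" and k: "S v_coflow 0 0 = k" "k < n"
    and e: "S i2 0 0 = e" "e < N * N" and new: "(e div N, e mod N, k) \<notin> Z"
    and params: "S v_used 0 0 = used_cores" "S v_steps 0 0 = 2 * F + 1"
    and ml: "\<And>p. p < 2 * N ==> load_of Z p \<le> ml k" "\<And>k. k < n ==> ml k \<le> sum_L"
  shows "wp place_flow (list_inv ml (insert (e div N, e mod N, k) Z)) S"
proof -
  define i j f where "i = e div N" and "j = e mod N" and "f = (i, j, k)"
  have ij: "i < N" "j < N" using div_mod_N(1)[OF e(2)] div_mod_N(2)[of e] by (simp_all add: i_def j_def)
  have f: "f \<in> flows I" "f \<notin> Z" using ij k new by (simp_all add: flows_def f_def i_def j_def)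
  have size: "S a_demand k e = dd_flow f" using prepared_demand[OF ok k(2) e(2)] by (simp add: dd_flow_def f_def i_def j_def)
  show ?thesis
  proof (cases "dd_flow f = 0")
    case True
    have "list_inv ml (insert f Z) (upd S v_size 0 0 0)"
      by (rule list_inv_cong[OF list_inv_zero[OF inv f True]]) auto
    then show ?thesis using True size k e by (simp add: place_flow_def f_def i_def j_def)
  next
    case False
    define S1 where "S1 = upd (upd (upd S v_size 0 0 (dd_flow f)) v_src 0 0 i) v_dst 0 0 j"
    have inv1: "list_inv ml Z S1" by (rule list_inv_cong[OF inv]) (auto simp: S1_def)
    have at: "S1 v_src 0 0 = i" "S1 v_dst 0 0 = j" "S1 v_ports 0 0 = N" "S1 v_used 0 0 = used_cores" "S1 v_size 0 0 = dd_flow f"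
        "S1 v_coflow 0 0 = k" "S1 v_steps 0 0 = 2 * F + 1" "S1 a_rho k 0 = rho k"
      using params preparedD(2,8)[OF ok] k by (simp_all add: S1_def)
    have "load_of Z p \<le> sum_L" if "p < 2 * N" for p using ml(1)[OF that] ml(2)[OF k(2)] by simp
    then have "wp (assign_core ;; transmit_flow) (list_inv ml (insert f Z)) S1"
      using False wp_transmit_assigned[OF inv1 f_def ij k(2) f _ at(1,2,5-8) ml]
      by (intro wp_seq[OF wp_assign_core[where S = S1 and k = k and f = f, OF inv1 _ f_def ij k(2) at(1-5)]]) auto
    moreover have "i \<le> M" "j \<le> M" "dd_flow f \<le> M"
      using ij N_le_M dd_le_M[OF ij k(2)] by (simp_all add: dd_flow_def f_def)
    ultimately show ?thesis
      using False size e k preparedD(2)[OF ok] by (simp add: place_flow_def S1_def flip: i_def j_def f_def)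
  qed
qed

end
context bounded_run
begin

definition handled :: "nat set => nat => nat => flow set" where
  "handled U k e = {(i, j, k'). i < N \<and> j < N \<and> (k' \<in> U \<or> k' = k \<and> i * N + j < e)}"

lemma handled_0: "handled U k 0 = handled U k' 0"
  by (simp add: handled_def)

lemma handled_Suc: "e < N * N ==> handled U k (Suc e) = insert (e div N, e mod N, k) (handled U k e)"
  using div_mod_N(1)[of e] div_mod_N(2)[of e] flat_eq_iff[of _ N _ e] by (auto simp: handled_def less_Suc_eq)

lemma handled_full: "handled U k (N * N) = handled (insert k U) k' 0"
  by (auto simp: handled_def intro: flat_less)

lemma handled_subset: "handled U k e \<subseteq> {..<N} \<times> {..<N} \<times> insert k U"
  by (auto simp: handled_def)

lemma wp_place_coflow:
  assumes ok: "prepared S" and params: "S v_used 0 0 = used_cores" "S v_steps 0 0 = 2 * F + 1"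
    and inv: "list_inv ml (handled U k 0) S" and k: "S v_coflow 0 0 = k" "k < n" "k \<notin> U" "finite U"
    and ml: "ml k = loads.max_load (insert k U)" "\<And>k. k < n ==> ml k \<le> sum_L"
  shows "wp (Loop i2 v_pairs place_flow) (list_inv ml (handled (insert k U) k 0)) S"
proof (rule wp_Loop[where Inv = "\<lambda>e. list_inv ml (handled U k e)"])
  show "list_inv ml (handled U k 0) (upd S i2 0 0 0)"
    by (rule list_inv_cong[OF inv]) auto
next
  fix e S1
  assume "e < S v_pairs 0 0" and inv1: "list_inv ml (handled U k e) S1" and index: "S1 i2 0 0 = e"
    and frame: "\<And>r. r \<noteq> i2 ==> r \<notin> mods place_flow ==> S1 r = S r"
  then have e: "e < N * N" using preparedD(4)[OF ok] by simp
  have ok1: "prepared S1" by (rule prepared_frame[OF ok]) (auto simp: frame)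
  have new: "(e div N, e mod N, k) \<notin> handled U k e" using k(3) by (simp add: handled_def)
  have at: "S1 v_coflow 0 0 = k" "S1 v_used 0 0 = used_cores" "S1 v_steps 0 0 = 2 * F + 1"
    using k(1) params by (simp_all add: frame)
  have "load_of (handled U k e) p \<le> ml k" if "p < 2 * N" for p
    unfolding ml(1) by (rule load_of_coflows[OF that _ handled_subset]) (simp add: k(4))
  then have "wp place_flow (list_inv ml (handled U k (Suc e))) S1"
    unfolding handled_Suc[OF e] by (intro wp_place_flow[where S = S1, OF ok1 inv1 at(1) k(2) index e new at(2,3)] ml(2))
  then show "wp place_flow (\<lambda>S'. list_inv ml (handled U k (Suc e)) (upd S' i2 0 0 (Suc e))) S1"
    by (rule wp_mono) (erule list_inv_cong, auto)
next
  show "list_inv ml (handled (insert k U) k 0) S1" if "list_inv ml (handled U k (S v_pairs 0 0)) S1" for S1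
    using that unfolding preparedD(4)[OF ok] handled_full[of U k k] .
qed (use lim_NN preparedD(4)[OF ok] in simp_all)

lemma drop_rev_index:
  assumes "distinct ys" "t < length ys"
  defines "y == ys ! (length ys - 1 - t)" and "U == \<lambda>t. set (drop (length ys - t) ys)"
  shows "y \<in> set ys" "y \<notin> U t" "insert y (U t) = U (Suc t)"
proof -
  have "Suc (length ys - 1 - t) = length ys - t" "length ys - 1 - t < length ys" using assms(2) by linarith+
  then have drop: "drop (length ys - 1 - t) ys = y # drop (length ys - t) ys"
    using Cons_nth_drop_Suc[of "length ys - 1 - t" ys] by (simp add: y_def)
  then show "insert y (U t) = U (Suc t)" by (simp add: U_def)
  show "y \<notin> U t" using drop distinct_drop[OF assms(1), of "length ys - 1 - t"] by (simp add: U_def)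
  show "y \<in> set ys" using assms(2) by (simp add: y_def)
qed

lemma list_inv_empty: "num_periods S = 0 ==> S a_coreload = (\<lambda>_ _. 0) ==> list_inv ml {} S"
  by (simp add: list_inv_def plan_def partial_schedule_0 busy_def load_of_def endpoints_def occupied_def)

lemma wp_place_round:
  assumes ok: "prepared S" and params: "S v_used 0 0 = used_cores" "S v_steps 0 0 = 2 * F + 1"
    and t: "S i1 0 0 = t" "t < n" and ys: "distinct ys" "set ys = {..<n}" "S a_order t 0 = ys ! (n - 1 - t)"
  defines "ml == \<lambda>k. loads.max_load (loads.up_to ys k)" and "U == \<lambda>t. set (drop (n - t) ys)"
  assumes inv: "list_inv ml (handled (U t) 0 0) S"
  shows "wp place_round (list_inv ml (handled (U (Suc t)) 0 0)) S"
proof -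
  have length: "length ys = n" using ys by (metis card_lessThan distinct_card)
  have ml: "ml k \<le> sum_L" for k
    unfolding ml_def loads.max_load_le_iff loads.total_load_def
    using loads.up_to_subset[of ys k] ys(2) by (auto intro: L_le_sum_L)
  define k where "k = ys ! (n - 1 - t)"
  have k: "k < n" "k \<notin> U t" "insert k (U t) = U (Suc t)"
    using drop_rev_index[OF ys(1), of t] t ys(2) unfolding length by (auto simp: k_def U_def)
  have ml_k: "ml k = loads.max_load (insert k (U t))"
    using loads.up_to_nth[OF ys(1), of "n - 1 - t"] t length k(3) by (simp add: ml_def k_def U_def)
  let ?S = "upd S v_coflow 0 0 k"
  have "prepared ?S" by (rule prepared_frame[OF ok]) auto
  moreover have "list_inv ml (handled (U t) k 0) ?S"
    unfolding handled_0[of _ k 0] by (rule list_inv_cong[OF inv]) auto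
  ultimately have "wp (Loop i2 v_pairs place_flow) (list_inv ml (handled (insert k (U t)) k 0)) ?S"
    using params k ml_k ml by (intro wp_place_coflow) (simp_all add: U_def)
  then show ?thesis
    using t k(1) n_le_M ys(3) unfolding k(3) handled_0[of _ k 0] by (simp add: place_round_def k_def)
qed

lemma wp_place_all:
  assumes ok: "prepared S" and params: "S v_used 0 0 = used_cores" "S v_steps 0 0 = 2 * F + 1"
    and start: "num_periods S = 0" "S a_coreload = (\<lambda>_ _. 0)"
    and ys: "distinct ys" "set ys = {..<n}" "\<And>t. t < n ==> S a_order t 0 = ys ! (n - 1 - t)"
  shows "wp place_all (list_inv (\<lambda>k. loads.max_load (loads.up_to ys k)) (flows I)) S"
    (is "wp _ (list_inv ?ml _) _")
  unfolding place_all_def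
proof (rule wp_Loop[where Inv = "\<lambda>t. list_inv ?ml (handled (set (drop (n - t) ys)) 0 0)"])
  have "length ys = n" using ys by (metis card_lessThan distinct_card)
  then have "handled (set (drop (n - 0) ys)) 0 0 = {}" by (simp add: handled_def)
  then show "list_inv ?ml (handled (set (drop (n - 0) ys)) 0 0) (upd S i1 0 0 0)"
    using start by (simp add: list_inv_empty)
next
  fix t S1
  assume t: "t < S v_coflows 0 0" "S1 i1 0 0 = t" and inv: "list_inv ?ml (handled (set (drop (n - t) ys)) 0 0) S1"
    and frame: "\<And>r. r \<noteq> i1 ==> r \<notin> mods place_round ==> S1 r = S r"
  have "prepared S1" by (rule prepared_frame[OF ok]) (auto simp: frame)
  then have "wp place_round (list_inv ?ml (handled (set (drop (n - Suc t) ys)) 0 0)) S1"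
    using params t preparedD(3)[OF ok] ys inv by (intro wp_place_round) (simp_all add: frame)
  then show "wp place_round (\<lambda>S'. list_inv ?ml (handled (set (drop (n - Suc t) ys)) 0 0) (upd S' i1 0 0 (Suc t))) S1"
    by (rule wp_mono) (erule list_inv_cong, auto)
next
  have "handled (set (drop (n - n) ys)) 0 0 = flows I" using ys(2) by (auto simp: handled_def flows_def)
  then show "list_inv ?ml (flows I) S1" if "list_inv ?ml (handled (set (drop (n - S v_coflows 0 0) ys)) 0 0) S1" for S1
    using that preparedD(3)[OF ok] by simp
qed (use preparedD(3)[OF ok] lim_n in simp_all)

text \<open>
  A flow waits only while one of its two ports is busy with flows of higher priority. On the least
  loaded core these take at most \<open>2 / m\<close> times the load of the coflows up to its own, and the sum
  of its size and its release time is at most the optimal completion time.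
\<close>

lemma list_inv_end_le_bound:
  assumes inv: "list_inv ml (flows I) S" and C: "lower_bounds C" and q: "q < num_periods S"
  shows "end_at S q \<le> C (S p_coflow q 0) + 2 * ml (S p_coflow q 0) / m"
proof -
  let ?k = "S p_coflow q 0"
  have "real (m * end_at S q) \<le> real (m * (rho ?k + dd_flow (flow_at S q)) + 2 * ml ?k)"
    using list_invD(7)[OF inv q] by (simp only: of_nat_le_iff)
  moreover have "real (rho ?k + dd_flow (flow_at S q)) \<le> C ?k"
    using lower_bounds_flow[OF C] planD[OF list_invD(3)[OF inv] q] by (simp add: dd_flow_def)
  then have "real m * real (rho ?k + dd_flow (flow_at S q)) \<le> real m * C ?k" by (intro mult_left_mono) auto
  ultimately have "real m * end_at S q \<le> real m * C ?k + 2 * ml ?k" by simp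
  then show ?thesis using m_pos by (simp add: field_simps)
qed

lemma list_inv_good:
  assumes ys: "distinct ys" "set ys = {..<n}" "loads.local_ratio_order W ys"
    and inv: "list_inv (\<lambda>k. loads.max_load (loads.up_to ys k)) (flows I) S"
  shows "good_schedule 1 5 S"
proof -
  define ml where "ml k = loads.max_load (loads.up_to ys k)" for k
  have "approximates 1 (num_periods S) (flow_at S) (end_at S) 5"
    unfolding approximates_def
  proof (intro allI impI exI[of _ "\<lambda>k. C k + 2 * ml k / m" for C] conjI)
    fix C :: "nat => real"
    assume C: "lower_bounds C"
    show "rho k \<le> C k + 2 * ml k / m" if "k < n" for k
      using lower_bounds_rho[OF C that] by (simp add: add_increasing2)
    show "end_at S q \<le> real 1 * (C (coflow_of (flow_at S q)) + 2 * ml (coflow_of (flow_at S q)) / m)" if "q < num_periods S" for q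
      using list_inv_end_le_bound[OF inv C that] by (simp add: ml_def)
    have "real (loads.order_cost W ys) \<le> 2 * real m * (\<Sum>k\<in>set ys. W k * C k)"
      using ys lower_bounds_nonneg[OF C] lower_bounds_load[OF C] by (intro loads.local_ratio_order_cost) auto
    then have order_cost: "(\<Sum>k<n. real (W k) * ml k) \<le> 2 * real m * (\<Sum>k<n. W k * C k)"
      unfolding loads.order_cost_sum[OF ys(1)] ys(2) ml_def by simp
    have "(\<Sum>k<n. W k * (C k + 2 * ml k / m)) = (\<Sum>k<n. W k * C k) + 2 / m * (\<Sum>k<n. real (W k) * ml k)"
      by (simp add: distrib_left sum.distrib sum_distrib_left mult_ac)
    also have "... \<le> (\<Sum>k<n. W k * C k) + 2 / m * (2 * real m * (\<Sum>k<n. W k * C k))"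
      using order_cost by (intro add_left_mono mult_left_mono) auto
    also have "... = 5 * (\<Sum>k<n. W k * C k)" using m_pos by simp
    finally show "(\<Sum>k<n. W k * (C k + 2 * ml k / m)) \<le> 5 * (\<Sum>k<n. W k * C k)" .
  qed
  moreover have "sent_in S (i, j, k) = 1 * dd i j k" if "i < N" "j < N" "k < n" for i j k
    using list_invD(4)[OF inv, of "(i, j, k)"] that by (simp add: flows_def dd_flow_def)
  ultimately show ?thesis using list_invD(3)[OF inv] by (simp add: good_schedule_def)
qed

lemma good_schedule_cong:
  assumes "good_schedule u \<rho> S" "\<And>r. r \<in> period_names ==> S' r = S r"
  shows "good_schedule u \<rho> S'"
  using assms(1) plan_cong[of S' S] sent_in_cong[of S' S] assms(2) by (simp add: good_schedule_def)

lemma wp_list_scheduling: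
  assumes ok: "prepared S" and W: "\<And>k. k < n ==> S a_weight k 0 = W k"
    and start: "num_periods S = 0" "S a_coreload = (\<lambda>_ _. 0)" "S a_ordered = (\<lambda>_ _. 0)"
  shows "wp list_scheduling (\<lambda>S'. good_schedule 1 5 S' \<and> S' v_den 0 0 = D * 1 \<and> num_periods S' \<le> Lim) S"
    (is "wp _ ?Q S")
  unfolding list_scheduling_def
proof (rule wp_seq[OF wp_compute_order[OF ok]])
  fix S1
  assume "\<exists>ys. distinct ys \<and> set ys = {..<n} \<and> loads.local_ratio_order W ys \<and> (\<forall>t<n. S1 a_order t 0 = ys ! (n - 1 - t))"
    and frame1: "\<And>r. r \<notin> mods compute_order ==> S1 r = S r"
  then obtain ys where ys: "distinct ys" "set ys = {..<n}" "loads.local_ratio_order W ys"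
    "\<And>t. t < n ==> S1 a_order t 0 = ys ! (n - 1 - t)" by blast
  let ?S = "upd (upd S1 v_used 0 0 used_cores) v_steps 0 0 (2 * F + 1)"
  have ok1: "prepared ?S" by (rule prepared_frame[OF ok]) (auto simp: frame1)
  have "wp (place_all ;; v_den :=: V v_D) ?Q ?S"
  proof (rule wp_seq[OF wp_place_all[OF ok1 _ _ _ _ ys(1,2)]])
    fix S2
    assume inv: "list_inv (\<lambda>k. loads.max_load (loads.up_to ys k)) (flows I) S2" and frame2: "\<And>r. r \<notin> mods place_all ==> S2 r = ?S r"
    have "good_schedule 1 5 (upd S2 v_den 0 0 D)"
      by (rule good_schedule_cong[OF list_inv_good[OF ys(1-3) inv]]) auto
    moreover have "S2 v_D 0 0 = D" using preparedD(5)[OF ok] by (simp add: frame2 frame1)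
    ultimately show "wp (v_den :=: V v_D) ?Q S2"
      using list_invD(12)[OF inv] lim_periods A_le_M_1[OF D_le_A(1)] by (simp add: card_flows)
  qed (use ys start in \<open>simp_all add: frame1\<close>)
  moreover have "1 * (2 * F + 1) \<le> F * (2 * F + 1)" using N_pos coflows_pos by (intro mult_le_mono1) simp
  from order_trans[OF this order_trans[OF lim_periods Lim_le_M]] have "2 * F + 1 \<le> M" by simp
  moreover have "used_cores = (if m < F then m else F)" by (simp add: used_cores_def)
  ultimately show "wp (Test (V v_flows .- V v_cores) (v_used :=: V v_cores) (v_used :=: V v_flows) ;;
      v_steps :=: Cn 2 .* V v_flows .+ Cn 1 ;; place_all ;; v_den :=: V v_D) ?Q S1"
    using preparedD(1,7)[OF ok] by (cases "m < F") (simp_all add: frame1)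
qed (use start W in auto)

end
section \<open>The program: fractional completion on a single core\<close>

abbreviation "v_Nn == 151::nat"
abbreviation "v_K == 152::nat"
abbreviation "a_bound == 153::nat"
abbreviation "v_maxbound == 154::nat"
abbreviation "v_len == 155::nat"
abbreviation "v_tmp == 156::nat"
abbreviation "v_top == 157::nat"
abbreviation "v_H == 158::nat"
abbreviation "v_10H == 159::nat"
abbreviation "v_110H == 160::nat"
abbreviation "a_time == 161::nat"
abbreviation "v_base == 162::nat"
abbreviation "v_drift == 163::nat"
abbreviation "v_rounds == 164::nat"
abbreviation "v_costfac == 165::nat"
abbreviation "v_loadfac == 166::nat"
abbreviation "v_bound == 167::nat"

definition largest_load :: prog where
  "largest_load = v_bound :=: Cn 0 ;;
    Loop i2 v_2N (Test (Arr a_load (V i2) (V i1) .- V v_bound) (v_bound :=: Arr a_load (V i2) (V i1)) Skp)"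

definition record_bound :: prog where
  "record_bound = Test (V v_bound) Skp (Put a_weight (V i1) (Cn 0) (Cn 0)) ;;
    Test (Vec a_rho (V i1) .- V v_bound) (v_bound :=: Vec a_rho (V i1)) Skp ;;
    Put a_bound (V i1) (Cn 0) (V v_bound) ;; Test (V v_bound .- V v_maxbound) (v_maxbound :=: V v_bound) Skp"

definition compute_bounds :: prog where
  "compute_bounds = v_Nn :=: V v_ports .* V v_coflows ;; v_K :=: Cn 12 .* V v_Nn ;; v_maxbound :=: Cn 0 ;;
    Loop i1 v_coflows (largest_load ;; record_bound)"

definition compute_powers :: prog where
  "compute_powers = Bit_length v_len v_tmp (V v_coflows .* V v_maxbound) ;; v_top :=: Cn 8 .* V v_len ;; v_H :=: V v_top .+ Cn 12 ;;
    v_10H :=: Cn 1 ;; v_110H :=: Cn 1 ;;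
    Loop i1 v_H (v_10H :=: V v_10H .* Cn 10 ;; v_110H :=: V v_110H .* Cn 110)"

definition compute_times :: prog where
  "compute_times = Put a_time (Cn 0) (Cn 0) (V v_10H) ;;
    Loop i1 v_H (Put a_time (V i1 .+ Cn 1) (Cn 0) (Vec a_time (V i1) .* Cn 11 \<oslash> Cn 10))"

definition compute_factors :: prog where
  "compute_factors = v_base :=: V v_base .* V v_10H .+ Cn 1 ;;
    v_drift :=: V v_ports .* V v_H .* V v_coflows .* V v_coflows ;;
    v_rounds :=: Cn 9000 .* V v_ports .* V v_H .* V v_coflows .* V v_coflows .* V v_coflows ;;
    v_costfac :=: Cn 40 .* V v_drift .* V v_110H .* V v_110H ;; v_loadfac :=: V v_base .* V v_10H"

definition compute_constants :: prog where
  "compute_constants = Sum_to v_base i1 v_coflows (Vec a_weight (V i1) .* Vec a_bound (V i1)) ;; compute_factors"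

definition prepare_grid :: prog where
  "prepare_grid = compute_bounds ;; compute_powers ;; compute_times ;; compute_constants"

lemma mods_grid [simp]:
  "mods largest_load = {v_bound, i2}"
  "mods record_bound = {a_weight, v_bound, a_bound, v_maxbound}"
  "mods compute_bounds = {v_Nn, v_K, i1, v_bound, i2, a_weight, a_bound, v_maxbound}"
  "mods compute_powers = {v_len, v_tmp, v_top, v_H, v_10H, v_110H, i1}"
  "mods compute_times = {a_time, i1}"
  "mods compute_constants = {v_base, i1, v_drift, v_rounds, v_costfac, v_loadfac}"
  "mods prepare_grid = {v_Nn, v_K, i1, i2, v_bound, a_weight, a_bound, v_maxbound, v_len, v_tmp, v_top, v_H,
    v_10H, v_110H, a_time, v_base, v_drift, v_rounds, v_costfac, v_loadfac}"
  by (auto simp: largest_load_def record_bound_def compute_bounds_def compute_powers_def compute_times_def compute_constants_def compute_factors_def prepare_grid_def)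

context bounded_run
begin

lemma le_A: "n \<le> A" "N \<le> A" "2 * N \<le> A" "H \<le> A" "K \<le> A" "dr.rounds \<le> A"
  using lim_n lim_N lim_2N lim_le_H lim_K lim_rounds Lim_le_A by linarith+

lemma powers_le_A: "10 ^ H \<le> A" "11 ^ H \<le> A"
  using power_mono[of "10::nat" 110 H] power_mono[of "11::nat" 110 H] power_le_A by simp_all

lemma T_le_A: "g \<le> H ==> dr.T g \<le> A"
  using T_le powers_le_A(2) by (rule order_trans)

lemma drift_bound_le_A: "dr.drift_bound \<le> A"
proof -
  have "dr.drift_bound * 1 \<le> dr.drift_bound * (9000 * n)" using coflows_pos by (intro mult_le_mono2) simp
  also have "... = dr.rounds" by (simp add: dr.rounds_eq)
  finally show ?thesis using le_A(6) by simp
qed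

lemma active_weight_le: "active_weight k \<le> W k"
  by (simp add: active_weight_def)

lemma active_weight_le_A: "k < n ==> active_weight k \<le> A"
proof -
  assume "k < n"
  then have "W k + 1 \<le> (\<Sum>k<n. W k + 1)" by (intro member_le_sum) auto
  then show ?thesis using W_le_A active_weight_le[of k] by linarith
qed

lemma weighted_bounds_le: "(\<Sum>k<n. active_weight k * B k) \<le> A ^ 2"
proof -
  have "(\<Sum>k<n. active_weight k * B k) \<le> (\<Sum>k<n. (W k + 1) * max_B)"
    using active_weight_le B_le_max_B by (intro sum_mono mult_le_mono) (auto intro: le_SucI)
  also have "... \<le> A * A" unfolding sum_distrib_right[symmetric] using W_le_A max_B_le_A by (rule mult_le_mono)
  finally show ?thesis by (simp add: power2_eq_square)
qed

lemma base_cost_le: "dr.base_cost \<le> A ^ 4"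
proof -
  have "(\<Sum>k<n. active_weight k * B k) * 10 ^ H \<le> A ^ (2 + 1)"
    by (intro mult_le_A weighted_bounds_le le_A_1 powers_le_A)
  moreover have "1 \<le> A ^ (2 + 1)" using numeral_le_A by simp
  ultimately have "dr.base_cost \<le> A ^ Suc (2 + 1)" unfolding dr.base_cost_def by (rule add_le_A)
  then show ?thesis by simp
qed

lemma cost_factor_le: "40 * dr.drift_bound * 110 ^ H * 110 ^ H \<le> A ^ (1 + 1 + 1 + 1)"
  using numeral_le_A by (intro mult_le_A le_A_1 drift_bound_le_A power_le_A) simp

lemma load_factor_le: "dr.base_cost * 10 ^ H \<le> A ^ (4 + 1)"
  by (intro mult_le_A base_cost_le le_A_1 powers_le_A)

definition "grid_ready S \<longleftrightarrow> prepared S \<and> S v_Nn 0 0 = N * n \<and> S v_K 0 0 = K \<and> S v_top 0 0 = H - 12 \<and> S v_H 0 0 = H \<and>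
   S v_10H 0 0 = 10 ^ H \<and> S v_110H 0 0 = 110 ^ H \<and> S v_rounds 0 0 = dr.rounds \<and>
   S v_costfac 0 0 = 40 * dr.drift_bound * 110 ^ H * 110 ^ H \<and> S v_loadfac 0 0 = dr.base_cost * 10 ^ H \<and>
   (\<forall>g\<le>H. S a_time g 0 = dr.T g) \<and> (\<forall>k<n. S a_bound k 0 = B k \<and> S a_weight k 0 = active_weight k)"

abbreviation "grid_names == prepared_names \<union>
   {v_Nn, v_K, v_top, v_H, v_10H, v_110H, v_rounds, v_costfac, v_loadfac, a_time, a_bound, a_weight}"

lemma grid_ready_frame:
  assumes "grid_ready S" "\<And>r. r \<in> grid_names ==> S' r = S r"
  shows "grid_ready S'"
  using assms prepared_frame[of S S'] by (simp add: grid_ready_def)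

lemma grid_readyD:
  assumes "grid_ready S"
  shows "prepared S" "S v_Nn 0 0 = N * n" "S v_K 0 0 = K" "S v_top 0 0 = H - 12" "S v_H 0 0 = H" "S v_10H 0 0 = 10 ^ H" "S v_110H 0 0 = 110 ^ H"
    "S v_rounds 0 0 = dr.rounds" "S v_costfac 0 0 = 40 * dr.drift_bound * 110 ^ H * 110 ^ H" "S v_loadfac 0 0 = dr.base_cost * 10 ^ H"
    "g \<le> H ==> S a_time g 0 = dr.T g" "k < n ==> S a_bound k 0 = B k" "k < n ==> S a_weight k 0 = active_weight k"
  using assms by (simp_all add: grid_ready_def)

lemma wp_largest_load:
  assumes ok: "prepared S" and k: "S i1 0 0 = k" "k < n"
  shows "wp largest_load (\<lambda>S'. S' v_bound 0 0 = loads.max_load {k}) S"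
proof -
  let ?S = "upd S v_bound 0 0 0"
  let ?b = "Test (Arr a_load (V i2) (V i1) .- V v_bound) (v_bound :=: Arr a_load (V i2) (V i1)) Skp"
  let ?Inv = "\<lambda>i S'. (\<forall>p<i. L p k \<le> S' v_bound 0 0) \<and> (S' v_bound 0 0 = 0 \<or> (\<exists>p<2*N. S' v_bound 0 0 = L p k))"
  have "wp (Loop i2 v_2N ?b) (\<lambda>S'. S' v_bound 0 0 = loads.max_load {k}) ?S"
  proof (rule wp_Loop[where Inv = ?Inv])
    fix i S1
    assume "i < ?S v_2N 0 0" and "?Inv i S1" and "S1 i2 0 0 = i" and "\<And>r. r \<noteq> i2 ==> r \<notin> mods ?b ==> S1 r = ?S r"
    then show "wp ?b (\<lambda>S'. ?Inv (Suc i) (upd S' i2 0 0 (Suc i))) S1"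
      using preparedD(6,9)[OF ok] L_le_M[of i k] k by (auto simp: less_Suc_eq)
  next
    fix S1
    assume "?Inv (?S v_2N 0 0) S1"
    then show "S1 v_bound 0 0 = loads.max_load {k}"
      using preparedD(6)[OF ok] by (intro max_load_single[symmetric]) auto
  qed (use preparedD(6)[OF ok] lim_2N in auto)
  then show ?thesis by (simp add: largest_load_def)
qed

lemma wp_record_bound:
  assumes ok: "prepared S" and k: "S i1 0 0 = k" "k < n" and weight: "S a_weight k 0 = W k" and bound: "S v_bound 0 0 = loads.max_load {k}"
  shows "wp record_bound (\<lambda>S'. S' a_bound k 0 = B k \<and> S' a_weight k 0 = active_weight k \<and> S' v_maxbound 0 0 = max (B k) (S v_maxbound 0 0) \<and>
    (\<forall>k'. k' \<noteq> k \<longrightarrow> S' a_bound k' 0 = S a_bound k' 0 \<and> S' a_weight k' 0 = S a_weight k' 0)) S"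
proof -
  have "B k \<le> M" using B_le_max_B[OF k(2)] max_B_le_A A_le_M_1[of "B k"] by simp
  moreover have "B k = (if loads.max_load {k} < rho k then rho k else loads.max_load {k})" by (simp add: B_def)
  ultimately show ?thesis
    using k bound weight preparedD(8)[OF ok k(2)]
    by (cases "loads.max_load {k} = 0"; cases "loads.max_load {k} < rho k") (auto simp: record_bound_def active_weight_def)
qed

lemma wp_compute_bounds:
  assumes ok: "prepared S" and weights: "\<And>k. k < n ==> S a_weight k 0 = W k"
  shows "wp compute_bounds (\<lambda>S'. (\<forall>k<n. S' a_bound k 0 = B k \<and> S' a_weight k 0 = active_weight k) \<and> S' v_maxbound 0 0 = max_B \<and>
     S' v_Nn 0 0 = N * n \<and> S' v_K 0 0 = K) S"
proof -
  let ?S = "upd (upd (upd S v_Nn 0 0 (N * n)) v_K 0 0 K) v_maxbound 0 0 0"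
  let ?Inv = "\<lambda>i S'. (\<forall>k<n. if k < i then S' a_bound k 0 = B k \<and> S' a_weight k 0 = active_weight k else S' a_weight k 0 = W k) \<and>
      S' v_maxbound 0 0 = Max (insert 0 (B ` {..<i}))"
  have "wp (Loop i1 v_coflows (largest_load ;; record_bound)) (\<lambda>S'. (\<forall>k<n. S' a_bound k 0 = B k \<and> S' a_weight k 0 = active_weight k) \<and>
     S' v_maxbound 0 0 = max_B \<and> S' v_Nn 0 0 = N * n \<and> S' v_K 0 0 = K) ?S"
  proof (rule wp_Loop[where Inv = ?Inv])
    fix k S1
    assume "k < ?S v_coflows 0 0" and inv: "?Inv k S1" and index: "S1 i1 0 0 = k"
      and frame: "\<And>r. r \<noteq> i1 ==> r \<notin> mods (largest_load ;; record_bound) ==> S1 r = ?S r"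
    then have k: "k < n" using preparedD(3)[OF ok] by simp
    have ok1: "prepared S1" by (rule prepared_frame[OF ok]) (auto simp: frame)
    have Max: "Max (insert 0 (B ` {..<Suc k})) = max (B k) (Max (insert 0 (B ` {..<k})))"
      by (simp add: lessThan_Suc insert_commute[of 0])
    show "wp (largest_load ;; record_bound) (\<lambda>S'. ?Inv (Suc k) (upd S' i1 0 0 (Suc k))) S1"
    proof (rule wp_seq[OF wp_largest_load[where S = S1, OF ok1 index k]])
      fix S2
      assume bound: "S2 v_bound 0 0 = loads.max_load {k}" and frame2: "\<And>r. r \<notin> mods largest_load ==> S2 r = S1 r"
      have ok2: "prepared S2" by (rule prepared_frame[OF ok1]) (auto simp: frame2)
      have at: "S2 i1 0 0 = k" "S2 a_weight k 0 = W k" using inv k index by (simp_all add: frame2)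
      show "wp record_bound (\<lambda>S'. ?Inv (Suc k) (upd S' i1 0 0 (Suc k))) S2"
        by (rule wp_mono[OF wp_record_bound[where S = S2, OF ok2 at(1) k at(2) bound]])
          (use inv in \<open>auto simp: less_Suc_eq Max frame2\<close>)
    qed
  next
    fix S1
    assume "?Inv (?S v_coflows 0 0) S1" and "\<And>r. r \<noteq> i1 ==> r \<notin> mods (largest_load ;; record_bound) ==> S1 r = ?S r"
    then show "(\<forall>k<n. S1 a_bound k 0 = B k \<and> S1 a_weight k 0 = active_weight k) \<and> S1 v_maxbound 0 0 = max_B \<and>
        S1 v_Nn 0 0 = N * n \<and> S1 v_K 0 0 = K"
      using preparedD(3)[OF ok] by (simp add: max_B_def)
  qed (use preparedD(3)[OF ok] lim_n weights in simp_all)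
  then show ?thesis using K_le_M Nn_le_M preparedD(2,3)[OF ok] by (simp add: compute_bounds_def K_def)
qed

lemma wp_compute_powers:
  assumes "S v_coflows 0 0 = n" "S v_maxbound 0 0 = max_B"
  shows "wp compute_powers (\<lambda>S'. S' v_top 0 0 = H - 12 \<and> S' v_H 0 0 = H \<and> S' v_10H 0 0 = 10 ^ H \<and> S' v_110H 0 0 = 110 ^ H) S"
    (is "wp _ ?Q S")
  unfolding compute_powers_def wp_Sq
proof (rule wp_Bit_length)
  let ?b = "floorlog 2 (n * max_B)"
  have "n * max_B \<le> A ^ (1 + 1)" by (intro mult_le_A le_A_1 le_A max_B_le_A)
  then show "ev S (V v_coflows .* V v_maxbound) \<le> M" using assms by (intro le_M[where c = "1 + 1"]) simp_all
  show "floorlog 2 (ev S (V v_coflows .* V v_maxbound)) \<le> Lim" using assms lim_le_H by (simp add: H_def)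
  let ?step = "v_10H :=: V v_10H .* Cn 10 ;; v_110H :=: V v_110H .* Cn 110"
  let ?S = "upd (upd (upd (upd (upd (upd S v_tmp 0 0 0) v_len 0 0 ?b) v_top 0 0 (H - 12)) v_H 0 0 H) v_10H 0 0 1) v_110H 0 0 1"
  have "wp (Loop i1 v_H ?step) ?Q ?S"
  proof (rule wp_Loop[where Inv = "\<lambda>i S'. S' v_10H 0 0 = 10 ^ i \<and> S' v_110H 0 0 = 110 ^ i"])
    fix i and S1 :: store
    assume "i < ?S v_H 0 0" and "S1 v_10H 0 0 = 10 ^ i \<and> S1 v_110H 0 0 = 110 ^ i"
    moreover have "(10::nat) ^ Suc i \<le> 10 ^ H" "(110::nat) ^ Suc i \<le> 110 ^ H" if "i < H"
      using that by (intro power_increasing; simp)+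
    ultimately show "wp ?step (\<lambda>S'. upd S' i1 0 0 (Suc i) v_10H 0 0 = 10 ^ Suc i \<and> upd S' i1 0 0 (Suc i) v_110H 0 0 = 110 ^ Suc i) S1"
      using A_le_M_1[OF power_le_A] A_le_M_1[OF powers_le_A(1)] by (simp add: mult.commute)
  qed (use lim_le_H in simp_all)
  then show "wp (v_top :=: Cn 8 .* V v_len) (wp (v_H :=: V v_top .+ Cn 12) (wp (v_10H :=: Cn 1) (wp (v_110H :=: Cn 1)
      (wp (Loop i1 v_H ?step) ?Q)))) (upd (upd S v_tmp 0 0 0) v_len 0 0 (floorlog 2 (ev S (V v_coflows .* V v_maxbound))))"
    using assms H_le_M one_le_M by (simp add: H_def)
qed simp

lemma wp_compute_times:
  assumes "S v_H 0 0 = H" "S v_10H 0 0 = 10 ^ H"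
  shows "wp compute_times (\<lambda>S'. \<forall>g\<le>H. S' a_time g 0 = dr.T g) S"
proof -
  let ?S = "upd S a_time 0 0 (10 ^ H)" and ?step = "Put a_time (V i1 .+ Cn 1) (Cn 0) (Vec a_time (V i1) .* Cn 11 \<oslash> Cn 10)"
  have "wp (Loop i1 v_H ?step) (\<lambda>S'. \<forall>g\<le>H. S' a_time g 0 = dr.T g) ?S"
  proof (rule wp_Loop[where Inv = "\<lambda>i S'. \<forall>g\<le>i. S' a_time g 0 = dr.T g"])
    fix i and S1 :: store
    assume "i < ?S v_H 0 0" "\<forall>g\<le>i. S1 a_time g 0 = dr.T g" "S1 i1 0 0 = i"
    then show "wp ?step (\<lambda>S'. \<forall>g\<le>Suc i. upd S' i1 0 0 (Suc i) a_time g 0 = dr.T g) S1"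
      using T_Suc[of i] A_le_M_1[OF T_le_A[of "Suc i"]] assms(1) by (auto simp: le_Suc_eq)
  qed (use assms lim_le_H in \<open>simp_all add: dr.T_def\<close>)
  then show ?thesis using assms A_le_M_1[OF powers_le_A(1)] by (simp add: compute_times_def)
qed

lemma wp_compute_constants:
  assumes ok: "prepared S" and powers: "S v_10H 0 0 = 10 ^ H" "S v_110H 0 0 = 110 ^ H" "S v_H 0 0 = H" "S v_top 0 0 = H - 12"
    and sizes: "S v_Nn 0 0 = N * n" "S v_K 0 0 = K" and times: "\<forall>g\<le>H. S a_time g 0 = dr.T g"
    and bounds: "\<forall>k<n. S a_bound k 0 = B k \<and> S a_weight k 0 = active_weight k"
  shows "wp compute_constants grid_ready S"
  unfolding compute_constants_def wp_Sq
proof (rule wp_Sum_to)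
  let ?sum = "\<Sum>k<n. active_weight k * B k"
  have sum: "(\<Sum>k<S v_coflows 0 0. ev (upd S i1 0 0 k) (Vec a_weight (V i1) .* Vec a_bound (V i1))) = ?sum"
    using bounds preparedD(3)[OF ok] by simp
  show "(\<Sum>k<S v_coflows 0 0. ev (upd S i1 0 0 k) (Vec a_weight (V i1) .* Vec a_bound (V i1))) \<le> M"
    unfolding sum using weighted_bounds_le by (rule le_M) simp
  have le: "dr.base_cost \<le> M" "dr.drift_bound \<le> M" "dr.rounds \<le> M" "40 * dr.drift_bound * 110 ^ H * 110 ^ H \<le> M" "dr.base_cost * 10 ^ H \<le> M"
    using le_M[OF base_cost_le] A_le_M_1[OF drift_bound_le_A] A_le_M_1[OF le_A(6)] le_M[OF cost_factor_le] le_M[OF load_factor_le]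
    by simp_all
  let ?S = "upd (upd S i1 0 0 n) v_base 0 0 ?sum"
  let ?S' = "upd (upd (upd (upd (upd ?S v_base 0 0 dr.base_cost) v_drift 0 0 dr.drift_bound) v_rounds 0 0 dr.rounds)
      v_costfac 0 0 (40 * dr.drift_bound * 110 ^ H * 110 ^ H)) v_loadfac 0 0 (dr.base_cost * 10 ^ H)"
  have "prepared ?S'" by (rule prepared_frame[OF ok]) auto
  then have "grid_ready ?S'" using powers sizes times bounds by (simp add: grid_ready_def)
  moreover have "Suc (?sum * 10 ^ H) = dr.base_cost" "N * H * n * n = dr.drift_bound" "9000 * N * H * n * n * n = dr.rounds"
    by (simp_all add: dr.base_cost_def dr.drift_bound_def dr.rounds_def)
  ultimately have "wp compute_factors grid_ready ?S"
    using le preparedD(2,3)[OF ok] by (simp add: compute_factors_def powers)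
  then show "wp compute_factors grid_ready (upd (upd S i1 0 0 (S v_coflows 0 0)) v_base 0 0
      (\<Sum>k<S v_coflows 0 0. ev (upd S i1 0 0 k) (Vec a_weight (V i1) .* Vec a_bound (V i1))))"
    unfolding sum by (simp only: preparedD(3)[OF ok])
qed (use preparedD(3)[OF ok] lim_n in auto)

lemma wp_prepare_grid:
  assumes ok: "prepared S" and weights: "\<And>k. k < n ==> S a_weight k 0 = W k"
  shows "wp prepare_grid grid_ready S"
  unfolding prepare_grid_def
proof (rule wp_seq[OF wp_compute_bounds[OF ok weights]])
  fix S1
  assume bounds: "(\<forall>k<n. S1 a_bound k 0 = B k \<and> S1 a_weight k 0 = active_weight k) \<and> S1 v_maxbound 0 0 = max_B \<and>
      S1 v_Nn 0 0 = N * n \<and> S1 v_K 0 0 = K"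
    and frame1: "\<And>r. r \<notin> mods compute_bounds ==> S1 r = S r"
  have "S1 v_coflows 0 0 = n" "S1 v_maxbound 0 0 = max_B" using bounds preparedD(3)[OF ok] by (simp_all add: frame1)
  then show "wp (compute_powers ;; compute_times ;; compute_constants) grid_ready S1"
  proof (rule wp_seq[OF wp_compute_powers])
    fix S2
    assume powers: "S2 v_top 0 0 = H - 12 \<and> S2 v_H 0 0 = H \<and> S2 v_10H 0 0 = 10 ^ H \<and> S2 v_110H 0 0 = 110 ^ H"
      and frame2: "\<And>r. r \<notin> mods compute_powers ==> S2 r = S1 r"
    then have "S2 v_H 0 0 = H" "S2 v_10H 0 0 = 10 ^ H" by auto
    then show "wp (compute_times ;; compute_constants) grid_ready S2"
    proof (rule wp_seq[OF wp_compute_times])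
      fix S3
      assume times: "\<forall>g\<le>H. S3 a_time g 0 = dr.T g" and frame3: "\<And>r. r \<notin> mods compute_times ==> S3 r = S2 r"
      have "prepared S3" by (rule prepared_frame[OF ok]) (auto simp: frame3 frame2 frame1)
      then show "wp compute_constants grid_ready S3"
        by (rule wp_compute_constants) (use bounds powers times in \<open>simp_all add: frame3 frame2 frame1\<close>)
    qed
  qed
qed simp

end
subsection \<open>The greedy rounds\<close>

abbreviation "a_queue == 168::nat"
abbreviation "a_hits == 169::nat"
abbreviation "a_point == 170::nat"
abbreviation "v_acc == 171::nat"
abbreviation "v_chosen == 172::nat"
abbreviation "v_g == 173::nat"
abbreviation "v_cost == 174::nat"
abbreviation "v_mincost == 175::nat"
abbreviation "v_ratio == 176::nat"
abbreviation "v_portsum == 177::nat"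

definition compare_point :: prog where
  "compare_point = Test (V v_g .- V v_top) Skp (Test (V v_10H .* Vec a_bound (V i2) .- Vec a_time (V v_g)) Skp (
      v_cost :=: V v_costfac .* Vec a_weight (V i2) .* Vec a_time (V v_g) .+ V v_loadfac .* V v_acc ;;
      Test ((Cn 1 .- V v_chosen) .+ (V v_mincost .- V v_cost))
        (v_chosen :=: Cn 1 ;; v_mincost :=: V v_cost ;; Put a_point (V i2) (Cn 0) (V v_g)) Skp))"

definition add_price :: prog where
  "add_price = v_g :=: V v_H .- Cn 1 .- V i3 ;; v_ratio :=: V v_110H \<oslash> Vec a_time (V v_g) ;;
    Sum_to v_portsum i4 v_2N (Arr a_queue (V i4) (V v_g) .* Arr a_load (V i4) (V i2)) ;;
    v_acc :=: V v_acc .+ V v_portsum .* V v_ratio .* V v_ratio"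

definition choose_point :: prog where
  "choose_point = v_acc :=: Cn 0 ;; v_chosen :=: Cn 0 ;; Loop i3 v_H (add_price ;; compare_point)"

definition count_points :: prog where
  "count_points = Loop i2 v_coflows (Loop i3 v_H (
     Test (Vec a_point (V i2) .- V i3) Skp (Put a_hits (V i2) (V i3) (Arr a_hits (V i2) (V i3) .+ Cn 1))))"

definition update_queue :: prog where
  "update_queue = Sum_to v_portsum i4 v_coflows (Arr a_load (V i2) (V i4) .* (Cn 1 .- (Vec a_point (V i4) .- V i3))) ;;
     Put a_queue (V i2) (V i3) (Arr a_queue (V i2) (V i3) .+ V v_10H .* V v_portsum .- Vec a_time (V i3))"

definition drift_round :: prog where
  "drift_round = Loop i2 v_coflows choose_point ;; count_points ;; Loop i2 v_2N (Loop i3 v_H update_queue)"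

definition run_drift :: prog where
  "run_drift = Loop i1 v_rounds drift_round"

abbreviation "point_names == {v_g, v_ratio, v_portsum, i4, v_acc, v_cost, v_chosen, v_mincost, a_point, i3}"

lemma mods_drift [simp]:
  "mods compare_point = {v_cost, v_chosen, v_mincost, a_point}"
  "mods add_price = {v_g, v_ratio, v_portsum, i4, v_acc}"
  "mods choose_point = point_names"
  "mods count_points = {i2, i3, a_hits}"
  "mods update_queue = {v_portsum, i4, a_queue}"
  "mods drift_round = {i2, a_hits, a_queue} \<union> point_names"
  "mods run_drift = {i1, i2, a_hits, a_queue} \<union> point_names"
  by (auto simp: compare_point_def add_price_def choose_point_def count_points_def update_queue_def drift_round_def run_drift_def)

context bounded_run
begin

text \<open>The grid points are visited in decreasing order, so that the sum in the cost grows by one term at each.\<close>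

definition price :: "(nat => nat => nat) => nat => nat => nat" where
  "price q k g = (\<Sum>p<2*N. q p g * L p k) * (110 ^ H div dr.T g) * (110 ^ H div dr.T g)"

definition acc :: "(nat => nat => nat) => nat => nat => nat" where
  "acc q k e = (\<Sum>g\<in>{H - e..<H}. price q k g)"

definition queue_bounded :: "(nat => nat => nat) => bool" where
  "queue_bounded q \<longleftrightarrow> (\<forall>p<2*N. \<forall>g<H. q p g \<le> A ^ 3)"

definition chosen :: "(nat => nat => nat) => nat => nat => store => bool" where
  "chosen q k e S \<longleftrightarrow>
     (if S v_chosen 0 0 = 0 then \<forall>g. H - e \<le> g \<longrightarrow> \<not> dr.allowed k g
      else dr.allowed k (S a_point k 0) \<and> S v_mincost 0 0 = dr.cost q k (S a_point k 0) \<and>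
        (\<forall>g. H - e \<le> g \<longrightarrow> dr.allowed k g \<longrightarrow> S v_mincost 0 0 \<le> dr.cost q k g))"

lemma chosen_cong:
  assumes "chosen q k e S" "S' v_chosen = S v_chosen" "S' v_mincost = S v_mincost" "S' a_point = S a_point"
  shows "chosen q k e S'"
  using assms(1) unfolding chosen_def assms(2-4) .

lemma acc_Suc: "e < H ==> acc q k (Suc e) = acc q k e + price q k (H - Suc e)"
proof -
  assume e: "e < H"
  have "{H - Suc e..<H} = insert (H - Suc e) {H - e..<H}" "H - Suc e \<notin> {H - e..<H}" using e by auto
  then show ?thesis by (simp add: acc_def)
qed

lemma cost_acc: "dr.cost q k (H - e) = 40 * dr.drift_bound * 110 ^ H * 110 ^ H * active_weight k * dr.T (H - e) + dr.base_cost * 10 ^ H * acc q k e"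
  by (simp add: dr.cost_def acc_def price_def)

lemma port_sum_le:
  assumes "queue_bounded q" "k < n" "g < H"
  shows "(\<Sum>p<2*N. q p g * L p k) \<le> A ^ 5"
proof -
  have "q p g * L p k \<le> A ^ (3 + 1)" if "p < 2 * N" for p
    using assms that L1_le_sum_L[of p k] sum_L_le_A by (intro mult_le_A) (simp_all add: queue_bounded_def)
  then have "(\<Sum>p<2*N. q p g * L p k) \<le> of_nat (card {..<2*N}) * A ^ (3 + 1)"
    by (intro sum_bounded_above) simp
  also have "... \<le> A * A ^ (3 + 1)" using le_A(3) by (intro mult_le_mono1) simp
  finally show ?thesis by (simp add: eval_nat_numeral)
qed

lemma acc_le:
  assumes "queue_bounded q" "k < n"
  shows "acc q k e \<le> A ^ 8"
proof -
  have "price q k g \<le> A ^ (5 + 1 + 1)" if "g < H" for g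
    unfolding price_def using power_le_A
    by (intro mult_le_A port_sum_le assms that le_A_1 order_trans[OF div_le_dividend])
  then have "acc q k e \<le> of_nat (card {H - e..<H}) * A ^ (5 + 1 + 1)"
    unfolding acc_def by (intro sum_bounded_above) simp
  also have "... \<le> A * A ^ (5 + 1 + 1)" using le_A(4) by (intro mult_le_mono1) simp
  finally show ?thesis by (simp add: eval_nat_numeral)
qed

lemma cost_le_M:
  assumes "queue_bounded q" "k < n"
  shows "dr.cost q k (H - e) \<le> M"
proof -
  have "40 * dr.drift_bound * 110 ^ H * 110 ^ H * active_weight k * dr.T (H - e) \<le> A ^ (1 + 1 + 1 + 1 + 1 + 1)"
    by (intro mult_le_A cost_factor_le le_A_1 active_weight_le_A T_le_A assms(2)) simp
  also have "... \<le> A ^ (4 + 1 + 8)" using numeral_le_A by (intro power_increasing) auto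
  finally have "40 * dr.drift_bound * 110 ^ H * 110 ^ H * active_weight k * dr.T (H - e) \<le> A ^ (4 + 1 + 8)" .
  moreover have "dr.base_cost * 10 ^ H * acc q k e \<le> A ^ (4 + 1 + 8)"
    by (intro mult_le_A load_factor_le acc_le assms)
  ultimately have "dr.cost q k (H - e) \<le> A ^ Suc (4 + 1 + 8)" unfolding cost_acc by (rule add_le_A)
  then show ?thesis by (rule le_M) simp
qed

lemma allowed_less: "dr.allowed k g ==> g < H"
  using dr.H unfolding dr.allowed_def by linarith

lemma wp_add_price:
  assumes ok: "grid_ready S" and k: "S i2 0 0 = k" "k < n" and e: "S i3 0 0 = e" "e < H"
    and q: "queue_bounded (S a_queue)" and acc: "S v_acc 0 0 = acc (S a_queue) k e"
  shows "wp add_price (\<lambda>S'. S' v_g 0 0 = H - Suc e \<and> S' v_acc 0 0 = acc (S a_queue) k (Suc e)) S"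
  unfolding add_price_def
proof -
  let ?g = "H - Suc e" and ?q = "S a_queue"
  let ?r = "110 ^ H div dr.T ?g" and ?s = "\<Sum>p<2*N. S a_queue p (H - Suc e) * L p k"
  let ?S = "upd (upd S v_g 0 0 ?g) v_ratio 0 0 ?r"
  have grid: "S v_H 0 0 = H" "S v_110H 0 0 = 110 ^ H" "S v_2N 0 0 = 2 * N" "S a_time ?g 0 = dr.T ?g" "\<And>p. p < 2 * N ==> S a_load p k = L p k"
    using grid_readyD[OF ok] preparedD[OF grid_readyD(1)[OF ok]] k by simp_all
  have sum: "(\<Sum>i<?S v_2N 0 0. ev (upd ?S i4 0 0 i) (Arr a_queue (V i4) (V v_g) .* Arr a_load (V i4) (V i2))) = ?s"
    using grid k by simp
  have "acc ?q k (Suc e) \<le> M" by (rule le_M[OF acc_le[OF q k(2)]]) simp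
  then have step: "acc ?q k e + ?s * ?r * ?r = acc ?q k (Suc e)" "acc ?q k (Suc e) \<le> M"
    unfolding acc_Suc[OF e(2)] price_def by simp_all
  have "?s \<le> M" by (rule le_M[OF port_sum_le[OF q k(2)]]) (use e in simp_all)
  then have "wp (Sum_to v_portsum i4 v_2N (Arr a_queue (V i4) (V v_g) .* Arr a_load (V i4) (V i2)))
      (wp (v_acc :=: V v_acc .+ V v_portsum .* V v_ratio .* V v_ratio)
        (\<lambda>S'. S' v_g 0 0 = H - Suc e \<and> S' v_acc 0 0 = acc (S a_queue) k (Suc e))) ?S"
    by (intro wp_Sum_to, unfold sum) (use grid lim_2N acc step in auto)
  moreover have "?r \<le> M" using div_le_dividend A_le_M_1[OF power_le_A] by (rule order_trans)
  moreover have "?g \<le> M" using H_le_M by simp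
  ultimately show "wp (v_g :=: V v_H .- Cn 1 .- V i3 ;; v_ratio :=: V v_110H \<oslash> Vec a_time (V v_g) ;;
      Sum_to v_portsum i4 v_2N (Arr a_queue (V i4) (V v_g) .* Arr a_load (V i4) (V i2)) ;;
      v_acc :=: V v_acc .+ V v_portsum .* V v_ratio .* V v_ratio)
    (\<lambda>S'. S' v_g 0 0 = H - Suc e \<and> S' v_acc 0 0 = acc (S a_queue) k (Suc e)) S"
    using grid e by simp
qed

lemma wp_compare_point:
  assumes ok: "grid_ready S" and k: "S i2 0 0 = k" "k < n" and at: "S v_g 0 0 = g" and g: "g = H - Suc e" "e < H"
    and q: "queue_bounded q" and acc: "S v_acc 0 0 = acc q k (Suc e)" and before: "chosen q k e S"
  shows "wp compare_point (\<lambda>S'. chosen q k (Suc e) S' \<and> (\<forall>k'. k' \<noteq> k \<longrightarrow> S' a_point k' 0 = S a_point k' 0)) S"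
    (is "wp _ ?Q S")
proof -
  have "g \<le> M" using g H_le_M by simp
  have grid: "S a_time g 0 = dr.T g" "S v_top 0 0 = H - 12" "S v_10H 0 0 = 10 ^ H" "S a_bound k 0 = B k" "S a_weight k 0 = active_weight k"
      "S v_costfac 0 0 = 40 * dr.drift_bound * 110 ^ H * 110 ^ H" "S v_loadfac 0 0 = dr.base_cost * 10 ^ H"
    using grid_readyD[OF ok] k g(1) by simp_all
  have range: "H - Suc e \<le> g' \<longleftrightarrow> g' = g \<or> H - e \<le> g'" for g' using g by auto
  have cost: "40 * dr.drift_bound * 110 ^ H * 110 ^ H * active_weight k * dr.T g + dr.base_cost * 10 ^ H * acc q k (Suc e) = dr.cost q k g"
    unfolding g(1) by (rule cost_acc[symmetric])
  note facts = grid k at acc cost cost_le_M[OF q k(2), of "Suc e", folded g(1)] \<open>g \<le> M\<close>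
  consider (forbidden) "\<not> dr.allowed k g" | (better) "dr.allowed k g" "S v_chosen 0 0 = 0 \<or> dr.cost q k g < S v_mincost 0 0"
    | (worse) "dr.allowed k g" "S v_chosen 0 0 \<noteq> 0" "S v_mincost 0 0 \<le> dr.cost q k g" by linarith
  then show ?thesis
  proof cases
    case forbidden
    then have "chosen q k (Suc e) S" using before unfolding chosen_def range by (auto split: if_splits)
    then show ?thesis using forbidden facts by (auto simp: compare_point_def dr.allowed_def)
  next
    case better
    let ?S = "upd (upd (upd (upd S v_cost 0 0 (dr.cost q k g)) v_chosen 0 0 1) v_mincost 0 0 (dr.cost q k g)) a_point k 0 g"
    have "chosen q k (Suc e) ?S"
      using before better unfolding chosen_def range by (auto split: if_splits intro: less_imp_le order_trans[OF less_imp_le])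
    then have "?Q ?S" by simp
    then show ?thesis using better facts one_le_M by (auto simp: compare_point_def dr.allowed_def)
  next
    case worse
    then have "chosen q k (Suc e) (upd S v_cost 0 0 (dr.cost q k g))"
      using before unfolding chosen_def range by auto
    then show ?thesis using worse facts by (auto simp: compare_point_def dr.allowed_def)
  qed
qed

lemma wp_choose_point:
  assumes ok: "grid_ready S" and k: "S i2 0 0 = k" "k < n" and q: "queue_bounded (S a_queue)"
  shows "wp choose_point (\<lambda>S'. dr.best (S a_queue) k (S' a_point k 0) \<and> (\<forall>k'. k' \<noteq> k \<longrightarrow> S' a_point k' 0 = S a_point k' 0)) S"
proof -
  let ?q = "S a_queue" and ?S = "upd (upd S v_acc 0 0 0) v_chosen 0 0 0"
  let ?Inv = "\<lambda>e S'. S' v_acc 0 0 = acc ?q k e \<and> chosen ?q k e S' \<and> (\<forall>k'. k' \<noteq> k \<longrightarrow> S' a_point k' 0 = S a_point k' 0)"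
  have H: "S v_H 0 0 = H" by (rule grid_readyD(5)[OF ok])
  have "wp (Loop i3 v_H (add_price ;; compare_point))
    (\<lambda>S'. dr.best ?q k (S' a_point k 0) \<and> (\<forall>k'. k' \<noteq> k \<longrightarrow> S' a_point k' 0 = S a_point k' 0)) ?S"
  proof (rule wp_Loop[where Inv = ?Inv])
    show "?Inv 0 (upd ?S i3 0 0 0)" using allowed_less by (fastforce simp: chosen_def acc_def)
    fix e S1
    assume "e < ?S v_H 0 0" and inv: "?Inv e S1" and index: "S1 i3 0 0 = e"
      and frame1: "\<And>r. r \<noteq> i3 ==> r \<notin> mods (add_price ;; compare_point) ==> S1 r = ?S r"
    then have e: "e < H" using H by simp
    have ok1: "grid_ready S1" by (rule grid_ready_frame[OF ok]) (auto simp: frame1)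
    have at: "S1 i2 0 0 = k" "queue_bounded (S1 a_queue)" "S1 v_acc 0 0 = acc (S1 a_queue) k e"
      using k q inv by (simp_all add: frame1)
    show "wp (add_price ;; compare_point) (\<lambda>S'. ?Inv (Suc e) (upd S' i3 0 0 (Suc e))) S1"
    proof (rule wp_seq[OF wp_add_price[where S = S1, OF ok1 at(1) k(2) index e at(2,3)]])
      fix S2
      assume price: "S2 v_g 0 0 = H - Suc e \<and> S2 v_acc 0 0 = acc (S1 a_queue) k (Suc e)" and frame2: "\<And>r. r \<notin> mods add_price ==> S2 r = S1 r"
      have "grid_ready S2" by (rule grid_ready_frame[OF ok1]) (auto simp: frame2)
      moreover have "chosen ?q k e S2" using conjunct1[OF conjunct2[OF inv]] by (rule chosen_cong) (simp_all add: frame2)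
      ultimately have "wp compare_point (\<lambda>S'. chosen ?q k (Suc e) S' \<and> (\<forall>k'. k' \<noteq> k \<longrightarrow> S' a_point k' 0 = S2 a_point k' 0)) S2"
        using price at k(2) e q by (intro wp_compare_point[where g = "H - Suc e"]) (simp_all add: frame2 frame1)
      then show "wp compare_point (\<lambda>S'. ?Inv (Suc e) (upd S' i3 0 0 (Suc e))) S2"
        by (rule wp_mono) (use price inv in \<open>auto simp: frame2 frame1 elim: chosen_cong\<close>)
    qed
  next
    fix S1
    assume inv: "?Inv (?S v_H 0 0) S1"
    have "dr.allowed k (H - 12)" using dr.B_le_top[OF k(2)] by (simp add: dr.allowed_iff)
    then show "dr.best ?q k (S1 a_point k 0) \<and> (\<forall>k'. k' \<noteq> k \<longrightarrow> S1 a_point k' 0 = S a_point k' 0)"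
      using inv H by (auto simp: chosen_def dr.best_def split: if_splits)
  qed (use H lim_le_H in auto)
  then show ?thesis using one_le_M by (simp add: choose_point_def)
qed

lemma wp_choose_points:
  assumes ok: "grid_ready S" and q: "queue_bounded (S a_queue)"
  shows "wp (Loop i2 v_coflows choose_point) (\<lambda>S'. \<forall>k<n. dr.best (S a_queue) k (S' a_point k 0)) S"
proof (rule wp_Loop[where Inv = "\<lambda>k S'. \<forall>k'<k. dr.best (S a_queue) k' (S' a_point k' 0)"])
  have n: "S v_coflows 0 0 = n" by (rule preparedD(3)[OF grid_readyD(1)[OF ok]])
  then show "S v_coflows 0 0 \<le> Lim" using lim_n by simp
  show "\<forall>k<n. dr.best (S a_queue) k (S1 a_point k 0)" if "\<forall>k<S v_coflows 0 0. dr.best (S a_queue) k (S1 a_point k 0)" for S1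
    using that n by simp
  fix k S1
  assume "k < S v_coflows 0 0" and inv: "\<forall>k'<k. dr.best (S a_queue) k' (S1 a_point k' 0)" and index: "S1 i2 0 0 = k"
    and frame: "\<And>r. r \<noteq> i2 ==> r \<notin> mods choose_point ==> S1 r = S r"
  then have k: "k < n" using n by simp
  have "grid_ready S1" by (rule grid_ready_frame[OF ok]) (auto simp: frame)
  then have "wp choose_point (\<lambda>S'. dr.best (S1 a_queue) k (S' a_point k 0) \<and> (\<forall>k'. k' \<noteq> k \<longrightarrow> S' a_point k' 0 = S1 a_point k' 0)) S1"
    using index k q by (intro wp_choose_point) (simp_all add: frame)
  then show "wp choose_point (\<lambda>S'. \<forall>k'<Suc k. dr.best (S a_queue) k' (upd S' i2 0 0 (Suc k) a_point k' 0)) S1"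
    by (rule wp_mono) (use inv in \<open>auto simp: less_Suc_eq frame\<close>)
qed auto

definition counts :: "(nat => nat => nat) => nat => nat => nat => nat" where
  "counts Gs s k g = (\<Sum>s'<s. of_bool (Gs s' k \<le> g))"

lemma counts_le: "counts Gs s k g \<le> s"
proof -
  have "counts Gs s k g \<le> of_nat (card {..<s}) * 1" unfolding counts_def by (intro sum_bounded_above) simp
  then show ?thesis by simp
qed

lemma wp_count_points:
  assumes ok: "grid_ready S" and bound: "\<And>k g. k < n ==> g < H ==> S a_hits k g < dr.rounds"
  shows "wp count_points (\<lambda>S'. \<forall>k<n. \<forall>g<H. S' a_hits k g = S a_hits k g + of_bool (S a_point k 0 \<le> g)) S"
proof -
  have sizes: "S v_coflows 0 0 = n" "S v_H 0 0 = H" using preparedD(3)[OF grid_readyD(1)[OF ok]] grid_readyD(5)[OF ok] by simp_all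
  have le: "Suc (S a_hits k g) \<le> M" if "k < n" "g < H" for k g using bound[OF that] A_le_M_1[OF le_A(6)] by simp
  have "wp count_points (\<lambda>S'. \<forall>k<S v_coflows 0 0. \<forall>g<S v_H 0 0. S' a_hits k g = S a_hits k g + of_bool (S a_point k 0 \<le> g)) S"
    unfolding count_points_def
  proof (rule wp_fill)
    fix k g S1
    let ?b = "Test (Vec a_point (V i2) .- V i3) Skp (Put a_hits (V i2) (V i3) (Arr a_hits (V i2) (V i3) .+ Cn 1))"
    assume "k < S v_coflows 0 0" "g < S v_H 0 0" "S1 i2 0 0 = k" "S1 i3 0 0 = g"
      "\<And>r. r \<notin> insert i2 (insert i3 (mods ?b)) ==> S1 r = S r" "S1 a_hits k g = S a_hits k g"
    then show "wp ?b (\<lambda>S'. S' a_hits k g = S a_hits k g + of_bool (S a_point k 0 \<le> g) \<and>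
        (\<forall>k' g'. \<not> (k' = k \<and> g' = g) \<longrightarrow> S' a_hits k' g' = S1 a_hits k' g')) S1"
      using le sizes by auto
  qed (use sizes lim_n lim_le_H in auto)
  then show ?thesis by (simp add: sizes)
qed

lemma load_le: "p < 2 * N ==> dr.load G p g \<le> sum_L"
proof -
  assume p: "p < 2 * N"
  have "dr.load G p g \<le> (\<Sum>k<n. L p k)" unfolding dr.load_def by (intro sum_mono) auto
  then show ?thesis using L_le_sum_L[OF p, of "{..<n}"] by simp
qed

lemma wp_update_queue:
  assumes ok: "grid_ready S" and p: "S i2 0 0 = p" "p < 2 * N" and g: "S i3 0 0 = g" "g < H"
    and bound: "S a_queue p g + 10 ^ H * sum_L \<le> M"
  shows "wp update_queue (\<lambda>S'. S' a_queue p g = S a_queue p g + 10 ^ H * dr.load (\<lambda>k. S a_point k 0) p g - dr.T g \<and>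
    (\<forall>p' g'. \<not> (p' = p \<and> g' = g) \<longrightarrow> S' a_queue p' g' = S a_queue p' g')) S"
  unfolding update_queue_def wp_Sq
proof (rule wp_Sum_to)
  let ?e = "Arr a_load (V i2) (V i4) .* (Cn 1 .- (Vec a_point (V i4) .- V i3))"
  let ?load = "dr.load (\<lambda>k. S a_point k 0) p g"
  have grid: "S v_10H 0 0 = 10 ^ H" "S a_time g 0 = dr.T g" "S v_coflows 0 0 = n" "\<And>k. k < n ==> S a_load p k = L p k"
    using grid_readyD[OF ok] preparedD[OF grid_readyD(1)[OF ok]] p g by simp_all
  have sum: "(\<Sum>i<S v_coflows 0 0. ev (upd S i4 0 0 i) ?e) = ?load"
    unfolding dr.load_def grid(3) using p g grid by (intro sum.cong) (auto simp: of_bool_def)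
  have load: "?load \<le> sum_L" using p by (intro load_le)
  show "(\<Sum>i<S v_coflows 0 0. ev (upd S i4 0 0 i) ?e) \<le> M" unfolding sum using load sum_L_le_M by simp
  have "10 ^ H * ?load \<le> 10 ^ H * sum_L" using load by (rule mult_le_mono2)
  then have "S a_queue p g + 10 ^ H * ?load \<le> M" using bound by linarith
  then show "wp (Put a_queue (V i2) (V i3) (Arr a_queue (V i2) (V i3) .+ V v_10H .* V v_portsum .- Vec a_time (V i3)))
     (\<lambda>S'. S' a_queue p g = S a_queue p g + 10 ^ H * ?load - dr.T g \<and> (\<forall>p' g'. \<not> (p' = p \<and> g' = g) \<longrightarrow> S' a_queue p' g' = S a_queue p' g'))
     (upd (upd S i4 0 0 (S v_coflows 0 0)) v_portsum 0 0 (\<Sum>i<S v_coflows 0 0. ev (upd S i4 0 0 i) ?e))"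
    unfolding sum using grid p g by simp
  show "S v_coflows 0 0 \<le> Lim" using grid lim_n by simp
qed simp_all

lemma wp_update_queues:
  assumes ok: "grid_ready S" and bound: "\<And>p g. p < 2 * N ==> g < H ==> S a_queue p g + 10 ^ H * sum_L \<le> M"
  shows "wp (Loop i2 v_2N (Loop i3 v_H update_queue))
    (\<lambda>S'. \<forall>p<2*N. \<forall>g<H. S' a_queue p g = S a_queue p g + 10 ^ H * dr.load (\<lambda>k. S a_point k 0) p g - dr.T g) S"
proof -
  have sizes: "S v_2N 0 0 = 2 * N" "S v_H 0 0 = H" using preparedD(6)[OF grid_readyD(1)[OF ok]] grid_readyD(5)[OF ok] by simp_all
  have "wp (Loop i2 v_2N (Loop i3 v_H update_queue)) (\<lambda>S'. \<forall>p<S v_2N 0 0. \<forall>g<S v_H 0 0.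
      S' a_queue p g = S a_queue p g + 10 ^ H * dr.load (\<lambda>k. S a_point k 0) p g - dr.T g) S"
  proof (rule wp_fill)
    fix p g S1
    assume at: "p < S v_2N 0 0" "g < S v_H 0 0" "S1 i2 0 0 = p" "S1 i3 0 0 = g" "S1 a_queue p g = S a_queue p g"
      and frame: "\<And>r. r \<notin> insert i2 (insert i3 (mods update_queue)) ==> S1 r = S r"
    have "grid_ready S1" by (rule grid_ready_frame[OF ok]) (auto simp: frame)
    moreover have "S1 a_point = S a_point" by (simp add: frame)
    ultimately show "wp update_queue (\<lambda>S'. S' a_queue p g = S a_queue p g + 10 ^ H * dr.load (\<lambda>k. S a_point k 0) p g - dr.T g \<and>
        (\<forall>p' g'. \<not> (p' = p \<and> g' = g) \<longrightarrow> S' a_queue p' g' = S1 a_queue p' g')) S1"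
      using wp_update_queue[of S1 p g] at bound[of p g] sizes by simp
  qed (use sizes lim_2N lim_le_H in auto)
  then show ?thesis by (simp add: sizes)
qed

lemma queue_cong:
  assumes "\<And>s' k. s' < s ==> k < n ==> Gs s' k = Gs' s' k"
  shows "dr.queue Gs s = dr.queue Gs' s"
  using assms
proof (induction s)
  case (Suc s)
  have "dr.load (Gs s) p g = dr.load (Gs' s) p g" for p g
    unfolding dr.load_def using Suc.prems by (intro sum.cong) auto
  then show ?case using Suc by simp
qed simp

lemma queue_le: "p < 2 * N ==> dr.queue Gs s p g \<le> s * (10 ^ H * sum_L)"
proof (induction s)
  case (Suc s)
  have "dr.queue Gs s p g + 10 ^ H * dr.load (Gs s) p g \<le> s * (10 ^ H * sum_L) + 10 ^ H * sum_L"
    using Suc load_le[of p] by (intro add_mono mult_le_mono2) auto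
  then show ?case by simp
qed simp

lemma queue_le_A:
  assumes "p < 2 * N" "s < dr.rounds"
  shows "dr.queue Gs s p g + 10 ^ H * sum_L \<le> A ^ 3"
proof -
  have "dr.queue Gs s p g + 10 ^ H * sum_L \<le> Suc s * (10 ^ H * sum_L)" using queue_le[OF assms(1), of Gs s g] by simp
  also have "... \<le> dr.rounds * (10 ^ H * sum_L)" using assms(2) by (intro mult_le_mono1) simp
  also have "... \<le> A ^ (1 + (1 + 1))" by (intro mult_le_A le_A_1 le_A powers_le_A sum_L_le_A)
  finally show ?thesis by (simp add: eval_nat_numeral)
qed

lemma best_cong:
  assumes "\<And>p g. p < 2 * N ==> g < H ==> q p g = q' p g"
  shows "dr.best q k g \<longleftrightarrow> dr.best q' k g"
proof -
  have "dr.cost q k g = dr.cost q' k g" for g unfolding dr.cost_def using assms by simp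
  then show ?thesis by (simp add: dr.best_def)
qed

definition drift_inv :: "nat => (nat => nat => nat) => store => bool" where
  "drift_inv s Gs S \<longleftrightarrow> (\<forall>s'<s. \<forall>k<n. dr.best (dr.queue Gs s') k (Gs s' k)) \<and>
     (\<forall>p<2*N. \<forall>g<H. S a_queue p g = dr.queue Gs s p g) \<and> (\<forall>k<n. \<forall>g<H. S a_hits k g = counts Gs s k g)"

lemma drift_inv_Suc:
  assumes inv: "drift_inv s Gs S"
    and best: "\<forall>k<n. dr.best (S a_queue) k (G k)"
    and hits: "\<forall>k<n. \<forall>g<H. S' a_hits k g = S a_hits k g + of_bool (G k \<le> g)"
    and queue: "\<forall>p<2*N. \<forall>g<H. S' a_queue p g = S a_queue p g + 10 ^ H * dr.load G p g - dr.T g"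
  shows "drift_inv (Suc s) (Gs(s := G)) S'"
proof -
  let ?Gs = "Gs(s := G)"
  have same: "dr.queue ?Gs s' = dr.queue Gs s'" if "s' \<le> s" for s'
    using that by (intro queue_cong) auto
  have q: "S a_queue p g = dr.queue Gs s p g" if "p < 2 * N" "g < H" for p g using inv that by (simp add: drift_inv_def)
  have "dr.best (dr.queue Gs s) k (G k)" if "k < n" for k
    using best that best_cong[of "S a_queue" "dr.queue Gs s" k, OF q] by blast
  then have "dr.best (dr.queue ?Gs s') k (?Gs s' k)" if "s' < Suc s" "k < n" for s' k
    using that inv same[of s'] by (cases "s' = s") (auto simp: drift_inv_def)
  moreover have "S' a_queue p g = dr.queue ?Gs (Suc s) p g" if "p < 2 * N" "g < H" for p g
    using queue that q same[of s] by simp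
  moreover have "S' a_hits k g = counts ?Gs (Suc s) k g" if "k < n" "g < H" for k g
    using hits that inv by (simp add: drift_inv_def counts_def)
  ultimately show ?thesis unfolding drift_inv_def by blast
qed

lemma wp_drift_round:
  assumes ok: "grid_ready S" and s: "s < dr.rounds" and inv: "drift_inv s Gs S"
  shows "wp drift_round (\<lambda>S'. \<exists>G. drift_inv (Suc s) (Gs(s := G)) S') S"
  unfolding drift_round_def
proof (rule wp_seq[OF wp_choose_points[OF ok]])
  have queue: "S a_queue p g + 10 ^ H * sum_L \<le> A ^ 3" if "p < 2 * N" "g < H" for p g
    using queue_le_A[OF that(1) s, of Gs g] inv that by (simp add: drift_inv_def)
  then show "queue_bounded (S a_queue)" unfolding queue_bounded_def using add_leD1 by blast
  fix S1
  assume best: "\<forall>k<n. dr.best (S a_queue) k (S1 a_point k 0)" and frame1: "\<And>r. r \<notin> mods (Loop i2 v_coflows choose_point) ==> S1 r = S r"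
  have ok1: "grid_ready S1" by (rule grid_ready_frame[OF ok]) (auto simp: frame1)
  show "wp (count_points ;; Loop i2 v_2N (Loop i3 v_H update_queue)) (\<lambda>S'. \<exists>G. drift_inv (Suc s) (Gs(s := G)) S') S1"
  proof (rule wp_seq[OF wp_count_points[where S = S1, OF ok1]])
    show "S1 a_hits k g < dr.rounds" if "k < n" "g < H" for k g
      using counts_le[of Gs s k g] s inv that by (simp add: drift_inv_def frame1)
    fix S2
    assume hits: "\<forall>k<n. \<forall>g<H. S2 a_hits k g = S1 a_hits k g + of_bool (S1 a_point k 0 \<le> g)"
      and frame2: "\<And>r. r \<notin> mods count_points ==> S2 r = S1 r"
    have "grid_ready S2" by (rule grid_ready_frame[OF ok1]) (auto simp: frame2)
    then show "wp (Loop i2 v_2N (Loop i3 v_H update_queue)) (\<lambda>S'. \<exists>G. drift_inv (Suc s) (Gs(s := G)) S') S2"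
    proof (rule wp_mono[OF wp_update_queues[where S = S2]])
      show "S2 a_queue p g + 10 ^ H * sum_L \<le> M" if "p < 2 * N" "g < H" for p g
        using le_M[OF queue[OF that]] by (simp add: frame2 frame1)
      fix S3
      assume "\<forall>p<2*N. \<forall>g<H. S3 a_queue p g = S2 a_queue p g + 10 ^ H * dr.load (\<lambda>k. S2 a_point k 0) p g - dr.T g"
        and "\<And>r. r \<notin> mods (Loop i2 v_2N (Loop i3 v_H update_queue)) ==> S3 r = S2 r"
      then have "drift_inv (Suc s) (Gs(s := \<lambda>k. S1 a_point k 0)) S3"
        using hits by (intro drift_inv_Suc[OF inv best]) (simp_all add: frame2 frame1)
      then show "\<exists>G. drift_inv (Suc s) (Gs(s := G)) S3" by blast
    qed
  qed
qed

lemma wp_run_drift: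
  assumes ok: "grid_ready S" and start: "S a_queue = (\<lambda>_ _. 0)" "S a_hits = (\<lambda>_ _. 0)"
  shows "wp run_drift (\<lambda>S'. \<exists>Gs. dr.greedy Gs \<and> (\<forall>k<n. \<forall>g<H. S' a_hits k g = dr.hits Gs k g)) S"
  unfolding run_drift_def
proof (rule wp_Loop[where Inv = "\<lambda>s S'. \<exists>Gs. drift_inv s Gs S'"])
  have rounds: "S v_rounds 0 0 = dr.rounds" by (rule grid_readyD(8)[OF ok])
  then show "S v_rounds 0 0 \<le> Lim" using lim_rounds by simp
  show "\<exists>Gs. drift_inv 0 Gs (upd S i1 0 0 0)" using start by (simp add: drift_inv_def counts_def)
  have same: "drift_inv s Gs (upd S' i1 0 0 x) = drift_inv s Gs S'" for s Gs S' x
    by (simp add: drift_inv_def)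
  fix s S1
  assume s: "s < S v_rounds 0 0" and "\<exists>Gs. drift_inv s Gs S1" and frame: "\<And>r. r \<noteq> i1 ==> r \<notin> mods drift_round ==> S1 r = S r"
  then obtain Gs where inv: "drift_inv s Gs S1" by blast
  have "grid_ready S1" by (rule grid_ready_frame[OF ok]) (auto simp: frame)
  then have "wp drift_round (\<lambda>S'. \<exists>G. drift_inv (Suc s) (Gs(s := G)) S') S1"
    using s rounds inv by (intro wp_drift_round) simp_all
  then show "wp drift_round (\<lambda>S'. \<exists>Gs'. drift_inv (Suc s) Gs' (upd S' i1 0 0 (Suc s))) S1"
    by (rule wp_mono) (auto simp: same)
next
  fix S1
  assume "\<exists>Gs. drift_inv (S v_rounds 0 0) Gs S1"
  then show "\<exists>Gs. dr.greedy Gs \<and> (\<forall>k<n. \<forall>g<H. S1 a_hits k g = dr.hits Gs k g)"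
    unfolding grid_readyD(8)[OF ok] by (auto simp: drift_inv_def counts_def dr.hits_def dr.greedy_def)
qed auto

end
section \<open>The program: colouring the edges of an interval\<close>

abbreviation "a_in == 178::nat"
abbreviation "a_out == 179::nat"
abbreviation "v_slots == 180::nat"
abbreviation "v_a == 181::nat"
abbreviation "v_b == 182::nat"
abbreviation "v_active == 183::nat"
abbreviation "v_in == 184::nat"
abbreviation "v_label == 185::nat"
abbreviation "v_out == 186::nat"
abbreviation "v_old == 187::nat"
abbreviation "v_in2 == 188::nat"
abbreviation "v_label2 == 189::nat"
abbreviation "v_k == 190::nat"

definition chain_move :: prog where
  "chain_move =
    v_out :=: Mod (V v_label) (V v_ports) ;;
    Test (Arr a_out (V v_out) (V v_a))
     (v_in2 :=: Arr a_out (V v_out) (V v_a) .- Cn 1 ;;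
      v_old :=: Arr a_in (V v_in2) (V v_a) ;; v_label2 :=: Arr a_in (V v_in2) (V v_b) ;;
      Put a_in (V v_in) (V v_a) (V v_label .+ Cn 1) ;; Put a_in (V v_in2) (V v_a) (Cn 0) ;; Put a_in (V v_in2) (V v_b) (V v_old) ;;
      Put a_out (V v_out) (V v_a) (V v_in .+ Cn 1) ;; Put a_out (V v_out) (V v_b) (V v_in2 .+ Cn 1) ;;
      Test (V v_label2)
       (v_label :=: V v_label2 .- Cn 1 ;; v_in :=: V v_in2 ;; Put a_out (Mod (V v_label) (V v_ports)) (V v_b) (Cn 0))
       (v_active :=: Cn 0))
     (Put a_in (V v_in) (V v_a) (V v_label .+ Cn 1) ;; Put a_out (V v_out) (V v_a) (V v_in .+ Cn 1) ;; v_active :=: Cn 0)"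

definition find_free :: "nat => nat => nat => prog" where
  "find_free c arr x = Loop i5 v_K (Test (Arr arr (V x) (V i5)) Skp (c :=: V i5))"

definition insert_edge :: prog where
  "insert_edge = find_free v_a a_in i2 ;; find_free v_b a_out v_dst ;;
    v_in :=: V i2 ;; v_label :=: V i3 ;; v_active :=: Cn 1 ;; Loop i5 v_ports (Test (V v_active) chain_move Skp)"

definition colour_edge :: prog where
  "colour_edge =
    v_k :=: V i3 \<oslash> V v_ports ;; v_dst :=: Mod (V i3) (V v_ports) ;;
    v_slots :=: (Cn 10 .* V v_Nn .* Arr a_demand (V v_k) (V i2 .* V v_ports .+ V v_dst) .* Arr a_hits (V v_k) (V i1) .* V v_10H .+
       (V v_rounds .* Vec a_time (V i1) .- Cn 1)) \<oslash> (V v_rounds .* Vec a_time (V i1)) ;;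
    Loop i4 v_slots insert_edge"

definition clear_array :: "nat => prog" where
  "clear_array arr = Loop i2 v_ports (Loop i3 v_K (Put arr (V i2) (V i3) (Cn 0)))"

definition colour_all :: prog where
  "colour_all = clear_array a_in ;; clear_array a_out ;; Loop i2 v_ports (Loop i3 v_Nn colour_edge)"

abbreviation "chain_names == {v_out, v_in2, v_old, v_label2, a_in, a_out, v_label, v_in, v_active}"

lemma mods_colour [simp]:
  "mods chain_move = chain_names"
  "mods (find_free c arr x) = {i5, c}"
  "mods insert_edge = {i5, v_a, v_b} \<union> chain_names"
  "mods colour_edge = {v_k, v_dst, v_slots, i4, i5, v_a, v_b} \<union> chain_names"
  "mods (clear_array arr) = {i2, i3, arr}"
  "mods colour_all = {i2, i3, v_k, v_dst, v_slots, i4, i5, v_a, v_b} \<union> chain_names"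
  by (auto simp: chain_move_def find_free_def insert_edge_def colour_edge_def clear_array_def colour_all_def)

context bounded_run
begin

sublocale col: colouring N K
  by unfold_locales (rule N_pos)

lemma nN_le_M: "n * N \<le> M"
  using Nn_le_M by (simp add: mult.commute)

definition "labels_ok S \<longleftrightarrow> (\<forall>i<N. \<forall>c<K. S a_in i c \<le> n * N)"

definition "chaining a b A0 i0 l0 s S \<longleftrightarrow> labels_ok S \<and>
   (if S v_active 0 0 = 0 then col.inserted A0 i0 l0 (S a_in) (S a_out)
    else S v_label 0 0 < n * N \<and> col.chain a b A0 i0 l0 s (S a_in) (S a_out) (S v_in 0 0) (S v_label 0 0))"

lemma chaining_cong: "chaining a b A0 i0 l0 s S ==> (\<And>r. r \<in> chain_names ==> S' r = S r) ==> chaining a b A0 i0 l0 s S'"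
  by (simp add: chaining_def labels_ok_def)

lemma chaining_inserted:
  assumes "col.inserted A0 i0 l0 A' R'" "S v_active 0 0 = 0" "\<And>i c. S a_in i c = A' i c" "\<And>j c. S a_out j c = R' j c"
    and "\<And>i c. i < N ==> c < K ==> A' i c \<le> n * N"
  shows "chaining a b A0 i0 l0 s S"
proof -
  have "S a_in = A'" "S a_out = R'" using assms by (auto simp: fun_eq_iff)
  then show ?thesis using assms by (simp add: chaining_def labels_ok_def)
qed

lemma chaining_next:
  assumes "col.chain a b A0 i0 l0 s A' R' i l" "l < n * N" "S v_active 0 0 \<noteq> 0" "S v_in 0 0 = i" "S v_label 0 0 = l"
    and "\<And>i c. S a_in i c = A' i c" "\<And>j c. S a_out j c = R' j c"
    and "\<And>i c. i < N ==> c < K ==> A' i c \<le> n * N"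
  shows "chaining a b A0 i0 l0 s S"
proof -
  have "S a_in = A'" "S a_out = R'" using assms by (auto simp: fun_eq_iff)
  then show ?thesis using assms by (simp add: chaining_def labels_ok_def)
qed

lemma wp_chain_move:
  assumes chaining: "chaining a b A0 i0 l0 s S" and active: "S v_active 0 0 \<noteq> 0"
    and at: "S v_ports 0 0 = N" "S v_a 0 0 = a" "S v_b 0 0 = b" and colours_less: "a < K" "b < K"
  shows "wp chain_move (chaining a b A0 i0 l0 (Suc s)) S"
proof -
  define i l where "i = S v_in 0 0" and "l = S v_label 0 0"
  let ?A = "S a_in" and ?R = "S a_out"
  have l: "l < n * N" and chain: "col.chain a b A0 i0 l0 s ?A ?R i l" and labels: "x < N ==> c < K ==> ?A x c \<le> n * N" for x c
    using chaining active by (auto simp: chaining_def labels_ok_def i_def l_def)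
  have i: "i < N" using chain by (simp add: col.chain_def)
  have le: "Suc l \<le> M" "Suc i \<le> M" "l mod N \<le> M"
    using l i nN_le_M N_le_M mod_less_divisor[of N l] N_pos by linarith+
  have entry_le: "?A x c \<le> M" if "x < N" "c < K" for x c
    using labels[OF that] nN_le_M by simp
  note facts = at active le labels colours_less l i_def[symmetric] l_def[symmetric] chain_move_def
  consider (output_free) "?R (l mod N) a = 0" | (input_free) i' where "?R (l mod N) a = Suc i'" "?A i' b = 0"
    | (both_used) i' l' where "?R (l mod N) a = Suc i'" "?A i' b = Suc l'"
    by (metis old.nat.exhaust)
  then show ?thesis
  proof cases
    case output_free
    then show ?thesis
      by (simp add: facts) (rule chaining_inserted[OF col.chain_end_output[OF chain colours_less output_free]], use facts in \<open>auto simp: Suc_leI\<close>)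
  next
    case input_free
    note next_input = col.chain_next_input[OF chain colours_less input_free(1)]
    have "Suc i' \<le> M" "?A i' a \<le> M" using next_input(2) N_le_M entry_le[of i' a] colours_less by simp_all
    then show ?thesis
      using input_free next_input by (simp add: facts)
        (rule chaining_inserted[OF col.chain_end_input[OF chain colours_less input_free]], use facts in \<open>auto simp: Suc_leI col.swap_inputs_def col.swap_outputs_def\<close>)
  next
    case both_used
    note next_input = col.chain_next_input[OF chain colours_less both_used(1)]
    have "Suc i' \<le> M" "?A i' a \<le> M" using next_input(2) N_le_M entry_le[of i' a] colours_less by simp_all
    moreover have "l' < n * N" "Suc l' \<le> M" using labels[of i' b] entry_le[of i' b] both_used(2) next_input(2) colours_less by simp_all
    ultimately show ?thesis
      using both_used next_input by (simp add: facts)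
        (rule chaining_next[OF col.chain_next[OF chain colours_less both_used]], use facts in \<open>auto simp: Suc_leI col.swap_inputs_def col.swap_outputs_def\<close>)
  qed
qed

lemma wp_find_free:
  assumes free: "card {c. c < K \<and> S arr x c \<noteq> 0} < K" and at: "S v_K 0 0 = K" "S v 0 0 = x"
    and fresh: "d \<notin> {i5, v_K, v, arr}" "v \<noteq> i5" "arr \<noteq> i5"
  shows "wp (find_free d arr v) (\<lambda>S'. S' d 0 0 < K \<and> S arr x (S' d 0 0) = 0) S"
  unfolding find_free_def
proof (rule wp_Loop[where Inv = "\<lambda>i S'. (\<exists>c<i. S arr x c = 0) \<longrightarrow> S' d 0 0 < i \<and> S arr x (S' d 0 0) = 0"])
  show "S v_K 0 0 \<le> Lim" using at lim_K by simp
  fix c S1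
  let ?b = "Test (Arr arr (V v) (V i5)) Skp (d :=: V i5)"
  assume "c < S v_K 0 0" and "(\<exists>c'<c. S arr x c' = 0) \<longrightarrow> S1 d 0 0 < c \<and> S arr x (S1 d 0 0) = 0" "S1 i5 0 0 = c"
    and frame: "\<And>r. r \<noteq> i5 ==> r \<notin> mods ?b ==> S1 r = S r"
  moreover have "S1 arr = S arr" "S1 v = S v" using frame fresh by auto
  ultimately show "wp ?b (\<lambda>S'. (\<exists>c'<Suc c. S arr x c' = 0) \<longrightarrow> upd S' i5 0 0 (Suc c) d 0 0 < Suc c \<and>
      S arr x (upd S' i5 0 0 (Suc c) d 0 0) = 0) S1"
    using at K_le_M fresh by (auto simp: less_Suc_eq)
next
  fix S1
  assume found: "(\<exists>c<S v_K 0 0. S arr x c = 0) \<longrightarrow> S1 d 0 0 < S v_K 0 0 \<and> S arr x (S1 d 0 0) = 0"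
  have "\<exists>c<K. S arr x c = 0"
  proof (rule ccontr)
    assume "\<not> ?thesis"
    then have "{c. c < K \<and> S arr x c \<noteq> 0} = {..<K}" by auto
    then show False using free by simp
  qed
  then show "S1 d 0 0 < K \<and> S arr x (S1 d 0 0) = 0" using found at by simp
qed (use fresh in auto)

definition "edge_inserted A0 i0 l0 S \<longleftrightarrow> labels_ok S \<and> col.inserted A0 i0 l0 (S a_in) (S a_out)"

lemma wp_chain:
  assumes start: "chaining a b A0 i0 l0 0 S" and at: "S v_ports 0 0 = N" "S v_a 0 0 = a" "S v_b 0 0 = b" and colours_less: "a < K" "b < K"
  shows "wp (Loop i5 v_ports (Test (V v_active) chain_move Skp)) (edge_inserted A0 i0 l0) S"
proof (rule wp_Loop[where Inv = "chaining a b A0 i0 l0"])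
  show "chaining a b A0 i0 l0 0 (upd S i5 0 0 0)" by (rule chaining_cong[OF start]) auto
  fix s S1
  assume chaining: "chaining a b A0 i0 l0 s S1" and frame: "\<And>r. r \<noteq> i5 ==> r \<notin> mods (Test (V v_active) chain_move Skp) ==> S1 r = S r"
  show "wp (Test (V v_active) chain_move Skp) (\<lambda>S'. chaining a b A0 i0 l0 (Suc s) (upd S' i5 0 0 (Suc s))) S1"
  proof (cases "S1 v_active 0 0 = 0")
    case True
    then show ?thesis using chaining by (simp add: chaining_def labels_ok_def)
  next
    case False
    then have "wp chain_move (chaining a b A0 i0 l0 (Suc s)) S1"
      using chaining at colours_less by (intro wp_chain_move) (simp_all add: frame)
    then have "wp chain_move (\<lambda>S'. chaining a b A0 i0 l0 (Suc s) (upd S' i5 0 0 (Suc s))) S1"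
      by (rule wp_mono) (erule chaining_cong, auto)
    then show ?thesis using False by simp
  qed
next
  fix S1
  assume "chaining a b A0 i0 l0 (S v_ports 0 0) S1"
  then show "edge_inserted A0 i0 l0 S1"
    using at(1) col.chain_less[of a b A0 i0 l0 N] by (auto simp: chaining_def edge_inserted_def split: if_splits)
qed (use at lim_N in auto)

lemma wp_insert_edge:
  assumes proper: "col.proper (S a_in) (S a_out)" "labels_ok S"
    and at: "S v_K 0 0 = K" "S v_ports 0 0 = N" "S i2 0 0 = i" "S i3 0 0 = l" "S v_dst 0 0 = l mod N" "i < N" "l < n * N"
    and free: "card {c. c < K \<and> S a_in i c \<noteq> 0} < K" "card {c. c < K \<and> S a_out (l mod N) c \<noteq> 0} < K"
  shows "wp insert_edge (edge_inserted (S a_in) i l) S"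
  unfolding insert_edge_def
proof (rule wp_seq[OF wp_find_free[where x = i]])
  fix S1
  assume a: "S1 v_a 0 0 < K \<and> S a_in i (S1 v_a 0 0) = 0" and frame1: "\<And>r. r \<notin> mods (find_free v_a a_in i2) ==> S1 r = S r"
  show "wp (find_free v_b a_out v_dst ;; v_in :=: V i2 ;; v_label :=: V i3 ;; v_active :=: Cn 1 ;;
      Loop i5 v_ports (Test (V v_active) chain_move Skp)) (edge_inserted (S a_in) i l) S1"
  proof (rule wp_seq[OF wp_find_free[where x = "l mod N"]])
    fix S2
    assume b: "S2 v_b 0 0 < K \<and> S1 a_out (l mod N) (S2 v_b 0 0) = 0" and frame2: "\<And>r. r \<notin> mods (find_free v_b a_out v_dst) ==> S2 r = S1 r"
    let ?S = "upd (upd (upd S2 v_in 0 0 i) v_label 0 0 l) v_active 0 0 1"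
    have "col.chain (S1 v_a 0 0) (S2 v_b 0 0) (S a_in) i l 0 (S a_in) (S a_out) i l"
      using proper at a b by (intro col.chain_start) (simp_all add: frame1)
    then have "chaining (S1 v_a 0 0) (S2 v_b 0 0) (S a_in) i l 0 ?S"
      using proper at by (simp add: chaining_def labels_ok_def frame2 frame1)
    then have "wp (Loop i5 v_ports (Test (V v_active) chain_move Skp)) (edge_inserted (S a_in) i l) ?S"
      by (rule wp_chain) (use a b at in \<open>simp_all add: frame2 frame1\<close>)
    then show "wp (v_in :=: V i2 ;; v_label :=: V i3 ;; v_active :=: Cn 1 ;; Loop i5 v_ports (Test (V v_active) chain_move Skp))
        (edge_inserted (S a_in) i l) S2"
      using at N_le_M nN_le_M one_le_M by (simp add: frame2 frame1)
  qed (use at free in \<open>simp_all add: frame1\<close>)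
qed (use at free in simp_all)

definition "coloured w S \<longleftrightarrow> col.proper (S a_in) (S a_out) \<and> labels_ok S \<and> (\<forall>i<N. \<forall>l. col.colours (S a_in) i l = w i l)"

lemma coloured_cong:
  assumes "coloured w S" "\<And>i l. i < N ==> w i l = w' i l" "S' a_in = S a_in" "S' a_out = S a_out"
  shows "coloured w' S'"
  using assms by (simp add: coloured_def labels_ok_def)

lemma no_colours:
  assumes "labels_ok S" "i < N" "n * N \<le> l"
  shows "col.colours (S a_in) i l = 0"
proof -
  have "S a_in i c \<noteq> Suc l" if "c < K" for c
    using assms that unfolding labels_ok_def by (metis Suc_n_not_le_n order_trans)
  then show ?thesis by (simp add: col.colours_def)
qed

lemma free_colours:
  assumes coloured: "coloured w S" and le: "\<And>i l. i < N ==> w i l \<le> w' i l" and less: "w i l < w' i l" and edge: "i < N" "l < n * N"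
    and degree: "(\<Sum>l<n * N. w' i l) \<le> K" "(\<Sum>i<N. \<Sum>l' | l' < n * N \<and> l' mod N = l mod N. w' i l') \<le> K"
  shows "card {c. c < K \<and> S a_in i c \<noteq> 0} < K" "card {c. c < K \<and> S a_out (l mod N) c \<noteq> 0} < K"
proof -
  have proper: "col.proper (S a_in) (S a_out)" "labels_ok S" and w: "\<And>i l. i < N ==> col.colours (S a_in) i l = w i l"
    using coloured by (auto simp: coloured_def)
  have "(\<Sum>l<n * N. w i l) < (\<Sum>l<n * N. w' i l)"
    using edge le less by (intro sum_strict_mono_ex1) auto
  then show "card {c. c < K \<and> S a_in i c \<noteq> 0} < K"
    using degree(1) col.used_at_input[of "n * N" "S a_in" i, OF no_colours[OF proper(2) edge(1)]] w edge by simp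
  have "(\<Sum>l' | l' < n * N \<and> l' mod N = l mod N. w i l') < (\<Sum>l' | l' < n * N \<and> l' mod N = l mod N. w' i l')"
    using edge le less by (intro sum_strict_mono_ex1) auto
  then have "(\<Sum>i<N. \<Sum>l' | l' < n * N \<and> l' mod N = l mod N. w i l') < (\<Sum>i<N. \<Sum>l' | l' < n * N \<and> l' mod N = l mod N. w' i l')"
    using edge le by (intro sum_strict_mono_ex1) (auto intro!: sum_mono)
  then show "card {c. c < K \<and> S a_out (l mod N) c \<noteq> 0} < K"
    using degree(2) col.used_at_output[of "S a_in" "S a_out" "l mod N" "n * N", OF proper(1) _ no_colours[OF proper(2)]] w N_pos
    by simp
qed

lemma wp_insert_coloured:
  assumes coloured: "coloured w S" and le: "\<And>i l. i < N ==> w i l \<le> w' i l" and less: "w i l < w' i l"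
    and at: "S v_K 0 0 = K" "S v_ports 0 0 = N" "S i2 0 0 = i" "S i3 0 0 = l" "S v_dst 0 0 = l mod N" "i < N" "l < n * N"
    and degree: "(\<Sum>l<n * N. w' i l) \<le> K" "(\<Sum>i<N. \<Sum>l' | l' < n * N \<and> l' mod N = l mod N. w' i l') \<le> K"
  shows "wp insert_edge (coloured (\<lambda>i' l'. w i' l' + of_bool (i' = i \<and> l' = l))) S"
proof -
  have "wp insert_edge (edge_inserted (S a_in) i l) S"
    by (rule wp_insert_edge[OF _ _ at free_colours[OF coloured le less at(6,7) degree]]) (use coloured in \<open>simp_all add: coloured_def\<close>)
  then show ?thesis
    by (rule wp_mono) (use coloured in \<open>auto simp: coloured_def edge_inserted_def col.inserted_def\<close>)
qed

definition "drifted Gs S \<longleftrightarrow> grid_ready S \<and> (\<forall>k<n. \<forall>g<H. S a_hits k g = dr.hits Gs k g)"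

lemma drifted_frame:
  assumes "drifted Gs S" "\<And>r. r \<in> insert a_hits grid_names ==> S' r = S r"
  shows "drifted Gs S'"
  using assms grid_ready_frame[of S S'] by (simp add: drifted_def)

lemma driftedD:
  assumes "drifted Gs S"
  shows "grid_ready S" "prepared S" "S v_ports 0 0 = N" "S v_K 0 0 = K" "S v_Nn 0 0 = N * n"
  using assms grid_readyD[of S] preparedD[of S] by (simp_all add: drifted_def)

context
  fixes Gs :: "nat => nat => nat"
  assumes greedy: "dr.greedy Gs"
begin

lemma wp_colour_edge:
  assumes drifted: "drifted Gs S" and g: "S i1 0 0 = g" "g < H" and i: "S i2 0 0 = i" "i < N" and l: "S i3 0 0 = l" "l < n * N"
    and coloured: "coloured w S" and w: "w i l = 0" "\<And>i l. i < N ==> w i l \<le> edge_slots Gs g i l"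
  shows "wp colour_edge (coloured (\<lambda>i' l'. if i' = i \<and> l' = l then edge_slots Gs g i l else w i' l')) S"
    (is "wp _ (coloured ?w') S")
proof -
  define k j where "k = l div N" and "j = l mod N"
  have flow_less: "k < n" "j < N" using l N_pos by (simp_all add: k_def j_def less_mult_imp_div_less)
  have grid: "S v_10H 0 0 = 10 ^ H" "S v_rounds 0 0 = dr.rounds" "S a_time g 0 = dr.T g" "S a_hits k g = dr.hits Gs k g"
      "S a_demand k (i * N + j) = dd i j k"
    using drifted grid_readyD[OF driftedD(1)[OF drifted]] preparedD(10)[OF driftedD(2)[OF drifted]] g i flow_less by (simp_all add: drifted_def)
  let ?s = "edge_slots Gs g i l"
  have slots: "ceil_div (10 * (N * n) * dd i j k * dr.hits Gs k g * 10 ^ H) (dr.rounds * dr.T g) = ?s"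
    using l by (simp add: edge_slots_def slots_def k_def j_def)
  have s: "?s \<le> K" by (rule edge_slots_le[OF greedy g(2) i(2) l(2)])
  let ?S = "upd (upd (upd S v_k 0 0 k) v_dst 0 0 j) v_slots 0 0 ?s"
  let ?Inv = "\<lambda>c. coloured (\<lambda>i' l'. w i' l' + (if i' = i \<and> l' = l then c else 0))"
  have "wp (Loop i4 v_slots insert_edge) (coloured ?w') ?S"
  proof (rule wp_Loop[where Inv = ?Inv])
    show "?S v_slots 0 0 \<le> Lim" using s lim_K by simp
    show "?Inv 0 (upd ?S i4 0 0 0)" by (rule coloured_cong[OF coloured]) auto
    show "coloured ?w' S1" if "?Inv (?S v_slots 0 0) S1" for S1
      using that by (rule coloured_cong) (use w(1) in auto)
    fix c S1
    assume c: "c < ?S v_slots 0 0" and inv: "?Inv c S1" and frame: "\<And>r. r \<noteq> i4 ==> r \<notin> mods insert_edge ==> S1 r = ?S r"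
    have "wp insert_edge (coloured (\<lambda>i' l'. w i' l' + (if i' = i \<and> l' = l then c else 0) + of_bool (i' = i \<and> l' = l))) S1"
    proof (rule wp_insert_coloured[OF inv])
      show "(\<Sum>l<n * N. edge_slots Gs g i l) \<le> K" by (rule input_degree[OF greedy g(2) i(2)])
      show "(\<Sum>i<N. \<Sum>l' | l' < n * N \<and> l' mod N = l mod N. edge_slots Gs g i l') \<le> K"
        using output_degree[OF greedy g(2) flow_less(2)] by (simp only: j_def)
    qed (use c w driftedD(3,4)[OF drifted] i l in \<open>auto simp: frame j_def\<close>)
    then show "wp insert_edge (\<lambda>S'. ?Inv (Suc c) (upd S' i4 0 0 (Suc c))) S1"
      by (rule wp_mono) (erule coloured_cong, auto)
  qed auto
  moreover have "k \<le> M" "j \<le> M" "?s \<le> M" using flow_less n_le_M N_le_M s K_le_M by linarith+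
  ultimately show ?thesis
    using grid driftedD(3,5)[OF drifted] g i l slots
    by (simp add: colour_edge_def ceil_div_def flip: k_def j_def)
qed

lemma wp_clear_array:
  assumes drifted: "drifted Gs S" and arr: "arr \<notin> {i2, i3, v_ports, v_K}"
  shows "wp (clear_array arr) (\<lambda>S'. \<forall>i<N. \<forall>c<K. S' arr i c = 0) S"
proof -
  have "wp (clear_array arr) (\<lambda>S'. \<forall>i<S v_ports 0 0. \<forall>c<S v_K 0 0. S' arr i c = 0) S"
    unfolding clear_array_def by (rule wp_fill) (use arr driftedD(3,4)[OF drifted] lim_N lim_K in auto)
  then show ?thesis by (simp add: driftedD(3,4)[OF drifted])
qed

lemma wp_colour_inputs:
  assumes drifted: "drifted Gs S" and g: "S i1 0 0 = g" "g < H" and coloured: "coloured (\<lambda>_ _. 0) S"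
  shows "wp (Loop i2 v_ports (Loop i3 v_Nn colour_edge)) (coloured (edge_slots Gs g)) S"
proof -
  let ?before = "\<lambda>i l. coloured (\<lambda>i' l'. if i' < i \<or> i' = i \<and> l' < l then edge_slots Gs g i' l' else 0)"
  show ?thesis
  proof (rule wp_Loop[where Inv = "\<lambda>i. ?before i 0"])
    show "S v_ports 0 0 \<le> Lim" using driftedD(3)[OF drifted] lim_N by simp
    show "?before 0 0 (upd S i2 0 0 0)" by (rule coloured_cong[OF coloured]) auto
    show "coloured (edge_slots Gs g) S1" if "?before (S v_ports 0 0) 0 S1" for S1
      using that by (rule coloured_cong) (use driftedD(3)[OF drifted] in auto)
    fix i S1
    assume "i < S v_ports 0 0" and inv1: "?before i 0 S1" and i2: "S1 i2 0 0 = i"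
      and frame1: "\<And>r. r \<noteq> i2 ==> r \<notin> mods (Loop i3 v_Nn colour_edge) ==> S1 r = S r"
    then have i: "i < N" using driftedD(3)[OF drifted] by simp
    have drifted1: "drifted Gs S1" by (rule drifted_frame[OF drifted]) (auto simp: frame1)
    show "wp (Loop i3 v_Nn colour_edge) (\<lambda>S'. ?before (Suc i) 0 (upd S' i2 0 0 (Suc i))) S1"
    proof (rule wp_Loop[where Inv = "?before i"])
      show "S1 v_Nn 0 0 \<le> Lim" using driftedD(5)[OF drifted1] lim_Nn by simp
      show "?before i 0 (upd S1 i3 0 0 0)" by (rule coloured_cong[OF inv1]) auto
      show "?before (Suc i) 0 (upd S2 i2 0 0 (Suc i))" if "?before i (S1 v_Nn 0 0) S2" for S2
        using that by (rule coloured_cong) (use driftedD(5)[OF drifted1] in \<open>auto simp: edge_slots_def less_Suc_eq mult.commute\<close>)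
      fix l S2
      assume "l < S1 v_Nn 0 0" and inv2: "?before i l S2" and i3: "S2 i3 0 0 = l"
        and frame2: "\<And>r. r \<noteq> i3 ==> r \<notin> mods colour_edge ==> S2 r = S1 r"
      then have l: "l < n * N" using driftedD(5)[OF drifted1] by (simp add: mult.commute)
      have drifted2: "drifted Gs S2" by (rule drifted_frame[OF drifted1]) (auto simp: frame2)
      have at: "S2 i1 0 0 = g" "S2 i2 0 0 = i" using g i2 by (simp_all add: frame2 frame1)
      show "wp colour_edge (\<lambda>S'. ?before i (Suc l) (upd S' i3 0 0 (Suc l))) S2"
        by (rule wp_mono[OF wp_colour_edge[where S = S2, OF drifted2 at(1) g(2) at(2) i i3 l inv2]]) (auto elim!: coloured_cong simp: less_Suc_eq)
    qed auto
  qed auto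
qed

lemma wp_colour_all:
  assumes drifted: "drifted Gs S" and g: "S i1 0 0 = g" "g < H"
  shows "wp colour_all (coloured (edge_slots Gs g)) S"
  unfolding colour_all_def
proof (rule wp_seq[OF wp_clear_array[OF drifted]])
  fix S1
  assume in_clear: "\<forall>i<N. \<forall>c<K. S1 a_in i c = 0" and frame1: "\<And>r. r \<notin> mods (clear_array a_in) ==> S1 r = S r"
  have drifted1: "drifted Gs S1" by (rule drifted_frame[OF drifted]) (auto simp: frame1)
  show "wp (clear_array a_out ;; Loop i2 v_ports (Loop i3 v_Nn colour_edge)) (coloured (edge_slots Gs g)) S1"
  proof (rule wp_seq[OF wp_clear_array[OF drifted1]])
    fix S2
    assume out_clear: "\<forall>j<N. \<forall>c<K. S2 a_out j c = 0" and frame2: "\<And>r. r \<notin> mods (clear_array a_out) ==> S2 r = S1 r"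
    have drifted2: "drifted Gs S2" by (rule drifted_frame[OF drifted1]) (auto simp: frame2)
    have "coloured (\<lambda>_ _. 0) S2"
      using in_clear out_clear by (simp add: coloured_def labels_ok_def col.proper_def col.colours_def frame2)
    then show "wp (Loop i2 v_ports (Loop i3 v_Nn colour_edge)) (coloured (edge_slots Gs g)) S2"
      using g by (intro wp_colour_inputs[OF drifted2]) (simp_all add: frame2 frame1)
  qed simp
qed simp

end

end
section \<open>The program: transmitting along the colours\<close>

abbreviation "a_left == 191::nat"
abbreviation "v_amount == 192::nat"
abbreviation "v_X == 193::nat"

definition send_amount :: prog where
  "send_amount = Test (V v_amount)
       (emit (Cn 0) (V i3) (V v_dst) (V v_k) ((Cn 10 .* V v_K .+ V i2) .* Vec a_time (V i1))
          ((Cn 10 .* V v_K .+ V i2) .* Vec a_time (V i1) .+ V v_amount) ;;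
        Put a_left (V v_k) (V i3 .* V v_ports .+ V v_dst) (Arr a_left (V v_k) (V i3 .* V v_ports .+ V v_dst) .- V v_amount)) Skp"

definition use_slot :: prog where
  "use_slot = Test (Arr a_in (V i3) (V i2))
     (v_label :=: Arr a_in (V i3) (V i2) .- Cn 1 ;; v_k :=: V v_label \<oslash> V v_ports ;; v_dst :=: Mod (V v_label) (V v_ports) ;;
      v_amount :=: Arr a_left (V v_k) (V i3 .* V v_ports .+ V v_dst) ;;
      Test (V v_amount .- Vec a_time (V i1)) (v_amount :=: Vec a_time (V i1)) Skp ;;
      send_amount) Skp"

definition use_interval :: prog where
  "use_interval = colour_all ;; Loop i2 v_K (Loop i3 v_ports use_slot)"

definition fill_left :: prog where
  "fill_left = Loop i1 v_coflows (Loop i2 v_pairs (Put a_left (V i1) (V i2) (Arr a_demand (V i1) (V i2) .* V v_X)))"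

definition send_all :: prog where
  "send_all = v_X :=: Cn 10 .* V v_K .* V v_10H ;; fill_left ;; Loop i1 v_H use_interval ;; v_den :=: V v_D .* V v_X"

definition single_core :: prog where
  "single_core = prepare_grid ;; run_drift ;; send_all"

lemma mods_send [simp]:
  "mods send_amount = insert a_left period_names"
  "mods use_slot = {v_label, v_k, v_dst, v_amount, a_left} \<union> period_names"
  "mods use_interval = {i2, i3} \<union> mods colour_all \<union> mods use_slot"
  "mods fill_left = {i1, i2, a_left}"
  by (auto simp: send_amount_def use_slot_def use_interval_def fill_left_def)

lemma flat_inj: "j < N ==> j' < N ==> i * N + j = i' * N + j' \<longleftrightarrow> i = i' \<and> j = j'" for i j i' j' N :: nat
  using flat_eq_iff[of j N i "i' * N + j'"] by simp

context bounded_run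
begin

definition used_slots :: "(nat => nat => nat) => nat => nat => nat => nat => nat" where
  "used_slots A' c i i' l = card {c'. (c' < c \<or> c' = c \<and> i' < i) \<and> A' i' c' = Suc l}"

lemma used_slots_Suc: "used_slots A' c (Suc i) i' l = used_slots A' c i i' l + of_bool (i' = i \<and> A' i' c = Suc l)"
proof -
  have "{c'. (c' < c \<or> c' = c \<and> i' < Suc i) \<and> A' i' c' = Suc l} =
     {c'. (c' < c \<or> c' = c \<and> i' < i) \<and> A' i' c' = Suc l} \<union> (if i' = i \<and> A' i' c = Suc l then {c} else {})"
    by (auto simp: less_Suc_eq)
  moreover have "finite {c'. (c' < c \<or> c' = c \<and> i' < i) \<and> A' i' c' = Suc l}" by (rule finite_subset[of _ "{..c}"]) auto
  ultimately show ?thesis unfolding used_slots_def by (auto simp: card_insert_if)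
qed

lemma used_slots_row: "i' < N ==> used_slots A' c N i' l = used_slots A' (Suc c) 0 i' l"
  unfolding used_slots_def by (intro arg_cong[of _ _ card]) (auto simp: less_Suc_eq)

lemma used_slots_all: "used_slots A' K 0 i' l = col.colours A' i' l"
  by (simp add: used_slots_def col.colours_def)

lemma used_slots_0: "used_slots A' 0 0 i' l = 0"
  by (simp add: used_slots_def)

definition "unfinished Gs g S q \<longleftrightarrow>
   progress Gs g (S p_src q 0) (S p_dst q 0) (S p_coflow q 0) < X * dd (S p_src q 0) (S p_dst q 0) (S p_coflow q 0)"

definition "sent_before Gs g S q \<longleftrightarrow> (\<exists>g'<g. end_at S q \<le> 10 * K * dr.T (Suc g') \<and> unfinished Gs g' S q)"

definition "sent_during Gs g c i S q \<longleftrightarrow> unfinished Gs g S q \<and> (\<exists>c'. (c' < c \<or> c' = c \<and> S p_src q 0 < i) \<and> c' < K \<and>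
   S a_in (S p_src q 0) c' = Suc (S p_coflow q 0 * N + S p_dst q 0) \<and> end_at S q \<le> (10 * K + Suc c') * dr.T g)"

definition "left_ok Gs g c i S \<longleftrightarrow> (\<forall>i'<N. \<forall>j<N. \<forall>k<n. S a_left k (i' * N + j) + sent_in S (i', j, k) = X * dd i' j k \<and>
   X * dd i' j k - (progress Gs g i' j k + used_slots (S a_in) c i i' (k * N + j) * dr.T g) = S a_left k (i' * N + j))"

definition "sending Gs g c i S \<longleftrightarrow> plan X S \<and> num_periods S \<le> (g * K + c) * N + i \<and> left_ok Gs g c i S \<and>
   (\<forall>q<num_periods S. sent_before Gs g S q \<or> sent_during Gs g c i S q)"

lemma sending_left:
  assumes "sending Gs g c i S" "i' < N" "j < N" "k < n"
  shows "S a_left k (i' * N + j) + sent_in S (i', j, k) = X * dd i' j k"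
    "X * dd i' j k - (progress Gs g i' j k + used_slots (S a_in) c i i' (k * N + j) * dr.T g) = S a_left k (i' * N + j)"
  using assms by (simp_all add: sending_def left_ok_def)

lemma sending_cong:
  assumes "sending Gs g c i S" "\<And>r. r \<in> insert a_left period_names ==> S' r = S r" "S' a_in = S a_in \<or> c = 0 \<and> i = 0"
  shows "sending Gs g c i S'"
proof -
  have "used_slots (S' a_in) c i i' l = used_slots (S a_in) c i i' l" for i' l
    using assms(3) by (auto simp: used_slots_0)
  moreover have "sent_during Gs g c i S' q = sent_during Gs g c i S q" for q
    using assms(3) by (auto simp: sent_during_def unfinished_def assms(2))
  moreover have "plan u S' = plan u S" "sent_in S' f = sent_in S f" for u f
    using assms(2) by (auto intro!: plan_cong sent_in_cong)
  ultimately show ?thesis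
    using assms(1) by (simp add: sending_def left_ok_def sent_before_def unfinished_def assms(2))
qed

lemma sending_start:
  assumes "plan X S" "num_periods S = 0" "\<And>i j k. i < N ==> j < N ==> k < n ==> S a_left k (i * N + j) = X * dd i j k"
  shows "sending Gs 0 0 0 S"
  using assms by (simp add: sending_def left_ok_def sent_in_def sent_0 progress_def used_slots_0)

lemma sending_row:
  assumes "sending Gs g c N S"
  shows "sending Gs g (Suc c) 0 S"
proof -
  have "sent_during Gs g (Suc c) 0 S q" if "sent_during Gs g c N S q" for q
    using that unfolding sent_during_def by (metis less_Suc_eq)
  then show ?thesis
    using assms by (auto simp: sending_def left_ok_def used_slots_row add_ac)
qed

lemma sending_next:
  assumes sending: "sending Gs g K 0 S" and coloured: "coloured (edge_slots Gs g) S" and g: "g < H"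
  shows "sending Gs (Suc g) 0 0 S"
proof -
  have "sent_before Gs (Suc g) S q" if during: "sent_during Gs g K 0 S q" for q
  proof -
    obtain c where c: "c < K" "end_at S q \<le> (10 * K + Suc c) * dr.T g" and "unfinished Gs g S q"
      using during by (auto simp: sent_during_def)
    have "(10 * K + Suc c) * dr.T g \<le> 11 * K * dr.T g" using c(1) by (intro mult_le_mono1) simp
    also have "... = 10 * K * dr.T (Suc g)" using T_Suc[OF g] by simp
    finally show ?thesis using c(2) \<open>unfinished Gs g S q\<close> by (auto simp: sent_before_def)
  qed
  moreover have "sent_before Gs (Suc g) S q" if "sent_before Gs g S q" for q
    using that less_SucI unfolding sent_before_def by blast
  moreover have "progress Gs (Suc g) i j k = progress Gs g i j k + used_slots (S a_in) K 0 i (k * N + j) * dr.T g"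
    if "i < N" "j < N" "k < n" for i j k
    using coloured that flat_less[OF that(3,2)] by (simp add: used_slots_all coloured_def edge_slots_def progress_def)
  ultimately show ?thesis
    using sending by (auto simp: sending_def left_ok_def used_slots_0 add_mult_distrib)
qed

lemma sent_during_Suc: "sent_during Gs g c i S q ==> sent_during Gs g c (Suc i) S q"
  unfolding sent_during_def by (metis less_SucI)

lemma sending_unused:
  assumes sending: "sending Gs g c i S" and unused: "S a_in i c = 0"
  shows "sending Gs g c (Suc i) S"
proof -
  have "used_slots (S a_in) c (Suc i) i' l = used_slots (S a_in) c i i' l" for i' l
    using unused by (auto simp: used_slots_Suc)
  then show ?thesis
    using sending sent_during_Suc by (auto simp: sending_def left_ok_def)
qed

lemma period_end_le: "g < H ==> c < K ==> (10 * K + Suc c) * dr.T g \<le> M"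
proof -
  assume g: "g < H" and c: "c < K"
  have "10 * K + Suc c \<le> 11 * K" using c by simp
  also have "... \<le> A ^ (1 + 1)" using numeral_le_A by (intro mult_le_A le_A_1 le_A) simp
  finally have "(10 * K + Suc c) * dr.T g \<le> A ^ (1 + 1 + 1)" using g by (intro mult_le_A le_A_1 T_le_A) simp_all
  then show ?thesis by (rule le_M) simp
qed

context
  fixes Gs :: "nat => nat => nat" and g c i j k :: nat and S :: store
  assumes greedy: "dr.greedy Gs" and single: "m = 1" and sending: "sending Gs g c i S" and coloured: "coloured (edge_slots Gs g) S"
    and g: "g < H" and c: "c < K" and i: "i < N" and j: "j < N" and used: "S a_in i c = Suc (k * N + j)"
begin

lemma edge_label: "k * N + j < n * N" "k < n"
proof -
  have "Suc (k * N + j) \<le> n * N" using coloured c i used[symmetric] by (simp add: coloured_def labels_ok_def)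
  then show "k * N + j < n * N" by simp
  then have "(k * N + j) div N < n" by (rule less_mult_imp_div_less)
  then show "k < n" using j by simp
qed

lemma slot_release: "X * rho k \<le> (10 * K + c) * dr.T g"
proof -
  have "{c. c < K \<and> S a_in i c = Suc (k * N + j)} \<noteq> {}" using c used by blast
  then have "0 < col.colours (S a_in) i (k * N + j)" unfolding col.colours_def by (simp add: card_gt_0_iff)
  then have "0 < slots Gs g i j k" using coloured i j edge_label by (simp add: coloured_def edge_slots_def)
  then have "X * rho k \<le> 10 * K * dr.T g" by (rule slots_release[OF greedy edge_label(2) g])
  then show ?thesis by (simp add: add_mult_distrib)
qed

lemma proper_output: "i' < N ==> c' < K ==> S a_in i' c' = Suc l ==> S a_out (l mod N) c' = Suc i'"
  using coloured unfolding coloured_def col.proper_def by (metis diff_Suc_1 nat.distinct(1))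

lemma slot_colour:
  assumes c': "c' < c \<or> c' = c \<and> i' < i" and edge: "i' < N" "j' < N" "S a_in i' c' = Suc (k' * N + j')" and port: "i' = i \<or> j' = j"
  shows "c' < c"
proof (rule ccontr)
  assume "\<not> c' < c"
  then have "c' = c" "i' < i" "j' = j" using c' port by auto
  moreover from this have "S a_out j c = Suc i'" "S a_out j c = Suc i"
    using coloured c i used edge proper_output[of i' c "k' * N + j'"] proper_output[of i c "k * N + j"] j by auto
  ultimately show False by simp
qed

lemma slot_free:
  assumes q: "q < num_periods S" and port: "S p_src q 0 = i \<or> S p_dst q 0 = j"
  shows "end_at S q \<le> (10 * K + c) * dr.T g"
proof -
  have edge: "S p_src q 0 < N" "S p_dst q 0 < N" using planD[of X S q] sending q by (simp_all add: sending_def)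
  consider (before) "sent_before Gs g S q" | (during) "sent_during Gs g c i S q" using sending q by (auto simp: sending_def)
  then show ?thesis
  proof cases
    case before
    then obtain g' where g': "g' < g" "end_at S q \<le> 10 * K * dr.T (Suc g')" by (auto simp: sent_before_def)
    have "10 * K * dr.T (Suc g') \<le> (10 * K + c) * dr.T g" using g' g by (intro mult_le_mono T_mono) auto
    then show ?thesis using g' by simp
  next
    case during
    then obtain c' where c': "c' < c \<or> c' = c \<and> S p_src q 0 < i" "S a_in (S p_src q 0) c' = Suc (S p_coflow q 0 * N + S p_dst q 0)"
      "end_at S q \<le> (10 * K + Suc c') * dr.T g" by (auto simp: sent_during_def)
    have "c' < c" by (rule slot_colour[OF c'(1) edge c'(2) port])
    then have "(10 * K + Suc c') * dr.T g \<le> (10 * K + c) * dr.T g" by (intro mult_le_mono1) simp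
    then show ?thesis using c'(3) by simp
  qed
qed

lemma left_ok_used:
  assumes x: "x = min (S a_left k (i * N + j)) (dr.T g)"
    and sent: "\<And>f. sent_in S' f = sent_in S f + (if f = (i, j, k) then x else 0)" and "S' a_in = S a_in"
    and left: "\<And>k' e. S' a_left k' e = S a_left k' e - (if k' = k \<and> e = i * N + j then x else 0)"
  shows "left_ok Gs g c (Suc i) S'"
  unfolding left_ok_def
proof (intro allI impI)
  fix i' j' k' assume flow: "i' < N" "j' < N" "k' < n"
  let ?z = "progress Gs g i' j' k' + used_slots (S a_in) c i i' (k' * N + j') * dr.T g"
  have before: "S a_left k' (i' * N + j') + sent_in S (i', j', k') = X * dd i' j' k'" "X * dd i' j' k' - ?z = S a_left k' (i' * N + j')"
    by (rule sending_left[OF sending flow])+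
  have "i' = i \<and> S a_in i' c = Suc (k' * N + j') \<longleftrightarrow> (i', j', k') = (i, j, k)"
    using used flat_inj[OF flow(2) j, of k' k] by auto
  then have slots: "used_slots (S' a_in) c (Suc i) i' (k' * N + j') = used_slots (S a_in) c i i' (k' * N + j') + of_bool ((i', j', k') = (i, j, k))"
    by (simp only: used_slots_Suc assms(3))
  have "k' = k \<and> i' * N + j' = i * N + j \<longleftrightarrow> (i', j', k') = (i, j, k)" using flat_inj[OF flow(2) j] by auto
  then have left': "S' a_left k' (i' * N + j') = S a_left k' (i' * N + j') - (if (i', j', k') = (i, j, k) then x else 0)"
    by (simp only: left)
  show "S' a_left k' (i' * N + j') + sent_in S' (i', j', k') = X * dd i' j' k' \<and>
      X * dd i' j' k' - (progress Gs g i' j' k' + used_slots (S' a_in) c (Suc i) i' (k' * N + j') * dr.T g) = S' a_left k' (i' * N + j')"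
  proof (cases "(i', j', k') = (i, j, k)")
    case True
    then have "x \<le> S a_left k' (i' * N + j')" "x = min (S a_left k' (i' * N + j')) (dr.T g)" using x by auto
    moreover have "progress Gs g i' j' k' + (used_slots (S a_in) c i i' (k' * N + j') + 1) * dr.T g = ?z + dr.T g" by simp
    ultimately show ?thesis unfolding left' slots sent using before True by (simp only: if_True of_bool_eq simp_thms) linarith
  next
    case False
    then show ?thesis unfolding left' slots sent using before by (simp only: if_False of_bool_eq) simp
  qed
qed

lemma sending_finished:
  assumes "S a_left k (i * N + j) = 0"
  shows "sending Gs g c (Suc i) S"
proof -
  have "left_ok Gs g c (Suc i) S" by (rule left_ok_used[of 0]) (use assms in auto)
  then show ?thesis using sending sent_during_Suc by (auto simp: sending_def)
qed

lemma sending_emitted: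
  assumes x: "x = min (S a_left k (i * N + j)) (dr.T g)" "0 < x"
  shows "sending Gs g c (Suc i) (upd (emitted S 0 i j k ((10 * K + c) * dr.T g) ((10 * K + c) * dr.T g + x))
    a_left k (i * N + j) (S a_left k (i * N + j) - x))"
proof -
  let ?a = "(10 * K + c) * dr.T g"
  let ?E = "emitted S 0 i j k ?a (?a + x)"
  define S' where "S' = upd ?E a_left k (i * N + j) (S a_left k (i * N + j) - x)"
  have plan: "plan X S" using sending by (simp add: sending_def)
  have fields: "num_periods S' = Suc (num_periods S)" "flow_at S' q = (if q = num_periods S then (i, j, k) else flow_at S q)"
      "end_at S' q = (if q = num_periods S then ?a + x else end_at S q)" "S' a_in = S a_in" for q
    by (simp_all add: S'_def)
  have "core_at S q = 0" if "q < num_periods S" for q using planD(1)[OF plan that] single by simp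
  then have "plan X ?E"
    using single edge_label(2) i j slot_release x(2) slot_free by (intro plan_emitted[OF plan]) auto
  then have "plan X S'" unfolding S'_def by (subst plan_cong) auto
  moreover have "sent_in S' f = sent_in ?E f" for f unfolding S'_def by (rule sent_in_cong) auto
  then have "left_ok Gs g c (Suc i) S'"
    by (intro left_ok_used[OF x(1)]) (auto simp: sent_in_emitted fields(4), auto simp: S'_def)
  moreover have "sent_before Gs g S' q \<or> sent_during Gs g c (Suc i) S' q" if q: "q < Suc (num_periods S)" for q
  proof (cases "q = num_periods S")
    case True
    have "progress Gs g i j k < X * dd i j k"
      using sending_left(2)[OF sending i j edge_label(2)] x by linarith
    moreover have "?a + x \<le> (10 * K + Suc c) * dr.T g" using x(1) by simp
    ultimately have "sent_during Gs g c (Suc i) S' q"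
      using True used c by (auto simp: sent_during_def unfinished_def S'_def intro!: exI[of _ c])
    then show ?thesis ..
  next
    case False
    then have old: "flow_at S' q = flow_at S q" "end_at S' q = end_at S q" "q < num_periods S" using q by (simp_all add: fields)
    then have "sent_before Gs g S' q = sent_before Gs g S q" "sent_during Gs g c (Suc i) S' q = sent_during Gs g c (Suc i) S q"
      by (auto simp: sent_before_def sent_during_def unfinished_def fields(4))
    then show ?thesis using sending old(3) sent_during_Suc by (auto simp: sending_def)
  qed
  ultimately show ?thesis using sending unfolding S'_def[symmetric] by (auto simp: sending_def fields(1))
qed

lemma wp_send_amount:
  assumes drifted: "drifted Gs S" and at: "S i1 0 0 = g" "S i2 0 0 = c" "S i3 0 0 = i" "S v_dst 0 0 = j" "S v_k 0 0 = k"
    and x: "S v_amount 0 0 = min (S a_left k (i * N + j)) (dr.T g)" and left: "S a_left k (i * N + j) \<le> M"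
  shows "wp send_amount (sending Gs g c (Suc i)) S"
proof (cases "S a_left k (i * N + j) = 0")
  case True
  then show ?thesis using x sending_finished by (simp add: send_amount_def)
next
  case False
  let ?a = "(10 * K + c) * dr.T g" and ?x = "S v_amount 0 0"
  have pos: "0 < ?x" "?x \<le> dr.T g" using False x dr.T_pos[of g] by simp_all
  have grid: "S a_time g 0 = dr.T g" "S v_K 0 0 = K" "S v_ports 0 0 = N"
    using grid_readyD(11)[OF driftedD(1)[OF drifted]] driftedD(3,4)[OF drifted] g by simp_all
  have "?a + ?x \<le> (10 * K + Suc c) * dr.T g" using pos by simp
  then have le: "?a + ?x \<le> M" "i \<le> M" "j \<le> M" "k \<le> M"
    using period_end_le[OF g c] i j edge_label(2) N_le_M n_le_M by linarith+
  have "num_periods S < (g * K + Suc c) * N" using sending i by (simp add: sending_def add_mult_distrib)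
  also have "... \<le> (Suc g * K) * N" using c by (intro mult_le_mono1) simp
  also have "... \<le> H * K * N" using g by (intro mult_le_mono1) simp
  finally have count: "num_periods S < Lim" using lim_HKN by (simp add: mult.assoc)
  have "sending Gs g c (Suc i) (upd (emitted S 0 i j k ?a (?a + ?x)) a_left k (i * N + j) (S a_left k (i * N + j) - ?x))"
    using x pos by (intro sending_emitted)
  then have "wp (emit (Cn 0) (V i3) (V v_dst) (V v_k) ((Cn 10 .* V v_K .+ V i2) .* Vec a_time (V i1))
      ((Cn 10 .* V v_K .+ V i2) .* Vec a_time (V i1) .+ V v_amount))
     (wp (Put a_left (V v_k) (V i3 .* V v_ports .+ V v_dst) (Arr a_left (V v_k) (V i3 .* V v_ports .+ V v_dst) .- V v_amount))
       (sending Gs g c (Suc i))) S"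
    by (intro wp_emit) (use at grid le left count in simp_all)
  then show ?thesis using pos by (simp add: send_amount_def)
qed

end

lemma left_le_M:
  assumes "sending Gs g c i S" "i' < N" "j < N" "k < n"
  shows "S a_left k (i' * N + j) \<le> M"
proof -
  have "S a_left k (i' * N + j) \<le> dd i' j k * X" using sending_left(1)[OF assms] by (simp add: mult.commute)
  also have "... \<le> A ^ (1 + (1 + 1 + 1))" unfolding X_def using numeral_le_A
    by (intro mult_le_A le_A_1 le_A powers_le_A order_trans[OF dd_le_sum_L sum_L_le_A] assms) simp
  finally show ?thesis by (rule le_M) simp
qed

lemma wp_use_slot:
  assumes greedy: "dr.greedy Gs" and single: "m = 1" and drifted: "drifted Gs S"
    and g: "S i1 0 0 = g" "g < H" and c: "S i2 0 0 = c" "c < K" and i: "S i3 0 0 = i" "i < N"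
    and sending: "sending Gs g c i S" and coloured: "coloured (edge_slots Gs g) S"
  shows "wp use_slot (sending Gs g c (Suc i)) S"
proof (cases "S a_in i c")
  case 0
  then show ?thesis using sending_unused[OF sending 0] c i by (simp add: use_slot_def)
next
  case (Suc l)
  define k j where "k = l div N" and "j = l mod N"
  have j: "j < N" and used: "S a_in i c = Suc (k * N + j)" using Suc N_pos by (simp_all add: k_def j_def)
  have edge: "k * N + j < n * N" "k < n"
    by (rule edge_label[where i = i and c = c, OF greedy single sending coloured g(2) c(2) i(2) j used])+
  have l: "l = k * N + j" by (simp add: k_def j_def)
  have grid: "S a_time g 0 = dr.T g" "S v_ports 0 0 = N"
    using grid_readyD(11)[OF driftedD(1)[OF drifted]] driftedD(3)[OF drifted] g by simp_all
  let ?x = "min (S a_left k (i * N + j)) (dr.T g)"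
  have left: "S a_left k (i * N + j) \<le> M" by (rule left_le_M[OF sending i(2) j edge(2)])
  let ?S = "upd (upd (upd (upd S v_label 0 0 l) v_k 0 0 k) v_dst 0 0 j) v_amount 0 0 (S a_left k (i * N + j))"
  have send: "wp send_amount (sending Gs g c (Suc i)) S'"
    if "S' v_amount 0 0 = ?x" and frame: "\<And>r. r \<noteq> v_amount ==> S' r = ?S r" for S'
  proof (rule wp_send_amount[where k = k and j = j, OF greedy single _ _ g(2) c(2) i(2) j])
    show "sending Gs g c i S'" by (rule sending_cong[OF sending]) (auto simp: frame)
    show "coloured (edge_slots Gs g) S'" by (rule coloured_cong[OF coloured]) (auto simp: frame)
    show "drifted Gs S'" by (rule drifted_frame[OF drifted]) (auto simp: frame)
  qed (use that used g c i left in \<open>simp_all add: frame\<close>)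
  have "k \<le> M" "j \<le> M" "l \<le> M" "dr.T g \<le> M"
    using edge j n_le_M N_le_M nN_le_M A_le_M_1[OF T_le_A[of g]] g(2) unfolding l by linarith+
  moreover have "wp send_amount (sending Gs g c (Suc i)) (if dr.T g < S a_left k (i * N + j) then upd ?S v_amount 0 0 (dr.T g) else ?S)"
    by (rule send) (auto simp: min_def)
  ultimately show ?thesis
    using Suc grid g c i left
    by (cases "dr.T g < S a_left k (i * N + j)") (simp_all add: use_slot_def flip: k_def j_def)
qed

lemma wp_use_slots:
  assumes greedy: "dr.greedy Gs" and single: "m = 1" and drifted: "drifted Gs S" and g: "S i1 0 0 = g" "g < H"
    and sending: "sending Gs g 0 0 S" and coloured: "coloured (edge_slots Gs g) S"
  shows "wp (Loop i2 v_K (Loop i3 v_ports use_slot)) (sending Gs (Suc g) 0 0) S"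
proof (rule wp_Loop[where Inv = "\<lambda>c. sending Gs g c 0"])
  show "S v_K 0 0 \<le> Lim" using driftedD(4)[OF drifted] lim_K by simp
  show "sending Gs g 0 0 (upd S i2 0 0 0)" by (rule sending_cong[OF sending]) auto
  show "sending Gs (Suc g) 0 0 S1"
    if "sending Gs g (S v_K 0 0) 0 S1" and frame: "\<And>r. r \<noteq> i2 ==> r \<notin> mods (Loop i3 v_ports use_slot) ==> S1 r = S r" for S1
  proof (rule sending_next[OF _ _ g(2)])
    show "sending Gs g K 0 S1" using that(1) driftedD(4)[OF drifted] by simp
    show "coloured (edge_slots Gs g) S1" by (rule coloured_cong[OF coloured]) (auto simp: frame)
  qed
  fix c S1
  assume "c < S v_K 0 0" and inv1: "sending Gs g c 0 S1" and index: "S1 i2 0 0 = c"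
    and frame1: "\<And>r. r \<noteq> i2 ==> r \<notin> mods (Loop i3 v_ports use_slot) ==> S1 r = S r"
  then have c: "c < K" using driftedD(4)[OF drifted] by simp
  have drifted1: "drifted Gs S1" by (rule drifted_frame[OF drifted]) (auto simp: frame1)
  show "wp (Loop i3 v_ports use_slot) (\<lambda>S'. sending Gs g (Suc c) 0 (upd S' i2 0 0 (Suc c))) S1"
  proof (rule wp_Loop[where Inv = "sending Gs g c"])
    show "S1 v_ports 0 0 \<le> Lim" using driftedD(3)[OF drifted1] lim_N by simp
    show "sending Gs g c 0 (upd S1 i3 0 0 0)" by (rule sending_cong[OF inv1]) auto
    show "sending Gs g (Suc c) 0 (upd S2 i2 0 0 (Suc c))" if "sending Gs g c (S1 v_ports 0 0) S2" for S2
      by (rule sending_cong[OF sending_row]) (use that driftedD(3)[OF drifted1] in auto)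
    fix i S2
    assume "i < S1 v_ports 0 0" and inv2: "sending Gs g c i S2" and i2: "S2 i3 0 0 = i"
      and frame2: "\<And>r. r \<noteq> i3 ==> r \<notin> mods use_slot ==> S2 r = S1 r"
    then have i: "i < N" using driftedD(3)[OF drifted1] by simp
    have "drifted Gs S2" by (rule drifted_frame[OF drifted1]) (auto simp: frame2)
    moreover have "coloured (edge_slots Gs g) S2" by (rule coloured_cong[OF coloured]) (auto simp: frame2 frame1)
    ultimately have "wp use_slot (sending Gs g c (Suc i)) S2"
      using g c index i i2 inv2 by (intro wp_use_slot[OF greedy single]) (simp_all add: frame2 frame1)
    then show "wp use_slot (\<lambda>S'. sending Gs g c (Suc i) (upd S' i3 0 0 (Suc i))) S2"
      by (rule wp_mono) (erule sending_cong, auto)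
  qed auto
qed auto

lemma wp_use_interval:
  assumes greedy: "dr.greedy Gs" and single: "m = 1" and drifted: "drifted Gs S" and g: "S i1 0 0 = g" "g < H" and sending: "sending Gs g 0 0 S"
  shows "wp use_interval (sending Gs (Suc g) 0 0) S"
  unfolding use_interval_def
proof (rule wp_seq[OF wp_colour_all[OF greedy drifted g]])
  fix S1
  assume coloured: "coloured (edge_slots Gs g) S1" and frame: "\<And>r. r \<notin> mods colour_all ==> S1 r = S r"
  have "drifted Gs S1" by (rule drifted_frame[OF drifted]) (auto simp: frame)
  moreover have "sending Gs g 0 0 S1" by (rule sending_cong[OF sending]) (auto simp: frame)
  ultimately show "wp (Loop i2 v_K (Loop i3 v_ports use_slot)) (sending Gs (Suc g) 0 0) S1"
    using g coloured by (intro wp_use_slots[OF greedy single]) (simp_all add: frame)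
qed

lemma sending_end_le:
  assumes greedy: "dr.greedy Gs" and sending: "sending Gs H 0 0 S" and q: "q < num_periods S"
  shows "end_at S q \<le> X * finish_bound Gs (S p_coflow q 0)"
proof -
  let ?i = "S p_src q 0" and ?j = "S p_dst q 0" and ?k = "S p_coflow q 0"
  let ?e = "dr.finish_index Gs ?k"
  have flow: "?i < N" "?j < N" "?k < n" using planD[of X S q] sending q by (simp_all add: sending_def)
  have e: "?e \<le> H" by (rule dr.finish_index_le[OF greedy flow(3)])
  obtain g where g: "g < H" "end_at S q \<le> 10 * K * dr.T (Suc g)" and unfinished: "progress Gs g ?i ?j ?k < X * dd ?i ?j ?k"
    using sending q by (auto simp: sending_def sent_during_def sent_before_def unfinished_def)
  have "g < ?e"
  proof (rule ccontr)
    assume "\<not> ?thesis"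
    then have "X * dd ?i ?j ?k \<le> progress Gs g ?i ?j ?k" using flow by (intro progress_enough[OF greedy]) auto
    then show False using unfinished by simp
  qed
  then have "10 * K * dr.T (Suc g) \<le> 10 * K * dr.T ?e" using e by (intro mult_le_mono2 T_mono) auto
  then have "real (end_at S q) \<le> real (10 * K * dr.T ?e)" using g(2) by linarith
  also have "... = X * dr.\<tau> ?e" using e by (simp add: dr.T_eq X_def)
  also have "dr.\<tau> ?e = finish_bound Gs ?k"
  proof -
    have "0 < dd ?i ?j ?k" using unfinished by (cases "dd ?i ?j ?k") auto
    also have "... \<le> loads.max_load {?k}"
      using dd_le_L(1)[OF flow(1,2), of ?k] loads.total_load_le_max[of ?i "{?k}"] flow(1) by (simp add: loads.total_load_def)
    finally show ?thesis by (simp add: finish_bound_def[OF greedy])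
  qed
  finally show ?thesis .
qed

lemma sending_good:
  assumes greedy: "dr.greedy Gs" and single: "m = 1" and sending: "sending Gs H 0 0 S"
  shows "good_schedule X 4 S"
proof -
  have "sent_in S (i, j, k) = X * dd i j k" if "i < N" "j < N" "k < n" for i j k
    using sending_left[OF sending that] progress_enough[OF greedy that(3) dr.finish_index_le[OF greedy that(3)], of i j] by simp
  moreover have "approximates X (num_periods S) (flow_at S) (end_at S) 4"
    unfolding approximates_def
  proof (intro allI impI exI[of _ "finish_bound Gs"] conjI)
    show "rho k \<le> finish_bound Gs k" if "k < n" for k using that by (rule rho_le_finish_bound[OF greedy])
    show "end_at S q \<le> X * finish_bound Gs (coflow_of (flow_at S q))" if "q < num_periods S" for q
      using sending_end_le[OF greedy sending that] by simp
    show "(\<Sum>k<n. W k * finish_bound Gs k) \<le> 4 * (\<Sum>k<n. W k * C k)" if "lower_bounds C" for C :: "nat => real"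
      using that by (rule finish_bound_cost[OF greedy single])
  qed
  ultimately show ?thesis using sending by (simp add: good_schedule_def sending_def)
qed

lemma X_le_A: "X \<le> A ^ (1 + 1 + 1)"
  unfolding X_def using numeral_le_A by (intro mult_le_A le_A_1 le_A powers_le_A) simp

lemma wp_fill_left:
  assumes ok: "prepared S" and X: "S v_X 0 0 = X"
  shows "wp fill_left (\<lambda>S'. \<forall>i<N. \<forall>j<N. \<forall>k<n. S' a_left k (i * N + j) = X * dd i j k) S"
proof -
  let ?dd = "\<lambda>k e. dd (e div N) (e mod N) k"
  have sizes: "S v_coflows 0 0 = n" "S v_pairs 0 0 = N * N" using preparedD(3,4)[OF ok] by simp_all
  have "wp fill_left (\<lambda>S'. \<forall>k<S v_coflows 0 0. \<forall>e<S v_pairs 0 0. S' a_left k e = ?dd k e * X) S"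
    unfolding fill_left_def
  proof (rule wp_fill)
    fix k e S1
    let ?b = "Put a_left (V i1) (V i2) (Arr a_demand (V i1) (V i2) .* V v_X)"
    assume at: "k < S v_coflows 0 0" "e < S v_pairs 0 0" "S1 i1 0 0 = k" "S1 i2 0 0 = e"
      and frame: "\<And>r. r \<notin> insert i1 (insert i2 (mods ?b)) ==> S1 r = S r"
    then have entry_less: "k < n" "e < N * N" using sizes by simp_all
    have "?dd k e * X \<le> A ^ (1 + (1 + 1 + 1))"
      by (intro mult_le_A X_le_A le_A_1 order_trans[OF dd_le_sum_L sum_L_le_A]) (use entry_less div_mod_N[of e] in auto)
    then have "?dd k e * X \<le> M" by (rule le_M) simp
    then show "wp ?b (\<lambda>S'. S' a_left k e = ?dd k e * X \<and> (\<forall>k' e'. \<not> (k' = k \<and> e' = e) \<longrightarrow> S' a_left k' e' = S1 a_left k' e')) S1"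
      using at prepared_demand[OF ok entry_less] X by (simp add: frame)
  qed (use sizes lim_n lim_NN in auto)
  then show ?thesis
    by (rule wp_mono) (use sizes in \<open>auto simp: flat_less mult.commute\<close>)
qed

lemma wp_use_intervals:
  assumes greedy: "dr.greedy Gs" and single: "m = 1" and drifted: "drifted Gs S" and sending: "sending Gs 0 0 0 S"
  shows "wp (Loop i1 v_H use_interval) (sending Gs H 0 0) S"
proof (rule wp_Loop[where Inv = "\<lambda>g. sending Gs g 0 0"])
  show "sending Gs 0 0 0 (upd S i1 0 0 0)" by (rule sending_cong[OF sending]) auto
next
  fix g S1
  assume g: "g < S v_H 0 0" "S1 i1 0 0 = g" and inv: "sending Gs g 0 0 S1" and frame: "\<And>r. r \<noteq> i1 ==> r \<notin> mods use_interval ==> S1 r = S r"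
  have "drifted Gs S1" by (rule drifted_frame[OF drifted]) (auto simp: frame)
  then have "wp use_interval (sending Gs (Suc g) 0 0) S1"
    using g grid_readyD(5)[OF driftedD(1)[OF drifted]] inv by (intro wp_use_interval[OF greedy single]) simp_all
  then show "wp use_interval (\<lambda>S'. sending Gs (Suc g) 0 0 (upd S' i1 0 0 (Suc g))) S1"
    by (rule wp_mono) (erule sending_cong, auto)
qed (use grid_readyD(5)[OF driftedD(1)[OF drifted]] lim_le_H in auto)

lemma wp_send_all:
  assumes greedy: "dr.greedy Gs" and single: "m = 1" and drifted: "drifted Gs S" and start: "num_periods S = 0"
  shows "wp send_all (\<lambda>S'. good_schedule X 4 S' \<and> S' v_den 0 0 = D * X \<and> num_periods S' \<le> Lim) S"
    (is "wp _ ?Q S")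
proof -
  let ?S = "upd S v_X 0 0 X"
  have "prepared ?S" by (rule prepared_frame[OF driftedD(2)[OF drifted]]) auto
  then have "wp fill_left (\<lambda>S'. \<forall>i<N. \<forall>j<N. \<forall>k<n. S' a_left k (i * N + j) = X * dd i j k) ?S"
    by (rule wp_fill_left) simp
  then have "wp (fill_left ;; Loop i1 v_H use_interval ;; v_den :=: V v_D .* V v_X) ?Q ?S"
  proof (rule wp_seq)
    fix S1
    assume left: "\<forall>i<N. \<forall>j<N. \<forall>k<n. S1 a_left k (i * N + j) = X * dd i j k" and frame1: "\<And>r. r \<notin> mods fill_left ==> S1 r = ?S r"
    have drifted1: "drifted Gs S1" by (rule drifted_frame[OF drifted]) (auto simp: frame1)
    have "sending Gs 0 0 0 S1"
      using left start by (intro sending_start) (simp_all add: frame1 plan_def partial_schedule_0)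
    from wp_use_intervals[OF greedy single drifted1 this]
    show "wp (Loop i1 v_H use_interval ;; v_den :=: V v_D .* V v_X) ?Q S1"
    proof (rule wp_seq)
      fix S2
      assume sent: "sending Gs H 0 0 S2" and frame2: "\<And>r. r \<notin> mods (Loop i1 v_H use_interval) ==> S2 r = S1 r"
      have "good_schedule X 4 (upd S2 v_den 0 0 (D * X))"
        by (rule good_schedule_cong[OF sending_good[OF greedy single sent]]) auto
      moreover have "num_periods S2 \<le> Lim" using sent lim_HKN by (simp add: sending_def mult.assoc)
      moreover have "D * X \<le> M" by (rule le_M[OF mult_le_A[OF le_A_1[OF D_le_A(1)] X_le_A]]) simp
      moreover have "S2 v_D 0 0 = D" "S2 v_X 0 0 = X"
        using preparedD(5)[OF driftedD(2)[OF drifted1]] by (simp_all add: frame2 frame1)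
      ultimately show "wp (v_den :=: V v_D .* V v_X) ?Q S2" by simp
    qed
  qed
  moreover have "X \<le> M" by (rule le_M[OF X_le_A]) simp
  ultimately show ?thesis
    using driftedD(4)[OF drifted] grid_readyD(6)[OF driftedD(1)[OF drifted]] by (simp add: send_all_def X_def)
qed

lemma wp_single_core:
  assumes single: "m = 1" and ok: "prepared S" and weights: "\<And>k. k < n ==> S a_weight k 0 = W k"
    and start: "num_periods S = 0" "S a_queue = (\<lambda>_ _. 0)" "S a_hits = (\<lambda>_ _. 0)"
  shows "wp single_core (\<lambda>S'. good_schedule X 4 S' \<and> S' v_den 0 0 = D * X \<and> num_periods S' \<le> Lim) S"
  unfolding single_core_def
proof (rule wp_seq[OF wp_prepare_grid[OF ok weights]])
  fix S1
  assume ready: "grid_ready S1" and frame1: "\<And>r. r \<notin> mods prepare_grid ==> S1 r = S r"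
  have "S1 a_queue = (\<lambda>_ _. 0)" "S1 a_hits = (\<lambda>_ _. 0)" using start by (simp_all add: frame1)
  then show "wp (run_drift ;; send_all) (\<lambda>S'. good_schedule X 4 S' \<and> S' v_den 0 0 = D * X \<and> num_periods S' \<le> Lim) S1"
  proof (rule wp_seq[OF wp_run_drift[OF ready]])
    fix S2
    assume "\<exists>Gs. dr.greedy Gs \<and> (\<forall>k<n. \<forall>g<H. S2 a_hits k g = dr.hits Gs k g)" and frame2: "\<And>r. r \<notin> mods run_drift ==> S2 r = S1 r"
    then obtain Gs where Gs: "dr.greedy Gs" "\<forall>k<n. \<forall>g<H. S2 a_hits k g = dr.hits Gs k g" by blast
    have "grid_ready S2" by (rule grid_ready_frame[OF ready]) (auto simp: frame2)
    then have "drifted Gs S2" using Gs(2) by (simp add: drifted_def)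
    then show "wp send_all (\<lambda>S'. good_schedule X 4 S' \<and> S' v_den 0 0 = D * X \<and> num_periods S' \<le> Lim) S2"
      using start by (intro wp_send_all[OF Gs(1) single]) (simp_all add: frame2 frame1)
  qed
qed simp

end
section \<open>Input and output\<close>

abbreviation "v_length == 194::nat"
abbreviation "v_pos == 195::nat"

abbreviation Read_to :: "nat => expr => com" where
  "Read_to r e == Read (addr r (aexp_of e) (aexp_of (Cn 0)))"

definition count_loop :: "nat => com => com" where
  "count_loop l c = Seq (compile (v_pos :=: Cn 0))
     (While (aexp_of (V l .- V v_pos)) (Seq c (compile (v_pos :=: V v_pos .+ Cn 1))))"

definition count_loop_poly :: "nat => nat => nat poly" where
  "count_loop_poly l T = (let test = cost_factor (aexp_of (V l .- V v_pos)) in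
     time_poly (v_pos :=: Cn 0) + [:test:] + [:0, 1:] * ([:test + T:] + time_poly (v_pos :=: V v_pos .+ Cn 1)))"

lemma runs_count_loop:
  assumes l: "l \<noteq> v_pos" and bounded: "\<And>i. i \<le> k ==> bounded_store M (S i)" and limit: "\<And>i. i \<le> k ==> S i l 0 0 = k"
    and body: "\<And>i. i < k ==>
      runs c (enc (upd (S i) v_pos 0 0 i), inp i, out i) (T * bits M) (enc (upd (S (Suc i)) v_pos 0 0 i), inp (Suc i), out (Suc i))"
  shows "runs (count_loop l c) (enc (S 0), inp 0, out 0) (poly (count_loop_poly l T) k * bits M)
    (enc (upd (S k) v_pos 0 0 k), inp k, out k)"
proof -
  let ?S = "\<lambda>i. upd (S i) v_pos 0 0 i" and ?test = "V l .- V v_pos" and ?next = "v_pos :=: V v_pos .+ Cn 1"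
  let ?test_cost = "cost_factor (aexp_of ?test) * bits M"
  let ?T = "T * bits M + poly (time_poly ?next) k * bits M"
  have k_le: "i \<le> M" if "i \<le> k" for i
    using that bounded[of 0] limit[of 0] unfolding bounded_store_def by (metis le0 order_trans)
  have bounded_upd: "bounded_store M (upd (S i) v_pos 0 0 j)" if "i \<le> k" "j \<le> k" for i j
    using that bounded k_le by (intro bounded_store_upd)
  have init: "runs (compile (v_pos :=: Cn 0)) (enc (S 0), inp 0, out 0) (poly (time_poly (v_pos :=: Cn 0)) k * bits M) (enc (?S 0), inp 0, out 0)"
    using runs_Assign[OF bounded[of 0], of v_pos "Cn 0" "Cn 0" "Cn 0"] by simp
  have step: "runs (Seq c (compile ?next)) (enc (?S i), inp i, out i) ?T (enc (?S (Suc i)), inp (Suc i), out (Suc i))" if i: "i < k" for i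
  proof (rule runs_Seq[OF body[OF i]])
    have "upd (upd (S (Suc i)) v_pos 0 0 i) v_pos 0 0 (Suc i) = ?S (Suc i)" by (simp add: fun_eq_iff upd_apply)
    then show "runs (compile ?next) (enc (upd (S (Suc i)) v_pos 0 0 i), inp (Suc i), out (Suc i))
        (poly (time_poly ?next) k * bits M) (enc (?S (Suc i)), inp (Suc i), out (Suc i))"
      using runs_Assign[OF bounded_upd[of "Suc i" i], of v_pos "Cn 0" "Cn 0" "V v_pos .+ Cn 1"] i by simp
  qed
  have "runs (While (aexp_of ?test) (Seq c (compile ?next))) (enc (?S 0), inp 0, out 0) (?test_cost + k * (?test_cost + ?T)) (enc (?S k), inp k, out k)"
    by (rule runs_While[where S = ?S, OF _ _ _ step]) (use l limit bounded_upd in auto)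
  from runs_Seq[OF init this] show ?thesis
    unfolding count_loop_def by (rule runs_mono) (simp add: count_loop_poly_def Let_def algebra_simps)
qed

definition read_input :: com where
  "read_input = count_loop v_length (Read_to a_input (V v_pos))"

definition read_input_poly :: "nat poly" where
  "read_input_poly = count_loop_poly v_length (cost_factor (addr a_input (aexp_of (V v_pos)) (aexp_of (Cn 0))) + 1)"

definition input_read :: "nat list => nat => store => store" where
  "input_read xs i S = (\<lambda>r a b. if r = a_input \<and> a < i \<and> b = 0 then xs ! a else S r a b)"

lemma input_read_frame [simp]: "r \<noteq> a_input ==> input_read xs i S r = S r"
  by (simp add: input_read_def)

lemma runs_read_input:
  assumes bounded: "bounded_store M S" and length: "S v_length 0 0 = length xs" and entries_le: "\<And>v. v \<in> set xs ==> v \<le> M"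
  shows "runs read_input (enc S, xs, out) (poly read_input_poly (length xs) * bits M)
    (enc (upd (input_read xs (length xs) S) v_pos 0 0 (length xs)), [], out)"
    and "bounded_store M (upd (input_read xs (length xs) S) v_pos 0 0 (length xs))"
proof -
  let ?S = "\<lambda>i. input_read xs i S"
  have bounded_read: "bounded_store M (?S i)" if "i \<le> length xs" for i
    using that bounded entries_le by (auto simp: bounded_store_def input_read_def)
  have "length xs \<le> M" using bounded unfolding bounded_store_def length[symmetric] by blast
  then show "bounded_store M (upd (?S (length xs)) v_pos 0 0 (length xs))"
    by (intro bounded_store_upd bounded_read) simp_all
  have "runs read_input (enc (?S 0), drop 0 xs, out) (poly read_input_poly (length xs) * bits M)
      (enc (upd (?S (length xs)) v_pos 0 0 (length xs)), drop (length xs) xs, out)"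
    unfolding read_input_def read_input_poly_def
  proof (rule runs_count_loop)
    fix i assume i: "i < length xs"
    have "bounded_store M (upd (?S i) v_pos 0 0 i)"
      using i \<open>length xs \<le> M\<close> by (intro bounded_store_upd bounded_read) simp_all
    moreover have "upd (upd (?S i) v_pos 0 0 i) a_input i 0 (xs ! i) = upd (?S (Suc i)) v_pos 0 0 i"
      by (auto simp: fun_eq_iff upd_apply input_read_def less_Suc_eq)
    ultimately show "runs (Read_to a_input (V v_pos)) (enc (upd (?S i) v_pos 0 0 i), drop i xs, out)
        ((cost_factor (addr a_input (aexp_of (V v_pos)) (aexp_of (Cn 0))) + 1) * bits M) (enc (upd (?S (Suc i)) v_pos 0 0 i), drop (Suc i) xs, out)"
      using runs_Read[of M "upd (?S i) v_pos 0 0 i" "xs ! i" a_input "V v_pos" "Cn 0" "drop (Suc i) xs" out] i entries_le[OF nth_mem[OF i]]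
      by (simp add: Cons_nth_drop_Suc)
  qed (use length bounded_read in simp_all)
  then show "runs read_input (enc S, xs, out) (poly read_input_poly (length xs) * bits M)
      (enc (upd (?S (length xs)) v_pos 0 0 (length xs)), [], out)"
    by (simp add: input_read_def)
qed

primrec writes :: "expr list => com" where
  "writes [] = Skip"
| "writes (e # es) = Seq (Write (aexp_of e)) (writes es)"

definition writes_cost :: "expr list => nat" where
  "writes_cost es = 1 + (\<Sum>e\<leftarrow>es. cost_factor (aexp_of e))"

lemma runs_writes:
  assumes "bounded_store M S"
  shows "runs (writes es) (enc S, inp, out) (writes_cost es * bits M) (enc S, inp, out @ map (ev S) es)"
proof (induction es arbitrary: out)
  case Nil
  show ?case using bits_pos[of M] by (auto simp: writes_cost_def intro: runs_mono[OF runs_Skip])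
next
  case (Cons e es)
  show ?case
    using runs_Seq[OF runs_Write[OF assms] Cons.IH] by (auto simp: writes_cost_def algebra_simps)
qed

definition period_exprs :: "expr list" where
  "period_exprs = [Vec p_core (V v_pos), Vec p_src (V v_pos), Vec p_dst (V v_pos), Vec p_coflow (V v_pos),
     Vec p_start (V v_pos), V v_den, Vec p_end (V v_pos), V v_den]"

definition period_numbers :: "store => nat => nat list" where
  "period_numbers S q = (case flow_at S q of (i, j, k) => [core_at S q, i, j, k, start_at S q, S v_den 0 0, end_at S q, S v_den 0 0])"

definition write_periods :: com where
  "write_periods = count_loop v_count (writes period_exprs)"

definition write_periods_poly :: "nat poly" where
  "write_periods_poly = count_loop_poly v_count (writes_cost period_exprs)"

lemma runs_write_periods:
  assumes bounded: "bounded_store M S"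
  shows "runs write_periods (enc S, inp, []) (poly write_periods_poly (num_periods S) * bits M)
    (enc (upd S v_pos 0 0 (num_periods S)), inp, concat (map (period_numbers S) [0..<num_periods S]))"
proof -
  let ?out = "\<lambda>q. concat (map (period_numbers S) [0..<q])"
  have "runs write_periods (enc S, inp, ?out 0) (poly write_periods_poly (num_periods S) * bits M)
      (enc (upd S v_pos 0 0 (num_periods S)), inp, ?out (num_periods S))"
    unfolding write_periods_def write_periods_poly_def
  proof (rule runs_count_loop)
    fix q assume "q < num_periods S"
    also have "num_periods S \<le> M" using bounded unfolding bounded_store_def by blast
    finally have "bounded_store M (upd S v_pos 0 0 q)" using bounded by (intro bounded_store_upd) simp_all
    moreover have "map (ev (upd S v_pos 0 0 q)) period_exprs = period_numbers S q"
      by (simp add: period_exprs_def period_numbers_def)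
    ultimately show "runs (writes period_exprs) (enc (upd S v_pos 0 0 q), inp, ?out q) (writes_cost period_exprs * bits M)
        (enc (upd S v_pos 0 0 q), inp, ?out (Suc q))"
      using runs_writes[of M "upd S v_pos 0 0 q" period_exprs inp "?out q"] by simp
  qed (use bounded in simp_all)
  then show ?thesis by simp
qed

section \<open>Polynomial bounds\<close>

lemma nth_concat_rows:
  assumes "\<And>x. x \<in> set xss ==> length x = r" "k < length xss" "e < r"
  shows "concat xss ! (k * r + e) = xss ! k ! e"
  using assms
proof (induction xss arbitrary: k)
  case (Cons x xss)
  then show ?case by (cases k) (auto simp: nth_append)
qed simp

lemma length_concat_rows: "(\<And>x. x \<in> set xss ==> length x = r) ==> length (concat xss) = length xss * r"
  by (induction xss) auto

lemma sum_le_power_two: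
  fixes f :: "'a => nat"
  assumes "card U \<le> 2 ^ a" "\<And>x. x \<in> U ==> f x \<le> 2 ^ b"
  shows "(\<Sum>x\<in>U. f x) \<le> 2 ^ (a + b)"
proof -
  have "(\<Sum>x\<in>U. f x) \<le> card U * 2 ^ b" using sum_bounded_above[of U f "2 ^ b"] assms(2) by simp
  also have "... \<le> 2 ^ a * 2 ^ b" using assms(1) by (rule mult_le_mono1)
  finally show ?thesis by (simp only: power_add)
qed

context nonempty_instance
begin

abbreviation "sz == input_size I"
abbreviation "input_rows == concat (map (encode_coflow I) [0..<n])"
abbreviation "demands k == [demand I i j k. i \<leftarrow> [0..<N], j \<leftarrow> [0..<N]]"

subsection \<open>The entries of the input\<close>

lemma encode_rats: "encode_rat (release I k) = [release_num k, release_den k]" "encode_rat (weight I k) = [weight_num k, weight_den k]"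
  by (simp_all add: encode_rat_def release_num_def release_den_def weight_num_def weight_den_def split: prod.split)

lemma length_demands: "length (demands k) = N * N"
  by (subst length_concat_rows[where r = N]) auto

lemma nth_demands:
  assumes e: "e < N * N"
  shows "demands k ! e = demand I (e div N) (e mod N) k"
proof -
  have less: "e div N < N" "e mod N < N" using e N_pos by (auto simp: less_mult_imp_div_less)
  have "demands k ! (e div N * N + e mod N) = map (\<lambda>i. map (\<lambda>j. demand I i j k) [0..<N]) [0..<N] ! (e div N) ! (e mod N)"
    by (rule nth_concat_rows) (use less in auto)
  then show ?thesis using less by simp
qed

lemma length_encode_coflow: "length (encode_coflow I k) = N * N + 4"
  unfolding encode_coflow_def length_append length_demands encode_rats by simp

lemma nth_encode_coflow:
  "e < N * N ==> encode_coflow I k ! e = demand I (e div N) (e mod N) k"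
  "encode_coflow I k ! (N * N) = release_num k" "encode_coflow I k ! (N * N + 1) = release_den k"
  "encode_coflow I k ! (N * N + 2) = weight_num k" "encode_coflow I k ! (N * N + 3) = weight_den k"
  unfolding encode_coflow_def encode_rats
  by (simp_all add: nth_append length_demands nth_demands del: length_concat)

lemma nth_input_rows: "k < n ==> e < N * N + 4 ==> input_rows ! (k * (N * N + 4) + e) = encode_coflow I k ! e"
  by (subst nth_concat_rows[where r = "N * N + 4"]) (auto simp: length_encode_coflow)

lemma length_input_rows: "length input_rows = n * (N * N + 4)"
  by (subst length_concat_rows[where r = "N * N + 4"]) (auto simp: length_encode_coflow)

lemma encoded_less: "v \<in> set (encode_instance I) ==> v < 2 ^ sz"
proof -
  assume "v \<in> set (encode_instance I)"
  then have "bits v \<le> sz" unfolding input_size_def by (intro member_le_sum_list) auto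
  then have "(2::nat) ^ bits v \<le> 2 ^ sz" by (intro power_increasing) auto
  then show ?thesis using less_two_power_bits[of v] by linarith
qed

lemma ports_coflows_less: "N < 2 ^ sz" "n < 2 ^ sz"
  by (rule encoded_less, simp add: encode_instance_def)+

lemma nth_encode_coflow_less: "k < n ==> e < N * N + 4 ==> encode_coflow I k ! e < 2 ^ sz"
proof (rule encoded_less)
  assume k: "k < n" and e: "e < N * N + 4"
  then have "encode_coflow I k ! e \<in> set (encode_coflow I k)" by (intro nth_mem) (simp add: length_encode_coflow)
  then show "encode_coflow I k ! e \<in> set (encode_instance I)" using k by (auto simp: encode_instance_def)
qed

lemma entries_less:
  assumes k: "k < n"
  shows "release_num k < 2 ^ sz" "release_den k < 2 ^ sz" "weight_num k < 2 ^ sz" "weight_den k < 2 ^ sz"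
    "i < N ==> j < N ==> demand I i j k < 2 ^ sz"
proof -
  show "release_num k < 2 ^ sz" "release_den k < 2 ^ sz" "weight_num k < 2 ^ sz" "weight_den k < 2 ^ sz"
    using nth_encode_coflow_less[OF k, of "N * N"] nth_encode_coflow_less[OF k, of "N * N + 1"]
      nth_encode_coflow_less[OF k, of "N * N + 2"] nth_encode_coflow_less[OF k, of "N * N + 3"]
    unfolding nth_encode_coflow by simp_all
  assume ij: "i < N" "j < N"
  then have "i * N + j < N * N" by (rule flat_less)
  then show "demand I i j k < 2 ^ sz"
    using nth_encode_coflow_less[OF k, of "i * N + j"] nth_encode_coflow(1)[of "i * N + j" k] ij by simp
qed

lemma length_input_le: "n * (N * N + 4) + 3 \<le> sz"
proof -
  have "length xs \<le> sum_list (map bits xs)" for xs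
  proof (induction xs)
    case (Cons x xs)
    then show ?case using bits_pos[of x] by simp
  qed simp
  then have "length (encode_instance I) \<le> sz" by (simp add: input_size_def)
  then show ?thesis using length_input_rows by (simp add: encode_instance_def)
qed

lemma counts_le_size: "N * N * n \<le> sz" "N \<le> sz" "n \<le> sz"
proof -
  show F: "N * N * n \<le> sz" using length_input_le by (simp add: algebra_simps)
  have "N * 1 * 1 \<le> N * N * n" using N_pos coflows_pos by (intro mult_le_mono) auto
  then show "N \<le> sz" using F by linarith
  have "1 * 1 * n \<le> N * N * n" using N_pos by (intro mult_le_mono) auto
  then show "n \<le> sz" using F by linarith
qed

subsection \<open>The magnitude of the scaled numbers\<close>

definition "value_bits = (sz + 3) ^ 2"

lemma le_value_bits: "x \<le> 2 ^ e ==> e \<le> sz * sz + 6 * sz + 9 ==> x \<le> 2 ^ value_bits" for x :: nat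
  unfolding value_bits_def by (erule order_trans, rule power_increasing) (auto simp: power2_eq_square algebra_simps)

lemma prod_le_power_two:
  assumes "\<And>k. k < n ==> f k < 2 ^ sz"
  shows "(\<Prod>k<n. f k) \<le> (2::nat) ^ (sz * sz)"
proof -
  have "(\<Prod>k<n. f k) \<le> (\<Prod>k<n. 2 ^ sz)" using assms by (intro prod_mono) (auto intro: less_imp_le)
  also have "... = 2 ^ (sz * n)" by (simp add: power_mult)
  also have "... \<le> 2 ^ (sz * sz)" using counts_le_size(3) by (intro power_increasing mult_le_mono2) auto
  finally show ?thesis .
qed

lemma scale_le: "D \<le> 2 ^ (sz * sz)" "Dw \<le> 2 ^ (sz * sz)"
  unfolding D_def Dw_def by (rule prod_le_power_two, erule entries_less)+

lemma mult_div_le_power_two: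
  assumes "a < 2 ^ sz" "P \<le> 2 ^ (sz * sz)"
  shows "a * (P div b) \<le> (2::nat) ^ (sz + sz * sz)"
proof -
  have "P div b \<le> 2 ^ (sz * sz)" using div_le_dividend[of P b] assms(2) by linarith
  then have "a * (P div b) \<le> 2 ^ sz * 2 ^ (sz * sz)" using assms(1) by (intro mult_le_mono) auto
  then show ?thesis by (simp add: power_add)
qed

lemma rho_le: "k < n ==> rho k \<le> 2 ^ (sz + sz * sz)"
  unfolding rho_def using entries_less(1) scale_le(1) by (intro mult_div_le_power_two)

lemma sum_W_le: "(\<Sum>k<n. W k + 1) \<le> 2 ^ value_bits"
proof -
  have "W k + 1 \<le> 2 ^ (sz + sz * sz + 1)" if "k < n" for k
  proof -
    have "W k \<le> 2 ^ (sz + sz * sz)"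
      unfolding W_def using entries_less(3)[OF that] scale_le(2) by (intro mult_div_le_power_two)
    moreover have "1 \<le> (2::nat) ^ (sz + sz * sz)" by simp
    ultimately show ?thesis unfolding power_add power_one_right by linarith
  qed
  then have "(\<Sum>k<n. W k + 1) \<le> 2 ^ (sz + (sz + sz * sz + 1))"
    using ports_coflows_less(2) by (intro sum_le_power_two) auto
  then show ?thesis by (rule le_value_bits) simp
qed

lemma L_le:
  assumes k: "k < n" and p: "p < 2 * N"
  shows "L p k \<le> 2 ^ (sz + (sz * sz + sz))"
proof -
  have "dd i j k \<le> 2 ^ (sz * sz + sz)" if "i < N" "j < N" for i j
    unfolding dd_def power_add using scale_le(1) entries_less(5)[OF k that] by (intro mult_le_mono) auto
  then show ?thesis
    unfolding L_def using p ports_coflows_less(1) by (auto intro!: sum_le_power_two)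
qed

lemma sum_L_le: "(\<Sum>p<2*N. \<Sum>k<n. L p k) + 1 \<le> 2 ^ value_bits"
proof -
  have "(\<Sum>k<n. L p k) \<le> 2 ^ (sz + (sz + (sz * sz + sz)))" if "p < 2 * N" for p
    using ports_coflows_less(2) L_le that by (intro sum_le_power_two) auto
  then have "(\<Sum>p<2*N. \<Sum>k<n. L p k) \<le> 2 ^ ((1 + sz) + (sz + (sz + (sz * sz + sz))))"
    using ports_coflows_less(1) by (intro sum_le_power_two[of _ "1 + sz"]) auto
  moreover have "1 \<le> (2::nat) ^ ((1 + sz) + (sz + (sz + (sz * sz + sz))))" by simp
  ultimately have "(\<Sum>p<2*N. \<Sum>k<n. L p k) + 1 \<le> 2 ^ ((1 + sz) + (sz + (sz + (sz * sz + sz))) + 1)"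
    unfolding power_add[of _ _ 1] power_one_right by linarith
  then show ?thesis by (rule le_value_bits) simp
qed

lemma max_B_le: "max_B \<le> 2 ^ value_bits"
proof -
  have "B k \<le> 2 ^ value_bits" if "k < n" for k
    using le_value_bits[OF rho_le[OF that]] le_value_bits[OF L_le[OF that]]
    by (simp add: B_def loads.max_load_le_iff loads.total_load_def)
  then show ?thesis unfolding max_B_def by (subst Max_le_iff) auto
qed

lemma H_le: "H \<le> 16 * value_bits + 20"
proof -
  have "n \<le> 2 ^ value_bits" using less_imp_le[OF ports_coflows_less(2)] by (rule le_value_bits) simp
  then have "n * max_B \<le> 2 ^ value_bits * 2 ^ value_bits" using max_B_le by (rule mult_le_mono)
  also have "... < 2 ^ (2 * value_bits + 1)" by (simp add: power_add[symmetric] mult_2)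
  finally have "floorlog 2 (n * max_B) \<le> 2 * value_bits + 1" by (simp add: floorlog_le_iff)
  then show ?thesis by (simp add: H_def)
qed

subsection \<open>The bounds on the run of the programs\<close>

definition "unit_bound = 9000 * value_bits"
definition "limit = unit_bound ^ 6"
definition "magnitude = (2::nat) ^ limit"
definition "cell_bound = magnitude ^ (18 + sz)"

lemma value_bits_ge: "sz \<le> value_bits" "9 \<le> value_bits"
  by (simp_all add: value_bits_def power2_eq_square algebra_simps)

lemma le_unit_bound: "value_bits < unit_bound" "sz \<le> unit_bound" "N \<le> unit_bound" "n \<le> unit_bound" "H \<le> unit_bound" "9000 \<le> unit_bound"
  using H_le counts_le_size value_bits_ge by (simp_all add: unit_bound_def)

lemma le_limit: "x \<le> unit_bound ^ c ==> c \<le> 6 ==> x \<le> limit"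
  unfolding limit_def using le_unit_bound(6) by (erule_tac order_trans) (rule power_increasing, auto)

lemma unit_bound_mult_le_limit: "9000 * unit_bound \<le> limit"
proof -
  have "9000 * unit_bound \<le> unit_bound ^ 2"
    using le_unit_bound(6) by (simp add: power2_eq_square)
  then show ?thesis by (rule le_limit) simp
qed

lemma limits:
  "N * N * n * (2 * (N * N * n) + 1) \<le> limit" "dr.rounds \<le> limit" "K \<le> limit" "H * (K * N) \<le> limit"
proof -
  have mult: "x * y \<le> unit_bound ^ (a + b)" if "x \<le> unit_bound ^ a" "y \<le> unit_bound ^ b" for x y a b
    unfolding power_add using that by (rule mult_le_mono)
  have unit: "x \<le> unit_bound ^ 1" if "x \<le> unit_bound" for x using that by simp
  note units = unit[OF le_unit_bound(3)] unit[OF le_unit_bound(4)] unit[OF le_unit_bound(5)] unit[OF le_unit_bound(6)]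
  have "2 * (N * N * n) + 1 \<le> unit_bound" using counts_le_size(1) value_bits_ge by (simp add: unit_bound_def)
  then have "N * N * n * (2 * (N * N * n) + 1) \<le> unit_bound ^ (1 + 1)"
    using order_trans[OF counts_le_size(1) le_unit_bound(2)] by (intro mult unit)
  then show "N * N * n * (2 * (N * N * n) + 1) \<le> limit" by (rule le_limit) simp
  have "dr.rounds \<le> unit_bound ^ (1 + 1 + 1 + 1 + 1 + 1)" unfolding dr.rounds_def by (intro mult units)
  then show "dr.rounds \<le> limit" by (rule le_limit) simp
  have K: "K \<le> unit_bound ^ (1 + (1 + 1))"
    unfolding K_def using le_unit_bound(6) by (intro mult units unit) simp
  then show "K \<le> limit" by (rule le_limit) simp
  have "H * (K * N) \<le> unit_bound ^ (1 + ((1 + (1 + 1)) + 1))" by (intro mult units K)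
  then show "H * (K * N) \<le> limit" by (rule le_limit) simp
qed

lemma le_magnitude: "x \<le> 2 ^ e ==> e \<le> limit ==> x \<le> magnitude"
  unfolding magnitude_def by (erule order_trans, rule power_increasing) auto

lemma limit_le_magnitude: "limit \<le> magnitude"
  unfolding magnitude_def using less_exp[of limit] by simp

lemma values_le_magnitude: "x \<le> 2 ^ value_bits ==> x \<le> magnitude"
  by (erule le_magnitude) (use le_unit_bound(1) unit_bound_mult_le_limit in linarith)

lemma power_110_le_magnitude: "110 ^ H \<le> magnitude"
proof (rule le_magnitude)
  have "(110::nat) ^ H \<le> (2 ^ 7) ^ H" by (rule power_mono) auto
  then show "(110::nat) ^ H \<le> 2 ^ (7 * H)" by (simp add: power_mult)
  show "7 * H \<le> limit" using le_unit_bound(5) unit_bound_mult_le_limit by linarith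
qed

lemma magnitude_ge: "100 \<le> magnitude"
  using order_trans[OF unit_bound_mult_le_limit limit_le_magnitude] le_unit_bound(6) by linarith

lemma bounded_run_bounds: "bounded_run I cell_bound limit magnitude"
proof unfold_locales
  have "2 * N \<le> 9000 * unit_bound" "H + 1 \<le> 9000 * unit_bound"
    using le_unit_bound by linarith+
  then show "2 * N \<le> limit" "H + 1 \<le> limit" using unit_bound_mult_le_limit by linarith+
  show "n * (N * N + 4) \<le> limit" using length_input_le le_unit_bound(2) unit_bound_mult_le_limit by linarith
  show "1 \<le> limit" using le_unit_bound(6) unit_bound_mult_le_limit by linarith
  show "D \<le> magnitude" "Dw \<le> magnitude" "\<And>k. k < n ==> rho k \<le> magnitude"
    by (rule values_le_magnitude, rule le_value_bits, rule scale_le rho_le, simp_all)+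
  show "magnitude ^ (18 + n) \<le> cell_bound"
    unfolding cell_bound_def using magnitude_ge counts_le_size(3) by (intro power_increasing) auto
  have "limit \<le> magnitude ^ 1" using limit_le_magnitude by simp
  also have "... \<le> cell_bound" unfolding cell_bound_def using magnitude_ge by (intro power_increasing) auto
  finally show "limit \<le> cell_bound" .
qed (rule limits limit_le_magnitude magnitude_ge power_110_le_magnitude values_le_magnitude[OF sum_W_le]
  values_le_magnitude[OF sum_L_le] values_le_magnitude[OF max_B_le])+

lemma encoded_le_cell_bound: "v \<in> set (encode_instance I) ==> v \<le> cell_bound"
proof -
  interpret bounded_run I cell_bound limit magnitude by (rule bounded_run_bounds)
  assume "v \<in> set (encode_instance I)"
  from less_imp_le[OF encoded_less[OF this]] have "v \<le> 2 ^ value_bits" by (rule le_value_bits) simp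
  then show "v \<le> cell_bound" by (intro A_le_M_1 values_le_magnitude)
qed

end

section \<open>The algorithm\<close>

definition prologue :: prog where
  "prologue = v_pairs :=: V v_ports .* V v_ports ;; v_row :=: V v_pairs .+ Cn 4 ;; v_length :=: V v_coflows .* V v_row"

definition main_part :: prog where
  "main_part = prepare ;; Test (V v_cores .- Cn 1) list_scheduling single_core"

definition algorithm_body :: com where
  "algorithm_body = Seq (compile prologue) (Seq read_input (Seq (compile main_part) write_periods))"

definition algorithm :: com where
  "algorithm = Seq (Read_to v_cores (Cn 0)) (Seq (Read_to v_ports (Cn 0)) (Seq (Read_to v_coflows (Cn 0))
     (Cond (aexp_of (V v_coflows)) algorithm_body Skip)))"

definition header :: "nat => nat => nat => store" where
  "header a b c = upd (upd (upd (\<lambda>_ _ _. 0) v_cores 0 0 a) v_ports 0 0 b) v_coflows 0 0 c"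

definition header_cost :: nat where
  "header_cost = (\<Sum>r\<leftarrow>[v_cores, v_ports, v_coflows]. cost_factor (addr r (aexp_of (Cn 0)) (aexp_of (Cn 0))) + 1)
     + cost_factor (aexp_of (V v_coflows))"

lemma bounded_store_header: "a \<le> M ==> b \<le> M ==> c \<le> M ==> bounded_store M (header a b c)"
  unfolding header_def by (intro bounded_store_upd) (simp_all add: bounded_store_def)

lemma runs_Read_scalar:
  assumes "bounded_store M S" "v \<le> M" "runs c (enc (upd S r 0 0 v), inp, out) t \<tau>"
  shows "runs (Seq (Read_to r (Cn 0)) c) (enc S, v # inp, out) ((cost_factor (addr r (aexp_of (Cn 0)) (aexp_of (Cn 0))) + 1) * bits M + t) \<tau>"
  using runs_Read[OF assms(1,2), of r "Cn 0" "Cn 0" inp out] assms(3) by (auto intro: runs_Seq)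

lemma runs_algorithm:
  assumes le: "a \<le> M" "b \<le> M" "c \<le> M"
    and rest: "runs (if c \<noteq> 0 then algorithm_body else Skip) (enc (header a b c), inp, []) t \<tau>"
  shows "runs algorithm (\<lambda>_. 0, a # b # c # inp, []) (header_cost * bits M + t) \<tau>"
proof -
  let ?cost = "\<lambda>r. (cost_factor (addr r (aexp_of (Cn 0)) (aexp_of (Cn 0))) + 1) * bits M"
  have bounded: "bounded_store M (\<lambda>_ _ _. 0)" by (simp add: bounded_store_def)
  have "runs (Cond (aexp_of (V v_coflows)) algorithm_body Skip) (enc (header a b c), inp, [])
      (cost_factor (aexp_of (V v_coflows)) * bits M + t) \<tau>"
    by (rule runs_Cond[OF bounded_store_header[OF le]]) (use rest in \<open>simp add: header_def\<close>)
  then have "runs algorithm (enc (\<lambda>_ _ _. 0), a # b # c # inp, [])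
      (?cost v_cores + (?cost v_ports + (?cost v_coflows + (cost_factor (aexp_of (V v_coflows)) * bits M + t)))) \<tau>"
    unfolding algorithm_def header_def by (intro runs_Read_scalar bounded_store_upd bounded le)
  then show ?thesis
    unfolding enc_zero by (rule runs_mono) (simp add: header_cost_def add_mult_distrib)
qed

lemma poly_mono_nat: "x \<le> y ==> poly p x \<le> poly p y" for p :: "nat poly"
  by (induction p) (auto intro: add_mono mult_le_mono)

subsection \<open>Scheduling and output\<close>

lemma (in nonempty_instance) good_schedule_output:
  assumes good: "good_schedule u \<rho> S" and u: "0 < u" "S v_den 0 0 = D * u" and \<rho>: "0 \<le> \<rho>"
  defines "x == schedule_of (decode_periods (concat (map (period_numbers S) [0..<num_periods S])))"
  shows "feasible I x" "objective I x \<le> \<rho> * optimum I"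
proof -
  have x: "x = schedule_of (map (\<lambda>q. (core_at S q, flow_at S q, real (start_at S q) / real (D * u), real (end_at S q) / real (D * u))) [0..<num_periods S])"
    unfolding x_def period_numbers_def u(2) decode_periods_map ..
  have plan: "partial_schedule u (num_periods S) (core_at S) (flow_at S) (start_at S) (end_at S)"
    and full: "\<And>i j k. i < N ==> j < N ==> k < n ==> sent (num_periods S) (flow_at S) (start_at S) (end_at S) (i, j, k) = u * dd i j k"
    and approx: "approximates u (num_periods S) (flow_at S) (end_at S) \<rho>"
    using good unfolding good_schedule_def plan_def sent_in_def by simp_all
  show "feasible I x" "objective I x \<le> \<rho> * optimum I"
    unfolding x using complete_schedule[OF u(1) plan full] approx \<rho> by simp_all
qed

context bounded_run
begin

lemma wp_main_part:
  assumes params: "params S" and input: "input_ok S"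
    and zero: "\<And>r. r \<in> {v_count, a_coreload, a_ordered, a_queue, a_hits} ==> S r = (\<lambda>_ _. 0)"
  shows "wp main_part (\<lambda>S'. \<exists>u>0. good_schedule u (6 - 2 / real m) S' \<and> S' v_den 0 0 = D * u \<and> num_periods S' \<le> Lim) S"
    (is "wp _ ?Q S")
  unfolding main_part_def
proof (rule wp_seq[OF wp_prepare[OF params input]])
  fix S1 :: store
  assume "prepared S1 \<and> (\<forall>k<n. S1 a_weight k 0 = W k)" and frame: "\<And>r. r \<notin> mods prepare ==> S1 r = S r"
  then have ok: "prepared S1" and weights: "\<And>k. k < n ==> S1 a_weight k 0 = W k" by auto
  have zero1: "num_periods S1 = 0" "S1 a_coreload = (\<lambda>_ _. 0)" "S1 a_ordered = (\<lambda>_ _. 0)" "S1 a_queue = (\<lambda>_ _. 0)" "S1 a_hits = (\<lambda>_ _. 0)"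
    by (simp_all add: frame zero)
  show "wp (Test (V v_cores .- Cn 1) list_scheduling single_core) ?Q S1"
  proof (cases "m = 1")
    case True
    have "0 < X" using N_pos coflows_pos by (simp add: X_def K_def)
    then have "wp single_core ?Q S1"
      using True by (intro wp_mono[OF wp_single_core[OF True ok weights zero1(1,4,5)]]) auto
    then show ?thesis using True preparedD(1)[OF ok] by simp
  next
    case False
    then have m: "2 \<le> m" using m_pos by simp
    have "5 \<le> 6 - 2 / real m" using m by (simp add: field_simps)
    then have "wp list_scheduling ?Q S1"
      using approximates_mono[of 1 _ _ _ 5 "6 - 2 / real m"]
      by (intro wp_mono[OF wp_list_scheduling[OF ok weights zero1(1-3)]] exI[of _ 1]) (auto simp: good_schedule_def)
    then show ?thesis using m preparedD(1)[OF ok] by simp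
  qed
qed

lemma runs_main_part:
  assumes bounded: "bounded_store M S" and params: "params S" and input: "input_ok S"
    and zero: "\<And>r. r \<in> {v_count, a_coreload, a_ordered, a_queue, a_hits} ==> S r = (\<lambda>_ _. 0)"
  obtains s out where "runs (Seq (compile main_part) write_periods) (enc S, [], [])
      (poly (time_poly main_part + write_periods_poly) Lim * bits M) (s, [], out)"
    "feasible I (schedule_of (decode_periods out))"
    "objective I (schedule_of (decode_periods out)) \<le> (6 - 2 / real m) * optimum I"
proof -
  let ?S = "sem main_part S"
  let ?out = "concat (map (period_numbers ?S) [0..<num_periods ?S])"
  obtain u where safe: "safe main_part S" and u: "0 < u" "good_schedule u (6 - 2 / real m) ?S" "?S v_den 0 0 = D * u" "num_periods ?S \<le> Lim"
    using wp_main_part[OF params input zero] unfolding wp_def by blast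
  have "poly write_periods_poly (num_periods ?S) * bits M \<le> poly write_periods_poly Lim * bits M"
    using u(4) by (intro mult_le_mono1 poly_mono_nat)
  with runs_write_periods[OF bounded_store_sem[OF safe bounded]]
  have "runs write_periods (enc ?S, [], []) (poly write_periods_poly Lim * bits M) (enc (upd ?S v_pos 0 0 (num_periods ?S)), [], ?out)"
    by (rule runs_mono)
  from runs_Seq[OF runs_compile[OF safe bounded] this]
  have "runs (Seq (compile main_part) write_periods) (enc S, [], []) (poly (time_poly main_part + write_periods_poly) Lim * bits M)
      (enc (upd ?S v_pos 0 0 (num_periods ?S)), [], ?out)"
    by (simp add: add_mult_distrib)
  moreover have "0 \<le> 6 - 2 / real m" using m_pos by (simp add: field_simps)
  ultimately show thesis using that good_schedule_output[OF u(2,1,3)] by blast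
qed

lemma input_ok_rows:
  assumes rows: "\<And>q. q < length input_rows ==> S a_input q 0 = input_rows ! q"
  shows "input_ok S"
proof -
  have entry: "S a_input (k * (N * N + 4) + e) 0 = encode_coflow I k ! e" if "k < n" "e < N * N + 4" for k e
    using rows[of "k * (N * N + 4) + e"] nth_input_rows[OF that] flat_less[OF that] by (simp add: length_input_rows)
  show ?thesis unfolding input_ok_def
  proof (intro allI impI conjI)
    fix k assume k: "k < n"
    show "S a_input (k * (N * N + 4) + e) 0 = demand I (e div N) (e mod N) k" if "e < N * N" for e
      using entry[OF k, of e] nth_encode_coflow(1)[OF that, of k] that by simp
    show "S a_input (k * (N * N + 4) + N * N) 0 = release_num k" "S a_input (k * (N * N + 4) + (N * N + 1)) 0 = release_den k"
      "S a_input (k * (N * N + 4) + (N * N + 2)) 0 = weight_num k" "S a_input (k * (N * N + 4) + (N * N + 3)) 0 = weight_den k"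
      unfolding nth_encode_coflow(2-5)[symmetric, of k] by (rule entry[OF k], simp)+
  qed
qed

end

definition body_poly :: "nat poly" where
  "body_poly = time_poly prologue + (read_input_poly + (time_poly main_part + write_periods_poly))"

lemma (in bounded_run) runs_algorithm_body:
  assumes entries: "\<And>v. v \<in> set (encode_instance I) ==> v \<le> M"
  obtains s out where "runs algorithm_body (enc (header m N n), input_rows, []) (poly body_poly Lim * bits M) (s, [], out)"
    "feasible I (schedule_of (decode_periods out))"
    "objective I (schedule_of (decode_periods out)) \<le> (6 - 2 / real m) * optimum I"
proof -
  let ?S1 = "upd (upd (upd (header m N n) v_pairs 0 0 (N * N)) v_row 0 0 (N * N + 4)) v_length 0 0 (n * (N * N + 4))"
  let ?S2 = "upd (input_read input_rows (length input_rows) ?S1) v_pos 0 0 (length input_rows)"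
  have header: "bounded_store M (header m N n)"
    by (intro bounded_store_header entries) (simp_all add: encode_instance_def)
  have sizes: "n * (N * N + 4) \<le> M" "N * N + 4 \<le> M"
    using order_trans[OF mult_le_mono1[OF coflows_pos, of "N * N + 4"] lim_input] lim_input Lim_le_M by simp_all
  have "wp prologue (\<lambda>S'. S' = ?S1) (header m N n)" using sizes by (simp add: prologue_def header_def)
  then have prologue: "safe prologue (header m N n)" "sem prologue (header m N n) = ?S1" by (simp_all add: wp_def)
  have bounded1: "bounded_store M ?S1" using bounded_store_sem[OF prologue(1) header] unfolding prologue(2) .
  have rows_le: "v \<le> M" if "v \<in> set input_rows" for v using that by (intro entries) (simp add: encode_instance_def)
  have length: "?S1 v_length 0 0 = length input_rows" by (simp add: length_input_rows)
  have params: "params ?S2" by (simp add: params_def header_def)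
  have input: "input_ok ?S2" by (rule input_ok_rows) (simp add: input_read_def)
  have zero: "?S2 r = (\<lambda>_ _. 0)" if "r \<in> {v_count, a_coreload, a_ordered, a_queue, a_hits}" for r
    using that by (auto simp: header_def)
  obtain s out where main: "runs (Seq (compile main_part) write_periods) (enc ?S2, [], [])
      (poly (time_poly main_part + write_periods_poly) Lim * bits M) (s, [], out)"
    and good: "feasible I (schedule_of (decode_periods out))"
      "objective I (schedule_of (decode_periods out)) \<le> (6 - 2 / real m) * optimum I"
    by (rule runs_main_part[OF runs_read_input(2)[OF bounded1 length rows_le] params input zero])
  have "poly read_input_poly (length input_rows) * bits M \<le> poly read_input_poly Lim * bits M"
    unfolding length_input_rows using lim_input by (intro mult_le_mono1 poly_mono_nat)
  with runs_read_input(1)[OF bounded1 length rows_le]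
  have "runs read_input (enc ?S1, input_rows, []) (poly read_input_poly Lim * bits M) (enc ?S2, [], [])"
    by (rule runs_mono)
  from runs_Seq[OF runs_compile[OF prologue(1) header, unfolded prologue(2)] runs_Seq[OF this main]]
  have "runs algorithm_body (enc (header m N n), input_rows, []) (poly body_poly Lim * bits M) (s, [], out)"
    by (simp add: algorithm_body_def body_poly_def add_mult_distrib)
  then show thesis using that good by blast
qed

subsection \<open>Running time and correctness\<close>

definition limit_poly :: "nat poly" where
  "limit_poly = ([:9000:] * [:3, 1:] ^ 2) ^ 6"

definition running_time :: "nat poly" where
  "running_time = pcompose ([:header_cost:] + body_poly) limit_poly * (limit_poly * [:18, 1:] + [:1:]) + [:1, header_cost:]"

context nonempty_instance
begin

lemma poly_limit_poly: "poly limit_poly sz = limit"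
  by (simp add: limit_poly_def limit_def unit_bound_def value_bits_def add.commute)

lemma bits_cell_bound: "bits cell_bound \<le> limit * (18 + sz) + 1"
  by (simp add: bits_le_iff cell_bound_def magnitude_def flip: power_mult)

lemma runs_nonempty:
  obtains s out where "runs algorithm (start I) (poly running_time sz) (s, [], out)"
    "feasible I (schedule_of (decode_periods out))"
    "objective I (schedule_of (decode_periods out)) \<le> (6 - 2 / real m) * optimum I"
proof -
  interpret bounded_run I cell_bound limit magnitude by (rule bounded_run_bounds)
  obtain s out where body: "runs algorithm_body (enc (header m N n), input_rows, []) (poly body_poly limit * bits cell_bound) (s, [], out)"
    and good: "feasible I (schedule_of (decode_periods out))"
      "objective I (schedule_of (decode_periods out)) \<le> (6 - 2 / real m) * optimum I"
    by (rule runs_algorithm_body[OF encoded_le_cell_bound])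
  have "start I = (\<lambda>_. 0, m # N # n # input_rows, [])" by (simp add: start_def encode_instance_def)
  moreover have "m \<le> cell_bound" "N \<le> cell_bound" "n \<le> cell_bound"
    by (rule encoded_le_cell_bound, simp add: encode_instance_def)+
  ultimately have "runs algorithm (start I) (header_cost * bits cell_bound + poly body_poly limit * bits cell_bound) (s, [], out)"
    using runs_algorithm body coflows_pos by simp
  moreover have "(header_cost + poly body_poly limit) * bits cell_bound \<le> poly running_time sz"
    using mult_le_mono2[OF bits_cell_bound, of "header_cost + poly body_poly limit"]
    by (simp add: running_time_def poly_pcompose poly_limit_poly algebra_simps)
  ultimately have "runs algorithm (start I) (poly running_time sz) (s, [], out)"
    by (auto simp: add_mult_distrib intro: runs_mono)
  then show thesis using that good by blast
qed

end

lemma empty_instance: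
  assumes "coflows I = 0"
  shows "feasible I x" "objective I x = 0" "optimum I = 0"
proof -
  have feasible: "feasible I x" for x using assms by (simp add: feasible_def flows_def)
  have objective: "objective I x = 0" for x using assms by (simp add: objective_def)
  show "feasible I x" "objective I x = 0" by (rule feasible objective)+
  show "optimum I = 0" unfolding optimum_def using feasible objective by (simp add: image_constant_conv)
qed

lemma runs_empty:
  assumes "coflows I = 0"
  shows "\<exists>s. runs algorithm (start I) (poly running_time (input_size I)) (s, [], [])"
proof -
  have encoding: "encode_instance I = [cores I, ports I, 0]" using assms by (simp add: encode_instance_def)
  define M where "M = max (cores I) (ports I)"
  have "runs algorithm (\<lambda>_. 0, [cores I, ports I, 0], []) (header_cost * bits M + 1) (enc (header (cores I) (ports I) 0), [], [])"
    by (rule runs_algorithm) (use runs_Skip in \<open>simp_all add: M_def\<close>)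
  moreover have "bits M \<le> input_size I" unfolding M_def input_size_def encoding by (simp add: max_def)
  then have "header_cost * bits M + 1 \<le> poly running_time (input_size I)"
    by (simp add: running_time_def trans_le_add2)
  ultimately show ?thesis unfolding start_def encoding by (blast intro: runs_mono)
qed

lemma algorithm_correct:
  assumes "valid_instance I"
  shows "\<exists>t s out. exec algorithm (start I) t (s, [], out) \<and> t \<le> poly running_time (input_size I) \<and>
     feasible I (schedule_of (decode_periods out)) \<and>
     objective I (schedule_of (decode_periods out)) \<le> (6 - 2 / real (cores I)) * optimum I"
proof (cases "coflows I = 0")
  case True
  then show ?thesis using runs_empty[OF True] empty_instance[OF True] unfolding runs_def
    by (metis mult_zero_right order_refl)
next
  case False
  then interpret nonempty_instance I using assms by unfold_locales auto
  show ?thesis by (rule runs_nonempty) (unfold runs_def, blast)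
qed

theorem theorem1:
  "\<exists>c :: com. polynomial_time c \<and>
     has_approximation_ratio c (\<lambda>I. 6 - 2 / real (cores I))"
proof (intro exI conjI)
  show "polynomial_time algorithm"
    unfolding polynomial_time_def using algorithm_correct by blast
  show "has_approximation_ratio algorithm (\<lambda>I. 6 - 2 / real (cores I))"
    unfolding has_approximation_ratio_def computes_schedule_def using algorithm_correct by metis
qed

end
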